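(* Let $N,n\ge 1$, let $\nu\in(0,1)$, let $w_1,\dots,w_N\in\mathcal A(A_\nu,\mathbb C^n)$ be such that the associated functionals $\Phi_1,\dots,\Phi_N$ are linearly independent (in the sense defined in the context), and let $a_1,\dots,a_N\in\mathbb R$. Let $D\subset\subset G\subset\subset\mathbb C^n$ be domains and let $u\in PSH(G)\cap\mathcal C(G)$ be such that $D=\{u<0\}$ and $\partial D=\{u=0\}$. Suppose that $f\in\mathcal O(E,D)$ is an extremal for problem $(\mathcal P)$ (for $D$, $\Phi_1,\dots,\Phi_N$, $a_1,\dots,a_N$). Assume that there exist a set $S\subset\partial E$, a mapping $s=(s_1,\dots,s_n)\in H^\infty(E,\mathbb C^n)$, a number $\varepsilon>0$, and a function $v:S\times\mathcal A(E,\mathbb C^n)\to\mathbb C$ such that: (a) $\partial E\setminus S$ has zero measure; (b) $f^*(\zeta)$, $\nabla u(f^*(\zeta))$, $s^*(\zeta)$ are defined for all $\zeta\in S$; (c) $s_k$ nowhere vanishes on $E$, $k=1,\dots,n$; (d) for all $\zeta\in S$ and all $h\in\mathcal A(E,\mathbb C^n)$ with $\|h\|_\infty\le\varepsilon$, $$u\big(f^*(\zeta)+s^*(\zeta)\cdot h(\zeta)\big)=u\big(f^*(\zeta)\big)+2\operatorname{Re}\Big(\nabla u(f^*(\zeta))\bullet\big(s^*(\zeta)\cdot h(\zeta)\big)\Big)+v(\zeta,h);$$ (e) $\displaystyle\lim_{h\to0}\frac{\sup\{|v(\zeta,h)|:\zeta\in S\}}{\|h\|_\infty}=0$. Then $$f^*(\zeta)\in\partial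 D\quad\text{for a.a. }\zeta\in\partial E,$$ and there exist $\varrho\in L^\infty(\partial E)$, $\varrho>0$, $g\in H^\infty(E,\mathbb C^n)$, and $(\lambda_1,\dots,\lambda_N)\in\mathbb R^N\setminus\{0\}$ such that $$\Big(\sum_{k=1}^N\lambda_kw_k(\zeta)\cdot s^*(\zeta)\Big)+g^*(\zeta)=\varrho(\zeta)\,s^*(\zeta)\cdot\nabla u(f^*(\zeta))\quad\text{for a.a. }\zeta\in\partial E.$$
   Context: Notation. $E$ is the open unit disk in $\mathbb C$; $\mathcal O(\Omega,D)$ is the set of all holomorphic mappings $\Omega\to D$; $A_\nu=\{z\in\mathbb C:\nu<|z|<1\}$; $\mathcal A(\Omega,\mathbb C^n)=\mathcal C(\overline\Omega,\mathbb C^n)\cap\mathcal O(\Omega,\mathbb C^n)$; $H^\infty(\Omega,\mathbb C^n)$ is the space of bounded holomorphic mappings $\Omega\to\mathbb C^n$, with $\|f\|_\infty=\sup_{\Omega}\|f\|$ where $\|\cdot\|$ is the Euclidean norm; $f^*(\zeta)$ is the non-tangential boundary value of $f$ at $\zeta\in\partial E$; $PSH(G)$ is the set of plurisubharmonic functions on $G$. For $z,w\in\mathbb C^n$: $z\bullet w=\sum_{j=1}^nz_jw_j$ (no conjugation) and $z\cdot w=(z_1w_1,\dots,z_nw_n)$. $\nabla u=(\partial u/\partial z_1,\dots,\partial u/\partial z_n)$ is the complex gradient. $A\subset\subset B$ means $A$ is relatively compact in $B$. Functionals. For given $w_1,\dots,w_N\in\mathcal A(A_\nu,\mathbb C^n)$,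 $$\Phi_j(h)=\frac1{2\pi}\int_0^{2\pi}\operatorname{Re}\big(h^*(e^{i\theta})\bullet w_j(e^{i\theta})\big)\,d\theta,\quad h\in H^\infty(E,\mathbb C^n),\ j=1,\dots,N.$$ They are called linearly independent if for arbitrary $s=(s_1,\dots,s_n),g\in H^\infty(E,\mathbb C^n)$ and $\lambda_1,\dots,\lambda_N\in\mathbb R$ such that each $s_k$ nowhere vanishes on $E$ and $g(0)=0$, the following holds: if $\sum_{k=1}^N\lambda_kw_k\cdot s^*=g^*$ on a subset of $\partial E$ of positive measure, then $\lambda_1=\dots=\lambda_N=0$. Problem $(\mathcal P)$. Given a bounded domain $D\subset\mathbb C^n$ and $a_1,\dots,a_N\in\mathbb R$, find $f\in\mathcal O(E,D)$ such that $\Phi_j(f)=a_j$, $j=1,\dots,N$, and there is no $g\in\mathcal O(E,D)$ with $\Phi_j(g)=a_j$, $j=1,\dots,N$, and $g(E)\subset\subset D$. Any solution $f$ is called an extremal for $(\mathcal P)$. *)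

theory Defs
  imports "HOL-Complex_Analysis.Complex_Analysis"
begin

no_notation fps_nth (infixl "$" 75)

text \<open>Mappings from \<open>\<Omega> \<subseteq> \<complex>\<close> are total functions whose values outside \<open>\<Omega>\<close>
  (respectively outside \<open>closure \<Omega>\<close>) are irrelevant.  The componentwise product
  \<open>z \<cdot> w\<close> of vectors is the library's \<open>z * w\<close> on \<open>complex ^ 'n\<close>, and the Euclidean
  norm is \<open>norm\<close>.\<close>

abbreviation unit_disk :: "complex set" where
  "unit_disk \<equiv> ball 0 1"

abbreviation unit_circle :: "complex set" where
  "unit_circle \<equiv> sphere 0 1"

definition annulus :: "real \<Rightarrow> complex set" where
  "annulus \<nu> = {z. \<nu> < norm z \<and> norm z < 1}"

definition is_domain :: "'a::topological_space set \<Rightarrow> bool" where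
  "is_domain G \<longleftrightarrow> open G \<and> connected G \<and> G \<noteq> {}"

definition relatively_compact_in :: "'a::topological_space set \<Rightarrow> 'a set \<Rightarrow> bool" where
  "relatively_compact_in A B \<longleftrightarrow> compact (closure A) \<and> closure A \<subseteq> B"

definition vec_holomorphic_on :: "(complex \<Rightarrow> complex ^ 'n) \<Rightarrow> complex set \<Rightarrow> bool" where
  "vec_holomorphic_on f \<Omega> \<longleftrightarrow> (\<forall>k. (\<lambda>z. f z $ k) holomorphic_on \<Omega>)"

definition hol_maps :: "complex set \<Rightarrow> (complex ^ 'n) set \<Rightarrow> (complex \<Rightarrow> complex ^ 'n) set" where
  "hol_maps \<Omega> D = {f. vec_holomorphic_on f \<Omega> \<and> f ` \<Omega> \<subseteq> D}"

definition hol_cont_closure :: "complex set \<Rightarrow> (complex \<Rightarrow> complex ^ 'n) set" where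
  "hol_cont_closure \<Omega> = {f. vec_holomorphic_on f \<Omega> \<and> continuous_on (closure \<Omega>) f}"

definition hol_bounded :: "complex set \<Rightarrow> (complex \<Rightarrow> complex ^ 'n) set" where
  "hol_bounded \<Omega> = {f. vec_holomorphic_on f \<Omega> \<and> bounded (f ` \<Omega>)}"

definition sup_norm_on :: "complex set \<Rightarrow> (complex \<Rightarrow> complex ^ 'n::finite) \<Rightarrow> real" where
  "sup_norm_on \<Omega> f = (SUP z\<in>\<Omega>. norm (f z))"

definition bullet :: "complex ^ 'n \<Rightarrow> complex ^ 'n \<Rightarrow> complex"  (infixl "\<bullet>\<^sub>c" 70) where
  "z \<bullet>\<^sub>c w = (\<Sum>k\<in>UNIV. z $ k * w $ k)"

definition stolz_region :: "complex \<Rightarrow> real \<Rightarrow> complex set" where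
  "stolz_region \<zeta> \<alpha> = {z. norm z < 1 \<and> norm (z - \<zeta>) < \<alpha> * (1 - norm z)}"

text \<open>Convergence along this filter means convergence within every Stolz region at \<open>\<zeta>\<close>.\<close>

definition nontangential :: "complex \<Rightarrow> complex filter" where
  "nontangential \<zeta> = (SUP \<alpha>\<in>{1<..}. at \<zeta> within stolz_region \<zeta> \<alpha>)"

definition has_bdval :: "(complex \<Rightarrow> 'a::t2_space) \<Rightarrow> complex \<Rightarrow> bool" where
  "has_bdval f \<zeta> \<longleftrightarrow> (\<exists>L. (f \<longlongrightarrow> L) (nontangential \<zeta>))"

definition bdval :: "(complex \<Rightarrow> 'a::t2_space) \<Rightarrow> complex \<Rightarrow> 'a" where
  "bdval f \<zeta> = Lim (nontangential \<zeta>) f"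

text \<open>Arc length on the unit circle, completed so that its null sets and measurable sets are
  those of Lebesgue measure.\<close>

definition circle_measure :: "complex measure" where
  "circle_measure =
     completion (distr (lebesgue_on {0..<2*pi}) (restrict_space borel unit_circle) cis)"

text \<open>Only real-valued functions are needed.  For an upper semicontinuous real-valued function
  the circle means in the sub-mean value inequality may a priori be \<open>-\<infinity>\<close>; the inequality
  excludes this, so integrability is part of it.\<close>

definition upper_semicont_on :: "'a::topological_space set \<Rightarrow> ('a \<Rightarrow> real) \<Rightarrow> bool" where
  "upper_semicont_on G u \<longleftrightarrow> (\<forall>c. openin (top_of_set G) {x \<in> G. u x < c})"

definition subharmonic_on :: "complex set \<Rightarrow> (complex \<Rightarrow> real) \<Rightarrow> bool" where
  "subharmonic_on \<Omega> u \<longleftrightarrow> upper_semicont_on \<Omega> u \<and>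
     (\<forall>c r. 0 < r \<and> cball c r \<subseteq> \<Omega> \<longrightarrow>
        set_integrable lebesgue {0..2*pi} (\<lambda>\<theta>. u (c + of_real r * cis \<theta>)) \<and>
        u c \<le> 1 / (2*pi) * (LINT \<theta>:{0..2*pi}|lebesgue. u (c + of_real r * cis \<theta>)))"

definition psh_on :: "(complex ^ 'n) set \<Rightarrow> (complex ^ 'n \<Rightarrow> real) \<Rightarrow> bool" where
  "psh_on G u \<longleftrightarrow> upper_semicont_on G u \<and>
     (\<forall>a b. subharmonic_on {z. a + z *s b \<in> G} (\<lambda>z. u (a + z *s b)))"

text \<open>\<open>\<partial>u/\<partial>z\<^sub>k = (\<partial>u/\<partial>x\<^sub>k - \<i> \<partial>u/\<partial>y\<^sub>k) / 2\<close> where \<open>z\<^sub>k = x\<^sub>k + \<i> y\<^sub>k\<close>.\<close>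

definition has_complex_gradient :: "(complex ^ 'n \<Rightarrow> real) \<Rightarrow> complex ^ 'n \<Rightarrow> bool" where
  "has_complex_gradient u z \<longleftrightarrow>
     (\<forall>k. (\<lambda>t::real. u (z + t *\<^sub>R axis k 1)) field_differentiable at 0 \<and>
          (\<lambda>t::real. u (z + t *\<^sub>R axis k \<i>)) field_differentiable at 0)"

definition complex_gradient :: "(complex ^ 'n \<Rightarrow> real) \<Rightarrow> complex ^ 'n \<Rightarrow> complex ^ 'n" where
  "complex_gradient u z =
     (\<chi> k. (of_real (deriv (\<lambda>t::real. u (z + t *\<^sub>R axis k 1)) 0)
            - \<i> * of_real (deriv (\<lambda>t::real. u (z + t *\<^sub>R axis k \<i>)) 0)) / 2)"

definition Phi :: "(complex \<Rightarrow> complex ^ 'n::finite) \<Rightarrow> (complex \<Rightarrow> complex ^ 'n) \<Rightarrow> real" where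
  "Phi w h = 1 / (2*pi) * (LINT \<theta>:{0..2*pi}|lebesgue. Re (bdval h (cis \<theta>) \<bullet>\<^sub>c w (cis \<theta>)))"

text \<open>The functionals \<open>Phi (w j)\<close>, \<open>j = 1, \<dots>, N\<close>, are represented by their kernels \<open>w j\<close>.\<close>

definition functionals_lin_indep ::
    "nat \<Rightarrow> (nat \<Rightarrow> complex \<Rightarrow> complex ^ 'n::finite) \<Rightarrow> bool" where
  "functionals_lin_indep N w \<longleftrightarrow>
     (\<forall>s\<in>hol_bounded unit_disk. \<forall>g\<in>hol_bounded unit_disk. \<forall>lam::nat \<Rightarrow> real.
        (\<forall>k. \<forall>z\<in>unit_disk. s z $ k \<noteq> 0) \<and> g 0 = 0 \<and>
        (\<exists>T\<in>sets circle_measure. 0 < emeasure circle_measure T \<and>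
           (\<forall>\<zeta>\<in>T. has_bdval s \<zeta> \<and> has_bdval g \<zeta> \<and>
              (\<Sum>j\<in>{1..N}. lam j *\<^sub>R (w j \<zeta> * bdval s \<zeta>)) = bdval g \<zeta>))
        \<longrightarrow> (\<forall>j\<in>{1..N}. lam j = 0))"

definition extremal ::
    "(complex ^ 'n::finite) set \<Rightarrow> nat \<Rightarrow> (nat \<Rightarrow> complex \<Rightarrow> complex ^ 'n) \<Rightarrow> (nat \<Rightarrow> real) \<Rightarrow>
     (complex \<Rightarrow> complex ^ 'n) \<Rightarrow> bool" where
  "extremal D N w a f \<longleftrightarrow>
     f \<in> hol_maps unit_disk D \<and> (\<forall>j\<in>{1..N}. Phi (w j) f = a j) \<and>
     \<not> (\<exists>g\<in>hol_maps unit_disk D. (\<forall>j\<in>{1..N}. Phi (w j) g = a j) \<and>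
           relatively_compact_in (g ` unit_disk) D)"

text \<open>The filter of \<open>h \<rightarrow> 0\<close>, \<open>h \<noteq> 0\<close>, in the space \<open>hol_cont_closure unit_disk\<close> with the
  supremum norm.\<close>

definition disk_algebra_at_0 :: "(complex \<Rightarrow> complex ^ 'n::finite) filter" where
  "disk_algebra_at_0 =
     inf (filtercomap (sup_norm_on unit_disk) (at_right 0)) (principal (hol_cont_closure unit_disk))"

end

theory Submission
  imports Defs
begin

text \<open>
  The theorem is a Lagrange multiplier rule, obtained by comparing the extremal map \<open>f\<close> with two kinds of
  variations.

  An outer variation \<open>f + t s \<cdot> h\<close>, with \<open>h\<close> in the disc algebra, changes \<open>u\<close> on the circle to first order by
  \<open>2 t Re ((s \<cdot> \<nabla>u(f\<^sup>*)) \<bullet> h)\<close>.  An inner variation replaces \<open>f\<close> by \<open>f \<circ> \<psi>\<close>, where \<open>\<psi> z = z exp (- t q (\<psi> z))\<close> and \<open>q\<close>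
  is the Herglotz integral of a bounded function \<open>\<phi> \<ge> 0\<close> on the circle
  (\<open>exponential_fixed_point_map\<close>).  It pushes the image into the interior.  Since \<open>u \<circ> f < 0\<close>, a Hopf type
  estimate (\<open>hopf_majorant\<close>) improves every harmonic majorant by \<open>\<kappa> ln |z|\<close>, and
  \<open>ln |\<psi> z| \<le> - t Re q (\<psi> z)\<close>; so the inner variation compensates a boundary excess of \<open>t \<kappa> \<phi>\<close>.  Suppose that
  \<open>u(f\<^sup>*) + 2 Re ((s \<cdot> \<nabla>u(f\<^sup>*)) \<bullet> h) + \<delta> \<le> \<kappa> \<phi>\<close> almost everywhere for some \<open>\<delta> > 0\<close>,
  and that \<open>h\<close> and \<open>\<phi>\<close> change every \<open>\<Phi>\<^sub>j\<close> to first order by opposite amounts.  For small \<open>t\<close> the map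
  \<open>(f + t s \<cdot> h) \<circ> \<psi>\<close>, after a small correction of \<open>h\<close>, attains the prescribed values exactly and has
  relatively compact image in \<open>D\<close>.  This contradicts extremality (\<open>no_admissible_variation\<close>).

  So a certain convex cone of bounded functions on the circle contains no function with negative essential
  supremum, and the Hahn-Banach theorem yields a linear form \<open>l\<close> that is dominated by the essential
  supremum and nonnegative on the cone (\<open>multiplier_functional\<close>).  On the
  different parts of the cone, this says:
  \<^item> on \<open>\<phi>\<close>: \<open>l \<phi>\<close> is at most a constant times the integral of \<open>\<phi>\<close>.  Hence \<open>l\<close> has a bounded density \<open>\<rho>\<close>
    (\<open>dominated_functional_density\<close>); this is what the inner variations are for.
  \<^item> on \<open>h\<close>: up to a constant factor of \<open>\<rho>\<close>, the function \<open>\<rho> s \<cdot> \<nabla>u(f\<^sup>*) - \<Sum> \<lambda>\<^sub>k w\<^sub>k \<cdot> s\<^sup>*\<close> annihilates the disc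
    algebra.  By a theorem of Fatou type it is the boundary value of a function \<open>g\<close> in \<open>H\<^sup>\<infinity>\<close> with \<open>g 0 = 0\<close>
    (\<open>annihilator_of_disk_algebra\<close>).
  \<^item> on \<open>u(f\<^sup>*)\<close>: the integral of \<open>\<rho> u(f\<^sup>*)\<close> is nonnegative, while \<open>u(f\<^sup>*) \<le> 0\<close>.

  Linear independence of the functionals shows that \<open>\<rho>\<close> cannot vanish on a set of positive measure.  Hence
  \<open>\<rho> > 0\<close> and \<open>u(f\<^sup>*) = 0\<close> almost everywhere, which is the assertion (\<open>extremal_multipliers\<close>).

  Along the variations the functionals are evaluated inside the disc: the weights are holomorphic in an annulus, so that
  \<open>\<Phi>\<^sub>j\<close> is an integral over a circle inside the disc (\<open>Phi_eq_circle_pairing\<close>), where compositions with \<open>\<psi>\<close>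
  converge uniformly.  That \<open>u \<circ> F\<close> lies below the Poisson integral of its boundary values is proved for
  continuous plurisubharmonic \<open>u\<close> by doubling the variables (\<open>psh_disc_maximum_principle\<close>).
\<close>

section \<open>Sublinear functionals and positive linear forms\<close>

text \<open>Vector spaces of real functions with pointwise operations, as subsets of a function type.  Besides the
  linear structure, separation uses only a sublinear functional, which will be the essential supremum.\<close>

definition function_space :: "('a \<Rightarrow> real) set \<Rightarrow> bool" where
  "function_space V \<longleftrightarrow> (\<lambda>_. 0) \<in> V \<and> (\<forall>x\<in>V. \<forall>y\<in>V. (\<lambda>t. x t + y t) \<in> V) \<and>
     (\<forall>c. \<forall>x\<in>V. (\<lambda>t. c * x t) \<in> V)"

definition sublinear_on :: "('a \<Rightarrow> real) set \<Rightarrow> (('a \<Rightarrow> real) \<Rightarrow> real) \<Rightarrow> bool" where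
  "sublinear_on V p \<longleftrightarrow> (\<forall>x\<in>V. \<forall>y\<in>V. p (\<lambda>t. x t + y t) \<le> p x + p y) \<and>
     (\<forall>c>0. \<forall>x\<in>V. p (\<lambda>t. c * x t) \<le> c * p x)"

definition linear_form_on :: "('a \<Rightarrow> real) set \<Rightarrow> (('a \<Rightarrow> real) \<Rightarrow> real) \<Rightarrow> bool" where
  "linear_form_on V l \<longleftrightarrow> (\<forall>x\<in>V. \<forall>y\<in>V. l (\<lambda>t. x t + y t) = l x + l y) \<and>
     (\<forall>c. \<forall>x\<in>V. l (\<lambda>t. c * x t) = c * l x)"

lemma function_space_add: "function_space V \<Longrightarrow> x \<in> V \<Longrightarrow> y \<in> V \<Longrightarrow> (\<lambda>t. x t + y t) \<in> V"
  and function_space_scale: "function_space V \<Longrightarrow> x \<in> V \<Longrightarrow> (\<lambda>t. c * x t) \<in> V"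
  by (simp_all add: function_space_def)

lemma sublinear_on_add: "sublinear_on V p \<Longrightarrow> x \<in> V \<Longrightarrow> y \<in> V \<Longrightarrow> p (\<lambda>t. x t + y t) \<le> p x + p y"
  and sublinear_on_scale_le: "sublinear_on V p \<Longrightarrow> c > 0 \<Longrightarrow> x \<in> V \<Longrightarrow> p (\<lambda>t. c * x t) \<le> c * p x"
  by (simp_all add: sublinear_on_def)

lemma linear_form_on_add: "linear_form_on V l \<Longrightarrow> x \<in> V \<Longrightarrow> y \<in> V \<Longrightarrow> l (\<lambda>t. x t + y t) = l x + l y"
  and linear_form_on_scale: "linear_form_on V l \<Longrightarrow> x \<in> V \<Longrightarrow> l (\<lambda>t. c * x t) = c * l x"
  by (simp_all add: linear_form_on_def)

lemma function_space_diff: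
  assumes "function_space V" "x \<in> V" "y \<in> V"
  shows "(\<lambda>t. x t - y t) \<in> V"
  using function_space_add[OF assms(1,2) function_space_scale[OF assms(1,3), of "-1"]] by simp

lemma sublinear_on_zero:
  assumes "function_space V" "sublinear_on V p"
  shows "p (\<lambda>_. 0) = 0"
proof -
  have z: "(\<lambda>_. 0) \<in> V" using assms by (simp add: function_space_def)
  show ?thesis
    using sublinear_on_scale_le[OF assms(2) _ z, of 2] sublinear_on_scale_le[OF assms(2) _ z, of "1/2"]
    by simp
qed

lemma sublinear_on_scale:
  assumes V: "function_space V" "sublinear_on V p" and x: "x \<in> V" and c: "c > 0"
  shows "p (\<lambda>t. c * x t) = c * p x"
proof (rule antisym)
  show "p (\<lambda>t. c * x t) \<le> c * p x" using assms by (auto simp: sublinear_on_def)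
  have "(\<lambda>t. c * x t) \<in> V" using V x by (auto simp: function_space_def)
  then have "p (\<lambda>t. (1/c) * (c * x t)) \<le> (1/c) * p (\<lambda>t. c * x t)"
    by (rule sublinear_on_scale_le[OF V(2), rotated]) (use c in simp)
  then show "c * p x \<le> p (\<lambda>t. c * x t)" using c by (simp add: field_simps)
qed

lemma sublinear_on_lower:
  assumes V: "function_space V" "sublinear_on V p" and x: "x \<in> V"
  shows "- p (\<lambda>t. - x t) \<le> p x"
proof -
  have m: "(\<lambda>t. - x t) \<in> V"
    using function_space_diff[OF V(1) _ x, of "\<lambda>_. 0"] V(1) by (simp add: function_space_def)
  have "p (\<lambda>t. x t + - x t) \<le> p x + p (\<lambda>t. - x t)"
    by (rule sublinear_on_add[OF V(2) x m])
  then show ?thesis using sublinear_on_zero[OF V] by simp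
qed

text \<open>For a fixed \<open>y\<close>, the functional \<open>r x = inf\<^sub>c (q (x + c y) - c q y)\<close> over \<open>c \<ge> 0\<close> is again sublinear and
  lies below \<open>q\<close>.  Minimality gives \<open>q x = r x \<le> q (x + y) - q y\<close>, the missing inequality.\<close>

lemma minimal_sublinear_additive:
  assumes V: "function_space V" and q: "sublinear_on V q"
    and min: "\<And>r. sublinear_on V r \<Longrightarrow> (\<And>x. x \<in> V \<Longrightarrow> r x \<le> q x) \<Longrightarrow> (\<And>x. x \<in> V \<Longrightarrow> r x = q x)"
    and x: "x \<in> V" and y: "y \<in> V"
  shows "q (\<lambda>t. x t + y t) = q x + q y"
proof (rule antisym)
  show "q (\<lambda>t. x t + y t) \<le> q x + q y" using q x y by (auto simp: sublinear_on_def)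
  define r where "r = (\<lambda>x. INF c\<in>{0..}. q (\<lambda>t. x t + c * y t) - c * q y)"
  have Vc: "(\<lambda>t. z t + c * y t) \<in> V" if "z \<in> V" for z c
    by (rule function_space_add[OF V that function_space_scale[OF V y]])
  have qc: "q (\<lambda>t. c * y t) = c * q y" if "c \<ge> 0" for c
    using sublinear_on_scale[OF V q y, of c] sublinear_on_zero[OF V q] that by (cases "c = 0") auto
  have lb: "- q (\<lambda>t. - z t) \<le> q (\<lambda>t. z t + c * y t) - c * q y" if z: "z \<in> V" and c: "c \<ge> 0" for z c
  proof -
    have m: "(\<lambda>t. - z t) \<in> V"
      using function_space_diff[OF V _ z, of "\<lambda>_. 0"] V by (simp add: function_space_def)
    have "q (\<lambda>t. (z t + c * y t) + - z t) \<le> q (\<lambda>t. z t + c * y t) + q (\<lambda>t. - z t)"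
      by (rule sublinear_on_add[OF q Vc[OF z, of c] m])
    moreover have "(\<lambda>t. (z t + c * y t) + - z t) = (\<lambda>t. c * y t)" by auto
    ultimately show ?thesis using qc[OF c] by simp
  qed
  have bdd: "bdd_below ((\<lambda>c. q (\<lambda>t. z t + c * y t) - c * q y) ` {0..})" if "z \<in> V" for z
    using lb[OF that] by (intro bdd_belowI[of _ "- q (\<lambda>t. - z t)"]) auto
  have rle: "r z \<le> q (\<lambda>t. z t + c * y t) - c * q y" if "z \<in> V" "c \<ge> 0" for z c
    unfolding r_def by (rule cINF_lower[OF bdd]) (use that in auto)
  have rge: "m \<le> r z" if "\<And>c. c \<ge> 0 \<Longrightarrow> m \<le> q (\<lambda>t. z t + c * y t) - c * q y" for z m
    unfolding r_def by (rule cINF_greatest) (use that in auto)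
  have "sublinear_on V r"
    unfolding sublinear_on_def
  proof (intro conjI ballI allI impI)
    fix a b assume a: "a \<in> V" and b: "b \<in> V"
    have ab: "(\<lambda>t. a t + b t) \<in> V" using V a b by (auto simp: function_space_def)
    have *: "r (\<lambda>t. a t + b t) \<le> (q (\<lambda>t. a t + c * y t) - c * q y) + (q (\<lambda>t. b t + d * y t) - d * q y)"
      if "c \<ge> 0" "d \<ge> 0" for c d
    proof -
      have "r (\<lambda>t. a t + b t) \<le> q (\<lambda>t. (a t + b t) + (c + d) * y t) - (c + d) * q y"
        using rle[OF ab, of "c + d"] that by simp
      also have "(\<lambda>t. (a t + b t) + (c + d) * y t) = (\<lambda>t. (a t + c * y t) + (b t + d * y t))"
        by (auto simp: algebra_simps)
      also have "q \<dots> \<le> q (\<lambda>t. a t + c * y t) + q (\<lambda>t. b t + d * y t)"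
        by (rule sublinear_on_add[OF q Vc[OF a] Vc[OF b]])
      finally show ?thesis by (simp add: algebra_simps)
    qed
    have "r (\<lambda>t. a t + b t) - (q (\<lambda>t. a t + c * y t) - c * q y) \<le> r b" if "c \<ge> 0" for c
      by (rule rge) (use *[OF that] in \<open>auto simp: algebra_simps\<close>)
    then have "r (\<lambda>t. a t + b t) - r b \<le> r a"
      by (intro rge) (auto simp: algebra_simps)
    then show "r (\<lambda>t. a t + b t) \<le> r a + r b" by simp
  next
    fix c :: real and a assume c: "c > 0" and a: "a \<in> V"
    have ca: "(\<lambda>t. c * a t) \<in> V" using V a by (auto simp: function_space_def)
    have "r (\<lambda>t. c * a t) / c \<le> r a"
    proof (rule rge)
      fix d :: real assume d: "d \<ge> 0"
      have "r (\<lambda>t. c * a t) \<le> q (\<lambda>t. c * a t + (c * d) * y t) - (c * d) * q y"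
        using rle[OF ca, of "c * d"] c d by simp
      also have "(\<lambda>t. c * a t + (c * d) * y t) = (\<lambda>t. c * (a t + d * y t))"
        by (auto simp: algebra_simps)
      also have "q \<dots> = c * q (\<lambda>t. a t + d * y t)"
        by (rule sublinear_on_scale[OF V q Vc[OF a] c])
      finally show "r (\<lambda>t. c * a t) / c \<le> q (\<lambda>t. a t + d * y t) - d * q y"
        using c by (simp add: field_simps)
    qed
    then show "r (\<lambda>t. c * a t) \<le> c * r a" using c by (simp add: field_simps)
  qed
  moreover have "r z \<le> q z" if "z \<in> V" for z
    using rle[OF that, of 0] by simp
  ultimately have "r x = q x" using min x by blast
  then show "q x + q y \<le> q (\<lambda>t. x t + y t)"
    using rle[OF x, of 1] by simp
qed

text \<open>Zorn's lemma produces a minimal sublinear functional below \<open>p\<close>; such a functional is additive and hence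
  linear.  Infima of chains stay finite because every sublinear \<open>q \<le> p\<close> satisfies \<open>q x \<ge> - p (- x)\<close>.\<close>

lemma sublinear_dominates_linear_form:
  assumes V: "function_space V" and p: "sublinear_on V p"
  obtains l where "linear_form_on V l" "\<And>x. x \<in> V \<Longrightarrow> l x \<le> p x"
proof -
  \<comment> \<open>Fixing the value \<open>0\<close> outside \<open>V\<close> makes the pointwise order antisymmetric on \<open>Q\<close>.\<close>
  define Q where "Q = {q. sublinear_on V q \<and> (\<forall>x\<in>V. q x \<le> p x) \<and> (\<forall>x. x \<notin> V \<longrightarrow> q x = 0)}"
  define P where "P = (\<lambda>q r :: ('a \<Rightarrow> real) \<Rightarrow> real. \<forall>x. r x \<le> q x)"
  have Vops: "(\<lambda>t. x t + y t) \<in> V" "(\<lambda>t. c * x t) \<in> V" if "x \<in> V" "y \<in> V" for x y c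
    using V that by (auto simp: function_space_def)
  have "\<exists>m\<in>Q. \<forall>a\<in>Q. P m a \<longrightarrow> a = m"
  proof (rule predicate_Zorn)
    show "partial_order_on Q (relation_of P Q)"
      unfolding partial_order_on_def preorder_on_def refl_on_def trans_def antisym_def relation_of_def P_def
      by (auto intro: order_trans antisym simp: fun_eq_iff)
    fix C assume C: "C \<in> Chains (relation_of P Q)"
    then have CQ: "C \<subseteq> Q" and tot: "\<And>q r. q \<in> C \<Longrightarrow> r \<in> C \<Longrightarrow> P q r \<or> P r q"
      unfolding Chains_def relation_of_def by blast+
    show "\<exists>u\<in>Q. \<forall>a\<in>C. P a u"
    proof (cases "C = {}")
      case True
      define p0 where "p0 = (\<lambda>x. if x \<in> V then p x else 0)"
      have "p0 \<in> Q" using p Vops unfolding Q_def p0_def sublinear_on_def by auto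
      then show ?thesis using True by auto
    next
      case False
      define m where "m = (\<lambda>x. INF q\<in>C. q x)"
      have lb: "- p (\<lambda>t. - x t) \<le> q x" if "q \<in> C" "x \<in> V" for q x
      proof -
        have q: "sublinear_on V q" "\<forall>x\<in>V. q x \<le> p x" using that CQ by (auto simp: Q_def)
        have "(\<lambda>t. - x t) \<in> V"
          using Vops(2)[OF that(2,2), of "-1"] by simp
        then show ?thesis using sublinear_on_lower[OF V q(1) that(2)] q(2) by force
      qed
      have bdd: "bdd_below ((\<lambda>q. q x) ` C)" for x
      proof (cases "x \<in> V")
        case True
        then show ?thesis using lb[OF _ True] by (intro bdd_belowI[of _ "- p (\<lambda>t. - x t)"]) auto
      next
        case False
        then show ?thesis using CQ by (intro bdd_belowI[of _ 0]) (auto simp: Q_def)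
      qed
      have mle: "m x \<le> q x" if "q \<in> C" for q x
        unfolding m_def by (rule cINF_lower[OF bdd that])
      have mge: "k \<le> m x" if "\<And>q. q \<in> C \<Longrightarrow> k \<le> q x" for k x
        unfolding m_def by (rule cINF_greatest) (use that False in auto)
      have sub: "q (\<lambda>t. x t + y t) \<le> q x + q y" if "q \<in> C" "x \<in> V" "y \<in> V" for q x y
        using that CQ by (auto simp: Q_def sublinear_on_def)
      have "sublinear_on V m"
        unfolding sublinear_on_def
      proof (intro conjI ballI allI impI)
        fix x y assume x: "x \<in> V" and y: "y \<in> V"
        have *: "m (\<lambda>t. x t + y t) \<le> q x + r y" if "q \<in> C" "r \<in> C" for q r
        proof -
          from tot[OF that] show ?thesis
          proof
            assume "P q r"
            then have "r x \<le> q x" by (auto simp: P_def)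
            then show ?thesis using mle[OF that(2), of "\<lambda>t. x t + y t"] sub[OF that(2) x y] by linarith
          next
            assume "P r q"
            then have "q y \<le> r y" by (auto simp: P_def)
            then show ?thesis using mle[OF that(1), of "\<lambda>t. x t + y t"] sub[OF that(1) x y] by linarith
          qed
        qed
        have "m (\<lambda>t. x t + y t) - q x \<le> m y" if "q \<in> C" for q
          by (rule mge) (use *[OF that] in \<open>auto simp: algebra_simps\<close>)
        then have "m (\<lambda>t. x t + y t) - m y \<le> m x"
          by (intro mge) (auto simp: algebra_simps)
        then show "m (\<lambda>t. x t + y t) \<le> m x + m y" by simp
      next
        fix c :: real and x assume c: "c > 0" and x: "x \<in> V"
        have "m (\<lambda>t. c * x t) / c \<le> m x"
        proof (rule mge)
          fix q assume q: "q \<in> C"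
          have "m (\<lambda>t. c * x t) \<le> c * q x"
            using mle[OF q, of "\<lambda>t. c * x t"] q CQ c x unfolding Q_def sublinear_on_def by force
          then show "m (\<lambda>t. c * x t) / c \<le> q x" using c by (simp add: field_simps)
        qed
        then show "m (\<lambda>t. c * x t) \<le> c * m x" using c by (simp add: field_simps)
      qed
      moreover have "m x \<le> p x" if "x \<in> V" for x
      proof -
        obtain q where "q \<in> C" using False by blast
        then have "m x \<le> q x" "q x \<le> p x" using mle CQ that by (auto simp: Q_def)
        then show ?thesis by simp
      qed
      moreover have "m x = 0" if "x \<notin> V" for x
      proof -
        have "m x = (INF q\<in>C. 0)"
          unfolding m_def by (rule INF_cong) (use CQ that in \<open>auto simp: Q_def\<close>)
        then show ?thesis using False by simp
      qed
      ultimately have "m \<in> Q" by (simp add: Q_def)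
      then show ?thesis using mle by (auto simp: P_def)
    qed
  qed
  then obtain q where qQ: "q \<in> Q" and qmin: "\<And>a. a \<in> Q \<Longrightarrow> P q a \<Longrightarrow> a = q" by blast
  have q: "sublinear_on V q" "\<And>x. x \<in> V \<Longrightarrow> q x \<le> p x" using qQ by (auto simp: Q_def)
  have min: "r x = q x" if r: "sublinear_on V r" "\<And>x. x \<in> V \<Longrightarrow> r x \<le> q x" and x: "x \<in> V" for r x
  proof -
    define r0 where "r0 = (\<lambda>x. if x \<in> V then r x else 0)"
    have "r0 \<in> Q" using r q(2) Vops unfolding Q_def r0_def sublinear_on_def by (auto intro: order_trans)
    moreover have "P q r0" using r(2) qQ by (auto simp: P_def r0_def Q_def)
    ultimately have "r0 = q" by (rule qmin)
    then show ?thesis using x by (metis r0_def)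
  qed
  have add: "q (\<lambda>t. x t + y t) = q x + q y" if "x \<in> V" "y \<in> V" for x y
    by (rule minimal_sublinear_additive[OF V q(1)]) (use min that in blast)+
  have neg: "q (\<lambda>t. - x t) = - q x" if "x \<in> V" for x
    using add[OF that, of "\<lambda>t. - x t"] Vops(2)[OF that that, of "-1"] sublinear_on_zero[OF V q(1)] by simp
  have "q (\<lambda>t. c * x t) = c * q x" if x: "x \<in> V" for c x
  proof -
    consider "c > 0" | "c = 0" | "c < 0" by linarith
    then show ?thesis
    proof cases
      case 1 then show ?thesis by (rule sublinear_on_scale[OF V q(1) x])
    next
      case 2 then show ?thesis using sublinear_on_zero[OF V q(1)] by simp
    next
      case 3
      then have "q (\<lambda>t. (-c) * x t) = (-c) * q x" by (intro sublinear_on_scale[OF V q(1) x]) simp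
      moreover have "q (\<lambda>t. - ((-c) * x t)) = - q (\<lambda>t. (-c) * x t)"
        by (rule neg) (rule Vops(2)[OF x x])
      ultimately show ?thesis by simp
    qed
  qed
  with add have "linear_form_on V q" by (auto simp: linear_form_on_def)
  with q(2) that show ?thesis by blast
qed

text \<open>The functional \<open>r x = inf\<^sub>k p (x + k)\<close> over the cone is sublinear, bounded below because \<open>p \<ge> 0\<close> on the
  cone, and satisfies \<open>r (- k) \<le> 0\<close>.  Every linear form below \<open>r\<close> is therefore below \<open>p\<close> and nonnegative on
  the cone.  This is the separation of a cone from the open set where \<open>p < 0\<close>.\<close>

lemma linear_form_nonneg_on_cone:
  assumes V: "function_space V" and p: "sublinear_on V p"
    and KV: "K \<subseteq> V" and K0: "(\<lambda>_. 0) \<in> K"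
    and Kadd: "\<And>x y. x \<in> K \<Longrightarrow> y \<in> K \<Longrightarrow> (\<lambda>t. x t + y t) \<in> K"
    and Kscale: "\<And>c x. c > 0 \<Longrightarrow> x \<in> K \<Longrightarrow> (\<lambda>t. c * x t) \<in> K"
    and pK: "\<And>k. k \<in> K \<Longrightarrow> 0 \<le> p k"
  obtains l where "linear_form_on V l" "\<And>x. x \<in> V \<Longrightarrow> l x \<le> p x" "\<And>k. k \<in> K \<Longrightarrow> 0 \<le> l k"
proof -
  define r where "r = (\<lambda>x. INF k\<in>K. p (\<lambda>t. x t + k t))"
  have Vadd: "(\<lambda>t. x t + y t) \<in> V" if "x \<in> V" "y \<in> V" for x y
    using V that by (auto simp: function_space_def)
  have Vsc: "(\<lambda>t. c * x t) \<in> V" if "x \<in> V" for x c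
    using V that by (auto simp: function_space_def)
  have lb: "- p (\<lambda>t. - x t) \<le> p (\<lambda>t. x t + k t)" if x: "x \<in> V" and k: "k \<in> K" for x k
  proof -
    have "p (\<lambda>t. (x t + k t) + - x t) \<le> p (\<lambda>t. x t + k t) + p (\<lambda>t. - x t)"
      using sublinear_on_add[OF p Vadd[OF x, of k] Vsc[OF x, of "-1"]] k KV by auto
    then show ?thesis using pK[OF k] by simp
  qed
  have bdd: "bdd_below ((\<lambda>k. p (\<lambda>t. x t + k t)) ` K)" if "x \<in> V" for x
    using lb[OF that] by (intro bdd_belowI[of _ "- p (\<lambda>t. - x t)"]) auto
  have rle: "r x \<le> p (\<lambda>t. x t + k t)" if "x \<in> V" "k \<in> K" for x k
    unfolding r_def by (rule cINF_lower[OF bdd]) (use that in auto)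
  have rge: "m \<le> r x" if "\<And>k. k \<in> K \<Longrightarrow> m \<le> p (\<lambda>t. x t + k t)" for x m
    unfolding r_def by (rule cINF_greatest) (use that K0 in auto)
  have "sublinear_on V r"
    unfolding sublinear_on_def
  proof (intro conjI ballI allI impI)
    fix a b assume a: "a \<in> V" and b: "b \<in> V"
    have *: "r (\<lambda>t. a t + b t) \<le> p (\<lambda>t. a t + k t) + p (\<lambda>t. b t + m t)" if k: "k \<in> K" and m: "m \<in> K" for k m
    proof -
      have "r (\<lambda>t. a t + b t) \<le> p (\<lambda>t. (a t + b t) + (k t + m t))"
        by (rule rle[OF Vadd[OF a b] Kadd[OF k m]])
      also have "(\<lambda>t. (a t + b t) + (k t + m t)) = (\<lambda>t. (a t + k t) + (b t + m t))"
        by (auto simp: algebra_simps)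
      also have "p \<dots> \<le> p (\<lambda>t. a t + k t) + p (\<lambda>t. b t + m t)"
        by (rule sublinear_on_add[OF p]) (use Vadd a b k m KV in auto)
      finally show ?thesis .
    qed
    have "r (\<lambda>t. a t + b t) - p (\<lambda>t. a t + k t) \<le> r b" if "k \<in> K" for k
      by (rule rge) (use *[OF that] in \<open>auto simp: algebra_simps\<close>)
    then have "r (\<lambda>t. a t + b t) - r b \<le> r a"
      by (intro rge) (auto simp: algebra_simps)
    then show "r (\<lambda>t. a t + b t) \<le> r a + r b" by simp
  next
    fix c :: real and a assume c: "c > 0" and a: "a \<in> V"
    have "r (\<lambda>t. c * a t) / c \<le> r a"
    proof (rule rge)
      fix k assume k: "k \<in> K"
      have "r (\<lambda>t. c * a t) \<le> p (\<lambda>t. c * a t + c * k t)"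
        by (rule rle[OF Vsc[OF a] Kscale[OF c k]])
      also have "(\<lambda>t. c * a t + c * k t) = (\<lambda>t. c * (a t + k t))"
        by (auto simp: algebra_simps)
      also have "p \<dots> = c * p (\<lambda>t. a t + k t)"
        by (rule sublinear_on_scale[OF V p _ c]) (use Vadd a k KV in auto)
      finally show "r (\<lambda>t. c * a t) / c \<le> p (\<lambda>t. a t + k t)"
        using c by (simp add: field_simps)
    qed
    then show "r (\<lambda>t. c * a t) \<le> c * r a" using c by (simp add: field_simps)
  qed
  then obtain l where l: "linear_form_on V l" "\<And>x. x \<in> V \<Longrightarrow> l x \<le> r x"
    using sublinear_dominates_linear_form[OF V] by blast
  have "l x \<le> p x" if "x \<in> V" for x
    using l(2)[OF that] rle[OF that K0] by simp
  moreover have "0 \<le> l k" if k: "k \<in> K" for k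
  proof -
    have kV: "k \<in> V" using k KV by auto
    have "l (\<lambda>t. (-1) * k t) \<le> r (\<lambda>t. (-1) * k t)" by (rule l(2)[OF Vsc[OF kV]])
    also have "\<dots> \<le> p (\<lambda>t. (-1) * k t + k t)" by (rule rle[OF Vsc[OF kV] k])
    also have "\<dots> = 0" using sublinear_on_zero[OF V p] by simp
    finally show ?thesis using l(1) kV unfolding linear_form_on_def by (metis mult_minus1 neg_le_0_iff_le)
  qed
  ultimately show ?thesis using that l(1) by blast
qed

section \<open>Finite families of linear functionals\<close>

text \<open>The vector space is described by operations \<open>add\<close> and \<open>sc\<close> on a carrier, since it will be a set of
  vector-valued functions and not a type.\<close>

lemma functional_in_span_of_kernel:
  fixes \<Psi> :: "'j \<Rightarrow> 'h \<Rightarrow> real" and add :: "'h \<Rightarrow> 'h \<Rightarrow> 'h" and sc :: "real \<Rightarrow> 'h \<Rightarrow> 'h"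
  assumes J: "finite J"
    and add: "\<And>x y. x \<in> X \<Longrightarrow> y \<in> X \<Longrightarrow> add x y \<in> X" and sc: "\<And>c x. x \<in> X \<Longrightarrow> sc c x \<in> X"
    and \<Psi>add: "\<And>j x y. j \<in> J \<Longrightarrow> x \<in> X \<Longrightarrow> y \<in> X \<Longrightarrow> \<Psi> j (add x y) = \<Psi> j x + \<Psi> j y"
    and \<Psi>sc: "\<And>j c x. j \<in> J \<Longrightarrow> x \<in> X \<Longrightarrow> \<Psi> j (sc c x) = c * \<Psi> j x"
    and \<Lambda>add: "\<And>x y. x \<in> X \<Longrightarrow> y \<in> X \<Longrightarrow> \<Lambda> (add x y) = \<Lambda> x + \<Lambda> y"
    and \<Lambda>sc: "\<And>c x. x \<in> X \<Longrightarrow> \<Lambda> (sc c x) = c * \<Lambda> x"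
    and ker: "\<And>x. x \<in> X \<Longrightarrow> (\<And>j. j \<in> J \<Longrightarrow> \<Psi> j x = 0) \<Longrightarrow> \<Lambda> x = 0"
  shows "\<exists>c. \<forall>x\<in>X. \<Lambda> x = (\<Sum>j\<in>J. c j * \<Psi> j x)"
  using J \<Psi>add \<Psi>sc \<Lambda>add \<Lambda>sc ker
proof (induction J arbitrary: \<Lambda> rule: finite_induct)
  case empty
  then show ?case by auto
next
  case (insert i J)
  show ?case
  proof (cases "\<exists>e\<in>X. (\<forall>j\<in>J. \<Psi> j e = 0) \<and> \<Psi> i e \<noteq> 0")
    case True
    then obtain e where e: "e \<in> X" "\<forall>j\<in>J. \<Psi> j e = 0" "\<Psi> i e \<noteq> 0" by blast
    define k where "k = \<Lambda> e / \<Psi> i e"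
    have "\<exists>c. \<forall>x\<in>X. \<Lambda> x - k * \<Psi> i x = (\<Sum>j\<in>J. c j * \<Psi> j x)"
    proof (rule insert.IH)
      show "\<Lambda> (add x y) - k * \<Psi> i (add x y) = \<Lambda> x - k * \<Psi> i x + (\<Lambda> y - k * \<Psi> i y)" if "x \<in> X" "y \<in> X" for x y
        using insert.prems(1)[of i x y] insert.prems(3) that by (simp add: algebra_simps)
      show "\<Lambda> (sc c x) - k * \<Psi> i (sc c x) = c * (\<Lambda> x - k * \<Psi> i x)" if "x \<in> X" for x c
        using insert.prems(2)[of i x c] insert.prems(4) that by (simp add: algebra_simps)
      show "\<Lambda> x - k * \<Psi> i x = 0" if x: "x \<in> X" and z: "\<And>j. j \<in> J \<Longrightarrow> \<Psi> j x = 0" for x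
      proof -
        define d where "d = - \<Psi> i x / \<Psi> i e"
        have "\<Lambda> (add x (sc d e)) = 0"
        proof (rule insert.prems(5))
          show "add x (sc d e) \<in> X" using add sc x e by blast
          show "\<Psi> j (add x (sc d e)) = 0" if "j \<in> insert i J" for j
            using that z e x sc insert.prems(1,2) by (auto simp: d_def)
        qed
        then show ?thesis using insert.prems(3,4) x e sc by (simp add: d_def k_def field_simps)
      qed
    qed (use insert.prems in auto)
    then obtain c where c: "\<And>x. x \<in> X \<Longrightarrow> \<Lambda> x - k * \<Psi> i x = (\<Sum>j\<in>J. c j * \<Psi> j x)" by blast
    have "\<Lambda> x = (\<Sum>j\<in>insert i J. (c(i := k)) j * \<Psi> j x)" if "x \<in> X" for x
    proof -
      have "(\<Sum>j\<in>J. (c(i := k)) j * \<Psi> j x) = (\<Sum>j\<in>J. c j * \<Psi> j x)"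
        by (rule sum.cong) (use insert.hyps in auto)
      then show ?thesis using c[OF that] insert.hyps by simp
    qed
    then show ?thesis by blast
  next
    case False
    have "\<exists>c. \<forall>x\<in>X. \<Lambda> x = (\<Sum>j\<in>J. c j * \<Psi> j x)"
    proof (rule insert.IH)
      show "\<Lambda> x = 0" if "x \<in> X" "\<And>j. j \<in> J \<Longrightarrow> \<Psi> j x = 0" for x
        using insert.prems(5) False that by (metis insert_iff)
    qed (use insert.prems in auto)
    then obtain c where c: "\<And>x. x \<in> X \<Longrightarrow> \<Lambda> x = (\<Sum>j\<in>J. c j * \<Psi> j x)" by blast
    have "\<Lambda> x = (\<Sum>j\<in>insert i J. (c(i := 0)) j * \<Psi> j x)" if "x \<in> X" for x
    proof -
      have "(\<Sum>j\<in>J. (c(i := 0)) j * \<Psi> j x) = (\<Sum>j\<in>J. c j * \<Psi> j x)"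
        by (rule sum.cong) (use insert.hyps in auto)
      then show ?thesis using c[OF that] insert.hyps by simp
    qed
    then show ?thesis by blast
  qed
qed

lemma dual_family_exists:
  fixes \<Psi> :: "'j \<Rightarrow> 'h \<Rightarrow> real" and add :: "'h \<Rightarrow> 'h \<Rightarrow> 'h" and sc :: "real \<Rightarrow> 'h \<Rightarrow> 'h"
  assumes J: "finite J"
    and add: "\<And>x y. x \<in> X \<Longrightarrow> y \<in> X \<Longrightarrow> add x y \<in> X" and sc: "\<And>c x. x \<in> X \<Longrightarrow> sc c x \<in> X"
    and \<Psi>add: "\<And>j x y. j \<in> J \<Longrightarrow> x \<in> X \<Longrightarrow> y \<in> X \<Longrightarrow> \<Psi> j (add x y) = \<Psi> j x + \<Psi> j y"
    and \<Psi>sc: "\<And>j c x. j \<in> J \<Longrightarrow> x \<in> X \<Longrightarrow> \<Psi> j (sc c x) = c * \<Psi> j x"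
    and indep: "\<And>c. (\<And>x. x \<in> X \<Longrightarrow> (\<Sum>j\<in>J. c j * \<Psi> j x) = 0) \<Longrightarrow> (\<And>j. j \<in> J \<Longrightarrow> c j = 0)"
  obtains e where "\<And>i. i \<in> J \<Longrightarrow> e i \<in> X" "\<And>i j. i \<in> J \<Longrightarrow> j \<in> J \<Longrightarrow> \<Psi> j (e i) = (if i = j then 1 else 0)"
proof -
  have "\<exists>x\<in>X. \<forall>j\<in>J. \<Psi> j x = (if i = j then 1 else 0)" if i: "i \<in> J" for i
  proof -
    have "\<exists>e\<in>X. (\<forall>j\<in>J - {i}. \<Psi> j e = 0) \<and> \<Psi> i e \<noteq> 0"
    proof (rule ccontr)
      assume neg: "\<not> ?thesis"
      have "\<exists>c. \<forall>x\<in>X. \<Psi> i x = (\<Sum>j\<in>J - {i}. c j * \<Psi> j x)"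
      proof (rule functional_in_span_of_kernel[of "J - {i}" X add sc])
        show "\<Psi> i x = 0" if "x \<in> X" "\<And>j. j \<in> J - {i} \<Longrightarrow> \<Psi> j x = 0" for x
          using neg that by blast
      qed (use J add sc \<Psi>add \<Psi>sc i in auto)
      then obtain c where c: "\<And>x. x \<in> X \<Longrightarrow> \<Psi> i x = (\<Sum>j\<in>J - {i}. c j * \<Psi> j x)" by blast
      have "(\<Sum>j\<in>J. (c(i := -1)) j * \<Psi> j x) = 0" if "x \<in> X" for x
      proof -
        have "(\<Sum>j\<in>J. (c(i := -1)) j * \<Psi> j x) = - \<Psi> i x + (\<Sum>j\<in>J - {i}. (c(i := -1)) j * \<Psi> j x)"
          using J i by (simp add: sum.remove)
        also have "(\<Sum>j\<in>J - {i}. (c(i := -1)) j * \<Psi> j x) = (\<Sum>j\<in>J - {i}. c j * \<Psi> j x)"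
          by (rule sum.cong) auto
        finally show ?thesis using c[OF that] by simp
      qed
      from indep[of "c(i := -1)", OF this i] show False by simp
    qed
    then obtain e where e: "e \<in> X" "\<And>j. j \<in> J - {i} \<Longrightarrow> \<Psi> j e = 0" "\<Psi> i e \<noteq> 0" by blast
    show ?thesis
      by (rule bexI[of _ "sc (1 / \<Psi> i e) e"]) (use e sc \<Psi>sc i in auto)
  qed
  then obtain e where "\<forall>i\<in>J. e i \<in> X \<and> (\<forall>j\<in>J. \<Psi> j (e i) = (if i = j then 1 else 0))"
    by metis
  then show ?thesis using that by blast
qed

text \<open>Neumann series for \<open>(I - E) y = b\<close> in the maximum norm.  The bound on the solution is what matters
  later: it keeps the correction terms of a variation small.\<close>

lemma near_identity_system_solvable:
  fixes E :: "'j \<Rightarrow> 'j \<Rightarrow> real"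
  assumes J: "finite J" and E: "\<And>i. i \<in> J \<Longrightarrow> (\<Sum>j\<in>J. \<bar>E i j\<bar>) \<le> 1/2"
    and b: "\<And>i. i \<in> J \<Longrightarrow> \<bar>b i\<bar> \<le> \<beta>"
  obtains y where "\<And>i. i \<in> J \<Longrightarrow> y i - (\<Sum>j\<in>J. E i j * y j) = b i" "\<And>i. i \<in> J \<Longrightarrow> \<bar>y i\<bar> \<le> 2 * \<beta>"
proof -
  define d where "d = rec_nat b (\<lambda>_ x i. \<Sum>j\<in>J. E i j * x j)"
  have d0: "d 0 = b" and dS: "d (Suc k) i = (\<Sum>j\<in>J. E i j * d k j)" for k i
    by (auto simp: d_def)
  have dk: "\<bar>d k i\<bar> \<le> \<beta> * (1/2)^k" if "i \<in> J" for k i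
    using that
  proof (induction k arbitrary: i)
    case 0 then show ?case using b by (simp add: d0)
  next
    case (Suc k)
    have \<beta>: "0 \<le> \<beta>" using b[OF Suc.prems] by linarith
    have "\<bar>d (Suc k) i\<bar> \<le> (\<Sum>j\<in>J. \<bar>E i j\<bar> * \<bar>d k j\<bar>)"
      unfolding dS by (rule order_trans[OF sum_abs]) (simp add: abs_mult)
    also have "\<dots> \<le> (\<Sum>j\<in>J. \<bar>E i j\<bar> * (\<beta> * (1/2)^k))"
      by (intro sum_mono mult_left_mono Suc.IH) auto
    also have "\<dots> = (\<Sum>j\<in>J. \<bar>E i j\<bar>) * (\<beta> * (1/2)^k)" by (simp add: sum_distrib_right)
    also have "\<dots> \<le> 1/2 * (\<beta> * (1/2)^k)"
      by (intro mult_right_mono E Suc.prems) (use \<beta> in auto)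
    finally show ?case by simp
  qed
  have geo: "(\<lambda>k. \<beta> * (1/2)^k) sums (\<beta> * 2)"
    using geometric_sums[of "1/2::real"] by (intro sums_mult) auto
  have summ: "summable (\<lambda>k. d k i)" "\<bar>\<Sum>k. d k i\<bar> \<le> \<beta> * 2" if "i \<in> J" for i
  proof -
    have sn: "summable (\<lambda>k. \<bar>d k i\<bar>)"
      by (rule summable_comparison_test[OF _ sums_summable[OF geo]]) (use dk[OF that] in auto)
    then show "summable (\<lambda>k. d k i)" by (rule summable_rabs_cancel)
    have "\<bar>\<Sum>k. d k i\<bar> \<le> (\<Sum>k. \<bar>d k i\<bar>)" by (rule summable_rabs[OF sn])
    also have "\<dots> \<le> (\<Sum>k. \<beta> * (1/2)^k)"
      by (rule suminf_le[OF _ sn sums_summable[OF geo]]) (use dk[OF that] in auto)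
    finally show "\<bar>\<Sum>k. d k i\<bar> \<le> \<beta> * 2" using sums_unique[OF geo] by simp
  qed
  define y where "y = (\<lambda>i. \<Sum>k. d k i)"
  have "y i - (\<Sum>j\<in>J. E i j * y j) = b i" if i: "i \<in> J" for i
  proof -
    have "(\<lambda>k. \<Sum>j\<in>J. E i j * d k j) sums (\<Sum>j\<in>J. E i j * y j)"
      unfolding y_def by (intro sums_sum sums_mult summable_sums summ)
    then have "(\<lambda>k. d (Suc k) i) sums (\<Sum>j\<in>J. E i j * y j)" by (simp add: dS)
    then have "(\<lambda>k. d k i) sums ((\<Sum>j\<in>J. E i j * y j) + b i)"
      using sums_Suc_iff[of "\<lambda>k. d k i"] by (simp add: d0)
    then have "y i = (\<Sum>j\<in>J. E i j * y j) + b i" unfolding y_def by (simp add: sums_iff)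
    then show ?thesis by simp
  qed
  then show ?thesis using that[of y] summ(2) by (simp add: y_def mult.commute)
qed

section \<open>Arc length and nontangential limits\<close>

text \<open>Boundary integrals are taken over the closed interval of angles, which suits the integration theorems on
  compact intervals; that the point \<open>1\<close> of the circle is counted twice does not affect null sets.\<close>

abbreviation ang :: "real measure" where "ang \<equiv> lebesgue_on {0..2*pi}"

lemma finite_measure_ang: "finite_measure ang"
  by (rule finite_measureI) (simp add: emeasure_restrict_space)

lemma LINT_ang:
  fixes k :: "real \<Rightarrow> 'a::{banach, second_countable_topology}"
  shows "(LINT \<theta>:{0..2*pi}|lebesgue. k \<theta>) = integral\<^sup>L ang k"
  using integral_restrict_space[of "{0..2*pi}" lebesgue k]
  by (simp add: set_lebesgue_integral_def)

lemma measure_ang: "measure ang {0..2*pi} = 2*pi"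
  by (simp add: measure_restrict_space)

lemma borel_imp_ang: "f \<in> borel_measurable borel \<Longrightarrow> f \<in> borel_measurable ang"
  by (intro measurable_restrict_space1 measurable_completion) simp

lemma continuous_imp_ang:
  fixes f :: "real \<Rightarrow> 'a::euclidean_space"
  assumes "continuous_on {0..2*pi} f" shows "f \<in> borel_measurable ang"
  using assms by (intro continuous_imp_measurable_on_sets_lebesgue) auto

lemma integrable_ang_bounded:
  fixes f :: "real \<Rightarrow> 'a::{banach,second_countable_topology}"
  assumes "f \<in> borel_measurable ang" "AE \<theta> in ang. norm (f \<theta>) \<le> C"
  shows "integrable ang f"
  using finite_measure.integrable_const_bound[OF finite_measure_ang assms(2,1)] .

lemma ang_AE_measurable:
  fixes f g :: "real \<Rightarrow> 'a::euclidean_space"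
  assumes g: "g \<in> borel_measurable ang" and eq: "AE \<theta> in ang. g \<theta> = f \<theta>"
  shows "f \<in> borel_measurable ang"
proof -
  have "(\<lambda>\<theta>. indicator {0..2*pi} \<theta> *\<^sub>R g \<theta>) \<in> borel_measurable lebesgue"
    using g by (subst (asm) borel_measurable_restrict_space_iff) auto
  moreover have "AE \<theta> in lebesgue. \<theta> \<in> {0..2*pi} \<longrightarrow> g \<theta> = f \<theta>"
    using eq by (subst (asm) AE_restrict_space_iff) auto
  then have "AE \<theta> in lebesgue. indicator {0..2*pi} \<theta> *\<^sub>R g \<theta> = indicator {0..2*pi} \<theta> *\<^sub>R f \<theta>"
    by eventually_elim (auto simp: indicator_def)
  ultimately have "(\<lambda>\<theta>. indicator {0..2*pi} \<theta> *\<^sub>R f \<theta>) \<in> borel_measurable lebesgue"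
    by (rule borel_measurable_AE)
  then show ?thesis by (subst borel_measurable_restrict_space_iff) auto
qed

lemma ang_AE_limit_measurable:
  fixes f :: "real \<Rightarrow> 'a::euclidean_space"
  assumes f: "\<And>n. F n \<in> borel_measurable ang"
    and lim: "AE \<theta> in ang. (\<lambda>n. F n \<theta>) \<longlonglongrightarrow> f \<theta>"
  shows "f \<in> borel_measurable ang"
proof -
  obtain N where N: "N \<in> null_sets ang" "{\<theta>\<in>space ang. \<not> (\<lambda>n. F n \<theta>) \<longlonglongrightarrow> f \<theta>} \<subseteq> N"
    using lim unfolding eventually_ae_filter by blast
  define g where "g = (\<lambda>\<theta>. if \<theta> \<in> N then 0 else f \<theta>)"
  have "g \<in> borel_measurable ang"
  proof (rule borel_measurable_LIMSEQ_metric)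
    show "(\<lambda>\<theta>. if \<theta> \<in> N then 0 else F n \<theta>) \<in> borel_measurable ang" for n
      by (rule measurable_If_set) (use f N in auto)
    show "(\<lambda>n. if \<theta> \<in> N then 0 else F n \<theta>) \<longlonglongrightarrow> g \<theta>" if "\<theta> \<in> space ang" for \<theta>
      using N(2) that by (cases "\<theta> \<in> N") (auto simp: g_def)
  qed
  moreover have "AE \<theta> in ang. g \<theta> = f \<theta>"
    using AE_not_in[OF N(1)] by eventually_elim (simp add: g_def)
  ultimately show ?thesis by (rule ang_AE_measurable)
qed

text \<open>A fixed sequence of radii increasing to \<open>1\<close>; boundary values are recovered along it, which turns
  nontangential limits into limits of sequences of measurable functions.\<close>

definition rad :: "nat \<Rightarrow> real" where "rad m = 1 - 1 / (real m + 2)"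

lemma rad: "0 < rad m" "rad m < 1" "1/2 \<le> rad m" "\<bar>rad m\<bar> = rad m"
  by (auto simp: rad_def field_simps)

lemma rad_tendsto: "rad \<longlonglongrightarrow> 1"
proof -
  have "filterlim (\<lambda>m. 2 + real m) at_top sequentially"
    by (rule filterlim_tendsto_add_at_top[OF tendsto_const filterlim_real_sequentially])
  then have "(\<lambda>m. 1 - 1 / (2 + real m)) \<longlonglongrightarrow> 1 - 0"
    by (intro tendsto_intros tendsto_divide_0[OF tendsto_const] filterlim_at_top_imp_at_infinity)
  then show ?thesis by (simp add: rad_def[abs_def] add.commute)
qed

lemma norm_rad_mult_less:
  fixes z :: complex
  assumes "norm z \<le> 1"
  shows "norm (of_real (rad m) * z) < 1"
proof -
  have "rad m * norm z \<le> rad m * 1" using assms rad[of m] by (intro mult_left_mono) auto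
  then have "rad m * norm z < 1" using rad(2)[of m] by linarith
  then show ?thesis using rad(4)[of m] by (simp add: norm_mult)
qed

lemma eventually_nontangential:
  "eventually P (nontangential \<zeta>) \<longleftrightarrow> (\<forall>\<alpha>>1. eventually P (at \<zeta> within stolz_region \<zeta> \<alpha>))"
  unfolding nontangential_def by (auto simp: eventually_Sup)

lemma tendsto_nontangential:
  "(f \<longlongrightarrow> L) (nontangential \<zeta>) \<longleftrightarrow> (\<forall>\<alpha>>1. (f \<longlongrightarrow> L) (at \<zeta> within stolz_region \<zeta> \<alpha>))"
  unfolding tendsto_def eventually_nontangential by blast

lemma radial_approach:
  assumes \<zeta>: "norm \<zeta> = 1"
  shows "filterlim (\<lambda>m. of_real (rad m) * \<zeta>) (nontangential \<zeta>) sequentially"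
proof -
  have 1: "of_real (rad m) * \<zeta> \<in> stolz_region \<zeta> 2" for m
  proof -
    have "of_real (rad m) * \<zeta> - \<zeta> = of_real (rad m - 1) * \<zeta>" by (simp add: algebra_simps)
    then have "norm (of_real (rad m) * \<zeta> - \<zeta>) = 1 - rad m"
      using rad[of m] \<zeta> by (simp add: norm_mult del: of_real_diff)
    then show ?thesis using rad[of m] \<zeta> by (simp add: stolz_region_def norm_mult)
  qed
  have 2: "of_real (rad m) * \<zeta> \<noteq> \<zeta>" for m
    using rad(2)[of m] \<zeta> by auto
  have "(\<lambda>m. of_real (rad m) * \<zeta>) \<longlonglongrightarrow> of_real 1 * \<zeta>"
    by (intro tendsto_intros rad_tendsto)
  then have "filterlim (\<lambda>m. of_real (rad m) * \<zeta>) (at \<zeta> within stolz_region \<zeta> 2) sequentially"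
    unfolding filterlim_at using 1 2 by simp
  moreover have "at \<zeta> within stolz_region \<zeta> 2 \<le> nontangential \<zeta>"
    unfolding nontangential_def by (rule SUP_upper) simp
  ultimately show ?thesis by (rule filterlim_mono) auto
qed

lemma nontangential_nontrivial: "norm \<zeta> = 1 \<Longrightarrow> nontangential \<zeta> \<noteq> bot"
  using radial_approach[of \<zeta>] by (auto simp: filterlim_def bot_unique filtermap_bot_iff)

lemma bdval_eqI:
  assumes "norm \<zeta> = 1" "(f \<longlongrightarrow> L) (nontangential \<zeta>)"
  shows "has_bdval f \<zeta>" "bdval f \<zeta> = L"
  using assms tendsto_Lim[OF nontangential_nontrivial assms(2)] by (auto simp: has_bdval_def bdval_def)

lemma tendsto_bdval:
  assumes "norm \<zeta> = 1" "has_bdval f \<zeta>"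
  shows "(f \<longlongrightarrow> bdval f \<zeta>) (nontangential \<zeta>)"
  using assms bdval_eqI(2) unfolding has_bdval_def by metis

lemma bdval_radial:
  assumes "norm \<zeta> = 1" "has_bdval f \<zeta>"
  shows "(\<lambda>m. f (of_real (rad m) * \<zeta>)) \<longlonglongrightarrow> bdval f \<zeta>"
  using filterlim_compose[OF tendsto_bdval[OF assms] radial_approach[OF assms(1)]] .

lemma nontangential_within: "nontangential \<zeta> \<le> at \<zeta> within cball 0 1"
  unfolding nontangential_def by (intro SUP_least at_le) (auto simp: stolz_region_def)

lemma bdval_continuous:
  assumes F: "continuous_on (cball 0 1) F" and \<zeta>: "norm \<zeta> = 1"
  shows "has_bdval F \<zeta>" "bdval F \<zeta> = F \<zeta>"
proof -
  have "(F \<longlongrightarrow> F \<zeta>) (at \<zeta> within cball 0 1)"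
    using F \<zeta> by (auto simp: continuous_on_def)
  then have "(F \<longlongrightarrow> F \<zeta>) (nontangential \<zeta>)" by (rule tendsto_mono[OF nontangential_within])
  then show "has_bdval F \<zeta>" "bdval F \<zeta> = F \<zeta>" using bdval_eqI[OF \<zeta>] by auto
qed

lemma AE_ang_iff: "(AE \<theta> in ang. P \<theta>) \<longleftrightarrow> (AE \<theta> in lborel. \<theta> \<in> {0..2*pi} \<longrightarrow> P \<theta>)"
  by (subst AE_restrict_space_iff) (auto simp: AE_completion_iff)

lemma Arg2pi_borel [measurable]: "Arg2pi \<in> borel_measurable borel"
  by (rule borel_measurable_iff_le[THEN iffD2]) (auto intro!: borel_closed closed_Arg2pi2pi_le)

lemma Arg2pi_cis: "0 \<le> \<theta> \<Longrightarrow> \<theta> < 2*pi \<Longrightarrow> Arg2pi (cis \<theta>) = \<theta>"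
  by (rule Arg2pi_unique[of 1]) (auto simp: cis_conv_exp)

lemma cis_Arg2pi: "norm \<zeta> = 1 \<Longrightarrow> cis (Arg2pi \<zeta>) = \<zeta>"
  using complex_norm_eq_1_exp[of \<zeta>] by (simp add: cis_conv_exp)

lemma cis_measurable_circle: "cis \<in> measurable (lebesgue_on {0..<2*pi}) (restrict_space borel unit_circle)"
proof (rule measurable_restrict_space2)
  have "cis \<in> borel_measurable borel"
    by (intro borel_measurable_continuous_onI) (auto intro!: continuous_intros)
  then have "cis \<in> borel_measurable lebesgue" by (simp add: measurable_completion)
  then show "cis \<in> borel_measurable (lebesgue_on {0..<2*pi})" by (rule measurable_restrict_space1)
qed auto

text \<open>Null sets of the circle are exactly the images of null sets of angles: the inverse of \<open>cis\<close> on
  \<open>{0..<2*pi}\<close> is \<open>Arg2pi\<close>, which is Borel.\<close>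

lemma AE_circle_measure: "(AE \<zeta> in circle_measure. P \<zeta>) \<longleftrightarrow> (AE \<theta> in ang. P (cis \<theta>))"
proof -
  let ?L = "lebesgue_on {0..<2*pi}" and ?M = "restrict_space borel unit_circle :: complex measure"
  have L: "(AE \<theta> in ?L. P (cis \<theta>)) \<longleftrightarrow> (AE \<theta> in lborel. \<theta> \<in> {0..<2*pi} \<longrightarrow> P (cis \<theta>))"
    by (subst AE_restrict_space_iff) (auto simp: AE_completion_iff)
  have "(AE \<theta> in lborel. \<theta> \<in> {0..<2*pi} \<longrightarrow> P (cis \<theta>)) \<longleftrightarrow> (AE \<theta> in lborel. \<theta> \<in> {0..2*pi} \<longrightarrow> P (cis \<theta>))"
    (is "?l \<longleftrightarrow> ?r")
  proof
    assume ?l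
    with AE_lborel_singleton[of "2*pi"] show ?r by eventually_elim auto
  next
    assume ?r then show ?l by eventually_elim auto
  qed
  then have eq: "(AE \<theta> in ?L. P (cis \<theta>)) \<longleftrightarrow> (AE \<theta> in ang. P (cis \<theta>))"
    using L AE_ang_iff[of "\<lambda>\<theta>. P (cis \<theta>)"] by simp
  have "(AE \<zeta> in circle_measure. P \<zeta>) \<longleftrightarrow> (AE \<zeta> in distr ?L ?M cis. P \<zeta>)"
    unfolding circle_measure_def by (rule AE_completion_iff)
  also have "\<dots> \<longleftrightarrow> (AE \<theta> in ?L. P (cis \<theta>))"
  proof
    assume "AE \<zeta> in distr ?L ?M cis. P \<zeta>"
    then show "AE \<theta> in ?L. P (cis \<theta>)" by (rule AE_distrD[OF cis_measurable_circle])
  next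
    assume "AE \<theta> in ?L. P (cis \<theta>)"
    then have "AE \<theta> in lborel. \<theta> \<in> {0..<2*pi} \<longrightarrow> P (cis \<theta>)" using L by simp
    then obtain N where N: "N \<in> null_sets lborel" "{\<theta>. \<not> (\<theta> \<in> {0..<2*pi} \<longrightarrow> P (cis \<theta>))} \<subseteq> N"
      unfolding eventually_ae_filter by auto
    define Z where "Z = {\<zeta> \<in> unit_circle. Arg2pi \<zeta> \<in> N}"
    have "N \<in> sets borel" using N(1) by auto
    then have "Arg2pi -` N \<inter> space borel \<in> sets borel" by (rule measurable_sets[OF Arg2pi_borel])
    then have ZM: "Z \<in> sets ?M"
      by (auto simp: sets_restrict_space Z_def image_iff intro!: bexI[of _ "Arg2pi -` N"])
    have "emeasure (distr ?L ?M cis) Z = emeasure ?L (cis -` Z \<inter> space ?L)"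
      using ZM by (rule emeasure_distr[OF cis_measurable_circle])
    also have "cis -` Z \<inter> space ?L = N \<inter> {0..<2*pi}"
      by (auto simp: Z_def Arg2pi_cis)
    also have "emeasure ?L (N \<inter> {0..<2*pi}) = emeasure lebesgue (N \<inter> {0..<2*pi})"
      by (rule emeasure_restrict_space) auto
    also have "\<dots> = 0"
    proof -
      have "N \<inter> {0..<2*pi} \<in> null_sets lborel" using N(1) by (rule null_set_Int2) auto
      then show ?thesis using null_sets_completionI by blast
    qed
    finally have "Z \<in> null_sets (distr ?L ?M cis)" using ZM by (intro null_setsI) auto
    moreover have "{\<zeta> \<in> space (distr ?L ?M cis). \<not> P \<zeta>} \<subseteq> Z"
    proof
      fix \<zeta> assume "\<zeta> \<in> {\<zeta> \<in> space (distr ?L ?M cis). \<not> P \<zeta>}"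
      then have "norm \<zeta> = 1" "\<not> P \<zeta>" by (auto simp: space_restrict_space)
      moreover from this have "\<not> P (cis (Arg2pi \<zeta>))" by (simp add: cis_Arg2pi)
      ultimately show "\<zeta> \<in> Z" using N(2) Arg2pi[of \<zeta>] by (auto simp: Z_def)
    qed
    ultimately show "AE \<zeta> in distr ?L ?M cis. P \<zeta>" by (rule AE_I')
  qed
  finally show ?thesis using eq by simp
qed

lemma AE_Arg2pi_cis: "AE \<theta> in ang. Arg2pi (cis \<theta>) = \<theta>"
  unfolding AE_ang_iff using AE_lborel_singleton[of "2*pi"]
  by eventually_elim (auto intro!: Arg2pi_cis)

lemma space_circle_measure: "space circle_measure = unit_circle"
  by (simp add: circle_measure_def space_restrict_space)

lemma circle_measure_measurable:
  fixes r :: "real \<Rightarrow> real"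
  assumes "r \<in> borel_measurable borel"
  shows "(\<lambda>\<zeta>. r (Arg2pi \<zeta>)) \<in> borel_measurable circle_measure"
proof -
  have "(\<lambda>\<zeta>. r (Arg2pi \<zeta>)) \<in> borel_measurable borel" using assms by measurable
  then have "(\<lambda>\<zeta>. r (Arg2pi \<zeta>)) \<in> borel_measurable (restrict_space borel unit_circle)"
    by (rule measurable_restrict_space1)
  then have "(\<lambda>\<zeta>. r (Arg2pi \<zeta>)) \<in>
      borel_measurable (distr (lebesgue_on {0..<2*pi}) (restrict_space borel unit_circle) cis)" by simp
  then show ?thesis unfolding circle_measure_def by (rule measurable_completion)
qed

lemma emeasure_circle_measure_pos:
  assumes T: "T \<in> sets circle_measure" and "\<not> (AE \<theta> in ang. cis \<theta> \<notin> T)"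
  shows "0 < emeasure circle_measure T"
proof (rule ccontr)
  assume "\<not> 0 < emeasure circle_measure T"
  then have "T \<in> null_sets circle_measure" using T by (intro null_setsI) auto
  then have "AE \<zeta> in circle_measure. \<zeta> \<notin> T" by (rule AE_not_in)
  then show False using assms(2) by (simp add: AE_circle_measure)
qed

lemma ang_not_AE_False: "\<not> (AE \<theta> in ang. False)"
proof
  assume "AE \<theta> in ang. False"
  then have "emeasure ang (space ang) = 0" by (subst (asm) AE_iff_measurable[of "space ang"]) auto
  then show False using measure_ang by (simp add: measure_def)
qed

section \<open>Mean values, Poisson and Herglotz integrals\<close>

lemma has_bochner_integral_const_ang:
  fixes c :: "'a::{banach, second_countable_topology}"
  shows "has_bochner_integral ang (\<lambda>\<theta>. c) ((2*pi) *\<^sub>R c)"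
proof -
  interpret finite_measure ang by (rule finite_measure_ang)
  show ?thesis
    using has_bochner_integral_integrable[OF integrable_const[of c]] by (simp add: measure_ang)
qed

lemma has_bochner_integral_angI:
  fixes f :: "real \<Rightarrow> 'a::euclidean_space"
  assumes c: "continuous_on {0..2*pi} f" and i: "(f has_integral I) {0..2*pi}"
  shows "has_bochner_integral ang f I"
proof -
  have "bounded (f ` {0..2*pi})"
    by (intro compact_imp_bounded compact_continuous_image c) auto
  then obtain B where "\<forall>\<theta>\<in>{0..2*pi}. norm (f \<theta>) \<le> B"
    unfolding bounded_iff by auto
  then have int: "integrable ang f"
    by (intro integrable_ang_bounded[of _ B] continuous_imp_ang c AE_I2) auto
  then have "integral\<^sup>L ang f = integral {0..2*pi} f"
    by (rule lebesgue_integral_eq_integral) auto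
  then show ?thesis using i int by (simp add: has_bochner_integral_iff integral_unique)
qed

lemma integrable_ang_continuous:
  fixes f :: "real \<Rightarrow> 'a::euclidean_space"
  assumes c: "continuous_on {0..2*pi} f"
  shows "integrable ang f"
  using has_bochner_integral_angI[OF c integrable_integral] integrable_continuous_real[OF c]
  by (auto simp: has_bochner_integral_iff)

lemma holomorphic_mean_value:
  fixes f :: "complex \<Rightarrow> complex"
  assumes f: "f holomorphic_on ball c R" and r: "0 < r" "r < R"
  shows "has_bochner_integral ang (\<lambda>\<theta>. f (c + of_real r * cis \<theta>)) (2 * pi * f c)"
proof (rule has_bochner_integral_angI)
  have sub: "c + of_real r * cis \<theta> \<in> ball c R" for \<theta>
    using r by (simp add: dist_norm norm_mult)
  show "continuous_on {0..2*pi} (\<lambda>\<theta>. f (c + of_real r * cis \<theta>))"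
    by (rule continuous_on_compose2[OF holomorphic_on_imp_continuous_on[OF f]])
      (use sub in \<open>auto intro!: continuous_intros\<close>)
  have "((\<lambda>u. f u / (u - c)) has_contour_integral (2 * of_real pi * \<i> * f c)) (circlepath c r)"
    by (rule Cauchy_integral_circlepath_simple) (use r in \<open>auto intro: holomorphic_on_subset[OF f]\<close>)
  then have "((\<lambda>t. f (c + of_real r * cis t) / (of_real r * cis t) * of_real r * \<i> * cis t) has_integral (2 * of_real pi * \<i> * f c)) {0..2*pi}"
    unfolding circlepath_def by (subst (asm) has_contour_integral_part_circlepath_iff) auto
  then have "((\<lambda>t. \<i> * f (c + of_real r * cis t)) has_integral (2 * of_real pi * \<i> * f c)) {0..2*pi}"
    by (rule has_integral_eq[rotated]) (use r in auto)
  then have "((\<lambda>t. (-\<i>) * (\<i> * f (c + of_real r * cis t))) has_integral (-\<i>) * (2 * of_real pi * \<i> * f c)) {0..2*pi}"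
    by (rule has_integral_mult_right)
  moreover have "(-\<i>) * (\<i> * x) = x" for x by (simp add: mult.assoc[symmetric])
  moreover have "2 * of_real pi * \<i> * f c = \<i> * (2 * of_real pi * f c)" by (simp add: mult_ac)
  ultimately show "((\<lambda>t. f (c + of_real r * cis t)) has_integral 2 * pi * f c) {0..2*pi}"
    by (simp only: of_real_mult of_real_numeral)
qed

lemma harmonic_mean_value:
  assumes q: "q holomorphic_on ball c R" and V: "\<And>w. w \<in> ball c R \<Longrightarrow> V w = Re (q w)" and r: "0 < r" "r < R"
  shows "has_bochner_integral ang (\<lambda>\<theta>. V (c + of_real r * cis \<theta>)) (2 * pi * V c)"
proof -
  have "has_bochner_integral ang (\<lambda>\<theta>. Re (q (c + of_real r * cis \<theta>))) (Re (2 * pi * q c))"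
    by (rule has_bochner_integral_Re[OF holomorphic_mean_value[OF q r]])
  moreover have "V (c + of_real r * cis \<theta>) = Re (q (c + of_real r * cis \<theta>))" for \<theta>
    by (rule V) (use r in \<open>simp add: dist_norm norm_mult\<close>)
  ultimately show ?thesis using V[of c] r by simp
qed

text \<open>Pulling back by \<open>exp\<close> turns the annulus into a strip, which is convex, so that \<open>k \<circ> exp\<close> has a primitive
  \<open>P\<close> there.  The integral over the circle of radius \<open>r\<close> is, up to the factor \<open>\<i>\<close>, the increment of \<open>P\<close>
  along a vertical segment of length \<open>2*pi\<close>, and this increment does not depend on the segment because
  \<open>k \<circ> exp\<close> is periodic.\<close>

lemma circle_integral_radius_independent:
  assumes k: "k holomorphic_on {z. a < norm z \<and> norm z < b}" and a: "0 \<le> a"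
    and r: "a < r1" "r1 < b" "a < r2" "r2 < b"
  shows "integral\<^sup>L ang (\<lambda>\<theta>. k (of_real r1 * cis \<theta>)) = integral\<^sup>L ang (\<lambda>\<theta>. k (of_real r2 * cis \<theta>))"
proof -
  define S where "S = {\<xi>. a < exp (Re \<xi>)} \<inter> {\<xi>. exp (Re \<xi>) < b}"
  have b: "0 < b" using a r by linarith
  have "{\<xi>. a < exp (Re \<xi>)} = (if a = 0 then UNIV else {\<xi>. ln a < Re \<xi>})"
  proof (cases "a = 0")
    case False
    then have "a < exp (Re \<xi>) \<longleftrightarrow> ln a < Re \<xi>" for \<xi>
      using a exp_less_cancel_iff[of "ln a" "Re \<xi>"] by simp
    then show ?thesis using False by simp
  qed simp
  moreover have "{\<xi>. exp (Re \<xi>) < b} = {\<xi>. Re \<xi> < ln b}"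
  proof -
    have "exp (Re \<xi>) < b \<longleftrightarrow> Re \<xi> < ln b" for \<xi>
      using b exp_less_cancel_iff[of "Re \<xi>" "ln b"] by simp
    then show ?thesis by simp
  qed
  ultimately have S: "convex S" "open S"
    unfolding S_def by (auto intro!: convex_Int convex_halfspace_Re_gt convex_halfspace_Re_lt open_Int
        open_halfspace_Re_gt open_halfspace_Re_lt)
  have "(\<lambda>\<xi>. k (exp \<xi>)) holomorphic_on S"
    by (rule holomorphic_on_compose_gen[OF _ k, unfolded o_def]) (auto intro!: holomorphic_intros simp: S_def)
  then obtain P where P: "\<And>\<xi>. \<xi> \<in> S \<Longrightarrow> (P has_field_derivative k (exp \<xi>)) (at \<xi>)"
    using holomorphic_convex_primitive'[OF S(1,2)] S(2) by (metis at_within_open)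
  have S2: "\<xi> + 2 * of_real pi * \<i> \<in> S \<longleftrightarrow> \<xi> \<in> S" for \<xi>
    by (simp add: S_def)
  have "((\<lambda>\<xi>. P (\<xi> + 2 * of_real pi * \<i>) - P \<xi>) has_field_derivative 0) (at \<xi> within S)" if "\<xi> \<in> S" for \<xi>
  proof -
    have "(P has_field_derivative k (exp (\<xi> + 2 * of_real pi * \<i>))) (at (\<xi> + 2 * of_real pi * \<i>))"
      by (rule P) (use that S2 in simp)
    then have "((\<lambda>\<xi>. P (\<xi> + 2 * of_real pi * \<i>)) has_field_derivative k (exp (\<xi> + 2 * of_real pi * \<i>)) * 1) (at \<xi>)"
      by (intro DERIV_chain2[of P]) (auto intro!: derivative_eq_intros)
    from DERIV_diff[OF this P[OF that]] have
      "((\<lambda>\<xi>. P (\<xi> + 2 * of_real pi * \<i>) - P \<xi>) has_field_derivative 0) (at \<xi>)"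
      by (simp add: exp_add mult.commute)
    then show ?thesis by (rule has_field_derivative_at_within)
  qed
  then have const: "\<exists>c. \<forall>\<xi>\<in>S. P (\<xi> + 2 * of_real pi * \<i>) - P \<xi> = c"
    using has_field_derivative_zero_constant[OF S(1)] by blast
  have I: "integral\<^sup>L ang (\<lambda>\<theta>. \<i> * k (of_real r * cis \<theta>)) = P (of_real (ln r) + 2 * of_real pi * \<i>) - P (of_real (ln r))"
    "of_real (ln r) \<in> S" if r: "a < r" "r < b" for r
  proof -
    have r0: "0 < r" using a r by linarith
    have inS: "of_real (ln r) + \<i> * of_real \<theta> \<in> S" for \<theta>
      using r r0 by (simp add: S_def)
    from inS[of 0] show "of_real (ln r) \<in> S" by simp
    have ex: "exp (of_real (ln r) + \<i> * of_real \<theta>) = of_real r * cis \<theta>" for \<theta>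
      using r0 by (simp add: exp_add cis_conv_exp exp_of_real)
    have der: "((\<lambda>\<theta>. P (of_real (ln r) + \<i> * of_real \<theta>)) has_vector_derivative \<i> * k (of_real r * cis \<theta>)) (at \<theta> within {0..2*pi})" for \<theta>
    proof -
      have "((\<lambda>z. P (of_real (ln r) + \<i> * z)) has_field_derivative k (exp (of_real (ln r) + \<i> * of_real \<theta>)) * \<i>) (at (of_real \<theta>))"
        by (rule DERIV_chain2[where f = P], rule P[OF inS]) (auto intro!: derivative_eq_intros)
      from has_vector_derivative_real_field[OF this] show ?thesis by (simp add: ex mult.commute)
    qed
    have "((\<lambda>\<theta>. \<i> * k (of_real r * cis \<theta>)) has_integral
        P (of_real (ln r) + \<i> * of_real (2*pi)) - P (of_real (ln r) + \<i> * of_real 0)) {0..2*pi}"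
      by (rule fundamental_theorem_of_calculus) (use der in auto)
    moreover have "continuous_on {0..2*pi} (\<lambda>\<theta>. \<i> * k (of_real r * cis \<theta>))"
      by (intro continuous_intros continuous_on_compose2[OF holomorphic_on_imp_continuous_on[OF k]])
        (use r r0 in \<open>auto simp: norm_mult\<close>)
    ultimately have "has_bochner_integral ang (\<lambda>\<theta>. \<i> * k (of_real r * cis \<theta>))
       (P (of_real (ln r) + \<i> * of_real (2*pi)) - P (of_real (ln r) + \<i> * of_real 0))"
      by (intro has_bochner_integral_angI)
    then show "integral\<^sup>L ang (\<lambda>\<theta>. \<i> * k (of_real r * cis \<theta>)) = P (of_real (ln r) + 2 * of_real pi * \<i>) - P (of_real (ln r))"
      by (simp add: has_bochner_integral_iff mult_ac)
  qed
  have "integral\<^sup>L ang (\<lambda>\<theta>. \<i> * k (of_real r1 * cis \<theta>)) = integral\<^sup>L ang (\<lambda>\<theta>. \<i> * k (of_real r2 * cis \<theta>))"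
    using I[of r1] I[of r2] r const by metis
  then show ?thesis by simp
qed

definition poisson_kernel :: "complex \<Rightarrow> real \<Rightarrow> real" where
  "poisson_kernel z \<theta> = (1 - (norm z)\<^sup>2) / (norm (cis \<theta> - z))\<^sup>2"

definition poisson_integral :: "(real \<Rightarrow> real) \<Rightarrow> complex \<Rightarrow> real" where
  "poisson_integral \<phi> z = 1 / (2*pi) * integral\<^sup>L ang (\<lambda>\<theta>. \<phi> \<theta> * poisson_kernel z \<theta>)"

definition cauchy_transform :: "(real \<Rightarrow> complex) \<Rightarrow> complex \<Rightarrow> complex" where
  "cauchy_transform \<gamma> z = 1 / (2*pi) * integral\<^sup>L ang (\<lambda>\<theta>. \<gamma> \<theta> / (1 - z * cis (-\<theta>)))"

lemma cis_minus_nonzero: "norm z < 1 \<Longrightarrow> cis \<theta> - z \<noteq> 0" "norm z < 1 \<Longrightarrow> 1 - z * cis \<theta> \<noteq> 0"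
proof -
  assume z: "norm z < 1"
  show "cis \<theta> - z \<noteq> 0" using z by auto
  have "norm (z * cis \<theta>) < 1" using z by (simp add: norm_mult)
  then show "1 - z * cis \<theta> \<noteq> 0" by auto
qed

lemma norm_one_minus_cis: "1 - norm z \<le> norm (1 - z * cis \<theta>)"
  using norm_triangle_ineq2[of 1 "z * cis \<theta>"] by (simp add: norm_mult)

lemma norm_cis_minus: "1 - norm z \<le> norm (cis \<theta> - z)"
  using norm_triangle_ineq2[of "cis \<theta>" z] by simp

lemma continuous_on_poisson_kernel: "norm z < 1 \<Longrightarrow> continuous_on A (poisson_kernel z)"
  unfolding poisson_kernel_def using cis_minus_nonzero(1) by (intro continuous_intros) auto

lemma poisson_kernel_nonneg: "norm z < 1 \<Longrightarrow> 0 \<le> poisson_kernel z \<theta>"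
  by (auto simp: poisson_kernel_def power_le_one intro!: divide_nonneg_nonneg)

text \<open>This splits the Poisson integral into a Cauchy integral and the conjugate of one.  It makes the real
  part of the Herglotz integral computable, and it shows that a density whose moments
  against \<open>1, z, z\<^sup>2, \<dots>\<close> vanish has a holomorphic Poisson integral.\<close>

lemma poisson_kernel_cauchy:
  assumes z: "norm z < 1"
  shows "complex_of_real (poisson_kernel z \<theta>) = 1 / (1 - z * cis (-\<theta>)) + 1 / (1 - cnj z * cis \<theta>) - 1"
proof -
  define a where "a = 1 - z * cis (-\<theta>)"
  have b: "1 - cnj z * cis \<theta> = cnj a" by (simp add: a_def cis_cnj)
  have a0: "a \<noteq> 0" unfolding a_def by (rule cis_minus_nonzero(2)[OF z])
  have "cis \<theta> - z = cis \<theta> * a" by (simp add: a_def algebra_simps cis_mult)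
  then have n: "(norm (cis \<theta> - z))\<^sup>2 = (norm a)\<^sup>2" by (simp add: norm_mult)
  have "(norm (1 - a))\<^sup>2 = (norm z)\<^sup>2" by (simp add: a_def norm_mult)
  then have "complex_of_real ((norm z)\<^sup>2) = (1 - a) * cnj (1 - a)"
    by (metis complex_norm_square)
  then have "complex_of_real (1 - (norm z)\<^sup>2) = a + cnj a - a * cnj a"
    by (simp add: algebra_simps)
  moreover have "complex_of_real ((norm a)\<^sup>2) = a * cnj a" by (rule complex_norm_square)
  ultimately have "complex_of_real (poisson_kernel z \<theta>) = (a + cnj a - a * cnj a) / (a * cnj a)"
    unfolding poisson_kernel_def n by (simp only: of_real_divide)
  also have "\<dots> = 1 / a + 1 / cnj a - 1" using a0 by (simp add: field_simps)
  finally show ?thesis unfolding b by (simp add: a_def)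
qed

lemma cauchy_kernel_mean:
  assumes z: "norm z < 1"
  shows "has_bochner_integral ang (\<lambda>\<theta>. 1 / (1 - z * cis \<theta>)) (2*pi)"
proof -
  have n: "1 < (if z = 0 then 2 else 1 / norm z)" using z by auto
  have "(\<lambda>w::complex. 1 / (1 - z * w)) holomorphic_on ball 0 (if z = 0 then 2 else 1 / norm z)"
  proof (intro holomorphic_intros)
    fix w :: complex assume w: "w \<in> ball 0 (if z = 0 then 2 else 1 / norm z)"
    then have "norm (z * w) < 1" by (cases "z = 0") (auto simp: norm_mult field_simps)
    then show "1 - z * w \<noteq> 0" by auto
  qed
  from holomorphic_mean_value[OF this, of 1] n show ?thesis by simp
qed

lemma poisson_kernel_mean:
  assumes z: "norm z < 1"
  shows "has_bochner_integral ang (poisson_kernel z) (2*pi)"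
proof -
  have 1: "has_bochner_integral ang (\<lambda>\<theta>. 1 / (1 - cnj z * cis \<theta>)) (2*pi)"
    using cauchy_kernel_mean[of "cnj z"] z by simp
  have 2: "has_bochner_integral ang (\<lambda>\<theta>. 1 / (1 - z * cis (-\<theta>))) (2*pi)"
    using has_bochner_integral_cnj[OF 1] by (simp add: cis_cnj)
  have "has_bochner_integral ang (\<lambda>\<theta>. 1 / (1 - z * cis (-\<theta>)) + 1 / (1 - cnj z * cis \<theta>) - 1) (2*pi + 2*pi - 2*pi)"
    using has_bochner_integral_diff[OF has_bochner_integral_add[OF 2 1] has_bochner_integral_const_ang[of "1::complex"]]
    by (simp add: scaleR_conv_of_real)
  from has_bochner_integral_Re[OF this[folded poisson_kernel_cauchy[OF z]]] show ?thesis by simp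
qed

lemma cauchy_transform_integrable:
  assumes g: "\<gamma> \<in> borel_measurable ang" and B: "AE \<theta> in ang. norm (\<gamma> \<theta>) \<le> B" and k: "continuous_on {0..2*pi} k"
  shows "integrable ang (\<lambda>\<theta>. \<gamma> \<theta> * (k \<theta> :: complex))"
proof -
  have "bounded (k ` {0..2*pi})"
    by (intro compact_imp_bounded compact_continuous_image k) auto
  then obtain C where C: "\<forall>\<theta>\<in>{0..2*pi}. norm (k \<theta>) \<le> C"
    unfolding bounded_iff by auto
  have "AE \<theta> in ang. norm (k \<theta>) \<le> C" using C by (intro AE_I2) simp
  with B have "AE \<theta> in ang. norm (\<gamma> \<theta> * k \<theta>) \<le> B * C"
  proof eventually_elim
    case (elim \<theta>)
    then show ?case unfolding norm_mult by (intro mult_mono) (auto intro: order_trans[OF norm_ge_zero])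
  qed
  then show ?thesis
    by (rule integrable_ang_bounded[rotated]) (intro borel_measurable_times g continuous_imp_ang k)
qed

lemma cauchy_transform_sums:
  assumes g: "\<gamma> \<in> borel_measurable ang" and B: "AE \<theta> in ang. norm (\<gamma> \<theta>) \<le> B" and z: "norm z < 1"
  shows "(\<lambda>n. (1 / (2*pi) * integral\<^sup>L ang (\<lambda>\<theta>. \<gamma> \<theta> * cis (- real n * \<theta>))) * z ^ n) sums cauchy_transform \<gamma> z"
proof -
  have int: "integrable ang (\<lambda>\<theta>. \<gamma> \<theta> * cis (- real n * \<theta>))" for n
    by (rule cauchy_transform_integrable[OF g B]) (intro continuous_intros)
  have ge: "(\<lambda>n. \<gamma> \<theta> * cis (- real n * \<theta>) * z ^ n) sums (\<gamma> \<theta> / (1 - z * cis (-\<theta>)))" for \<theta>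
  proof -
    have "(\<lambda>n. \<gamma> \<theta> * (z * cis (-\<theta>)) ^ n) sums (\<gamma> \<theta> * (1 / (1 - z * cis (-\<theta>))))"
      by (intro sums_mult geometric_sums) (use z in \<open>simp add: norm_mult\<close>)
    then show ?thesis by (simp add: power_mult_distrib Complex.DeMoivre mult_ac)
  qed
  have gi: "integrable ang (\<lambda>\<theta>. norm (\<gamma> \<theta>))"
    using cauchy_transform_integrable[OF g B continuous_on_const[of _ 1]] by (intro integrable_norm) simp
  have "(\<lambda>n. integral\<^sup>L ang (\<lambda>\<theta>. \<gamma> \<theta> * cis (- real n * \<theta>) * z ^ n)) sums
      integral\<^sup>L ang (\<lambda>\<theta>. \<Sum>n. \<gamma> \<theta> * cis (- real n * \<theta>) * z ^ n)"
  proof (rule sums_integral)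
    show "integrable ang (\<lambda>\<theta>. \<gamma> \<theta> * cis (- real n * \<theta>) * z ^ n)" for n
      by (rule integrable_mult_left[OF int])
    have sg: "summable (\<lambda>n. norm z ^ n)" using z by (intro summable_geometric) simp
    show "AE \<theta> in ang. summable (\<lambda>n. norm (\<gamma> \<theta> * cis (- real n * \<theta>) * z ^ n))"
      by (intro AE_I2) (simp only: norm_mult norm_power norm_cis mult_1_right summable_mult[OF sg])
    show "summable (\<lambda>n. integral\<^sup>L ang (\<lambda>\<theta>. norm (\<gamma> \<theta> * cis (- real n * \<theta>) * z ^ n)))"
      by (simp only: norm_mult norm_power norm_cis mult_1_right integral_mult_left_zero summable_mult[OF sg])
  qed
  then have "(\<lambda>n. integral\<^sup>L ang (\<lambda>\<theta>. \<gamma> \<theta> * cis (- real n * \<theta>)) * z ^ n) sums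
      integral\<^sup>L ang (\<lambda>\<theta>. \<gamma> \<theta> / (1 - z * cis (-\<theta>)))"
    using sums_unique[OF ge] by simp
  from sums_mult[OF this, of "1 / (2*pi)"] show ?thesis
    by (simp add: cauchy_transform_def mult.assoc)
qed

lemma cauchy_transform_holomorphic:
  assumes g: "\<gamma> \<in> borel_measurable ang" and B: "AE \<theta> in ang. norm (\<gamma> \<theta>) \<le> B"
  shows "cauchy_transform \<gamma> holomorphic_on ball 0 1"
  by (rule power_series_holomorphic[where a = "\<lambda>n. 1 / (2*pi) * integral\<^sup>L ang (\<lambda>\<theta>. \<gamma> \<theta> * cis (- real n * \<theta>))"])
    (use cauchy_transform_sums[OF g B] in simp)

text \<open>The kernel of this integral is \<open>2 / (1 - z * cis (-\<theta>)) - 1 = (cis \<theta> + z) / (cis \<theta> - z)\<close>, so this is the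
  holomorphic function whose real part is the Poisson integral of \<open>\<phi>\<close> and which is real at \<open>0\<close>.\<close>

definition herglotz :: "(real \<Rightarrow> real) \<Rightarrow> complex \<Rightarrow> complex" where
  "herglotz \<phi> z = 2 * cauchy_transform (\<lambda>\<theta>. of_real (\<phi> \<theta>)) z - 1 / (2*pi) * integral\<^sup>L ang (\<lambda>\<theta>. of_real (\<phi> \<theta>))"

lemma herglotz_holomorphic:
  assumes g: "\<phi> \<in> borel_measurable ang" and B: "AE \<theta> in ang. \<bar>\<phi> \<theta>\<bar> \<le> B"
  shows "herglotz \<phi> holomorphic_on ball 0 1"
proof -
  have "cauchy_transform (\<lambda>\<theta>. of_real (\<phi> \<theta>)) holomorphic_on ball 0 1"
    by (rule cauchy_transform_holomorphic[of _ B]) (use g B in auto)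
  then show ?thesis unfolding herglotz_def[abs_def] by (intro holomorphic_intros)
qed

lemma herglotz_integral:
  assumes g: "\<phi> \<in> borel_measurable ang" and B: "AE \<theta> in ang. \<bar>\<phi> \<theta>\<bar> \<le> B" and z: "norm z < 1"
  shows "integrable ang (\<lambda>\<theta>. of_real (\<phi> \<theta>) * (2 / (1 - z * cis (-\<theta>)) - 1))"
    and "herglotz \<phi> z = 1 / (2*pi) * integral\<^sup>L ang (\<lambda>\<theta>. of_real (\<phi> \<theta>) * (2 / (1 - z * cis (-\<theta>)) - 1))"
proof -
  have g': "(\<lambda>\<theta>. complex_of_real (\<phi> \<theta>)) \<in> borel_measurable ang" and B': "AE \<theta> in ang. norm (complex_of_real (\<phi> \<theta>)) \<le> B"
    using g B by auto
  have c: "continuous_on {0..2*pi} (\<lambda>\<theta>. 1 / (1 - z * cis (-\<theta>)))"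
    using cis_minus_nonzero(2)[OF z] by (intro continuous_intros) auto
  have i1: "integrable ang (\<lambda>\<theta>. of_real (\<phi> \<theta>) / (1 - z * cis (-\<theta>)))"
    using cauchy_transform_integrable[OF g' B' c] by simp
  have i2: "integrable ang (\<lambda>\<theta>. complex_of_real (\<phi> \<theta>))"
    using cauchy_transform_integrable[OF g' B' continuous_on_const[of _ 1]] by simp
  have eq: "of_real (\<phi> \<theta>) * (2 / (1 - z * cis (-\<theta>)) - 1) = 2 * (of_real (\<phi> \<theta>) / (1 - z * cis (-\<theta>))) - of_real (\<phi> \<theta>)" for \<theta>
    by (simp add: algebra_simps)
  show "integrable ang (\<lambda>\<theta>. of_real (\<phi> \<theta>) * (2 / (1 - z * cis (-\<theta>)) - 1))"
    unfolding eq by (intro Bochner_Integration.integrable_diff integrable_mult_right i1 i2)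
  show "herglotz \<phi> z = 1 / (2*pi) * integral\<^sup>L ang (\<lambda>\<theta>. of_real (\<phi> \<theta>) * (2 / (1 - z * cis (-\<theta>)) - 1))"
    unfolding eq herglotz_def cauchy_transform_def
    by (subst Bochner_Integration.integral_diff[OF integrable_mult_right[OF i1] i2], subst integral_mult_right_zero)
      (simp add: algebra_simps)
qed

lemma Re_herglotz_kernel:
  assumes "norm z < 1"
  shows "Re (2 / (1 - z * cis (-\<theta>)) - 1) = poisson_kernel z \<theta>"
proof -
  obtain X where X: "1 / (1 - z * cis (-\<theta>)) = X" by blast
  have "1 / (1 - cnj z * cis \<theta>) = cnj (1 / (1 - z * cis (-\<theta>)))"
    by (simp only: complex_cnj_divide complex_cnj_diff complex_cnj_mult complex_cnj_one cis_cnj minus_minus)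
  then have "complex_of_real (poisson_kernel z \<theta>) = X + cnj X - 1"
    unfolding poisson_kernel_cauchy[OF assms] X by simp
  then have "Re (complex_of_real (poisson_kernel z \<theta>)) = Re (X + cnj X - 1)" by (rule arg_cong)
  then have "poisson_kernel z \<theta> = 2 * Re X - 1" by simp
  moreover have "2 / (1 - z * cis (-\<theta>)) = 2 * (1 / (1 - z * cis (-\<theta>)))" by simp
  ultimately show ?thesis unfolding X by simp
qed

lemma Re_herglotz:
  assumes g: "\<phi> \<in> borel_measurable ang" and B: "AE \<theta> in ang. \<bar>\<phi> \<theta>\<bar> \<le> B" and z: "norm z < 1"
  shows "Re (herglotz \<phi> z) = poisson_integral \<phi> z" "integrable ang (\<lambda>\<theta>. \<phi> \<theta> * poisson_kernel z \<theta>)"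
proof -
  have R: "Re (of_real (\<phi> \<theta>) * (2 / (1 - z * cis (-\<theta>)) - 1)) = \<phi> \<theta> * poisson_kernel z \<theta>" for \<theta>
    unfolding Re_herglotz_kernel[OF z, symmetric] by simp
  have "Re (integral\<^sup>L ang (\<lambda>\<theta>. of_real (\<phi> \<theta>) * (2 / (1 - z * cis (-\<theta>)) - 1))) = integral\<^sup>L ang (\<lambda>\<theta>. \<phi> \<theta> * poisson_kernel z \<theta>)"
    unfolding R[symmetric] by (rule integral_Re[OF herglotz_integral(1)[OF assms], symmetric])
  then show "Re (herglotz \<phi> z) = poisson_integral \<phi> z"
    unfolding herglotz_integral(2)[OF assms] poisson_integral_def by (simp add: Re_divide_of_real[symmetric] del: Re_divide_of_real)
  show "integrable ang (\<lambda>\<theta>. \<phi> \<theta> * poisson_kernel z \<theta>)"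
    using integrable_Re[OF herglotz_integral(1)[OF assms]] unfolding R .
qed

text \<open>The bound by the integral of \<open>\<bar>\<phi>\<bar>\<close>, rather than by its supremum, is essential later: it is what makes the
  multiplier functional absolutely continuous.\<close>

lemma norm_herglotz_le:
  assumes g: "\<phi> \<in> borel_measurable ang" and B: "AE \<theta> in ang. \<bar>\<phi> \<theta>\<bar> \<le> B" and z: "norm z < 1"
  shows "norm (herglotz \<phi> z) \<le> 3 / (1 - norm z) * integral\<^sup>L ang (\<lambda>\<theta>. \<bar>\<phi> \<theta>\<bar>)"
proof -
  have "norm (2 / (1 - z * cis (-\<theta>)) - 1) \<le> 3 / (1 - norm z)" for \<theta>
  proof -
    have "norm (2 / (1 - z * cis (-\<theta>)) - 1) \<le> 2 / norm (1 - z * cis (-\<theta>)) + 1"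
      using norm_triangle_ineq4[of "2 / (1 - z * cis (-\<theta>))" 1] by (simp add: norm_divide)
    also have "\<dots> \<le> 2 / (1 - norm z) + 1 / (1 - norm z)"
      using z norm_one_minus_cis[of z "-\<theta>"] by (intro add_mono divide_left_mono mult_pos_pos) auto
    also have "\<dots> = 3 / (1 - norm z)" by (simp add: add_divide_distrib[symmetric])
    finally show ?thesis .
  qed
  then have "\<bar>\<phi> \<theta>\<bar> * norm (2 / (1 - z * cis (-\<theta>)) - 1) \<le> \<bar>\<phi> \<theta>\<bar> * (3 / (1 - norm z))" for \<theta>
    by (rule mult_left_mono) auto
  then have le: "norm (of_real (\<phi> \<theta>) * (2 / (1 - z * cis (-\<theta>)) - 1)) \<le> 3 / (1 - norm z) * \<bar>\<phi> \<theta>\<bar>" for \<theta>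
    unfolding norm_mult norm_of_real mult.commute[of "3 / (1 - norm z)"] .
  have "integrable ang \<phi>" using integrable_ang_bounded[OF g] B by simp
  then have ia: "integrable ang (\<lambda>\<theta>. \<bar>\<phi> \<theta>\<bar>)" by (rule integrable_abs)
  let ?I = "integral\<^sup>L ang (\<lambda>\<theta>. of_real (\<phi> \<theta>) * (2 / (1 - z * cis (-\<theta>)) - 1))"
  have "norm ?I \<le> integral\<^sup>L ang (\<lambda>\<theta>. 3 / (1 - norm z) * \<bar>\<phi> \<theta>\<bar>)"
    by (rule order_trans[OF integral_norm_bound integral_mono[OF integrable_norm[OF herglotz_integral(1)[OF assms]] integrable_mult_right[OF ia] le]])
  also have "\<dots> = 3 / (1 - norm z) * integral\<^sup>L ang (\<lambda>\<theta>. \<bar>\<phi> \<theta>\<bar>)" by simp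
  finally have *: "norm ?I \<le> 3 / (1 - norm z) * integral\<^sup>L ang (\<lambda>\<theta>. \<bar>\<phi> \<theta>\<bar>)" .
  have "norm (herglotz \<phi> z) = 1 / (2*pi) * norm ?I"
    unfolding herglotz_integral(2)[OF assms] by (simp add: norm_mult norm_divide)
  also have "\<dots> \<le> 1 * norm ?I" using pi_gt3 by (intro mult_right_mono) auto
  finally show ?thesis using * by simp
qed

text \<open>A quantitative form of the continuity of the Poisson integral up to the boundary.  Since
  \<open>\<bar>cis \<theta> - z\<bar>\<^sup>2 * poisson_kernel z \<theta> = 1 - \<bar>z\<bar>\<^sup>2\<close>, the quadratic bound
  \<open>\<bar>k \<zeta> - k \<xi>\<bar> \<le> e + (2 * M / d\<^sup>2) * \<bar>\<zeta> - \<xi>\<bar>\<^sup>2\<close> can be integrated exactly, without splitting the circle into arcs.\<close>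

lemma poisson_integral_boundary_estimate:
  assumes k: "continuous_on unit_circle k" and M: "\<And>\<zeta>. norm \<zeta> = 1 \<Longrightarrow> \<bar>k \<zeta>\<bar> \<le> M"
    and d: "d > 0" and e: "e \<ge> 0" and uc: "\<And>\<zeta> \<xi>. norm \<zeta> = 1 \<Longrightarrow> norm \<xi> = 1 \<Longrightarrow> norm (\<zeta> - \<xi>) < d \<Longrightarrow> \<bar>k \<zeta> - k \<xi>\<bar> \<le> e"
    and z: "norm z < 1" and \<xi>: "norm \<xi> = 1"
  shows "\<bar>poisson_integral (\<lambda>\<theta>. k (cis \<theta>)) z - k \<xi>\<bar> \<le> e + 4 * M / d\<^sup>2 * ((1 - (norm z)\<^sup>2) + (norm (z - \<xi>))\<^sup>2)"
proof -
  let ?P = "poisson_kernel z"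
  have M0: "0 \<le> M" using M[OF \<xi>] by linarith
  have kc: "continuous_on {0..2*pi} (\<lambda>\<theta>. k (cis \<theta>))"
    by (rule continuous_on_compose2[OF k]) (auto intro!: continuous_intros)
  have Pc: "continuous_on {0..2*pi} ?P" by (rule continuous_on_poisson_kernel[OF z])
  have i1: "has_bochner_integral ang (\<lambda>\<theta>. k (cis \<theta>) * ?P \<theta>) (2*pi * poisson_integral (\<lambda>\<theta>. k (cis \<theta>)) z)"
    unfolding poisson_integral_def
    using has_bochner_integral_integrable[OF integrable_ang_continuous[OF continuous_on_mult[OF kc Pc]]] by simp
  have i2: "has_bochner_integral ang (\<lambda>\<theta>. (k (cis \<theta>) - k \<xi>) * ?P \<theta>) (2*pi * (poisson_integral (\<lambda>\<theta>. k (cis \<theta>)) z - k \<xi>))"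
    using has_bochner_integral_diff[OF i1 has_bochner_integral_mult_right[OF poisson_kernel_mean[OF z], of "k \<xi>"]]
    by (simp add: algebra_simps)
  define L where "L = 4 * M / d\<^sup>2"
  have L: "0 \<le> L" using M0 by (simp add: L_def)
  have pw: "\<bar>(k (cis \<theta>) - k \<xi>) * ?P \<theta>\<bar> \<le> e * ?P \<theta> + (L * (1 - (norm z)\<^sup>2) + L * (norm (z - \<xi>))\<^sup>2 * ?P \<theta>)" for \<theta>
  proof -
    have P0: "0 \<le> ?P \<theta>" by (rule poisson_kernel_nonneg[OF z])
    have "\<bar>k (cis \<theta>) - k \<xi>\<bar> \<le> e + 2 * M / d\<^sup>2 * (norm (cis \<theta> - \<xi>))\<^sup>2"
    proof (cases "norm (cis \<theta> - \<xi>) < d")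
      case True
      then show ?thesis using uc[OF _ \<xi> True] M0 by (simp add: add_increasing2)
    next
      case False
      then have "d\<^sup>2 \<le> (norm (cis \<theta> - \<xi>))\<^sup>2" using d by (intro power_mono) auto
      then have "2 * M * d\<^sup>2 \<le> 2 * M * (norm (cis \<theta> - \<xi>))\<^sup>2" using M0 by (intro mult_left_mono) auto
      then have "2 * M \<le> 2 * M / d\<^sup>2 * (norm (cis \<theta> - \<xi>))\<^sup>2" using d by (simp add: field_simps)
      then show ?thesis using M[OF \<xi>] M[of "cis \<theta>"] e by auto
    qed
    moreover have "(norm (cis \<theta> - \<xi>))\<^sup>2 \<le> 2 * (norm (cis \<theta> - z))\<^sup>2 + 2 * (norm (z - \<xi>))\<^sup>2"
    proof -
      have "norm (cis \<theta> - \<xi>) \<le> norm (cis \<theta> - z) + norm (z - \<xi>)"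
        using norm_triangle_ineq[of "cis \<theta> - z" "z - \<xi>"] by simp
      then have "(norm (cis \<theta> - \<xi>))\<^sup>2 \<le> (norm (cis \<theta> - z) + norm (z - \<xi>))\<^sup>2" by (intro power_mono) auto
      also have "\<dots> \<le> 2 * (norm (cis \<theta> - z))\<^sup>2 + 2 * (norm (z - \<xi>))\<^sup>2"
        using sum_squares_bound[of "norm (cis \<theta> - z)" "norm (z - \<xi>)"] by (simp add: power2_sum)
      finally show ?thesis .
    qed
    then have "2 * M / d\<^sup>2 * (norm (cis \<theta> - \<xi>))\<^sup>2 \<le> 2 * M / d\<^sup>2 * (2 * (norm (cis \<theta> - z))\<^sup>2 + 2 * (norm (z - \<xi>))\<^sup>2)"
      using M0 by (intro mult_left_mono) auto
    ultimately have "\<bar>k (cis \<theta>) - k \<xi>\<bar> \<le> e + L * ((norm (cis \<theta> - z))\<^sup>2 + (norm (z - \<xi>))\<^sup>2)"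
      by (simp add: L_def algebra_simps add_divide_distrib)
    then have "\<bar>k (cis \<theta>) - k \<xi>\<bar> * ?P \<theta> \<le> (e + L * ((norm (cis \<theta> - z))\<^sup>2 + (norm (z - \<xi>))\<^sup>2)) * ?P \<theta>"
      by (rule mult_right_mono[OF _ P0])
    moreover have "(norm (cis \<theta> - z))\<^sup>2 * ?P \<theta> = 1 - (norm z)\<^sup>2"
      using cis_minus_nonzero(1)[OF z] by (simp add: poisson_kernel_def)
    moreover have "\<bar>(k (cis \<theta>) - k \<xi>) * ?P \<theta>\<bar> = \<bar>k (cis \<theta>) - k \<xi>\<bar> * ?P \<theta>"
      using P0 by (simp add: abs_mult)
    moreover have "(e + L * ((norm (cis \<theta> - z))\<^sup>2 + (norm (z - \<xi>))\<^sup>2)) * ?P \<theta>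
      = e * ?P \<theta> + (L * ((norm (cis \<theta> - z))\<^sup>2 * ?P \<theta>) + L * (norm (z - \<xi>))\<^sup>2 * ?P \<theta>)"
      by (simp add: algebra_simps)
    ultimately show ?thesis by simp
  qed
  have i3: "has_bochner_integral ang (\<lambda>\<theta>. e * ?P \<theta> + (L * (1 - (norm z)\<^sup>2) + L * (norm (z - \<xi>))\<^sup>2 * ?P \<theta>))
      (e * (2*pi) + ((2*pi) *\<^sub>R (L * (1 - (norm z)\<^sup>2)) + L * (norm (z - \<xi>))\<^sup>2 * (2*pi)))"
    by (intro has_bochner_integral_add has_bochner_integral_mult_right poisson_kernel_mean[OF z] has_bochner_integral_const_ang)
  have "\<bar>integral\<^sup>L ang (\<lambda>\<theta>. (k (cis \<theta>) - k \<xi>) * ?P \<theta>)\<bar> \<le> integral\<^sup>L ang (\<lambda>\<theta>. \<bar>(k (cis \<theta>) - k \<xi>) * ?P \<theta>\<bar>)"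
    by (rule integral_abs_bound)
  also have "\<dots> \<le> integral\<^sup>L ang (\<lambda>\<theta>. e * ?P \<theta> + (L * (1 - (norm z)\<^sup>2) + L * (norm (z - \<xi>))\<^sup>2 * ?P \<theta>))"
    by (rule integral_mono) (use i2 i3 pw in \<open>auto simp: has_bochner_integral_iff\<close>)
  finally have "\<bar>2*pi * (poisson_integral (\<lambda>\<theta>. k (cis \<theta>)) z - k \<xi>)\<bar> \<le> 2*pi * (e + L * ((1 - (norm z)\<^sup>2) + (norm (z - \<xi>))\<^sup>2))"
    unfolding has_bochner_integral_integral_eq[OF i2] has_bochner_integral_integral_eq[OF i3]
    by (simp add: algebra_simps)
  then have "2*pi * \<bar>poisson_integral (\<lambda>\<theta>. k (cis \<theta>)) z - k \<xi>\<bar> \<le> 2*pi * (e + L * ((1 - (norm z)\<^sup>2) + (norm (z - \<xi>))\<^sup>2))"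
    by (simp add: abs_mult)
  then show ?thesis by (simp add: L_def)
qed

section \<open>Plurisubharmonic functions on holomorphic discs\<close>

lemma norm_vector_scalar: "norm (c *s x) = norm c * norm (x :: complex ^ 'n::finite)"
  by (simp add: norm_vec_def norm_mult L2_set_right_distrib[symmetric])

lemma continuous_bounded_on_compact:
  fixes u :: "'a::topological_space \<Rightarrow> 'b::real_normed_vector"
  assumes "compact K" "continuous_on K u"
  obtains M where "0 \<le> M" "\<And>x. x \<in> K \<Longrightarrow> norm (u x) \<le> M"
proof -
  have "bounded (u ` K)" by (intro compact_imp_bounded compact_continuous_image assms)
  then obtain M where M: "\<forall>x\<in>K. norm (u x) \<le> M" unfolding bounded_iff by auto
  then have "norm (u x) \<le> max M 0" if "x \<in> K" for x using that by (meson max.coboundedI1)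
  then show ?thesis using that[of "max M 0"] by auto
qed

lemma vec_holomorphic_compose:
  assumes "vec_holomorphic_on F \<Omega>" "\<psi> holomorphic_on A" "\<psi> ` A \<subseteq> \<Omega>"
  shows "vec_holomorphic_on (\<lambda>z. F (\<psi> z)) A"
  unfolding vec_holomorphic_on_def
proof
  fix k
  have "(\<lambda>z. F z $ k) holomorphic_on \<Omega>" using assms(1) by (simp add: vec_holomorphic_on_def)
  from holomorphic_on_compose_gen[OF assms(2) this, unfolded o_def] assms(3)
  show "(\<lambda>z. F (\<psi> z) $ k) holomorphic_on A" by auto
qed

lemma vec_holomorphic_continuous_on:
  fixes F :: "complex \<Rightarrow> complex ^ 'n::finite"
  assumes "vec_holomorphic_on F \<Omega>"
  shows "continuous_on \<Omega> F"
proof -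
  have "continuous_on \<Omega> (\<lambda>z. \<chi> k. F z $ k)"
    using assms by (intro continuous_on_vec_lambda) (auto simp: vec_holomorphic_on_def holomorphic_on_imp_continuous_on)
  then show ?thesis by simp
qed

lemma vec_holomorphic_linear_approx:
  fixes F :: "complex \<Rightarrow> complex ^ 'n::finite"
  assumes F: "vec_holomorphic_on F \<Omega>" and \<Omega>: "open \<Omega>" "z \<in> \<Omega>" and k: "\<kappa> > 0"
  obtains F' \<rho> where "\<rho> > 0" "\<And>w. norm w < \<rho> \<Longrightarrow> norm (F (z + w) - F z - w *s F') \<le> \<kappa> * norm w"
proof -
  define F' where "F' = (\<chi> k. deriv (\<lambda>z. F z $ k) z)"
  have "((\<lambda>w. (F (z + w) $ k - F z $ k) / w) \<longlongrightarrow> F' $ k) (at 0)" for k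
  proof -
    have "(\<lambda>z. F z $ k) holomorphic_on \<Omega>" using F by (simp add: vec_holomorphic_on_def)
    then have "((\<lambda>z. F z $ k) has_field_derivative F' $ k) (at z)"
      unfolding F'_def using holomorphic_derivI[OF _ \<Omega>] by simp
    then show ?thesis unfolding DERIV_def .
  qed
  then have "((\<lambda>w. (F (z + w) $ k - F z $ k) / w - F' $ k) \<longlongrightarrow> 0) (at 0)" for k
    by (simp add: LIM_zero)
  then have "((\<lambda>w. \<chi> k. (F (z + w) $ k - F z $ k) / w - F' $ k) \<longlongrightarrow> 0) (at 0)"
    by (intro vec_tendstoI) simp
  then have "eventually (\<lambda>w. norm ((\<chi> k. (F (z + w) $ k - F z $ k) / w - F' $ k) :: complex ^ 'n) < \<kappa>) (at 0)"
    using k by (auto dest!: tendstoD[of _ _ _ \<kappa>] simp: dist_norm)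
  then obtain \<rho> where \<rho>: "\<rho> > 0" "\<And>w. w \<noteq> 0 \<Longrightarrow> norm w < \<rho> \<Longrightarrow>
      norm ((\<chi> k. (F (z + w) $ k - F z $ k) / w - F' $ k) :: complex ^ 'n) < \<kappa>"
    unfolding eventually_at by (auto simp: dist_norm)
  have "norm (F (z + w) - F z - w *s F') \<le> \<kappa> * norm w" if w: "norm w < \<rho>" for w
  proof (cases "w = 0")
    case False
    have "F (z + w) - F z - w *s F' = w *s (\<chi> k. (F (z + w) $ k - F z $ k) / w - F' $ k)"
      using False by (simp add: vec_eq_iff field_simps)
    then show ?thesis
      using mult_left_mono[OF less_imp_le[OF \<rho>(2)[OF False w]], of "norm w"] by (simp add: norm_vector_scalar mult.commute)
  qed simp
  with \<rho>(1) that show ?thesis by blast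
qed

lemma psh_on_disc_mean:
  fixes u :: "complex ^ 'n::finite \<Rightarrow> real"
  assumes psh: "psh_on G u" and r: "r > 0" and sub: "\<And>w. norm w \<le> r \<Longrightarrow> y + w *s b \<in> G"
  shows "integrable ang (\<lambda>\<theta>. u (y + (of_real r * cis \<theta>) *s b))"
    and "2 * pi * u y \<le> integral\<^sup>L ang (\<lambda>\<theta>. u (y + (of_real r * cis \<theta>) *s b))"
proof -
  have "cball 0 r \<subseteq> {z. y + z *s b \<in> G}" using sub by auto
  then have *: "set_integrable lebesgue {0..2*pi} (\<lambda>\<theta>. u (y + (0 + of_real r * cis \<theta>) *s b))"
    "u (y + 0 *s b) \<le> 1 / (2*pi) * (LINT \<theta>:{0..2*pi}|lebesgue. u (y + (0 + of_real r * cis \<theta>) *s b))"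
    using psh r unfolding psh_on_def subharmonic_on_def by blast+
  show "integrable ang (\<lambda>\<theta>. u (y + (of_real r * cis \<theta>) *s b))"
    using *(1) unfolding set_integrable_def by (subst integrable_restrict_space) auto
  have "u y \<le> 1 / (2*pi) * integral\<^sup>L ang (\<lambda>\<theta>. u (y + (of_real r * cis \<theta>) *s b))"
    using *(2) unfolding LINT_ang by simp
  then show "2 * pi * u y \<le> integral\<^sup>L ang (\<lambda>\<theta>. u (y + (of_real r * cis \<theta>) *s b))"
    by (simp add: field_simps)
qed

lemma norm_add_sq: "(norm (a + b :: 'a::real_inner))\<^sup>2 = (norm a)\<^sup>2 + 2 * (a \<bullet> b) + (norm b)\<^sup>2"
  by (simp add: power2_norm_eq_inner inner_add inner_commute)

lemma inner_complex_vec: "(a :: complex ^ 'n::finite) \<bullet> b = Re (\<Sum>k\<in>UNIV. cnj (a $ k) * b $ k)"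
  by (simp add: inner_vec_def inner_complex_def)

text \<open>The composition of a plurisubharmonic function with a holomorphic disc is subharmonic, but the
  definition only provides mean values along complex lines, so that the usual proof smooths \<open>u\<close> first.
  Doubling the variables avoids the smoothing.  If \<open>u (F z) > V z\<close> somewhere, one maximises
  \<open>u y - \<bar>F x - y\<bar>\<^sup>2 / \<epsilon> - V x + \<delta> * \<bar>x\<bar>\<^sup>2\<close> over pairs of \<open>x\<close> in a compact part of \<open>\<Omega>\<close> and \<open>y\<close> near \<open>K\<close>.  At the maximum \<open>(z0, y0)\<close> one moves \<open>x\<close> along a
  small circle about \<open>z0\<close> and \<open>y\<close> along the complex line through \<open>y0\<close> in the direction \<open>F' z0\<close>.  The mean
  of \<open>u\<close> does not decrease, that of \<open>V\<close> is unchanged, the term with \<open>\<delta>\<close> gains \<open>\<delta> * r\<^sup>2\<close>, and the penalty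
  changes by a harmonic term with mean zero and by at most \<open>\<delta> * r\<^sup>2 / 2\<close>, because \<open>x\<close> and \<open>y\<close> move in parallel
  up to \<open>o(r)\<close>.  This contradicts maximality.\<close>

lemma psh_disc_maximum_principle:
  fixes u :: "complex ^ 'n::finite \<Rightarrow> real" and F :: "complex \<Rightarrow> complex ^ 'n"
  assumes psh: "psh_on G u" and uc: "continuous_on G u" and G: "open G"
    and K: "compact K" "K \<subseteq> G"
    and \<Omega>: "open \<Omega>" "bounded \<Omega>" and F: "vec_holomorphic_on F \<Omega>" "F ` \<Omega> \<subseteq> K"
    and Vc: "continuous_on \<Omega> V"
    and Vm: "\<And>z. z \<in> \<Omega> \<Longrightarrow> \<exists>R>0. \<forall>r. 0 < r \<and> r < R \<longrightarrow>
        has_bochner_integral ang (\<lambda>\<theta>. V (z + of_real r * cis \<theta>)) (2*pi * V z)"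
    and bd: "\<And>e. e > 0 \<Longrightarrow> \<exists>C. compact C \<and> C \<subseteq> \<Omega> \<and> (\<forall>z\<in>\<Omega> - C. u (F z) - V z \<le> e)"
    and z: "z \<in> \<Omega>"
  shows "u (F z) \<le> V z"
proof (rule ccontr)
  assume neg: "\<not> u (F z) \<le> V z"
  define m where "m = (u (F z) - V z) / 4"
  have m: "m > 0" using neg by (simp add: m_def)
  obtain C where C: "compact C" "C \<subseteq> \<Omega>" "\<And>z. z \<in> \<Omega> - C \<Longrightarrow> u (F z) - V z \<le> m"
    using bd[OF m] by blast
  have zC: "z \<in> C" using C(3)[of z] z m by (auto simp: m_def)
  obtain d0 where d0: "d0 > 0" "{x. infdist x C \<le> d0} \<subseteq> \<Omega>"
    using compact_in_open_separated[of C \<Omega>] C \<Omega> zC by blast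
  define C' where "C' = {x. infdist x C \<le> d0}"
  have C': "compact C'" "C' \<subseteq> \<Omega>" "C \<subseteq> C'"
    using compact_infdist_le[of C d0] C zC d0 by (auto simp: C'_def)
  have Kne: "K \<noteq> {}" using z F(2) by auto
  obtain d where d: "d > 0" "{x. infdist x K \<le> d} \<subseteq> G"
    using compact_in_open_separated[OF Kne K(1) G K(2)] by blast
  define K2 where "K2 = {x. infdist x K \<le> d}"
  have K2: "compact K2" "K2 \<subseteq> G" "K \<subseteq> K2"
    using compact_infdist_le[OF Kne K(1) d(1)] d by (auto simp: K2_def)
  have uc2: "continuous_on K2 u" by (rule continuous_on_subset[OF uc K2(2)])
  obtain M where M0: "0 \<le> M" and M: "\<And>x. x \<in> K2 \<Longrightarrow> \<bar>u x\<bar> \<le> M"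
    using continuous_bounded_on_compact[OF K2(1) uc2] by auto
  have "uniformly_continuous_on K2 u" by (rule compact_uniformly_continuous[OF uc2 K2(1)])
  then obtain \<tau> where \<tau>: "\<tau> > 0" "\<And>x y. x \<in> K2 \<Longrightarrow> y \<in> K2 \<Longrightarrow> dist x y < \<tau> \<Longrightarrow> dist (u x) (u y) < m"
    unfolding uniformly_continuous_on_def using m by metis
  define \<sigma> where "\<sigma> = min \<tau> d"
  have \<sigma>: "\<sigma> > 0" "\<sigma> \<le> \<tau>" "\<sigma> \<le> d" using \<tau> d by (auto simp: \<sigma>_def)
  \<comment> \<open>The penalty is at most \<open>2 * M\<close> at the maximum, so this forces \<open>y0\<close> to be closer than \<open>\<sigma>\<close> to \<open>F z0\<close>.\<close>
  define \<epsilon> where "\<epsilon> = \<sigma>\<^sup>2 / (2 * M + 1)"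
  have \<epsilon>: "\<epsilon> > 0" and \<epsilon>M: "2 * M * \<epsilon> < \<sigma>\<^sup>2"
    using \<sigma> M0 by (auto simp: \<epsilon>_def field_simps)
  obtain B where B: "\<And>x. x \<in> \<Omega> \<Longrightarrow> norm x \<le> B" using \<Omega>(2) unfolding bounded_iff by blast
  have \<epsilon>0: "\<epsilon> \<noteq> 0" using \<epsilon> by simp
  define \<delta> where "\<delta> = m / (B\<^sup>2 + 1)"
  have \<delta>: "\<delta> > 0" using m by (simp add: \<delta>_def add_nonneg_pos)
  have \<delta>B: "\<delta> * (norm x)\<^sup>2 \<le> m" if "x \<in> \<Omega>" for x
  proof -
    have "(norm x)\<^sup>2 \<le> B\<^sup>2 + 1" using power_mono[OF B[OF that], of 2] by simp
    then have "\<delta> * (norm x)\<^sup>2 \<le> \<delta> * (B\<^sup>2 + 1)" using \<delta> by (intro mult_left_mono) auto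
    also have "\<dots> = m" using add_nonneg_pos[OF zero_le_power2[of B] zero_less_one] by (simp add: \<delta>_def)
    finally show ?thesis .
  qed
  have Fc: "continuous_on \<Omega> F" by (rule vec_holomorphic_continuous_on[OF F(1)])
  define \<Theta> where "\<Theta> = (\<lambda>(x, y). u y - (norm (F x - y))\<^sup>2 / \<epsilon> - V x + \<delta> * (norm x)\<^sup>2)"
  have "continuous_on (C' \<times> K2) \<Theta>"
    unfolding \<Theta>_def case_prod_unfold
  proof -
    have f: "continuous_on (C' \<times> K2) (\<lambda>q. F (fst q))"
      by (rule continuous_on_compose2[OF continuous_on_subset[OF Fc C'(2)]]) (auto intro!: continuous_intros)
    have v: "continuous_on (C' \<times> K2) (\<lambda>q. V (fst q))"
      by (rule continuous_on_compose2[OF continuous_on_subset[OF Vc C'(2)]]) (auto intro!: continuous_intros)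
    have w: "continuous_on (C' \<times> K2) (\<lambda>q. u (snd q))"
      by (rule continuous_on_compose2[OF uc2]) (auto intro!: continuous_intros)
    show "continuous_on (C' \<times> K2) (\<lambda>q. u (snd q) - (norm (F (fst q) - snd q))\<^sup>2 / \<epsilon> - V (fst q) + \<delta> * (norm (fst q))\<^sup>2)"
    proof -
      have n: "continuous_on (C' \<times> K2) (\<lambda>q. (norm (F (fst q) - snd q))\<^sup>2)"
        by (intro continuous_on_power continuous_on_norm continuous_on_diff f continuous_on_snd continuous_on_id)
      have e: "continuous_on (C' \<times> K2) (\<lambda>q. (norm (F (fst q) - snd q))\<^sup>2 / \<epsilon>)"
        by (rule continuous_on_divide[OF n continuous_on_const]) (simp add: \<epsilon>0)
      have d: "continuous_on (C' \<times> K2) (\<lambda>q. \<delta> * (norm (fst q))\<^sup>2)"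
        by (intro continuous_on_mult continuous_on_const continuous_on_power continuous_on_norm continuous_on_fst continuous_on_id)
      show ?thesis
        by (rule continuous_on_add[OF continuous_on_diff[OF continuous_on_diff[OF w e] v] d])
    qed
  qed
  moreover have "compact (C' \<times> K2)" by (rule compact_Times[OF C'(1) K2(1)])
  moreover have "C' \<times> K2 \<noteq> {}" using C'(3) K2(3) zC Kne by auto
  ultimately have "\<exists>p\<in>C' \<times> K2. \<forall>q\<in>C' \<times> K2. \<Theta> q \<le> \<Theta> p"
    by (intro continuous_attains_sup)
  then obtain p where p: "p \<in> C' \<times> K2" "\<And>q. q \<in> C' \<times> K2 \<Longrightarrow> \<Theta> q \<le> \<Theta> p"
    by blast
  obtain z0 y0 where zy: "p = (z0, y0)" by (cases p)
  have z0: "z0 \<in> C'" "z0 \<in> \<Omega>" and y0: "y0 \<in> K2" using p(1) C' by (auto simp: zy)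
  have Fz0: "F z0 \<in> K" "F z0 \<in> K2" using F z0 K2 by auto
  have Fz: "F z \<in> K2" using F z K2 by auto
  have 1: "u (F z) - V z + \<delta> * (norm z)\<^sup>2 \<le> \<Theta> p"
    using p(2)[of "(z, F z)"] Fz zC C' by (auto simp: \<Theta>_def)
  have 2: "u (F z0) - V z0 + \<delta> * (norm z0)\<^sup>2 \<le> \<Theta> p"
    using p(2)[of "(z0, F z0)"] Fz0 z0 by (auto simp: \<Theta>_def)
  have Tp: "\<Theta> p = u y0 - (norm (F z0 - y0))\<^sup>2 / \<epsilon> - V z0 + \<delta> * (norm z0)\<^sup>2" by (simp add: \<Theta>_def zy)
  have "(norm (F z0 - y0))\<^sup>2 / \<epsilon> \<le> 2 * M"
    using 2 M[OF y0] M[OF Fz0(2)] unfolding Tp by linarith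
  then have "(norm (F z0 - y0))\<^sup>2 < \<sigma>\<^sup>2" using \<epsilon> \<epsilon>M by (simp add: field_simps)
  then have n\<sigma>: "dist y0 (F z0) < \<sigma>" using \<sigma> by (simp add: dist_norm norm_minus_commute power_less_imp_less_base[of _ 2])
  then have "dist (u y0) (u (F z0)) < m" by (intro \<tau>(2) y0 Fz0) (use \<sigma> in auto)
  then have "u y0 \<le> u (F z0) + m" by (simp add: dist_real_def)
  moreover have "0 \<le> (norm (F z0 - y0))\<^sup>2 / \<epsilon>" using \<epsilon> by simp
  moreover have "0 \<le> \<delta> * (norm z)\<^sup>2" using \<delta> by simp
  ultimately have "u (F z0) - V z0 \<ge> 2 * m"
    using 1 \<delta>B[OF z0(2)] unfolding Tp m_def by argo
  then have z0C: "z0 \<in> C" using C(3)[of z0] z0(2) m by force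
  have bC': "ball z0 d0 \<subseteq> C'"
  proof
    fix x assume "x \<in> ball z0 d0"
    then show "x \<in> C'" using infdist_le[OF z0C, of x] by (auto simp: C'_def dist_commute)
  qed
  define \<eta> where "\<eta> = d - dist y0 (F z0)"
  have \<eta>: "\<eta> > 0" using n\<sigma> \<sigma> by (simp add: \<eta>_def)
  have bK2: "ball y0 \<eta> \<subseteq> K2"
  proof
    fix x assume "x \<in> ball y0 \<eta>"
    then have "dist x (F z0) \<le> d"
      using dist_triangle[of x "F z0" y0] by (simp add: \<eta>_def dist_commute)
    then show "x \<in> K2" using infdist_le[OF Fz0(1), of x] by (auto simp: K2_def)
  qed
  \<comment> \<open>With \<open>\<bar>\<Delta> w\<bar> \<le> \<kappa> * r\<close> the square of the error costs only \<open>\<delta> * r\<^sup>2 / 2\<close>, half of the gain.\<close>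
  define \<kappa> where "\<kappa> = sqrt (\<delta> * \<epsilon> / 2)"
  have \<kappa>: "\<kappa> > 0" "\<kappa>\<^sup>2 = \<delta> * \<epsilon> / 2" using \<delta> \<epsilon> by (auto simp: \<kappa>_def)
  obtain F' \<rho> where \<rho>: "\<rho> > 0" and F': "\<And>w. norm w < \<rho> \<Longrightarrow> norm (F (z0 + w) - F z0 - w *s F') \<le> \<kappa> * norm w"
    using vec_holomorphic_linear_approx[OF F(1) \<Omega>(1) z0(2) \<kappa>(1)] by blast
  obtain R where R: "R > 0" "\<And>r. 0 < r \<Longrightarrow> r < R \<Longrightarrow>
        has_bochner_integral ang (\<lambda>\<theta>. V (z0 + of_real r * cis \<theta>)) (2*pi * V z0)"
    using Vm[OF z0(2)] by blast
  define r where "r = Min {d0 / 2, \<rho> / 2, R / 2, \<eta> / (2 * (norm F' + 1))}"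
  have nF: "norm F' + 1 > 0" by (simp add: add_nonneg_pos)
  have r: "r > 0" "r < d0" "r < \<rho>" "r < R" "r * (norm F' + 1) < \<eta>"
  proof -
    show "r > 0" using d0 \<rho> R \<eta> nF by (simp add: r_def)
    have "r \<le> d0 / 2" "r \<le> \<rho> / 2" "r \<le> R / 2" and *: "r \<le> \<eta> / (2 * (norm F' + 1))"
      unfolding r_def by (rule Min_le; simp)+
    then show "r < d0" "r < \<rho>" "r < R" using d0 \<rho> R by auto
    have "r * (norm F' + 1) \<le> \<eta> / 2" using * nF by (simp add: field_simps)
    then show "r * (norm F' + 1) < \<eta>" using \<eta> by simp
  qed
  have yw: "y0 + w *s F' \<in> K2" if "norm w \<le> r" for w
  proof -
    have "norm (w *s F') \<le> r * norm F'" unfolding norm_vector_scalar by (intro mult_right_mono that) auto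
    also have "\<dots> < \<eta>" using r by (simp add: algebra_simps)
    finally show ?thesis using bK2 by (auto simp: dist_norm)
  qed
  define P where "P = F z0 - y0"
  \<comment> \<open>The distance vector after the move is \<open>P + \<Delta> w\<close>, and \<open>Re (H w)\<close>, the inner product of \<open>P\<close> and \<open>\<Delta> w\<close>, is harmonic and vanishes at \<open>0\<close>.\<close>
  define \<Delta> where "\<Delta> = (\<lambda>w. F (z0 + w) - F z0 - w *s F')"
  define H where "H = (\<lambda>w. \<Sum>k\<in>UNIV. cnj (P $ k) * \<Delta> w $ k)"
  have Hhol: "H holomorphic_on ball 0 d0"
  proof -
    have "(\<lambda>w. F (z0 + w) $ k) holomorphic_on ball 0 d0" for k
    proof (rule holomorphic_on_compose_gen[where g = "\<lambda>z. F z $ k" and f = "\<lambda>w. z0 + w" and t = \<Omega>, unfolded o_def])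
      have sub: "z0 + w \<in> \<Omega>" if "w \<in> ball 0 d0" for w
      proof -
        have "z0 + w \<in> ball z0 d0" using that by (simp add: dist_norm)
        then show ?thesis using bC' C' by blast
      qed
      show "(\<lambda>w. z0 + w) ` ball 0 d0 \<subseteq> \<Omega>" by (rule image_subsetI, rule sub)
    qed (use F(1) in \<open>auto simp: vec_holomorphic_on_def intro!: holomorphic_intros\<close>)
    then show ?thesis unfolding H_def \<Delta>_def by (auto intro!: holomorphic_intros)
  qed
  have H0: "H 0 = 0" by (simp add: H_def \<Delta>_def)
  have ReH: "P \<bullet> \<Delta> w = Re (H w)" for w by (simp add: inner_complex_vec H_def)
  define RHS where "RHS = (\<lambda>\<theta>. (\<Theta> p + (norm P)\<^sup>2 / \<epsilon> + \<delta> * r\<^sup>2 / 2 - \<delta> * (norm z0)\<^sup>2 - \<delta> * r\<^sup>2)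
      + 2 / \<epsilon> * Re (H (0 + of_real r * cis \<theta>)) + V (z0 + of_real r * cis \<theta>)
      - 2 * \<delta> * Re (cnj z0 * (0 + of_real r * cis \<theta>)))"
  have le: "u (y0 + (of_real r * cis \<theta>) *s F') \<le> RHS \<theta>" for \<theta>
  proof -
    define w where "w = of_real r * cis \<theta>"
    have nw: "norm w = r" using r(1) by (simp add: w_def norm_mult)
    have "z0 + w \<in> C'" using bC' r(2) nw by (auto simp: dist_norm)
    moreover have "y0 + w *s F' \<in> K2" using yw nw by simp
    ultimately have "\<Theta> (z0 + w, y0 + w *s F') \<le> \<Theta> p" using p(2) by blast
    moreover have "F (z0 + w) - (y0 + w *s F') = P + \<Delta> w" by (simp add: P_def \<Delta>_def)
    ultimately have a: "u (y0 + w *s F') \<le> \<Theta> p + (norm (P + \<Delta> w))\<^sup>2 / \<epsilon> + V (z0 + w) - \<delta> * (norm (z0 + w))\<^sup>2"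
      by (simp add: \<Theta>_def)
    have "norm (\<Delta> w) \<le> \<kappa> * r" unfolding \<Delta>_def using F'[of w] r(3) nw by simp
    then have "(norm (\<Delta> w))\<^sup>2 \<le> (\<kappa> * r)\<^sup>2" by (intro power_mono) auto
    also have "\<dots> = \<delta> * \<epsilon> / 2 * r\<^sup>2" by (simp add: power_mult_distrib \<kappa>)
    finally have "(norm (P + \<Delta> w))\<^sup>2 \<le> (norm P)\<^sup>2 + 2 * Re (H w) + \<delta> * \<epsilon> / 2 * r\<^sup>2"
      by (simp add: norm_add_sq ReH)
    then have "(norm (P + \<Delta> w))\<^sup>2 / \<epsilon> \<le> ((norm P)\<^sup>2 + 2 * Re (H w) + \<delta> * \<epsilon> / 2 * r\<^sup>2) / \<epsilon>"
      using \<epsilon> by (intro divide_right_mono) auto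
    also have "\<dots> = (norm P)\<^sup>2 / \<epsilon> + 2 / \<epsilon> * Re (H w) + \<delta> * r\<^sup>2 / 2" using \<epsilon> by (simp add: field_simps)
    finally have b: "(norm (P + \<Delta> w))\<^sup>2 / \<epsilon> \<le> (norm P)\<^sup>2 / \<epsilon> + 2 / \<epsilon> * Re (H w) + \<delta> * r\<^sup>2 / 2" .
    have "z0 \<bullet> w = Re (cnj z0 * w)" by (simp add: inner_complex_def)
    then have n2: "(norm (z0 + w))\<^sup>2 = (norm z0)\<^sup>2 + 2 * Re (cnj z0 * w) + r\<^sup>2"
      unfolding norm_add_sq nw by simp
    have "\<delta> * (a + 2 * b + c) = \<delta> * a + 2 * \<delta> * b + \<delta> * c" for a b c by (simp add: algebra_simps)
    then have c: "\<delta> * (norm (z0 + w))\<^sup>2 = \<delta> * (norm z0)\<^sup>2 + 2 * \<delta> * Re (cnj z0 * w) + \<delta> * r\<^sup>2"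
      unfolding n2 .
    show ?thesis using a b c unfolding RHS_def w_def[symmetric] by simp
  qed
  have "has_bochner_integral ang RHS ((2*pi) *\<^sub>R (\<Theta> p + (norm P)\<^sup>2 / \<epsilon> + \<delta> * r\<^sup>2 / 2 - \<delta> * (norm z0)\<^sup>2 - \<delta> * r\<^sup>2)
      + 2 / \<epsilon> * (2 * pi * Re (H 0)) + 2 * pi * V z0 - 2 * \<delta> * (2 * pi * Re (cnj z0 * 0)))"
    unfolding RHS_def
    by (intro has_bochner_integral_add has_bochner_integral_diff has_bochner_integral_const_ang has_bochner_integral_mult_right
        harmonic_mean_value[where R = d0 and q = H] harmonic_mean_value[where R = d0 and q = "\<lambda>w. cnj z0 * w"] R(2))
      (use r Hhol in \<open>auto intro!: holomorphic_intros\<close>)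
  then have RI: "integrable ang RHS" and RE: "integral\<^sup>L ang RHS = 2 * pi * (u y0 - \<delta> * r\<^sup>2 / 2)"
    unfolding has_bochner_integral_iff using H0 Tp by (auto simp: P_def algebra_simps)
  have "2 * pi * u y0 \<le> integral\<^sup>L ang (\<lambda>\<theta>. u (y0 + (of_real r * cis \<theta>) *s F'))"
    by (rule psh_on_disc_mean(2)[OF psh r(1)]) (use yw K2 in auto)
  also have "\<dots> \<le> integral\<^sup>L ang RHS"
    by (rule integral_mono[OF psh_on_disc_mean(1)[OF psh r(1)] RI le]) (use yw K2 in auto)
  finally have "2 * pi * u y0 \<le> 2 * pi * (u y0 - \<delta> * r\<^sup>2 / 2)" unfolding RE .
  then have "\<delta> * r\<^sup>2 \<le> 0" by simp
  moreover have "\<delta> * r\<^sup>2 > 0" using \<delta> r by simp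
  ultimately show False by simp
qed

section \<open>Boundary majorants\<close>

text \<open>The Poisson integral of the boundary values of \<open>u \<circ> F\<close> is harmonic and continuous up to the boundary, so
  the maximum principle applies directly.\<close>

lemma poisson_majorant_closed_disc:
  fixes u :: "complex ^ 'n::finite \<Rightarrow> real" and F :: "complex \<Rightarrow> complex ^ 'n"
  assumes psh: "psh_on G u" and uc: "continuous_on G u" and G: "open G"
    and K: "compact K" "K \<subseteq> G"
    and F: "vec_holomorphic_on F (ball 0 1)" "continuous_on (cball 0 1) F" "F ` cball 0 1 \<subseteq> K"
    and z: "norm z < 1"
  shows "u (F z) \<le> poisson_integral (\<lambda>\<theta>. u (F (cis \<theta>))) z"
proof -
  define U where "U = (\<lambda>z. u (F z))"
  have Uc: "continuous_on (cball 0 1) U"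
    unfolding U_def by (rule continuous_on_compose2[OF uc F(2)]) (use F K in auto)
  obtain M where M: "0 \<le> M" "\<And>z. z \<in> cball 0 1 \<Longrightarrow> norm (U z) \<le> M"
    using continuous_bounded_on_compact[OF compact_cball Uc] by blast
  have cc: "continuous_on {0..2*pi} (\<lambda>\<theta>. U (cis \<theta>))"
    by (rule continuous_on_compose2[OF Uc]) (auto intro!: continuous_intros)
  define q where "q = herglotz (\<lambda>\<theta>. U (cis \<theta>))"
  have m: "(\<lambda>\<theta>. U (cis \<theta>)) \<in> borel_measurable ang" by (rule continuous_imp_ang[OF cc])
  have b: "AE \<theta> in ang. \<bar>U (cis \<theta>)\<bar> \<le> M" using M(2) by (intro AE_I2) simp
  have q: "q holomorphic_on ball 0 1" unfolding q_def by (rule herglotz_holomorphic[OF m b])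
  have Rq: "Re (q w) = poisson_integral (\<lambda>\<theta>. U (cis \<theta>)) w" if "norm w < 1" for w
    unfolding q_def by (rule Re_herglotz(1)[OF m b that])
  have "u (F z) \<le> Re (q z)"
  proof (rule psh_disc_maximum_principle[OF psh uc G K open_ball bounded_ball F(1)])
    show "F ` ball 0 1 \<subseteq> K" using F(3) by (auto simp: image_subset_iff)
    show "continuous_on (ball 0 1) (\<lambda>z. Re (q z))"
      by (intro continuous_intros holomorphic_on_imp_continuous_on q)
    show "z \<in> ball 0 1" using z by simp
  next
    fix w :: complex assume w: "w \<in> ball 0 1"
    have "ball w (1 - norm w) \<subseteq> ball 0 1"
    proof
      fix x assume "x \<in> ball w (1 - norm w)"
      then show "x \<in> ball 0 1" using norm_triangle_ineq2[of x w] by (simp add: dist_norm norm_minus_commute)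
    qed
    then have "q holomorphic_on ball w (1 - norm w)" by (rule holomorphic_on_subset[OF q])
    then have "\<forall>r. 0 < r \<and> r < 1 - norm w \<longrightarrow> has_bochner_integral ang (\<lambda>\<theta>. Re (q (w + of_real r * cis \<theta>))) (2*pi * Re (q w))"
      using harmonic_mean_value[of q w "1 - norm w" "\<lambda>w. Re (q w)"] by auto
    then show "\<exists>R>0. \<forall>r. 0 < r \<and> r < R \<longrightarrow> has_bochner_integral ang (\<lambda>\<theta>. Re (q (w + of_real r * cis \<theta>))) (2*pi * Re (q w))"
      using w by (intro exI[of _ "1 - norm w"]) auto
  next
    fix e :: real assume e: "e > 0"
    have "uniformly_continuous_on (cball 0 1) U" by (rule compact_uniformly_continuous[OF Uc compact_cball])
    then obtain d where d: "d > 0" "\<And>x y. x \<in> cball 0 1 \<Longrightarrow> y \<in> cball 0 1 \<Longrightarrow> dist x y < d \<Longrightarrow> dist (U x) (U y) < e / 3"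
      unfolding uniformly_continuous_on_def using e by (metis divide_pos_pos zero_less_numeral)
    define L where "L = 4 * M / d\<^sup>2"
    have L: "L \<ge> 0" using M by (simp add: L_def)
    define t where "t = min (min d 1) (e / (9 * (L + 1)))"
    have t: "0 < t" "t \<le> d" "t \<le> 1" "t \<le> e / (9 * (L + 1))"
      using d e L by (auto simp: t_def add_nonneg_pos)
    have Lt: "L * (3 * t) \<le> e / 3"
    proof -
      have "(L + 1) * t \<le> (L + 1) * (e / (9 * (L + 1)))" using t L by (intro mult_left_mono) auto
      also have "\<dots> = e / 9" using L by (simp add: field_simps)
      finally show ?thesis using t L by (simp add: algebra_simps)
    qed
    have "u (F w) - Re (q w) \<le> e" if w: "w \<in> ball 0 1 - cball 0 (1 - t)" for w
    proof -
      have nw: "norm w < 1" "1 - t < norm w" using w by auto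
      then have w0: "w \<noteq> 0" using t by auto
      define \<xi> where "\<xi> = w / of_real (norm w)"
      have \<xi>: "norm \<xi> = 1" using w0 by (simp add: \<xi>_def norm_divide)
      have "w - \<xi> = of_real (norm w - 1) * \<xi>" using w0 by (simp add: \<xi>_def field_simps)
      then have wx: "norm (w - \<xi>) = 1 - norm w" using nw \<xi> by (simp add: norm_mult del: of_real_diff)
      have "dist (U w) (U \<xi>) < e / 3" by (rule d(2)) (use nw \<xi> wx t in \<open>auto simp: dist_norm\<close>)
      then have 1: "U w \<le> U \<xi> + e / 3" unfolding dist_real_def by linarith
      have "\<bar>poisson_integral (\<lambda>\<theta>. U (cis \<theta>)) w - U \<xi>\<bar> \<le> e / 3 + 4 * M / d\<^sup>2 * ((1 - (norm w)\<^sup>2) + (norm (w - \<xi>))\<^sup>2)"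
      proof (rule poisson_integral_boundary_estimate[OF _ _ d(1) _ _ nw(1) \<xi>])
        show "continuous_on (sphere 0 1) U" by (rule continuous_on_subset[OF Uc]) auto
        show "\<bar>U \<zeta>\<bar> \<le> M" if "norm \<zeta> = 1" for \<zeta> using M(2)[of \<zeta>] that by simp
        show "\<bar>U \<zeta> - U x\<bar> \<le> e / 3" if "norm \<zeta> = 1" "norm x = 1" "norm (\<zeta> - x) < d" for \<zeta> x
          using d(2)[of \<zeta> x] that by (simp add: dist_norm)
      qed (use e in auto)
      moreover have "(1 - (norm w)\<^sup>2) + (norm (w - \<xi>))\<^sup>2 \<le> 3 * t"
      proof -
        have "1 - (norm w)\<^sup>2 = (1 - norm w) * (1 + norm w)" by (simp add: power2_eq_square algebra_simps)
        also have "\<dots> \<le> t * 2" by (rule mult_mono) (use nw t in auto)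
        finally have "1 - (norm w)\<^sup>2 \<le> t * 2" .
        moreover have "(norm (w - \<xi>))\<^sup>2 \<le> t * 1" unfolding wx power2_eq_square by (rule mult_mono) (use nw t in auto)
        ultimately show ?thesis by simp
      qed
      then have "L * ((1 - (norm w)\<^sup>2) + (norm (w - \<xi>))\<^sup>2) \<le> L * (3 * t)" by (rule mult_left_mono[OF _ L])
      ultimately have "U \<xi> - Re (q w) \<le> e / 3 + e / 3" unfolding Rq[OF nw(1)] using Lt by (simp add: L_def abs_le_iff)
      then show ?thesis using 1 by (simp add: U_def)
    qed
    moreover have "cball 0 (1 - t) \<subseteq> ball (0::complex) 1" using t by auto
    ultimately show "\<exists>C. compact C \<and> C \<subseteq> ball 0 1 \<and> (\<forall>z\<in>ball 0 1 - C. u (F z) - Re (q z) \<le> e)"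
      by (intro exI[of _ "cball 0 (1 - t)"]) auto
  qed
  then show ?thesis using Rq[OF z] by (simp add: U_def)
qed

lemma bdval_measurable:
  fixes F :: "complex \<Rightarrow> 'a::euclidean_space"
  assumes F: "continuous_on (ball 0 1) F" and b: "AE \<theta> in ang. has_bdval F (cis \<theta>)"
  shows "(\<lambda>\<theta>. bdval F (cis \<theta>)) \<in> borel_measurable ang"
proof (rule ang_AE_limit_measurable)
  show "(\<lambda>\<theta>. F (of_real (rad m) * cis \<theta>)) \<in> borel_measurable ang" for m
    by (intro continuous_imp_ang continuous_on_compose2[OF F] continuous_intros)
      (use rad in \<open>auto simp: norm_mult\<close>)
  show "AE \<theta> in ang. (\<lambda>m. F (of_real (rad m) * cis \<theta>)) \<longlonglongrightarrow> bdval F (cis \<theta>)"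
    using b by eventually_elim (rule bdval_radial, auto)
qed

lemma bdval_in_closed:
  assumes \<zeta>: "norm \<zeta> = 1" and b: "has_bdval F \<zeta>" and C: "closed C" and F: "F ` ball 0 1 \<subseteq> C"
  shows "bdval F \<zeta> \<in> C"
proof (rule closed_sequentially[OF C _ bdval_radial[OF \<zeta> b]])
  show "F (of_real (rad m) * \<zeta>) \<in> C" for m
    using F rad[of m] \<zeta> by (auto simp: norm_mult)
qed

text \<open>Apply the previous lemma on the discs of radius \<open>rad m\<close> and pass to the limit by dominated convergence;
  \<open>u\<close> is bounded on \<open>K\<close>.\<close>

lemma poisson_majorant:
  fixes u :: "complex ^ 'n::finite \<Rightarrow> real" and F :: "complex \<Rightarrow> complex ^ 'n"
  assumes psh: "psh_on G u" and uc: "continuous_on G u" and G: "open G"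
    and K: "compact K" "K \<subseteq> G"
    and F: "vec_holomorphic_on F (ball 0 1)" "F ` ball 0 1 \<subseteq> K"
    and b: "AE \<theta> in ang. has_bdval F (cis \<theta>)"
    and z: "norm z < 1"
  shows "u (F z) \<le> poisson_integral (\<lambda>\<theta>. u (bdval F (cis \<theta>))) z"
proof -
  have Fc: "continuous_on (ball 0 1) F" by (rule vec_holomorphic_continuous_on[OF F(1)])
  have uK: "continuous_on K u" by (rule continuous_on_subset[OF uc K(2)])
  obtain M where M: "0 \<le> M" "\<And>x. x \<in> K \<Longrightarrow> norm (u x) \<le> M"
    using continuous_bounded_on_compact[OF K(1) uK] by blast
  have inb: "of_real (rad m) * w \<in> ball 0 1" if "norm w \<le> 1" for m and w :: complex
    using norm_rad_mult_less[OF that] by simp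
  have le: "u (F (of_real (rad m) * z)) \<le> poisson_integral (\<lambda>\<theta>. u (F (of_real (rad m) * cis \<theta>))) z" for m
  proof (rule poisson_majorant_closed_disc[OF psh uc G K _ _ _ z, where F = "\<lambda>z. F (of_real (rad m) * z)"])
    show "vec_holomorphic_on (\<lambda>z. F (of_real (rad m) * z)) (ball 0 1)"
      by (rule vec_holomorphic_compose[OF F(1)]) (use inb in \<open>auto intro!: holomorphic_intros simp: image_subset_iff\<close>)
    show "continuous_on (cball 0 1) (\<lambda>z. F (of_real (rad m) * z))"
      by (rule continuous_on_compose2[OF Fc]) (use inb in \<open>auto intro!: continuous_intros simp: image_subset_iff\<close>)
    show "(\<lambda>z. F (of_real (rad m) * z)) ` cball 0 1 \<subseteq> K" using inb F(2) by (auto simp: image_subset_iff)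
  qed
  have "(\<lambda>m. integral\<^sup>L ang (\<lambda>\<theta>. u (F (of_real (rad m) * cis \<theta>)) * poisson_kernel z \<theta>)) \<longlonglongrightarrow>
      integral\<^sup>L ang (\<lambda>\<theta>. u (bdval F (cis \<theta>)) * poisson_kernel z \<theta>)"
  proof (rule integral_dominated_convergence[where w = "\<lambda>\<theta>. M * poisson_kernel z \<theta>"])
    have Pm: "poisson_kernel z \<in> borel_measurable ang"
      by (intro continuous_imp_ang continuous_on_poisson_kernel z)
    show s: "(\<lambda>\<theta>. u (F (of_real (rad m) * cis \<theta>)) * poisson_kernel z \<theta>) \<in> borel_measurable ang" for m
    proof (intro borel_measurable_times Pm continuous_imp_ang)
      have "continuous_on {0..2*pi} (\<lambda>\<theta>. F (of_real (rad m) * cis \<theta>))"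
        by (rule continuous_on_compose2[OF Fc]) (use inb in \<open>auto intro!: continuous_intros\<close>)
      then show "continuous_on {0..2*pi} (\<lambda>\<theta>. u (F (of_real (rad m) * cis \<theta>)))"
        by (rule continuous_on_compose2[OF uK]) (use F inb in \<open>auto simp: image_subset_iff\<close>)
    qed
    show "AE \<theta> in ang. (\<lambda>m. u (F (of_real (rad m) * cis \<theta>)) * poisson_kernel z \<theta>) \<longlonglongrightarrow> u (bdval F (cis \<theta>)) * poisson_kernel z \<theta>"
      using b
    proof eventually_elim
      case (elim \<theta>)
      have "(\<lambda>m. u (F (of_real (rad m) * cis \<theta>))) \<longlonglongrightarrow> u (bdval F (cis \<theta>))"
      proof (rule continuous_on_tendsto_compose[OF uK])
        show "(\<lambda>m. F (of_real (rad m) * cis \<theta>)) \<longlonglongrightarrow> bdval F (cis \<theta>)" by (rule bdval_radial) (use elim in auto)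
        show "bdval F (cis \<theta>) \<in> K" by (rule bdval_in_closed[OF _ elim compact_imp_closed[OF K(1)] F(2)]) simp
        show "\<forall>\<^sub>F m in sequentially. F (of_real (rad m) * cis \<theta>) \<in> K"
          using F(2) inb by (auto simp: image_subset_iff)
      qed
      then show ?case by (intro tendsto_mult tendsto_const)
    qed
    then show "(\<lambda>\<theta>. u (bdval F (cis \<theta>)) * poisson_kernel z \<theta>) \<in> borel_measurable ang"
      by (rule ang_AE_limit_measurable[OF s])
    show "integrable ang (\<lambda>\<theta>. M * poisson_kernel z \<theta>)"
      using poisson_kernel_mean[OF z] by (auto simp: has_bochner_integral_iff)
    show "AE \<theta> in ang. norm (u (F (of_real (rad m) * cis \<theta>)) * poisson_kernel z \<theta>) \<le> M * poisson_kernel z \<theta>" for m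
    proof (rule AE_I2)
      fix \<theta>
      have "norm (u (F (of_real (rad m) * cis \<theta>))) \<le> M" using M(2) F(2) inb[of "cis \<theta>"] by (auto simp: image_subset_iff)
      then show "norm (u (F (of_real (rad m) * cis \<theta>)) * poisson_kernel z \<theta>) \<le> M * poisson_kernel z \<theta>"
        using poisson_kernel_nonneg[OF z, of \<theta>] by (simp add: abs_mult mult_right_mono)
    qed
  qed
  then have lim1: "(\<lambda>m. poisson_integral (\<lambda>\<theta>. u (F (of_real (rad m) * cis \<theta>))) z) \<longlonglongrightarrow> poisson_integral (\<lambda>\<theta>. u (bdval F (cis \<theta>))) z"
    unfolding poisson_integral_def by (intro tendsto_mult tendsto_const)
  have lim2: "(\<lambda>m. u (F (of_real (rad m) * z))) \<longlonglongrightarrow> u (F z)"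
  proof (rule continuous_on_tendsto_compose[OF uK])
    have "(\<lambda>m. of_real (rad m) * z) \<longlonglongrightarrow> of_real 1 * z" by (intro tendsto_intros rad_tendsto)
    then show "(\<lambda>m. F (of_real (rad m) * z)) \<longlonglongrightarrow> F z"
      by (intro continuous_on_tendsto_compose[OF Fc]) (use z inb[of z] in auto)
    show "F z \<in> K" using F z by (auto simp: image_subset_iff)
    show "\<forall>\<^sub>F m in sequentially. F (of_real (rad m) * z) \<in> K" using F(2) inb[of z] z by (auto simp: image_subset_iff)
  qed
  show ?thesis by (rule LIMSEQ_le[OF lim2 lim1]) (use le in blast)
qed

text \<open>On the annulus \<open>1/2 < \<bar>z\<bar> < 1\<close> the function \<open>Re (q z) + \<kappa> * ln (norm z)\<close> is a better majorant than
  \<open>Re (q z)\<close>: the logarithm vanishes on the outer circle, and on the inner circle it equals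
  \<open>- \<kappa> * ln 2\<close>, which the hypothesis on \<open>\<bar>z\<bar> \<le> 1/2\<close> leaves room for.  This is the mechanism of the Hopf lemma:
  a negative subharmonic function lies below a negative multiple of the distance to the boundary.\<close>

lemma hopf_majorant:
  fixes u :: "complex ^ 'n::finite \<Rightarrow> real" and F :: "complex \<Rightarrow> complex ^ 'n"
  assumes psh: "psh_on G u" and uc: "continuous_on G u" and G: "open G"
    and K: "compact K" "K \<subseteq> G"
    and F: "vec_holomorphic_on F (ball 0 1)" "F ` ball 0 1 \<subseteq> K"
    and q: "q holomorphic_on ball 0 1"
    and le: "\<And>z. norm z < 1 \<Longrightarrow> u (F z) \<le> Re (q z)"
    and c: "\<kappa> > 0" "\<And>z. norm z \<le> 1/2 \<Longrightarrow> u (F z) - Re (q z) \<le> - \<kappa> * ln 2 * 2"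
    and z: "1/2 < norm z" "norm z < 1"
  shows "u (F z) \<le> Re (q z) + \<kappa> * ln (norm z)"
proof -
  define \<Omega> where "\<Omega> = {z::complex. 1/2 < norm z} \<inter> ball 0 1"
  have \<Omega>o: "open \<Omega>" unfolding \<Omega>_def by (intro open_Int open_ball open_Collect_less continuous_intros)
  have \<Omega>1: "\<Omega> \<subseteq> ball 0 1" by (auto simp: \<Omega>_def)
  have qc: "continuous_on (ball 0 1) q" by (rule holomorphic_on_imp_continuous_on[OF q])
  show ?thesis
  proof (rule psh_disc_maximum_principle[OF psh uc G K \<Omega>o, where V = "\<lambda>z. Re (q z) + \<kappa> * ln (norm z)"])
    show "bounded \<Omega>" by (rule bounded_subset[OF bounded_ball \<Omega>1])
    show "vec_holomorphic_on F \<Omega>"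
      using F(1) \<Omega>1 by (auto simp: vec_holomorphic_on_def intro: holomorphic_on_subset)
    show "F ` \<Omega> \<subseteq> K" using F(2) \<Omega>1 by auto
    show "z \<in> \<Omega>" using z by (simp add: \<Omega>_def)
    show "continuous_on \<Omega> (\<lambda>z. Re (q z) + \<kappa> * ln (norm z))"
      by (intro continuous_intros continuous_on_subset[OF qc \<Omega>1]) (auto simp: \<Omega>_def)
  next
    fix w assume w: "w \<in> \<Omega>"
    obtain R where R: "R > 0" "ball w R \<subseteq> \<Omega>" using \<Omega>o w unfolding open_contains_ball by blast
    have w0: "w \<noteq> 0"
    proof
      assume "w = 0"
      then show False using w by (simp add: \<Omega>_def)
    qed
    define R' where "R' = min R (norm w)"
    have R': "R' > 0" "ball w R' \<subseteq> \<Omega>" "R' \<le> norm w" using R w0 by (auto simp: R'_def)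
    have re: "0 < Re (x / w)" if "x \<in> ball w R'" for x
    proof -
      have "norm (x / w - 1) < 1"
      proof -
        have "x / w - 1 = (x - w) / w" using w0 by (simp add: field_simps)
        then show ?thesis using that R' w0 by (simp add: norm_divide dist_norm norm_minus_commute)
      qed
      then show ?thesis using abs_Re_le_cmod[of "x / w - 1"] by simp
    qed
    \<comment> \<open>Near \<open>w\<close> the logarithm of the modulus is the real part of a branch of the logarithm of \<open>x / w\<close>.\<close>
    have np: "x / w \<notin> \<real>\<^sub>\<le>\<^sub>0" if "x \<in> ball w R'" for x
      using re[OF that] by (auto simp: complex_nonpos_Reals_iff)
    define Q where "Q = (\<lambda>x. q x + of_real \<kappa> * (Ln (x / w) + of_real (ln (norm w))))"
    have Qh: "Q holomorphic_on ball w R'"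
      unfolding Q_def using np w0 R' \<Omega>1 by (auto intro!: holomorphic_intros holomorphic_on_subset[OF q])
    have "Re (q x) + \<kappa> * ln (norm x) = Re (Q x)" if "x \<in> ball w R'" for x
    proof -
      have "x \<noteq> 0" using re[OF that] by auto
      then have "Re (Ln (x / w)) = ln (norm x) - ln (norm w)" using w0 by (simp add: norm_divide ln_div)
      then show ?thesis by (simp add: Q_def)
    qed
    then have "\<forall>r. 0 < r \<and> r < R' \<longrightarrow> has_bochner_integral ang (\<lambda>\<theta>. Re (q (w + of_real r * cis \<theta>)) + \<kappa> * ln (norm (w + of_real r * cis \<theta>)))
        (2*pi * (Re (q w) + \<kappa> * ln (norm w)))"
      using harmonic_mean_value[OF Qh, of "\<lambda>z. Re (q z) + \<kappa> * ln (norm z)"] by auto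
    then show "\<exists>R>0. \<forall>r. 0 < r \<and> r < R \<longrightarrow> has_bochner_integral ang (\<lambda>\<theta>. Re (q (w + of_real r * cis \<theta>)) + \<kappa> * ln (norm (w + of_real r * cis \<theta>)))
        (2*pi * (Re (q w) + \<kappa> * ln (norm w)))"
      using R'(1) by blast
  next
    fix e :: real assume e: "e > 0"
    have uFc: "continuous_on (ball 0 1) (\<lambda>z. u (F z) - Re (q z))"
      by (intro continuous_intros qc continuous_on_compose2[OF uc vec_holomorphic_continuous_on[OF F(1)]]) (use F K in auto)
    \<comment> \<open>Beyond the radius \<open>b\<close> the logarithm costs less than \<open>e\<close>.\<close>
    define b where "b = max (3/4) (exp (- e / \<kappa>))"
    have b: "3/4 \<le> b" "b < 1" "exp (- e / \<kappa>) \<le> b" using e c(1) by (auto simp: b_def)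
    have "uniformly_continuous_on (cball 0 (3/4)) (\<lambda>z. u (F z) - Re (q z))"
      by (rule compact_uniformly_continuous[OF continuous_on_subset[OF uFc]]) auto
    moreover have "\<kappa> * ln 2 / 1 > 0" using c(1) by simp
    ultimately obtain d where d: "d > 0" "\<And>x y. x \<in> cball 0 (3/4) \<Longrightarrow> y \<in> cball 0 (3/4) \<Longrightarrow> dist x y < d \<Longrightarrow>
        dist (u (F x) - Re (q x)) (u (F y) - Re (q y)) < \<kappa> * ln 2"
      unfolding uniformly_continuous_on_def by (metis div_by_1)
    define t where "t = min (d / 2) (1/8)"
    have t: "t > 0" "t < d" "t \<le> 1/8" using d by (auto simp: t_def)
    define C where "C = cball (0::complex) b - ball 0 (1/2 + t)"
    have C: "compact C" "C \<subseteq> \<Omega>"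
      using t b by (auto simp: C_def \<Omega>_def compact_diff)
    have "u (F w) - (Re (q w) + \<kappa> * ln (norm w)) \<le> e" if w: "w \<in> \<Omega> - C" for w
    proof -
      have nw: "1/2 < norm w" "norm w < 1" using w by (auto simp: \<Omega>_def)
      consider "b < norm w" | "norm w < 1/2 + t" using w by (auto simp: C_def \<Omega>_def)
      then show ?thesis
      proof cases
        case 1
        then have "exp (- e / \<kappa>) \<le> norm w" using b by linarith
        then have "- e / \<kappa> \<le> ln (norm w)" using nw by (subst ln_ge_iff) auto
        then have "- e \<le> \<kappa> * ln (norm w)" using c(1) by (simp add: field_simps)
        then show ?thesis using le[OF nw(2)] by simp
      next
        case 2
        have w0: "w \<noteq> 0"
        proof
          assume "w = 0"
          then have "norm w = 0" by simp
          with nw(1) show False by linarith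
        qed
        define x where "x = w / of_real (2 * norm w)"
        have nx: "norm x = 1/2" using w0 by (simp add: x_def norm_divide norm_mult)
        have "w - x = of_real (1 - 1 / (2 * norm w)) * w" using w0 by (simp add: x_def field_simps)
        then have "norm (w - x) = \<bar>1 - 1 / (2 * norm w)\<bar> * norm w" by (simp only: norm_mult norm_of_real)
        also have "\<dots> = norm w - 1/2" using nw w0 by (simp add: abs_if field_simps)
        finally have "dist w x < d" using 2 t by (simp add: dist_norm)
        then have "dist (u (F w) - Re (q w)) (u (F x) - Re (q x)) < \<kappa> * ln 2"
          by (intro d(2)) (use nx 2 t in auto)
        then have "u (F w) - Re (q w) \<le> - \<kappa> * ln 2" using c(2)[of x] nx unfolding dist_real_def by linarith
        moreover have "- ln 2 \<le> ln (norm w)"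
        proof -
          have "ln (1/2) \<le> ln (norm w)" using nw by (subst ln_le_cancel_iff) auto
          then show ?thesis by (simp add: ln_div)
        qed
        then have "\<kappa> * (- ln 2) \<le> \<kappa> * ln (norm w)" using c(1) by (intro mult_left_mono) auto
        ultimately show ?thesis using e by simp
      qed
    qed
    with C show "\<exists>C. compact C \<and> C \<subseteq> \<Omega> \<and> (\<forall>z\<in>\<Omega> - C. u (F z) - (Re (q z) + \<kappa> * ln (norm z)) \<le> e)" by blast
  qed
qed

section \<open>Self-maps of the disc given by a fixed point equation\<close>

text \<open>Moving one fixed point to the origin, the Schwarz lemma applies; a second fixed point would make the map
  a rotation about the first, which is impossible for a map that omits the points of modulus larger
  than \<open>r\<close>.\<close>

lemma disc_self_map_unique_fixed_point:
  assumes T: "T holomorphic_on ball 0 1" and im: "\<And>w. norm w < 1 \<Longrightarrow> norm (T w) \<le> r" and r: "r < 1"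
    and a: "norm a < 1" "T a = a" and b: "norm b < 1" "T b = b"
  shows "a = b"
proof (rule ccontr)
  assume ne: "a \<noteq> b"
  define M where "M = Moebius_function 0 a"
  define M' where "M' = Moebius_function 0 (- a)"
  have Mlt: "norm (M z) < 1" "norm (M' z) < 1" if "norm z < 1" for z
    using Moebius_function_norm_lt_1[of a z 0] Moebius_function_norm_lt_1[of "- a" z 0] a(1) that by (auto simp: M_def M'_def)
  have MM: "M' (M z) = z" "M (M' z) = z" if "norm z < 1" for z
    using Moebius_function_compose[of a "- a" z] Moebius_function_compose[of "- a" a z] a(1) that by (auto simp: M_def M'_def)
  have Mhol: "M holomorphic_on ball 0 1" "M' holomorphic_on ball 0 1"
    unfolding M_def M'_def using Moebius_function_holomorphic[of a 0] Moebius_function_holomorphic[of "-a" 0] a(1) by auto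
  have Tlt: "norm (T w) < 1" if "norm w < 1" for w using im[OF that] r by linarith
  define g where "g = (\<lambda>z. M (T (M' z)))"
  have ghol: "g holomorphic_on ball 0 1"
  proof -
    have "(\<lambda>z. T (M' z)) holomorphic_on ball 0 1"
      by (rule holomorphic_on_compose_gen[OF Mhol(2) T, unfolded o_def]) (use Mlt in auto)
    then show ?thesis unfolding g_def
      by (rule holomorphic_on_compose_gen[OF _ Mhol(1), unfolded o_def]) (use Mlt Tlt in auto)
  qed
  have g0: "g 0 = 0"
    by (simp add: g_def M'_def M_def Moebius_function_def a)
  have glt: "norm (g z) < 1" if "norm z < 1" for z
    unfolding g_def using Mlt Tlt that by blast
  define c where "c = M b"
  have c: "norm c < 1" "g c = c" using Mlt(1)[OF b(1)] MM(1)[OF b(1)] b(2) by (auto simp: c_def g_def)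
  have c0: "c \<noteq> 0"
  proof
    assume "c = 0"
    then have "b = M' 0" using MM(1)[OF b(1)] by (simp add: c_def)
    also have "\<dots> = a" by (simp add: M'_def Moebius_function_def)
    finally show False using ne by simp
  qed
  have "\<exists>\<alpha>. (\<forall>z. norm z < 1 \<longrightarrow> g z = \<alpha> * z) \<and> norm \<alpha> = 1"
    by (rule Schwarz_Lemma(3)[OF ghol g0 glt c(1)]) (use c c0 in auto)
  then obtain \<alpha> where \<alpha>: "\<And>z. norm z < 1 \<Longrightarrow> g z = \<alpha> * z" "norm \<alpha> = 1" by blast
  \<comment> \<open>A point of the disc that \<open>T\<close> omits.\<close>
  define y :: complex where "y = of_real ((1 + max r 0) / 2)"
  have "norm y = (1 + max r 0) / 2" unfolding y_def norm_of_real by simp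
  then have y: "norm y < 1" "r < norm y" using r by (auto simp: max_def split: if_splits)
  define x where "x = M y / \<alpha>"
  have x: "norm x < 1" using Mlt(1)[OF y(1)] \<alpha>(2) by (simp add: x_def norm_divide)
  have "M (T (M' x)) = M y" using \<alpha>(1)[OF x] \<alpha>(2) by (auto simp: g_def x_def)
  then have "M' (M (T (M' x))) = M' (M y)" by simp
  then have "T (M' x) = y" using MM(1) Tlt Mlt(2)[OF x] y(1) by simp
  then show False using im[OF Mlt(2)[OF x]] y(2) by simp
qed

text \<open>The map \<open>\<psi>\<close> is the inverse of \<open>g w = w * exp (q w)\<close>.  For \<open>\<bar>z\<bar> < 1\<close> the equation \<open>g w = z\<close> says that \<open>w\<close> is a
  fixed point of \<open>w \<mapsto> z * exp (- q w)\<close>, which maps the disc into the disc of radius \<open>\<bar>z\<bar>\<close>; Brouwer's theorem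
  gives existence, the Schwarz lemma uniqueness.  The point of the construction is the identity
  \<open>ln \<bar>\<psi> z\<bar> = ln \<bar>z\<bar> - Re (q (\<psi> z))\<close>, in which \<open>q\<close> is evaluated at \<open>\<psi> z\<close> and not at \<open>z\<close>.\<close>

lemma exponential_fixed_point_map:
  assumes q: "q holomorphic_on ball 0 1" and Rq: "\<And>z. norm z < 1 \<Longrightarrow> 0 \<le> Re (q z)"
  obtains \<psi> where "\<psi> holomorphic_on ball 0 1" "\<And>z. norm z < 1 \<Longrightarrow> norm (\<psi> z) \<le> norm z"
    "\<And>z. norm z < 1 \<Longrightarrow> \<psi> z = z * exp (- q (\<psi> z))"
proof -
  define g where "g = (\<lambda>w. w * exp (q w))"
  define \<Omega> where "\<Omega> = ball 0 1 \<inter> g -` ball 0 1"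
  have ghol: "g holomorphic_on ball 0 1" unfolding g_def by (intro holomorphic_intros q)
  have \<Omega>: "open \<Omega>" unfolding \<Omega>_def
    by (rule continuous_open_preimage[OF holomorphic_on_imp_continuous_on[OF ghol]]) auto
  have Tb: "norm (z * exp (- q w)) \<le> norm z" if "norm w < 1" for z w
  proof -
    have "exp (- Re (q w)) \<le> 1" using Rq[OF that] by simp
    then show ?thesis by (simp add: norm_mult mult_left_le)
  qed
  have Th: "(\<lambda>w. z * exp (- q w)) holomorphic_on ball 0 1" for z by (intro holomorphic_intros q)
  have fix_iff: "w = z * exp (- q w) \<longleftrightarrow> g w = z" for w z
    by (auto simp: g_def exp_minus field_simps)
  have ex: "\<exists>w. norm w \<le> norm z \<and> g w = z" if z: "norm z < 1" for z
  proof -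
    have "continuous_on (cball 0 (norm z)) (\<lambda>w. z * exp (- q w))"
      by (rule continuous_on_subset[OF holomorphic_on_imp_continuous_on[OF Th]]) (use z in auto)
    then obtain w where "w \<in> cball 0 (norm z)" "z * exp (- q w) = w"
      using brouwer[of "cball 0 (norm z)" "\<lambda>w. z * exp (- q w)"] Tb z by (auto simp: Pi_def)
    then show ?thesis using fix_iff[of w z] by (intro exI[of _ w]) auto
  qed
  have inj: "inj_on g \<Omega>"
  proof (rule inj_onI)
    fix a b assume ab: "a \<in> \<Omega>" "b \<in> \<Omega>" "g a = g b"
    then have n: "norm a < 1" "norm b < 1" "norm (g a) < 1" by (auto simp: \<Omega>_def)
    show "a = b"
      by (rule disc_self_map_unique_fixed_point[OF Th[of "g a"] Tb n(3) n(1) _ n(2)])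
        (use fix_iff ab in metis)+
  qed
  have sub: "g holomorphic_on \<Omega>" by (rule holomorphic_on_subset[OF ghol]) (auto simp: \<Omega>_def)
  obtain \<psi> where \<psi>: "\<psi> holomorphic_on (g ` \<Omega>)" "\<And>z. z \<in> \<Omega> \<Longrightarrow> \<psi> (g z) = z"
    using holomorphic_has_inverse[OF sub \<Omega> inj] by metis
  have im: "\<exists>w\<in>\<Omega>. g w = z \<and> norm w \<le> norm z" if z: "norm z < 1" for z
    using ex[OF z] z by (force simp: \<Omega>_def)
  have val: "norm (\<psi> z) \<le> norm z \<and> \<psi> z = z * exp (- q (\<psi> z))" if z: "norm z < 1" for z
  proof -
    obtain w where w: "w \<in> \<Omega>" "g w = z" "norm w \<le> norm z" using im[OF z] by blast
    then have "\<psi> z = w" using \<psi>(2) by blast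
    then show ?thesis using w fix_iff by auto
  qed
  have "\<psi> holomorphic_on ball 0 1"
    by (rule holomorphic_on_subset[OF \<psi>(1)]) (use im in force)
  with val that show ?thesis by blast
qed

section \<open>Evaluating the functionals inside the disc\<close>

definition circle_pairing :: "real \<Rightarrow> (complex \<Rightarrow> complex ^ 'n::finite) \<Rightarrow> (complex \<Rightarrow> complex ^ 'n) \<Rightarrow> real" where
  "circle_pairing r w H = 1 / (2*pi) * integral\<^sup>L ang (\<lambda>\<theta>. Re (H (of_real r * cis \<theta>) \<bullet>\<^sub>c w (of_real r * cis \<theta>)))"

lemma bullet_bound: "norm (a \<bullet>\<^sub>c b) \<le> real CARD('n) * (norm a * norm (b :: complex ^ 'n::finite))"
proof -
  have "norm (a \<bullet>\<^sub>c b) \<le> (\<Sum>k\<in>UNIV. norm (a $ k * b $ k))" unfolding bullet_def by (rule norm_sum)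
  also have "\<dots> \<le> (\<Sum>k\<in>(UNIV :: 'n set). norm a * norm b)"
    unfolding norm_mult by (intro sum_mono mult_mono component_le_norm_cart) (auto simp: Finite_Cartesian_Product.norm_nth_le)
  finally show ?thesis by simp
qed

lemma annulus_closure: "0 \<le> \<nu> \<Longrightarrow> \<nu> < norm z \<Longrightarrow> norm z \<le> 1 \<Longrightarrow> z \<in> closure (annulus \<nu>)"
proof -
  assume \<nu>: "0 \<le> \<nu>" "\<nu> < norm z" "norm z \<le> 1"
  show "z \<in> closure (annulus \<nu>)"
  proof (cases "norm z < 1")
    case True
    then show ?thesis using \<nu> closure_subset by (force simp: annulus_def)
  next
    case False
    then have nz: "norm z = 1" using \<nu> by simp
    have "(\<lambda>m. of_real (rad m) * z) \<longlonglongrightarrow> of_real 1 * z" by (intro tendsto_intros rad_tendsto)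
    moreover have "eventually (\<lambda>m. rad m > \<nu>) sequentially"
      using order_tendstoD(1)[OF rad_tendsto, of \<nu>] \<nu> nz by simp
    then have "eventually (\<lambda>m. of_real (rad m) * z \<in> closure (annulus \<nu>)) sequentially"
    proof eventually_elim
      case (elim m)
      then have "of_real (rad m) * z \<in> annulus \<nu>" using rad[of m] nz by (simp add: annulus_def norm_mult)
      then show ?case using closure_subset by blast
    qed
    ultimately show ?thesis
      using Lim_in_closed_set[OF closed_closure _ sequentially_bot] by force
  qed
qed

lemma continuous_on_bullet:
  fixes f g :: "'a::topological_space \<Rightarrow> complex ^ 'n::finite"
  assumes "continuous_on A f" "continuous_on A g"
  shows "continuous_on A (\<lambda>x. f x \<bullet>\<^sub>c g x)"
  unfolding bullet_def by (intro continuous_intros assms)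

lemma tendsto_bullet:
  fixes f g :: "'a \<Rightarrow> complex ^ 'n::finite"
  assumes "(f \<longlongrightarrow> a) F" "(g \<longlongrightarrow> b) F"
  shows "((\<lambda>x. f x \<bullet>\<^sub>c g x) \<longlongrightarrow> a \<bullet>\<^sub>c b) F"
  unfolding bullet_def by (intro tendsto_intros assms)

text \<open>The weights \<open>w\<close> are holomorphic in an annulus, so \<open>H(z) \<bullet> w(z)\<close> is too, and the integral over the unit
  circle can be moved to a circle inside the disc.  In this form the functional depends continuously on
  \<open>H\<close> with respect to locally uniform convergence and is not affected by what \<open>H\<close> does at the boundary.\<close>

lemma Phi_eq_circle_pairing:
  fixes w H :: "complex \<Rightarrow> complex ^ 'n::finite"
  assumes \<nu>: "0 < \<nu>" "\<nu> < r" "r < 1" and w: "w \<in> hol_cont_closure (annulus \<nu>)"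
    and H: "H \<in> hol_bounded unit_disk" and b: "AE \<theta> in ang. has_bdval H (cis \<theta>)"
  shows "Phi w H = circle_pairing r w H"
    and "integrable ang (\<lambda>\<theta>. Re (bdval H (cis \<theta>) \<bullet>\<^sub>c w (cis \<theta>)))"
proof -
  have wh: "vec_holomorphic_on w (annulus \<nu>)" and wc: "continuous_on (closure (annulus \<nu>)) w"
    using w by (auto simp: hol_cont_closure_def)
  have Hh: "vec_holomorphic_on H (ball 0 1)" using H by (simp add: hol_bounded_def)
  have Hc: "continuous_on (ball 0 1) H" by (rule vec_holomorphic_continuous_on[OF Hh])
  have "bounded (H ` unit_disk)" using H by (simp add: hol_bounded_def)
  then obtain B where "\<forall>z\<in>unit_disk. norm (H z) \<le> B" unfolding bounded_iff by auto
  then have B: "\<And>z. norm z < 1 \<Longrightarrow> norm (H z) \<le> B" by simp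
  have B0: "0 \<le> B" using order_trans[OF norm_ge_zero B[of 0]] by simp
  have cl: "{z. r \<le> norm z \<and> norm z \<le> 1} \<subseteq> closure (annulus \<nu>)" using annulus_closure \<nu> by auto
  have cmp: "compact ({z. r \<le> norm z} \<inter> cball (0::complex) 1)"
    by (intro closed_Int_compact compact_cball closed_Collect_le continuous_intros)
  have "continuous_on ({z. r \<le> norm z} \<inter> cball 0 1) w"
    by (rule continuous_on_subset[OF wc]) (use cl in auto)
  then obtain C where C: "0 \<le> C" "\<And>z. z \<in> {z. r \<le> norm z} \<inter> cball 0 1 \<Longrightarrow> norm (w z) \<le> C"
    using continuous_bounded_on_compact[OF cmp] by blast
  define A where "A = real CARD('n) * (B * C)"
  have bb: "norm (H z \<bullet>\<^sub>c w z') \<le> A" if "norm z < 1" "r \<le> norm z'" "norm z' \<le> 1" for z z'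
  proof -
    have "norm (H z) * norm (w z') \<le> B * C" using B[OF that(1)] C(2)[of z'] that B0 by (intro mult_mono) auto
    then show ?thesis unfolding A_def
      by (intro order_trans[OF bullet_bound] mult_left_mono) auto
  qed
  \<comment> \<open>Dilating \<open>H\<close> but not \<open>w\<close> gives functions that are continuous up to the unit circle.\<close>
  define k where "k = (\<lambda>\<rho> z. H (of_real \<rho> * z) \<bullet>\<^sub>c w z)"
  have nr: "norm (of_real (rad m) * z) < 1" if "norm z \<le> 1" for m and z :: complex
    by (rule norm_rad_mult_less[OF that])
  have khol: "k (rad m) holomorphic_on {z. \<nu> < norm z \<and> norm z < 1}" for m
  proof -
    have "vec_holomorphic_on (\<lambda>z. H (of_real (rad m) * z)) {z. \<nu> < norm z \<and> norm z < 1}"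
      by (rule vec_holomorphic_compose[OF Hh]) (use nr in \<open>auto intro!: holomorphic_intros\<close>)
    then show ?thesis using wh unfolding k_def bullet_def vec_holomorphic_on_def annulus_def
      by (auto intro!: holomorphic_intros)
  qed
  have kcont: "continuous_on ({z. r \<le> norm z} \<inter> cball 0 1) (k (rad m))" for m
    unfolding k_def
  proof (rule continuous_on_bullet)
    show "continuous_on ({z. r \<le> norm z} \<inter> cball 0 1) (\<lambda>z. H (of_real (rad m) * z))"
      by (rule continuous_on_compose2[OF Hc]) (use nr in \<open>auto intro!: continuous_intros\<close>)
    show "continuous_on ({z. r \<le> norm z} \<inter> cball 0 1) w"
      by (rule continuous_on_subset[OF wc]) (use cl in auto)
  qed
  have kb: "norm (k (rad m) z) \<le> A" if "r \<le> norm z" "norm z \<le> 1" for m z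
    unfolding k_def by (rule bb) (use that nr in auto)
  have kang: "continuous_on {0..2*pi} (\<lambda>\<theta>. k (rad m) (of_real \<rho> * cis \<theta>))" if "r \<le> \<rho>" "\<rho> \<le> 1" for m \<rho>
    by (rule continuous_on_compose2[OF kcont]) (use that \<nu> in \<open>auto intro!: continuous_intros simp: norm_mult\<close>)
  have radius: "integral\<^sup>L ang (\<lambda>\<theta>. k (rad m) (cis \<theta>)) = integral\<^sup>L ang (\<lambda>\<theta>. k (rad m) (of_real r * cis \<theta>))" for m
  proof -
    define \<rho> where "\<rho> = (\<lambda>j. r + (1 - r) * rad j)"
    have \<rho>: "r \<le> \<rho> j" "r < \<rho> j" "\<rho> j < 1" "\<rho> j \<le> 1" for j
    proof -
      have "0 < (1 - r) * rad j" "(1 - r) * rad j < (1 - r) * 1"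
        using rad[of j] \<nu> by (auto intro!: mult_strict_left_mono)
      then show "r \<le> \<rho> j" "r < \<rho> j" "\<rho> j < 1" "\<rho> j \<le> 1" by (auto simp: \<rho>_def)
    qed
    have "\<rho> \<longlonglongrightarrow> r + (1 - r) * 1" unfolding \<rho>_def by (intro tendsto_intros rad_tendsto)
    then have \<rho>lim: "\<rho> \<longlonglongrightarrow> 1" by simp
    have "(\<lambda>j. integral\<^sup>L ang (\<lambda>\<theta>. k (rad m) (of_real (\<rho> j) * cis \<theta>))) \<longlonglongrightarrow> integral\<^sup>L ang (\<lambda>\<theta>. k (rad m) (cis \<theta>))"
    proof (rule integral_dominated_convergence[where w = "\<lambda>_. A"])
      show "(\<lambda>\<theta>. k (rad m) (cis \<theta>)) \<in> borel_measurable ang"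
        using continuous_imp_ang[OF kang[of 1 m]] \<nu> by simp
      show "(\<lambda>\<theta>. k (rad m) (of_real (\<rho> j) * cis \<theta>)) \<in> borel_measurable ang" for j
        by (rule continuous_imp_ang[OF kang[OF \<rho>(1,4)]])
      show "integrable ang (\<lambda>_. A)" by (rule integrable_ang_continuous) auto
      show "AE \<theta> in ang. norm (k (rad m) (of_real (\<rho> j) * cis \<theta>)) \<le> A" for j
        by (intro AE_I2 kb) (use \<rho>[of j] \<nu> in \<open>auto simp: norm_mult\<close>)
      show "AE \<theta> in ang. (\<lambda>j. k (rad m) (of_real (\<rho> j) * cis \<theta>)) \<longlonglongrightarrow> k (rad m) (cis \<theta>)"
      proof (rule AE_I2)
        fix \<theta>
        have "(\<lambda>j. of_real (\<rho> j) * cis \<theta>) \<longlonglongrightarrow> of_real 1 * cis \<theta>" by (intro tendsto_intros \<rho>lim)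
        then show "(\<lambda>j. k (rad m) (of_real (\<rho> j) * cis \<theta>)) \<longlonglongrightarrow> k (rad m) (cis \<theta>)"
          by (intro continuous_on_tendsto_compose[OF kcont]) (use \<rho> \<nu> in \<open>auto simp: norm_mult less_imp_le abs_of_pos order_less_trans[OF _ \<rho>(2)] intro!: always_eventually\<close>)
      qed
    qed
    moreover have "integral\<^sup>L ang (\<lambda>\<theta>. k (rad m) (of_real (\<rho> j) * cis \<theta>)) = integral\<^sup>L ang (\<lambda>\<theta>. k (rad m) (of_real r * cis \<theta>))" for j
      by (rule circle_integral_radius_independent[OF khol]) (use \<nu> \<rho>[of j] in auto)
    ultimately show ?thesis using LIMSEQ_unique tendsto_const by (simp add: LIMSEQ_const_iff)
  qed
  have DCT: "integrable ang (\<lambda>\<theta>. bd \<theta>) \<and> (\<lambda>m. integral\<^sup>L ang (\<lambda>\<theta>. k (rad m) (of_real \<rho> * cis \<theta>))) \<longlonglongrightarrow> integral\<^sup>L ang bd"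
    if \<rho>: "r \<le> \<rho>" "\<rho> \<le> 1" and lim: "AE \<theta> in ang. (\<lambda>m. k (rad m) (of_real \<rho> * cis \<theta>)) \<longlonglongrightarrow> bd \<theta>" for \<rho> bd
  proof -
    have m: "(\<lambda>\<theta>. k (rad m) (of_real \<rho> * cis \<theta>)) \<in> borel_measurable ang" for m
      by (rule continuous_imp_ang[OF kang[OF \<rho>]])
    have bm: "bd \<in> borel_measurable ang" by (rule ang_AE_limit_measurable[OF m lim])
    have iA: "integrable ang (\<lambda>_. A)" by (rule integrable_ang_continuous) auto
    have le: "AE \<theta> in ang. norm (k (rad m) (of_real \<rho> * cis \<theta>)) \<le> A" for m
      by (intro AE_I2 kb) (use \<rho> \<nu> in \<open>auto simp: norm_mult\<close>)
    show ?thesis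
      using integrable_dominated_convergence[OF bm m iA lim le] integral_dominated_convergence[OF bm m iA lim le] by blast
  qed
  have D1: "integrable ang (\<lambda>\<theta>. bdval H (cis \<theta>) \<bullet>\<^sub>c w (cis \<theta>)) \<and>
      (\<lambda>m. integral\<^sup>L ang (\<lambda>\<theta>. k (rad m) (of_real 1 * cis \<theta>))) \<longlonglongrightarrow> integral\<^sup>L ang (\<lambda>\<theta>. bdval H (cis \<theta>) \<bullet>\<^sub>c w (cis \<theta>))"
  proof (rule DCT)
    show "AE \<theta> in ang. (\<lambda>m. k (rad m) (of_real 1 * cis \<theta>)) \<longlonglongrightarrow> bdval H (cis \<theta>) \<bullet>\<^sub>c w (cis \<theta>)"
      using b
    proof eventually_elim
      case (elim \<theta>)
      then show ?case unfolding k_def by (intro tendsto_bullet) (auto intro!: bdval_radial)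
    qed
  qed (use \<nu> in auto)
  have D2: "integrable ang (\<lambda>\<theta>. H (of_real r * cis \<theta>) \<bullet>\<^sub>c w (of_real r * cis \<theta>)) \<and>
      (\<lambda>m. integral\<^sup>L ang (\<lambda>\<theta>. k (rad m) (of_real r * cis \<theta>))) \<longlonglongrightarrow> integral\<^sup>L ang (\<lambda>\<theta>. H (of_real r * cis \<theta>) \<bullet>\<^sub>c w (of_real r * cis \<theta>))"
  proof (rule DCT)
    show "AE \<theta> in ang. (\<lambda>m. k (rad m) (of_real r * cis \<theta>)) \<longlonglongrightarrow> H (of_real r * cis \<theta>) \<bullet>\<^sub>c w (of_real r * cis \<theta>)"
    proof (rule AE_I2)
      fix \<theta>
      have "(\<lambda>m. of_real (rad m) * (of_real r * cis \<theta>)) \<longlonglongrightarrow> of_real 1 * (of_real r * cis \<theta>)"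
        by (intro tendsto_intros rad_tendsto)
      then have "(\<lambda>m. H (of_real (rad m) * (of_real r * cis \<theta>))) \<longlonglongrightarrow> H (of_real r * cis \<theta>)"
        by (intro continuous_on_tendsto_compose[OF Hc])
          (use nr[of "of_real r * cis \<theta>"] \<nu> in \<open>auto simp: norm_mult intro!: always_eventually\<close>)
      then show "(\<lambda>m. k (rad m) (of_real r * cis \<theta>)) \<longlonglongrightarrow> H (of_real r * cis \<theta>) \<bullet>\<^sub>c w (of_real r * cis \<theta>)"
        unfolding k_def by (intro tendsto_bullet tendsto_const)
    qed
  qed (use \<nu> in auto)
  have "(\<lambda>m. integral\<^sup>L ang (\<lambda>\<theta>. k (rad m) (of_real r * cis \<theta>))) \<longlonglongrightarrow> integral\<^sup>L ang (\<lambda>\<theta>. bdval H (cis \<theta>) \<bullet>\<^sub>c w (cis \<theta>))"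
    using D1 by (simp add: radius)
  then have eq: "integral\<^sup>L ang (\<lambda>\<theta>. bdval H (cis \<theta>) \<bullet>\<^sub>c w (cis \<theta>)) = integral\<^sup>L ang (\<lambda>\<theta>. H (of_real r * cis \<theta>) \<bullet>\<^sub>c w (of_real r * cis \<theta>))"
    using D2 LIMSEQ_unique by blast
  show "integrable ang (\<lambda>\<theta>. Re (bdval H (cis \<theta>) \<bullet>\<^sub>c w (cis \<theta>)))" using D1 by (intro integrable_Re) blast
  show "Phi w H = circle_pairing r w H"
    unfolding Phi_def LINT_ang circle_pairing_def
    using integral_Re[OF conjunct1[OF D1]] integral_Re[OF conjunct1[OF D2]] eq by simp
qed

section \<open>Fatou's theorem for bounded densities\<close>

lemma bounded_borel_absolutely_integrable:
  fixes f :: "real \<Rightarrow> complex"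
  assumes "f \<in> borel_measurable borel" "\<And>x. norm (f x) \<le> B"
  shows "f absolutely_integrable_on {a..b}"
  by (rule measurable_bounded_by_integrable_imp_absolutely_integrable[where g = "\<lambda>_. B"])
    (use assms in \<open>auto intro!: measurable_restrict_space1 measurable_completion\<close>)

lemma borel_representative:
  fixes \<gamma> :: "real \<Rightarrow> complex"
  assumes g: "\<gamma> \<in> borel_measurable ang" and B: "AE \<theta> in ang. norm (\<gamma> \<theta>) \<le> B"
  obtains f where "f \<in> borel_measurable borel" "\<And>x. norm (f x) \<le> \<bar>B\<bar>" "AE \<theta> in ang. \<gamma> \<theta> = f \<theta>"
proof -
  define h where "h = (\<lambda>\<theta>. indicator {0..2*pi} \<theta> *\<^sub>R \<gamma> \<theta>)"
  have h: "h \<in> borel_measurable lebesgue"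
    unfolding h_def using g by (subst (asm) borel_measurable_restrict_space_iff) auto
  obtain f1 where f1: "f1 \<in> borel_measurable lborel" "AE x in lborel. Re (h x) = f1 x"
    using completion_ex_borel_measurable_real[of "\<lambda>x. Re (h x)" lborel] h by auto
  obtain f2 where f2: "f2 \<in> borel_measurable lborel" "AE x in lborel. Im (h x) = f2 x"
    using completion_ex_borel_measurable_real[of "\<lambda>x. Im (h x)" lborel] h by auto
  define k where "k = (\<lambda>x. Complex (f1 x) (f2 x))"
  have k: "k \<in> borel_measurable borel" unfolding k_def borel_measurable_complex_iff using f1(1) f2(1) by simp
  define f where "f = (\<lambda>x. if x \<in> {0..2*pi} \<and> norm (k x) \<le> \<bar>B\<bar> then k x else 0)"
  have "f \<in> borel_measurable borel" unfolding f_def using k by measurable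
  moreover have "AE \<theta> in ang. \<gamma> \<theta> = f \<theta>"
  proof -
    have "AE x in lborel. h x = k x"
      using f1(2) f2(2) by eventually_elim (simp add: k_def complex_eq_iff)
    then have "AE \<theta> in ang. h \<theta> = k \<theta>" unfolding AE_ang_iff by eventually_elim simp
    then show ?thesis using B AE_space
      by eventually_elim (auto simp: f_def h_def)
  qed
  ultimately show ?thesis by (intro that[of f]) (auto simp: f_def)
qed

text \<open>Lebesgue's differentiation theorem for bounded functions.  The one-sided version is applied to \<open>f\<close> and
  to its reflection, which yields both directions.\<close>

lemma indefinite_integral_differentiable_AE:
  fixes f :: "real \<Rightarrow> complex"
  assumes f: "f \<in> borel_measurable borel" and b: "\<And>x. norm (f x) \<le> B"
  shows "AE \<theta> in ang. \<forall>e>0. \<exists>d>0. \<forall>\<tau>\<in>{0..2*pi}. \<bar>\<tau> - \<theta>\<bar> < d \<longrightarrow>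
    norm (integral {0..\<tau>} f - integral {0..\<theta>} f - of_real (\<tau> - \<theta>) * f \<theta>) \<le> e * \<bar>\<tau> - \<theta>\<bar>"
proof -
  have iab: "f integrable_on {a..b}" for a b
    by (rule set_lebesgue_integral_eq_integral(1)[OF bounded_borel_absolutely_integrable[OF f b]])
  have rab: "(\<lambda>x. f (- x)) integrable_on {a..b}" for a b
    using iab[of "-b" "-a"] Henstock_Kurzweil_Integration.integrable_reflect_real[where f = f and a = "-b" and b = "-a"] by simp
  obtain N1 where N1: "negligible N1" "\<And>x e. x \<notin> N1 \<Longrightarrow> 0 < e \<Longrightarrow>
      \<exists>d>0. \<forall>h. 0 < h \<and> h < d \<longrightarrow> norm (integral {x..x + h} f /\<^sub>R h - f x) < e"
    using integrable_ccontinuous_explicit[of f] iab by auto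
  obtain N2 where N2: "negligible N2" "\<And>x e. x \<notin> N2 \<Longrightarrow> 0 < e \<Longrightarrow>
      \<exists>d>0. \<forall>h. 0 < h \<and> h < d \<longrightarrow> norm (integral {x..x + h} (\<lambda>x. f (- x)) /\<^sub>R h - f (- x)) < e"
    using integrable_ccontinuous_explicit[of "\<lambda>x. f (- x)"] rab by auto
  have neg: "negligible (N1 \<union> uminus ` N2)"
    by (intro negligible_Un N1(1) negligible_differentiable_image_negligible N2(1))
      (auto intro!: derivative_intros)
  then have "AE \<theta> in lebesgue. \<theta> \<notin> N1 \<union> uminus ` N2"
    unfolding negligible_iff_null_sets by (rule AE_not_in)
  then have "AE \<theta> in ang. \<theta> \<notin> N1 \<union> uminus ` N2" by (subst AE_restrict_space_iff) auto
  then show ?thesis using AE_space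
  proof eventually_elim
    case (elim \<theta>)
    show ?case
    proof (intro allI impI)
      fix e :: real assume e: "e > 0"
      obtain d1 where d1: "d1 > 0" "\<And>h. 0 < h \<Longrightarrow> h < d1 \<Longrightarrow> norm (integral {\<theta>..\<theta> + h} f /\<^sub>R h - f \<theta>) < e"
        using N1(2)[of \<theta> e] elim e by auto
      have "- \<theta> \<notin> N2" using elim by force
      then obtain d2 where d2: "d2 > 0" "\<And>h. 0 < h \<Longrightarrow> h < d2 \<Longrightarrow> norm (integral {- \<theta>..- \<theta> + h} (\<lambda>x. f (- x)) /\<^sub>R h - f \<theta>) < e"
        using N2(2)[of "- \<theta>" e] e by auto
      have "norm (integral {0..\<tau>} f - integral {0..\<theta>} f - of_real (\<tau> - \<theta>) * f \<theta>) \<le> e * \<bar>\<tau> - \<theta>\<bar>"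
        if t: "\<tau> \<in> {0..2*pi}" "\<bar>\<tau> - \<theta>\<bar> < min d1 d2" for \<tau>
      proof -
        have scale: "norm (I - of_real h * c) \<le> e * h" if "0 < h" "norm (I /\<^sub>R h - c) < e" for I c :: complex and h
        proof -
          have "I - of_real h * c = of_real h * (I /\<^sub>R h - c)" using that(1) by (simp add: scaleR_conv_of_real field_simps)
          then have "norm (I - of_real h * c) = h * norm (I /\<^sub>R h - c)" using that(1) by (simp only: norm_mult) simp
          also have "\<dots> \<le> h * e" using that by (intro mult_left_mono) auto
          finally show ?thesis by (simp add: mult.commute)
        qed
        consider "\<tau> = \<theta>" | "\<theta> < \<tau>" | "\<tau> < \<theta>" by linarith
        then show ?thesis
        proof cases
          case 2
          have "integral {0..\<theta>} f + integral {\<theta>..\<tau>} f = integral {0..\<tau>} f"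
            by (rule Henstock_Kurzweil_Integration.integral_combine) (use elim 2 iab in auto)
          then have "integral {0..\<tau>} f - integral {0..\<theta>} f = integral {\<theta>..\<tau>} f"
            by (simp add: algebra_simps)
          moreover have "norm (integral {\<theta>..\<theta> + (\<tau> - \<theta>)} f - of_real (\<tau> - \<theta>) * f \<theta>) \<le> e * (\<tau> - \<theta>)"
            by (intro scale d1) (use 2 t in auto)
          ultimately show ?thesis using 2 by simp
        next
          case 3
          have "integral {0..\<tau>} f + integral {\<tau>..\<theta>} f = integral {0..\<theta>} f"
            by (rule Henstock_Kurzweil_Integration.integral_combine) (use t 3 iab in auto)
          then have "integral {0..\<tau>} f - integral {0..\<theta>} f - of_real (\<tau> - \<theta>) * f \<theta> = - (integral {\<tau>..\<theta>} f - of_real (\<theta> - \<tau>) * f \<theta>)"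
            by (auto simp: algebra_simps)
          moreover have "norm (integral {- \<theta>..- \<theta> + (\<theta> - \<tau>)} (\<lambda>x. f (- x)) - of_real (\<theta> - \<tau>) * f \<theta>) \<le> e * (\<theta> - \<tau>)"
            by (intro scale d2) (use 3 t in auto)
          moreover have "integral {- \<theta>..- \<theta> + (\<theta> - \<tau>)} (\<lambda>x. f (- x)) = integral {\<tau>..\<theta>} f"
            using integral_reflect_real[of \<theta> \<tau> f] by simp
          ultimately show ?thesis using 3 by (simp only: norm_minus_cancel) simp
        qed simp
      qed
      then show "\<exists>d>0. \<forall>\<tau>\<in>{0..2*pi}. \<bar>\<tau> - \<theta>\<bar> < d \<longrightarrow>
          norm (integral {0..\<tau>} f - integral {0..\<theta>} f - of_real (\<tau> - \<theta>) * f \<theta>) \<le> e * \<bar>\<tau> - \<theta>\<bar>"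
        using d1 d2 by (intro exI[of _ "min d1 d2"]) auto
    qed
  qed
qed

text \<open>The primitive of \<open>g\<close> is only absolutely continuous, so this is an instance of Fubini's theorem on the
  triangle \<open>t \<le> \<tau>\<close> and not of the classical formula.\<close>

lemma integral_by_parts_bounded:
  fixes g :: "real \<Rightarrow> complex" and P p :: "real \<Rightarrow> real"
  assumes g: "g \<in> borel_measurable borel" and b: "\<And>x. norm (g x) \<le> B"
    and P: "\<And>\<tau>. \<tau> \<in> {0..2*pi} \<Longrightarrow> (P has_real_derivative p \<tau>) (at \<tau> within {0..2*pi})"
    and p: "continuous_on UNIV p"
  shows "integral\<^sup>L ang (\<lambda>t. g t * of_real (P t)) =
    integral {0..2*pi} g * of_real (P (2*pi)) - integral\<^sup>L ang (\<lambda>\<tau>. of_real (p \<tau>) * integral {0..\<tau>} g)"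
proof -
  let ?I = "{0..2*pi} :: real set"
  have pm: "p \<in> borel_measurable borel" by (rule borel_measurable_continuous_onI[OF p])
  obtain C where C: "0 \<le> C" "\<And>x. x \<in> ?I \<Longrightarrow> norm (p x) \<le> C"
    using continuous_bounded_on_compact[OF _ continuous_on_subset[OF p]] by (metis compact_Icc subset_UNIV)
  define F where "F = (\<lambda>t \<tau>. (indicat_real ?I t * indicat_real ?I \<tau> * (if t \<le> \<tau> then 1 else 0)) *\<^sub>R (g t * of_real (p \<tau>)))"
  have Fm: "(\<lambda>(t, \<tau>). F t \<tau>) \<in> borel_measurable (lborel \<Otimes>\<^sub>M lborel)"
    unfolding F_def using g pm by measurable
  have "integrable (lborel \<Otimes>\<^sub>M lborel) (\<lambda>(t, \<tau>). F t \<tau>)"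
  proof (rule integrableI_bounded_set[where A = "?I \<times> ?I" and B = "B * C"])
    show "?I \<times> ?I \<in> sets (lborel \<Otimes>\<^sub>M lborel)" by auto
    show "emeasure (lborel \<Otimes>\<^sub>M lborel) (?I \<times> ?I) < \<infinity>"
      by (subst lborel.emeasure_pair_measure_Times) (auto simp: ennreal_mult_less_top)
    show "AE x in lborel \<Otimes>\<^sub>M lborel. x \<in> ?I \<times> ?I \<longrightarrow> norm (case x of (t, \<tau>) \<Rightarrow> F t \<tau>) \<le> B * C"
    proof (intro AE_I2 impI)
      fix x :: "real \<times> real" assume "x \<in> ?I \<times> ?I"
      then obtain t \<tau> where x: "x = (t, \<tau>)" "t \<in> ?I" "\<tau> \<in> ?I" by auto
      have "norm (g t * of_real (p \<tau>)) \<le> B * C"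
        unfolding norm_mult using b[of t] C(2)[OF x(3)] C(1) by (intro mult_mono) (auto intro: order_trans[OF norm_ge_zero])
      moreover have "0 \<le> B" using b[of 0] norm_ge_zero order_trans by blast
      then have "0 \<le> B * C" using C(1) by (rule mult_nonneg_nonneg)
      ultimately show "norm (case x of (t, \<tau>) \<Rightarrow> F t \<tau>) \<le> B * C" using x by (simp add: F_def)
    qed
    show "AE x in lborel \<Otimes>\<^sub>M lborel. x \<notin> ?I \<times> ?I \<longrightarrow> (case x of (t, \<tau>) \<Rightarrow> F t \<tau>) = 0"
      by (intro AE_I2) (auto simp: F_def indicator_def split: if_splits)
  qed (rule Fm)
  then have fub: "(\<integral>\<tau>. (\<integral>t. F t \<tau> \<partial>lborel) \<partial>lborel) = (\<integral>t. (\<integral>\<tau>. F t \<tau> \<partial>lborel) \<partial>lborel)"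
    by (rule lborel_pair.Fubini_integral)
  have iab: "set_integrable lborel {a..b} g" for a b
  proof -
    have "g absolutely_integrable_on {a..b}"
      by (rule bounded_borel_absolutely_integrable[OF g b])
    then show ?thesis using g unfolding set_integrable_def
      by (subst (asm) integrable_completion) auto
  qed
  have ang_lborel: "integral\<^sup>L ang k = (\<integral>t. indicat_real ?I t *\<^sub>R k t \<partial>lborel)"
    if "k \<in> borel_measurable borel" for k :: "real \<Rightarrow> complex"
    using that by (subst integral_restrict_space) (auto simp: integral_completion)
  have in1: "(\<integral>t. F t \<tau> \<partial>lborel) = indicat_real ?I \<tau> *\<^sub>R (of_real (p \<tau>) * integral {0..\<tau>} g)" for \<tau>
  proof (cases "\<tau> \<in> ?I")
    case True
    have "(\<integral>t. F t \<tau> \<partial>lborel) = (\<integral>t. (indicat_real {0..\<tau>} t *\<^sub>R g t) * of_real (p \<tau>) \<partial>lborel)"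
      by (rule Bochner_Integration.integral_cong) (use True in \<open>auto simp: F_def indicator_def\<close>)
    also have "\<dots> = (\<integral>t. indicat_real {0..\<tau>} t *\<^sub>R g t \<partial>lborel) * of_real (p \<tau>)"
      by (rule integral_mult_left_zero)
    also have "(\<integral>t. indicat_real {0..\<tau>} t *\<^sub>R g t \<partial>lborel) = integral {0..\<tau>} g"
      using set_borel_integral_eq_integral(2)[OF iab[of 0 \<tau>]] by (simp add: set_lebesgue_integral_def)
    finally show ?thesis using True by (simp add: mult.commute)
  qed (simp add: F_def)
  have FTC: "(\<integral>\<tau>. indicat_real {t..2*pi} \<tau> *\<^sub>R complex_of_real (p \<tau>) \<partial>lborel) = of_real (P (2*pi) - P t)" if t: "t \<in> ?I" for t
  proof -
    have "(p has_integral (P (2*pi) - P t)) {t..2*pi}"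
    proof (rule fundamental_theorem_of_calculus)
      fix x assume x: "x \<in> {t..2*pi}"
      have "(P has_real_derivative p x) (at x within {t..2*pi})"
        by (rule has_field_derivative_subset[OF P]) (use x t in auto)
      then show "(P has_vector_derivative p x) (at x within {t..2*pi})"
        by (simp add: has_real_derivative_iff_has_vector_derivative)
    qed (use t in auto)
    moreover have "set_integrable lborel {t..2*pi} p"
      by (rule borel_integrable_compact[unfolded set_integrable_def[symmetric]]) (auto intro: continuous_on_subset[OF p])
    ultimately have "(\<integral>\<tau>. indicat_real {t..2*pi} \<tau> *\<^sub>R p \<tau> \<partial>lborel) = P (2*pi) - P t"
      using set_borel_integral_eq_integral(2) integral_unique by (metis set_lebesgue_integral_def)
    then have "complex_of_real (\<integral>\<tau>. indicat_real {t..2*pi} \<tau> *\<^sub>R p \<tau> \<partial>lborel) = of_real (P (2*pi) - P t)" by simp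
    then show ?thesis by (simp only: integral_complex_of_real[symmetric]) (simp add: scaleR_conv_of_real)
  qed
  have in2: "(\<integral>\<tau>. F t \<tau> \<partial>lborel) = indicat_real ?I t *\<^sub>R (g t * of_real (P (2*pi) - P t))" for t
  proof (cases "t \<in> ?I")
    case True
    have "(\<integral>\<tau>. F t \<tau> \<partial>lborel) = (\<integral>\<tau>. g t * (indicat_real {t..2*pi} \<tau> *\<^sub>R complex_of_real (p \<tau>)) \<partial>lborel)"
      by (rule Bochner_Integration.integral_cong) (use True in \<open>auto simp: F_def indicator_def\<close>)
    also have "\<dots> = g t * (\<integral>\<tau>. indicat_real {t..2*pi} \<tau> *\<^sub>R complex_of_real (p \<tau>) \<partial>lborel)"
      by (rule integral_mult_right_zero)
    also have "\<dots> = g t * of_real (P (2*pi) - P t)" unfolding FTC[OF True] ..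
    finally show ?thesis using True by simp
  qed (simp add: F_def)
  define Q where "Q = (\<lambda>t. if t \<in> ?I then P t else 0)"
  have Pc: "continuous_on ?I P" by (rule DERIV_continuous_on) (rule P)
  have gm: "g \<in> borel_measurable ang" by (rule borel_imp_ang[OF g])
  have PM: "(\<lambda>t. complex_of_real (P t)) \<in> borel_measurable ang"
    by (intro continuous_imp_ang continuous_intros Pc)
  obtain CP where CP: "0 \<le> CP" "\<And>x. x \<in> ?I \<Longrightarrow> norm (P x) \<le> CP"
    using continuous_bounded_on_compact[OF compact_Icc Pc] by blast
  have i1: "integrable ang (\<lambda>t. g t * of_real (P t))" 
    by (rule cauchy_transform_integrable[OF gm _ continuous_on_of_real[OF Pc]]) (use b in auto)
  have i0: "integrable ang g" by (rule integrable_ang_bounded[OF gm]) (use b in auto)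
  have "integral\<^sup>L ang (\<lambda>t. g t * of_real (P (2*pi) - P t)) = integral\<^sup>L ang (\<lambda>\<tau>. of_real (p \<tau>) * integral {0..\<tau>} g)"
  proof -
    have "(\<integral>t. indicat_real ?I t *\<^sub>R (g t * of_real (P (2*pi) - P t)) \<partial>lborel) = (\<integral>\<tau>. indicat_real ?I \<tau> *\<^sub>R (of_real (p \<tau>) * integral {0..\<tau>} g) \<partial>lborel)"
      using fub unfolding in1 in2 by simp
    moreover have "(\<lambda>t. indicat_real ?I t *\<^sub>R (g t * complex_of_real (P (2*pi) - P t))) \<in> borel_measurable borel"
      unfolding in2[symmetric] using Fm by measurable
    moreover have "(\<lambda>\<tau>. indicat_real ?I \<tau> *\<^sub>R (complex_of_real (p \<tau>) * integral {0..\<tau>} g)) \<in> borel_measurable borel"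
      unfolding in1[symmetric] using Fm by measurable
    ultimately show ?thesis
      by (simp add: integral_restrict_space integral_completion)
  qed
  moreover have "integral\<^sup>L ang (\<lambda>t. g t * of_real (P (2*pi) - P t)) = integral\<^sup>L ang g * of_real (P (2*pi)) - integral\<^sup>L ang (\<lambda>t. g t * of_real (P t))"
    using Bochner_Integration.integral_diff[OF integrable_mult_left[OF i0] i1, of "of_real (P (2*pi))"]
    by (simp add: algebra_simps)
  moreover have "integral\<^sup>L ang g = integral {0..2*pi} g"
    by (rule lebesgue_integral_eq_integral[OF i0]) auto
  ultimately show ?thesis by (simp add: algebra_simps)
qed

definition poisson_kernel_deriv :: "complex \<Rightarrow> real \<Rightarrow> real" where
  "poisson_kernel_deriv z \<theta> = 2 * (1 - (norm z)\<^sup>2) * Re (\<i> * cnj z * cis \<theta>) / ((norm (cis \<theta> - z))\<^sup>2)\<^sup>2"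

lemma norm_cis_minus_sq: "(norm (cis \<theta> - z))\<^sup>2 = 1 + (norm z)\<^sup>2 - 2 * Re (cnj z * cis \<theta>)"
proof -
  have "(norm (cis \<theta> - z))\<^sup>2 = (norm (cis \<theta>))\<^sup>2 + 2 * (cis \<theta> \<bullet> (- z)) + (norm (- z))\<^sup>2"
    using norm_add_sq[of "cis \<theta>" "- z"] by simp
  then show ?thesis by (simp add: inner_complex_def algebra_simps)
qed

lemma poisson_kernel_has_deriv:
  assumes z: "norm z < 1"
  shows "(poisson_kernel z has_real_derivative poisson_kernel_deriv z \<theta>) (at \<theta> within A)"
proof -
  have d: "((\<lambda>\<theta>. Re (cnj z * cis \<theta>)) has_real_derivative Re (\<i> * cnj z * cis \<theta>)) (at \<theta> within A)"
  proof -
    have "((\<lambda>\<theta>. Re z * cos \<theta> + Im z * sin \<theta>) has_real_derivative (Re z * (- sin \<theta>) + Im z * cos \<theta>)) (at \<theta> within A)"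
      by (auto intro!: derivative_eq_intros)
    then show ?thesis by (simp add: cis.code mult.commute)
  qed
  have nz: "1 + (norm z)\<^sup>2 - 2 * Re (cnj z * cis \<theta>) \<noteq> 0"
    unfolding norm_cis_minus_sq[symmetric] using cis_minus_nonzero(1)[OF z] by simp
  have "((\<lambda>\<theta>. (1 - (norm z)\<^sup>2) / (1 + (norm z)\<^sup>2 - 2 * Re (cnj z * cis \<theta>))) has_real_derivative
      (0 * (1 + (norm z)\<^sup>2 - 2 * Re (cnj z * cis \<theta>)) - (1 - (norm z)\<^sup>2) * (0 + 0 - 2 * Re (\<i> * cnj z * cis \<theta>))) /
      ((1 + (norm z)\<^sup>2 - 2 * Re (cnj z * cis \<theta>)) * (1 + (norm z)\<^sup>2 - 2 * Re (cnj z * cis \<theta>)))) (at \<theta> within A)"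
    by (intro DERIV_divide DERIV_diff DERIV_add DERIV_const DERIV_cmult d nz)
  moreover have "(0 * X - c * (0 + 0 - 2 * R)) / (X * X) = 2 * c * R / X\<^sup>2" for X c R :: real
    by (simp add: power2_eq_square)
  then have "(0 * (1 + (norm z)\<^sup>2 - 2 * Re (cnj z * cis \<theta>)) - (1 - (norm z)\<^sup>2) * (0 + 0 - 2 * Re (\<i> * cnj z * cis \<theta>))) /
      ((1 + (norm z)\<^sup>2 - 2 * Re (cnj z * cis \<theta>)) * (1 + (norm z)\<^sup>2 - 2 * Re (cnj z * cis \<theta>))) = poisson_kernel_deriv z \<theta>"
    unfolding poisson_kernel_deriv_def norm_cis_minus_sq .
  moreover have "poisson_kernel z = (\<lambda>\<theta>. (1 - (norm z)\<^sup>2) / (1 + (norm z)\<^sup>2 - 2 * Re (cnj z * cis \<theta>)))"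
    by (rule ext) (simp only: poisson_kernel_def norm_cis_minus_sq)
  ultimately show ?thesis by (simp only:)
qed

lemma continuous_on_poisson_kernel_deriv: "norm z < 1 \<Longrightarrow> continuous_on A (poisson_kernel_deriv z)"
  unfolding poisson_kernel_deriv_def using cis_minus_nonzero(1) by (intro continuous_intros) auto

text \<open>The factor \<open>\<bar>cis \<theta> - z\<bar>\<close> compensates the derivative: integrated against a primitive that vanishes to first
  order at a point, the derivative of the kernel is as good as the kernel itself.\<close>

lemma poisson_kernel_deriv_bound:
  assumes z: "norm z < 1"
  shows "\<bar>poisson_kernel_deriv z \<theta>\<bar> * norm (cis \<theta> - z) \<le> 2 * poisson_kernel z \<theta>"
proof -
  define n where "n = norm (cis \<theta> - z)"
  have n: "n > 0" using cis_minus_nonzero(1)[OF z] by (simp add: n_def)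
  have "Re (\<i> * cnj z * cis \<theta>) = - Im (cnj z * (cis \<theta> - z))" by (simp add: algebra_simps)
  then have "\<bar>Re (\<i> * cnj z * cis \<theta>)\<bar> \<le> norm (cnj z * (cis \<theta> - z))"
    by (simp only: abs_minus_cancel abs_Im_le_cmod)
  also have "\<dots> \<le> 1 * n" unfolding norm_mult n_def using z by (intro mult_right_mono) auto
  finally have R: "\<bar>Re (\<i> * cnj z * cis \<theta>)\<bar> \<le> n" by simp
  have z2: "0 \<le> 1 - (norm z)\<^sup>2" using z by (simp add: power_le_one)
  have "\<bar>poisson_kernel_deriv z \<theta>\<bar> * n = 2 * (1 - (norm z)\<^sup>2) * (\<bar>Re (\<i> * cnj z * cis \<theta>)\<bar> * n) / (n\<^sup>2)\<^sup>2"
    using z2 unfolding poisson_kernel_deriv_def n_def[symmetric] abs_divide abs_mult by simp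
  also have "\<dots> \<le> 2 * (1 - (norm z)\<^sup>2) * (n * n) / (n\<^sup>2)\<^sup>2"
    by (intro divide_right_mono mult_left_mono mult_right_mono R) (use z2 n in auto)
  also have "\<dots> = 2 * poisson_kernel z \<theta>"
    unfolding poisson_kernel_def n_def[symmetric] using n by (simp add: power2_eq_square)
  finally show ?thesis by (simp add: n_def)
qed

lemma bochner_norm_le:
  fixes k :: "real \<Rightarrow> complex"
  assumes "integrable ang k" "integrable ang b" "\<And>\<theta>. \<theta> \<in> {0..2*pi} \<Longrightarrow> norm (k \<theta>) \<le> b \<theta>"
  shows "norm (integral\<^sup>L ang k) \<le> integral\<^sup>L ang b"
proof -
  have "norm (integral\<^sup>L ang k) \<le> integral\<^sup>L ang (\<lambda>\<theta>. norm (k \<theta>))" by (rule integral_norm_bound)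
  also have "\<dots> \<le> integral\<^sup>L ang b"
    by (rule integral_mono_AE[OF integrable_norm[OF assms(1)] assms(2)]) (use assms(3) in \<open>auto intro!: AE_I2\<close>)
  finally show ?thesis .
qed

text \<open>Fatou's theorem at a point where the primitive of \<open>f\<close> is differentiable with derivative \<open>f \<theta>\<close>.
  Integration by parts moves the kernel onto the primitive \<open>E\<close> of \<open>f - f \<theta>\<close>, which is \<open>o(\<bar>\<tau> - \<theta>\<bar>)\<close>.  Inside a
  Stolz region \<open>\<bar>\<tau> - \<theta>\<bar>\<close> is dominated by \<open>\<bar>cis \<tau> - z\<bar>\<close>, and the bound on the derivative of the kernel
  makes the part of the integral near \<open>\<theta>\<close> small.  Away from \<open>\<theta>\<close> the kernel tends to zero uniformly.  The
  endpoints of the interval of angles are excluded in order to have a neighbourhood of \<open>\<theta>\<close> inside it.\<close>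

lemma poisson_nontangential_limit:
  fixes f :: "real \<Rightarrow> complex"
  assumes f: "f \<in> borel_measurable borel" and b: "\<And>x. norm (f x) \<le> B"
    and \<theta>: "\<theta> \<in> {0<..<2*pi}"
    and lp: "\<forall>e>0. \<exists>d>0. \<forall>\<tau>\<in>{0..2*pi}. \<bar>\<tau> - \<theta>\<bar> < d \<longrightarrow>
      norm (integral {0..\<tau>} f - integral {0..\<theta>} f - of_real (\<tau> - \<theta>) * f \<theta>) \<le> e * \<bar>\<tau> - \<theta>\<bar>"
    and \<alpha>: "\<alpha> > 1"
  shows "((\<lambda>z. 1 / (2*pi) * integral\<^sup>L ang (\<lambda>t. f t * of_real (poisson_kernel z t))) \<longlongrightarrow> f \<theta>) (at (cis \<theta>) within stolz_region (cis \<theta>) \<alpha>)"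
proof (rule tendstoI)
  fix e :: real assume e: "e > 0"
  define \<zeta> where "\<zeta> = cis \<theta>"
  define g where "g = (\<lambda>t. f t - f \<theta>)"
  have gm: "g \<in> borel_measurable borel" unfolding g_def using f by measurable
  have gb: "norm (g t) \<le> 2 * B" for t
    unfolding g_def using norm_triangle_ineq4[of "f t" "f \<theta>"] b[of t] b[of \<theta>] by linarith
  have B0: "0 \<le> B" using b[of 0] norm_ge_zero order_trans by blast
  have f_int: "f integrable_on {a..b}" for a b
    by (rule set_lebesgue_integral_eq_integral(1)[OF bounded_borel_absolutely_integrable[OF f b]])
  define E where "E = (\<lambda>\<tau>. integral {0..\<tau>} g - integral {0..\<theta>} g)"
  have Eeq: "E \<tau> = integral {0..\<tau>} f - integral {0..\<theta>} f - of_real (\<tau> - \<theta>) * f \<theta>" if "\<tau> \<ge> 0" for \<tau>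
  proof -
    have X: "integral {0..x} g = integral {0..x} f - of_real x * f \<theta>" if "x \<ge> 0" for x
      unfolding g_def using that f_int
      by (subst Henstock_Kurzweil_Integration.integral_diff) (auto simp: scaleR_conv_of_real)
    have "0 \<le> \<theta>" using \<theta> by simp
    then show ?thesis unfolding E_def X[OF that] X[OF \<open>0 \<le> \<theta>\<close>] by (simp add: algebra_simps)
  qed
  have Econt: "continuous_on {0..2*pi} E"
  proof -
    have "g integrable_on {0..2*pi}" unfolding g_def using f_int by (intro integrable_diff) auto
    then show ?thesis unfolding E_def by (intro continuous_intros indefinite_integral_continuous_1)
  qed
  obtain M where M: "0 \<le> M" "\<And>\<tau>. \<tau> \<in> {0..2*pi} \<Longrightarrow> norm (E \<tau>) \<le> M"
    using continuous_bounded_on_compact[OF compact_Icc Econt] by blast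
  \<comment> \<open>The near part contributes at most \<open>4 * \<epsilon> * (1 + \<alpha>) * (2*pi) = pi * e\<close>, half of the admissible error.\<close>
  define \<epsilon> where "\<epsilon> = e / (8 * (1 + \<alpha>))"
  have \<epsilon>: "\<epsilon> > 0" using e \<alpha> by (simp add: \<epsilon>_def)
  obtain d1 where d1: "d1 > 0" "\<And>\<tau>. \<tau> \<in> {0..2*pi} \<Longrightarrow> \<bar>\<tau> - \<theta>\<bar> < d1 \<Longrightarrow> norm (E \<tau>) \<le> \<epsilon> * \<bar>\<tau> - \<theta>\<bar>"
    using lp \<epsilon> Eeq by (metis atLeastAtMost_iff)
  have "(cis has_vector_derivative \<i> * cis \<theta>) (at \<theta>)"
  proof -
    have "((\<lambda>x. exp (\<i> * x)) has_field_derivative exp (\<i> * of_real \<theta>) * \<i>) (at (of_real \<theta>))"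
      by (auto intro!: derivative_eq_intros)
    from has_vector_derivative_real_field[OF this]
    have "((\<lambda>x. exp (\<i> * of_real x)) has_vector_derivative \<i> * cis \<theta>) (at \<theta>)"
      by (simp add: cis_conv_exp mult.commute)
    moreover have "cis = (\<lambda>x. exp (\<i> * of_real x))" by (simp add: fun_eq_iff cis_conv_exp)
    ultimately show ?thesis by simp
  qed
  then have "(cis has_derivative (\<lambda>x. x *\<^sub>R (\<i> * cis \<theta>))) (at \<theta>)" by (simp add: has_vector_derivative_def)
  then obtain d2 where d2: "d2 > 0" "\<And>\<tau>. norm (\<tau> - \<theta>) < d2 \<Longrightarrow>
      norm (cis \<tau> - cis \<theta> - (\<tau> - \<theta>) *\<^sub>R (\<i> * cis \<theta>)) \<le> 1/2 * norm (\<tau> - \<theta>)"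
    unfolding has_derivative_at_alt by (metis half_gt_zero zero_less_one)
  have chord: "\<bar>\<tau> - \<theta>\<bar> \<le> 2 * norm (cis \<tau> - \<zeta>)" if "\<bar>\<tau> - \<theta>\<bar> < d2" for \<tau>
  proof -
    have "norm ((\<tau> - \<theta>) *\<^sub>R (\<i> * cis \<theta>)) = \<bar>\<tau> - \<theta>\<bar>" by (simp add: norm_mult)
    moreover have "norm ((\<tau> - \<theta>) *\<^sub>R (\<i> * cis \<theta>)) \<le> norm (cis \<tau> - cis \<theta>) + norm (cis \<tau> - cis \<theta> - (\<tau> - \<theta>) *\<^sub>R (\<i> * cis \<theta>))"
      using norm_triangle_sub[of "(\<tau> - \<theta>) *\<^sub>R (\<i> * cis \<theta>)" "cis \<tau> - cis \<theta>"] by (simp add: norm_minus_commute)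
    moreover have "norm (cis \<tau> - cis \<theta> - (\<tau> - \<theta>) *\<^sub>R (\<i> * cis \<theta>)) \<le> 1/2 * norm (\<tau> - \<theta>)"
      by (rule d2(2)) (use that in simp)
    moreover have "a \<le> 2 * y" if "x = a" "x \<le> y + z" "z \<le> 1/2 * a" for a x y z :: real
      using that by linarith
    ultimately show ?thesis unfolding \<zeta>_def real_norm_def by blast
  qed
  define d where "d = min d1 d2"
  have d: "d > 0" using d1 d2 by (simp add: d_def)
  obtain \<eta> where \<eta>: "\<eta> > 0" "\<And>\<tau>. \<tau> \<in> {0..2*pi} \<Longrightarrow> d \<le> \<bar>\<tau> - \<theta>\<bar> \<Longrightarrow> \<eta> \<le> norm (cis \<tau> - \<zeta>)"
  proof (cases "{0..2*pi} \<inter> {\<tau>. d \<le> \<bar>\<tau> - \<theta>\<bar>} = {}")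
    case True
    then have "False" if "\<tau> \<in> {0..2*pi}" "d \<le> \<bar>\<tau> - \<theta>\<bar>" for \<tau> using that by blast
    then show ?thesis by (intro that[of 1]) auto
  next
    case False
    have c1: "compact ({0..2*pi} \<inter> {\<tau>. d \<le> \<bar>\<tau> - \<theta>\<bar>})"
      by (intro compact_Int_closed compact_Icc closed_Collect_le continuous_intros)
    have c2: "continuous_on ({0..2*pi} \<inter> {\<tau>. d \<le> \<bar>\<tau> - \<theta>\<bar>}) (\<lambda>\<tau>. norm (cis \<tau> - \<zeta>))" by (intro continuous_intros)
    obtain x where x: "x \<in> {0..2*pi} \<inter> {\<tau>. d \<le> \<bar>\<tau> - \<theta>\<bar>}" "\<And>y. y \<in> {0..2*pi} \<inter> {\<tau>. d \<le> \<bar>\<tau> - \<theta>\<bar>} \<Longrightarrow> norm (cis x - \<zeta>) \<le> norm (cis y - \<zeta>)"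
      using continuous_attains_inf[OF c1 False c2] by blast
    have "cis x \<noteq> \<zeta>"
    proof
      assume eq: "cis x = \<zeta>"
      show False
      proof (cases "x = 2*pi")
        case True
        then have "cis 0 = cis \<theta>" using eq by (simp add: \<zeta>_def)
        then have "Arg2pi (cis 0) = Arg2pi (cis \<theta>)" by simp
        then show False using \<theta> Arg2pi_cis[of 0] Arg2pi_cis[of \<theta>] by simp
      next
        case False
        have "x \<in> {0..2*pi}" using x(1) by (rule IntD1)
        then have "0 \<le> x" "x \<le> 2*pi" by (simp_all only: atLeastAtMost_iff)
        moreover from this(2) False have "x < 2*pi" by (rule order_le_neq_trans)
        ultimately have "0 \<le> x" "x < 2*pi" by blast+
        then have "x = Arg2pi (cis x)" by (rule Arg2pi_cis[symmetric])
        also have "\<dots> = Arg2pi (cis \<theta>)" unfolding eq \<zeta>_def ..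
        also have "\<dots> = \<theta>" by (rule Arg2pi_cis) (use \<theta> in auto)
        finally have "x = \<theta>" .
        then have "d \<le> 0" using x(1) by simp
        then show False using d by simp
      qed
    qed
    then show ?thesis using that[of "norm (cis x - \<zeta>)"] x(2) by auto
  qed
  have \<zeta>1: "\<zeta> \<noteq> 1"
  proof
    assume "\<zeta> = 1"
    then have "Arg2pi (cis 0) = Arg2pi (cis \<theta>)" by (simp add: \<zeta>_def)
    then show False using \<theta> Arg2pi_cis[of 0] Arg2pi_cis[of \<theta>] by simp
  qed
  have n\<zeta>: "norm \<zeta> = 1" by (simp add: \<zeta>_def)
  \<comment> \<open>The boundary term of the integration by parts and the part of the integral away from \<open>\<theta>\<close>.\<close>
  define bnd where "bnd = (\<lambda>z::complex. (2 * M) * ((1 - (norm z)\<^sup>2) / (norm (1 - z))\<^sup>2) + 2*pi * (M * (16 * (1 - (norm z)\<^sup>2) / \<eta> ^ 3)))"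
  have "(bnd \<longlongrightarrow> (2 * M) * ((1 - (norm \<zeta>)\<^sup>2) / (norm (1 - \<zeta>))\<^sup>2) + 2*pi * (M * (16 * (1 - (norm \<zeta>)\<^sup>2) / \<eta> ^ 3))) (at \<zeta> within stolz_region \<zeta> \<alpha>)"
    unfolding bnd_def using \<zeta>1 \<eta> by (intro tendsto_intros) auto
  then have "(bnd \<longlongrightarrow> 0) (at \<zeta> within stolz_region \<zeta> \<alpha>)" using n\<zeta> by simp
  then have ev1: "eventually (\<lambda>z. bnd z < e) (at \<zeta> within stolz_region \<zeta> \<alpha>)" using e by (rule order_tendstoD)
  have ev2: "eventually (\<lambda>z. norm (z - \<zeta>) < \<eta> / 2) (at \<zeta> within stolz_region \<zeta> \<alpha>)"
    using \<eta>(1) by (auto simp: eventually_at dist_norm intro!: exI[of _ "\<eta> / 2"])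
  have ev3: "eventually (\<lambda>z. z \<in> stolz_region \<zeta> \<alpha>) (at \<zeta> within stolz_region \<zeta> \<alpha>)"
    by (auto simp: eventually_at intro!: exI[of _ 1])
  have "eventually (\<lambda>z. dist (1 / (2*pi) * integral\<^sup>L ang (\<lambda>t. f t * of_real (poisson_kernel z t))) (f \<theta>) < e) (at \<zeta> within stolz_region \<zeta> \<alpha>)"
    using ev1 ev2 ev3
  proof eventually_elim
    case (elim z)
    have z: "norm z < 1" and st: "norm (z - \<zeta>) < \<alpha> * (1 - norm z)" using elim(3) by (auto simp: stolz_region_def)
    let ?P = "poisson_kernel z" and ?p = "poisson_kernel_deriv z"
    have z2: "0 \<le> 1 - (norm z)\<^sup>2" using z by (simp add: power_le_one)
    have Pc: "continuous_on {0..2*pi} ?P" and pc: "continuous_on {0..2*pi} ?p"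
      by (rule continuous_on_poisson_kernel[OF z], rule continuous_on_poisson_kernel_deriv[OF z])
    have P0: "?P (2*pi) = (1 - (norm z)\<^sup>2) / (norm (1 - z))\<^sup>2" "?P 0 = ?P (2*pi)" by (simp_all add: poisson_kernel_def)
    have fm: "f \<in> borel_measurable ang" by (rule borel_imp_ang[OF f])
    have fi: "integrable ang (\<lambda>t. f t * of_real (?P t))"
      by (rule cauchy_transform_integrable[OF fm _ continuous_on_of_real[OF Pc]]) (use b in auto)
    have ci: "has_bochner_integral ang (\<lambda>t. f \<theta> * of_real (?P t)) (f \<theta> * of_real (2*pi))"
      by (intro has_bochner_integral_mult_right has_bochner_integral_of_real poisson_kernel_mean z)
    have I1: "integral\<^sup>L ang (\<lambda>t. g t * of_real (?P t)) = integral\<^sup>L ang (\<lambda>t. f t * of_real (?P t)) - f \<theta> * of_real (2*pi)"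
    proof -
      have cint: "integrable ang (\<lambda>t. f \<theta> * of_real (?P t))" using ci by (simp only: has_bochner_integral_iff)
      show ?thesis
        unfolding g_def left_diff_distrib Bochner_Integration.integral_diff[OF fi cint] has_bochner_integral_integral_eq[OF ci] ..
    qed
    have I2: "integral\<^sup>L ang (\<lambda>t. g t * of_real (?P t)) = integral {0..2*pi} g * of_real (?P (2*pi)) - integral\<^sup>L ang (\<lambda>\<tau>. of_real (?p \<tau>) * integral {0..\<tau>} g)"
      by (rule integral_by_parts_bounded[OF gm gb poisson_kernel_has_deriv[OF z] continuous_on_poisson_kernel_deriv[OF z]])
    have pE: "integrable ang (\<lambda>\<tau>. of_real (?p \<tau>) * E \<tau>)" by (intro integrable_ang_continuous continuous_intros pc Econt)
    have pint: "has_bochner_integral ang ?p 0"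
    proof -
      have "(?p has_integral (?P (2*pi) - ?P 0)) {0..2*pi}"
        by (rule fundamental_theorem_of_calculus)
          (use poisson_kernel_has_deriv[OF z] in \<open>auto simp: has_real_derivative_iff_has_vector_derivative[symmetric]\<close>)
      then show ?thesis using has_bochner_integral_angI[OF pc] P0 by simp
    qed
    have "integral\<^sup>L ang (\<lambda>\<tau>. of_real (?p \<tau>) * integral {0..\<tau>} g) = integral\<^sup>L ang (\<lambda>\<tau>. of_real (?p \<tau>) * E \<tau> + of_real (?p \<tau>) * integral {0..\<theta>} g)"
      by (simp add: E_def algebra_simps)
    also have "\<dots> = integral\<^sup>L ang (\<lambda>\<tau>. of_real (?p \<tau>) * E \<tau>) + of_real 0 * integral {0..\<theta>} g"
      using has_bochner_integral_integral_eq[OF has_bochner_integral_add[OF has_bochner_integral_integrable[OF pE]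
        has_bochner_integral_mult_left[OF has_bochner_integral_of_real[OF pint]]]] by simp
    finally have I3: "integral\<^sup>L ang (\<lambda>t. f t * of_real (?P t)) - f \<theta> * of_real (2*pi) =
        integral {0..2*pi} g * of_real (?P (2*pi)) - integral\<^sup>L ang (\<lambda>\<tau>. of_real (?p \<tau>) * E \<tau>)"
      using I1 I2 by simp
    have Eg: "integral {0..2*pi} g = E (2*pi) - E 0" by (simp add: E_def)
    have ng: "norm (integral {0..2*pi} g * of_real (?P (2*pi))) \<le> 2 * M * ?P (2*pi)"
    proof -
      have "norm (integral {0..2*pi} g) \<le> 2 * M"
        unfolding Eg using norm_triangle_ineq4[of "E (2*pi)" "E 0"] M(2)[of 0] M(2)[of "2*pi"] by simp
      then show ?thesis unfolding norm_mult using poisson_kernel_nonneg[OF z] by (simp add: mult_right_mono)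
    qed
    have pw: "norm (of_real (?p \<tau>) * E \<tau>) \<le> 4 * \<epsilon> * (1 + \<alpha>) * ?P \<tau> + M * (16 * (1 - (norm z)\<^sup>2) / \<eta> ^ 3)" if t: "\<tau> \<in> {0..2*pi}" for \<tau>
    proof (cases "\<bar>\<tau> - \<theta>\<bar> < d")
      case True
      have "norm (cis \<tau> - \<zeta>) \<le> norm (cis \<tau> - z) + norm (z - \<zeta>)" using norm_triangle_ineq[of "cis \<tau> - z" "z - \<zeta>"] by simp
      also have "norm (z - \<zeta>) \<le> \<alpha> * norm (cis \<tau> - z)"
        using st mult_left_mono[OF norm_cis_minus[of z \<tau>], of \<alpha>] \<alpha> by linarith
      finally have "norm (cis \<tau> - \<zeta>) \<le> (1 + \<alpha>) * norm (cis \<tau> - z)" by (simp add: algebra_simps)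
      then have "\<bar>\<tau> - \<theta>\<bar> \<le> 2 * ((1 + \<alpha>) * norm (cis \<tau> - z))" using chord[of \<tau>] True by (simp add: d_def)
      then have "\<epsilon> * \<bar>\<tau> - \<theta>\<bar> \<le> \<epsilon> * (2 * ((1 + \<alpha>) * norm (cis \<tau> - z)))" using \<epsilon> by (intro mult_left_mono) auto
      then have "norm (E \<tau>) \<le> \<epsilon> * (2 * ((1 + \<alpha>) * norm (cis \<tau> - z)))" using d1(2)[OF t] True by (simp add: d_def)
      then have "\<bar>?p \<tau>\<bar> * norm (E \<tau>) \<le> \<bar>?p \<tau>\<bar> * (\<epsilon> * (2 * ((1 + \<alpha>) * norm (cis \<tau> - z))))" by (rule mult_left_mono) simp
      also have "\<dots> = 2 * \<epsilon> * (1 + \<alpha>) * (\<bar>?p \<tau>\<bar> * norm (cis \<tau> - z))" by (simp add: algebra_simps)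
      also have "\<dots> \<le> 2 * \<epsilon> * (1 + \<alpha>) * (2 * ?P \<tau>)"
        by (rule mult_left_mono[OF poisson_kernel_deriv_bound[OF z]]) (use \<epsilon> \<alpha> in auto)
      finally have "norm (of_real (?p \<tau>) * E \<tau>) \<le> 4 * \<epsilon> * (1 + \<alpha>) * ?P \<tau>" by (simp add: norm_mult)
      moreover have "0 \<le> M * (16 * (1 - (norm z)\<^sup>2) / \<eta> ^ 3)" using M(1) z2 \<eta>(1) by simp
      ultimately show ?thesis by linarith
    next
      case False
      define n where "n = norm (cis \<tau> - z)"
      have "\<eta> \<le> norm (cis \<tau> - \<zeta>)" using \<eta>(2)[OF t] False by simp
      also have "\<dots> \<le> n + norm (z - \<zeta>)" unfolding n_def using norm_triangle_ineq[of "cis \<tau> - z" "z - \<zeta>"] by simp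
      finally have n: "\<eta> / 2 \<le> n" using elim(2) by simp
      then have n0: "n > 0" using \<eta>(1) by linarith
      have "(\<eta> / 2) ^ 3 \<le> n ^ 3" using n \<eta>(1) by (intro power_mono) auto
      then have n3: "\<eta> ^ 3 \<le> 8 * n ^ 3" by (simp add: power_divide)
      have "\<bar>?p \<tau>\<bar> * n \<le> 2 * ((1 - (norm z)\<^sup>2) / n\<^sup>2)"
        using poisson_kernel_deriv_bound[OF z, of \<tau>] by (simp add: poisson_kernel_def n_def)
      then have "\<bar>?p \<tau>\<bar> \<le> 2 * (1 - (norm z)\<^sup>2) / n ^ 3" using n0 by (simp add: field_simps power3_eq_cube power2_eq_square)
      also have "\<dots> \<le> 2 * (1 - (norm z)\<^sup>2) / (\<eta> ^ 3 / 8)"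
        by (rule divide_left_mono) (use n3 z2 n0 \<eta>(1) in auto)
      also have "\<dots> = 16 * (1 - (norm z)\<^sup>2) / \<eta> ^ 3" by simp
      finally have "\<bar>?p \<tau>\<bar> \<le> 16 * (1 - (norm z)\<^sup>2) / \<eta> ^ 3" .
      then have "\<bar>?p \<tau>\<bar> * norm (E \<tau>) \<le> 16 * (1 - (norm z)\<^sup>2) / \<eta> ^ 3 * M"
        by (intro mult_mono M(2)[OF t]) (use z2 \<eta>(1) in auto)
      moreover have "0 \<le> 4 * \<epsilon> * (1 + \<alpha>) * ?P \<tau>" using \<epsilon> \<alpha> poisson_kernel_nonneg[OF z] by simp
      moreover have "norm (of_real (?p \<tau>) * E \<tau>) = \<bar>?p \<tau>\<bar> * norm (E \<tau>)" by (simp add: norm_mult)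
      moreover have "16 * (1 - (norm z)\<^sup>2) / \<eta> ^ 3 * M = M * (16 * (1 - (norm z)\<^sup>2) / \<eta> ^ 3)" by (rule mult.commute)
      ultimately show ?thesis by linarith
    qed
    have bi: "has_bochner_integral ang (\<lambda>\<tau>. 4 * \<epsilon> * (1 + \<alpha>) * ?P \<tau> + M * (16 * (1 - (norm z)\<^sup>2) / \<eta> ^ 3))
        (4 * \<epsilon> * (1 + \<alpha>) * (2*pi) + (2*pi) *\<^sub>R (M * (16 * (1 - (norm z)\<^sup>2) / \<eta> ^ 3)))"
      by (intro has_bochner_integral_add has_bochner_integral_mult_right poisson_kernel_mean[OF z] has_bochner_integral_const_ang)
    have "norm (integral\<^sup>L ang (\<lambda>\<tau>. of_real (?p \<tau>) * E \<tau>)) \<le> 4 * \<epsilon> * (1 + \<alpha>) * (2*pi) + 2*pi * (M * (16 * (1 - (norm z)\<^sup>2) / \<eta> ^ 3))"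
      using bochner_norm_le[OF pE _ pw] bi by (simp add: has_bochner_integral_iff)
    then have "norm (integral\<^sup>L ang (\<lambda>t. f t * of_real (?P t)) - f \<theta> * of_real (2*pi)) \<le> bnd z + 4 * \<epsilon> * (1 + \<alpha>) * (2*pi)"
      unfolding I3 using ng norm_triangle_ineq4[of "integral {0..2*pi} g * of_real (?P (2*pi))" "integral\<^sup>L ang (\<lambda>\<tau>. of_real (?p \<tau>) * E \<tau>)"]
      by (simp add: bnd_def P0)
    also have "4 * \<epsilon> * (1 + \<alpha>) * (2*pi) = pi * e" using \<alpha> by (simp add: \<epsilon>_def field_simps)
    also have "bnd z + pi * e < e + pi * e" using elim(1) by simp
    also have "\<dots> \<le> 2 * pi * e" using pi_gt3 e by (simp add: algebra_simps mult_right_mono)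
    finally have L: "norm (integral\<^sup>L ang (\<lambda>t. f t * of_real (?P t)) - f \<theta> * of_real (2*pi)) < 2 * pi * e" .
    have "dist (1 / (2*pi) * integral\<^sup>L ang (\<lambda>t. f t * of_real (?P t))) (f \<theta>) =
        1 / (2*pi) * norm (integral\<^sup>L ang (\<lambda>t. f t * of_real (?P t)) - f \<theta> * of_real (2*pi))"
    proof -
      have "1 / (2*pi) * integral\<^sup>L ang (\<lambda>t. f t * of_real (?P t)) - f \<theta> =
          of_real (1 / (2*pi)) * (integral\<^sup>L ang (\<lambda>t. f t * of_real (?P t)) - f \<theta> * of_real (2*pi))"
        by (simp add: field_simps)
      then show ?thesis unfolding dist_norm by (simp only: norm_mult norm_of_real) simp
    qed
    also have "\<dots> < e" using L by (simp add: field_simps)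
    finally show ?case .
  qed
  then show "eventually (\<lambda>z. dist (1 / (2*pi) * integral\<^sup>L ang (\<lambda>t. f t * of_real (poisson_kernel z t))) (f \<theta>) < e) (at (cis \<theta>) within stolz_region (cis \<theta>) \<alpha>)"
    unfolding \<zeta>_def .
qed

section \<open>Boundary values of bounded holomorphic functions\<close>

text \<open>A bounded density whose moments against \<open>1, z, z\<^sup>2, \<dots>\<close> vanish is the boundary value of a bounded
  holomorphic function vanishing at \<open>0\<close>, namely of its Cauchy transform.  The moment condition makes the
  Cauchy transform equal to the Poisson integral, which is bounded and has the density as its
  nontangential limit almost everywhere.\<close>

lemma bounded_annihilator_extends:
  fixes \<gamma> :: "real \<Rightarrow> complex"
  assumes g: "\<gamma> \<in> borel_measurable ang" and B: "AE \<theta> in ang. norm (\<gamma> \<theta>) \<le> B"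
    and mom: "\<And>m::nat. integral\<^sup>L ang (\<lambda>\<theta>. \<gamma> \<theta> * cis (real m * \<theta>)) = 0"
  obtains h where "h holomorphic_on ball 0 1" "bounded (h ` ball 0 1)" "h 0 = 0"
    "AE \<theta> in ang. (h \<longlongrightarrow> \<gamma> \<theta>) (nontangential (cis \<theta>))"
proof -
  define h where "h = cauchy_transform \<gamma>"
  obtain f where f: "f \<in> borel_measurable borel" "\<And>x. norm (f x) \<le> \<bar>B\<bar>" "AE \<theta> in ang. \<gamma> \<theta> = f \<theta>"
    using borel_representative[OF g B] by blast
  have fm: "f \<in> borel_measurable ang" by (rule borel_imp_ang[OF f(1)])
  have hP: "h z = 1 / (2*pi) * integral\<^sup>L ang (\<lambda>t. f t * of_real (poisson_kernel z t))" if z: "norm z < 1" for z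
  proof -
    have c1: "continuous_on {0..2*pi} (\<lambda>\<theta>. 1 / (1 - z * cis (-\<theta>)))"
      using cis_minus_nonzero(2)[OF z] by (intro continuous_intros) auto
    have c2: "continuous_on {0..2*pi} (\<lambda>\<theta>. 1 / (1 - cnj z * cis \<theta>))"
      using cis_minus_nonzero(2)[of "cnj z"] z by (intro continuous_intros) auto
    have cp: "continuous_on {0..2*pi} (\<lambda>\<theta>. complex_of_real (poisson_kernel z \<theta>))"
      by (intro continuous_intros continuous_on_poisson_kernel z)
    have i1: "integrable ang (\<lambda>\<theta>. \<gamma> \<theta> * (1 / (1 - z * cis (-\<theta>))))" by (rule cauchy_transform_integrable[OF g B c1])
    have i2: "integrable ang (\<lambda>\<theta>. \<gamma> \<theta> * (1 / (1 - cnj z * cis \<theta>)))" by (rule cauchy_transform_integrable[OF g B c2])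
    have i3: "integrable ang \<gamma>" using cauchy_transform_integrable[OF g B continuous_on_const[of _ 1]] by simp
    have z3: "integral\<^sup>L ang \<gamma> = 0" using mom[of 0] by simp
    have z2: "integral\<^sup>L ang (\<lambda>\<theta>. \<gamma> \<theta> * (1 / (1 - cnj z * cis \<theta>))) = 0"
    proof -
      have gc: "(\<lambda>\<theta>. cnj (\<gamma> \<theta>)) \<in> borel_measurable ang"
        by (rule measurable_compose[OF g]) (intro borel_measurable_continuous_onI continuous_intros)
      have Bc: "AE \<theta> in ang. norm (cnj (\<gamma> \<theta>)) \<le> B" using B by simp
      have "integral\<^sup>L ang (\<lambda>\<theta>. cnj (\<gamma> \<theta>) * cis (- real n * \<theta>)) = 0" for n
      proof -
        have "integral\<^sup>L ang (\<lambda>\<theta>. cnj (\<gamma> \<theta> * cis (real n * \<theta>))) = cnj (integral\<^sup>L ang (\<lambda>\<theta>. \<gamma> \<theta> * cis (real n * \<theta>)))"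
          by (rule Bochner_Integration.integral_cnj)
        then show ?thesis by (simp only: mom complex_cnj_mult cis_cnj complex_cnj_zero mult_minus_left)
      qed
      then have "(\<lambda>n. 0) sums cauchy_transform (\<lambda>\<theta>. cnj (\<gamma> \<theta>)) z"
        using cauchy_transform_sums[OF gc Bc z] by (simp only: mult_zero_right mult_zero_left)
      then have "cauchy_transform (\<lambda>\<theta>. cnj (\<gamma> \<theta>)) z = 0" using sums_unique2 sums_zero by blast
      then have "integral\<^sup>L ang (\<lambda>\<theta>. cnj (\<gamma> \<theta>) / (1 - z * cis (-\<theta>))) = 0" by (simp add: cauchy_transform_def)
      moreover have "integral\<^sup>L ang (\<lambda>\<theta>. cnj (\<gamma> \<theta> * (1 / (1 - cnj z * cis \<theta>)))) = cnj (integral\<^sup>L ang (\<lambda>\<theta>. \<gamma> \<theta> * (1 / (1 - cnj z * cis \<theta>))))"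
        by (rule Bochner_Integration.integral_cnj)
      ultimately have "0 = cnj (integral\<^sup>L ang (\<lambda>\<theta>. \<gamma> \<theta> / (1 - cnj z * cis \<theta>)))"
        by (simp only: complex_cnj_mult complex_cnj_divide complex_cnj_diff complex_cnj_one complex_cnj_cnj cis_cnj
            times_divide_eq_right mult_1_right)
      then show ?thesis by simp
    qed
    have "integral\<^sup>L ang (\<lambda>t. f t * of_real (poisson_kernel z t)) = integral\<^sup>L ang (\<lambda>t. \<gamma> t * of_real (poisson_kernel z t))"
    proof (rule integral_cong_AE)
      show "AE t in ang. f t * of_real (poisson_kernel z t) = \<gamma> t * of_real (poisson_kernel z t)"
        using f(3) by eventually_elim simp
    qed (use fm g continuous_imp_ang[OF cp] in auto)
    also have "\<dots> = integral\<^sup>L ang (\<lambda>t. \<gamma> t * (1 / (1 - z * cis (-t))) + \<gamma> t * (1 / (1 - cnj z * cis t)) - \<gamma> t)"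
      unfolding poisson_kernel_cauchy[OF z] by (simp only: ring_distribs mult_1_right)
    also have "\<dots> = integral\<^sup>L ang (\<lambda>t. \<gamma> t * (1 / (1 - z * cis (-t)))) + 0 - 0"
      using Bochner_Integration.integral_diff[OF Bochner_Integration.integrable_add[OF i1 i2] i3]
        Bochner_Integration.integral_add[OF i1 i2] z2 z3 by simp
    finally show ?thesis by (simp add: h_def cauchy_transform_def)
  qed
  show ?thesis
  proof (rule that[of h])
    show "h holomorphic_on ball 0 1" unfolding h_def by (rule cauchy_transform_holomorphic[OF g B])
    show "h 0 = 0" using mom[of 0] by (simp add: h_def cauchy_transform_def)
    have "norm (h z) \<le> \<bar>B\<bar>" if z: "norm z < 1" for z
    proof -
      have bi: "has_bochner_integral ang (\<lambda>t. \<bar>B\<bar> * poisson_kernel z t) (\<bar>B\<bar> * (2*pi))"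
        by (intro has_bochner_integral_mult_right poisson_kernel_mean z)
      have "norm (integral\<^sup>L ang (\<lambda>t. f t * of_real (poisson_kernel z t))) \<le> \<bar>B\<bar> * (2*pi)"
      proof -
        have A: "integrable ang (\<lambda>t. f t * of_real (poisson_kernel z t))"
          by (rule cauchy_transform_integrable[OF fm _ continuous_on_of_real[OF continuous_on_poisson_kernel[OF z]], where B = "\<bar>B\<bar>"])
            (use f(2) in auto)
        have pw: "norm (f t * of_real (poisson_kernel z t)) \<le> \<bar>B\<bar> * poisson_kernel z t" for t
          using f(2)[of t] poisson_kernel_nonneg[OF z, of t] by (simp add: norm_mult mult_right_mono)
        have "integrable ang (\<lambda>t. \<bar>B\<bar> * poisson_kernel z t)" using bi by (simp only: has_bochner_integral_iff)
        from bochner_norm_le[OF A this pw] show ?thesis unfolding has_bochner_integral_integral_eq[OF bi] .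
      qed
      then have "1 / (2*pi) * norm (integral\<^sup>L ang (\<lambda>t. f t * of_real (poisson_kernel z t))) \<le> \<bar>B\<bar>"
        by (simp add: field_simps)
      then show ?thesis unfolding hP[OF z] by (simp add: norm_mult norm_divide)
    qed
    then show "bounded (h ` ball 0 1)" by (auto simp: bounded_iff intro!: exI[of _ "\<bar>B\<bar>"])
    have "AE \<theta> in ang. \<theta> \<in> {0<..<2*pi}"
      unfolding AE_ang_iff using AE_lborel_singleton[of 0] AE_lborel_singleton[of "2*pi"]
      by eventually_elim auto
    then show "AE \<theta> in ang. (h \<longlongrightarrow> \<gamma> \<theta>) (nontangential (cis \<theta>))"
      using indefinite_integral_differentiable_AE[OF f(1,2)] f(3)
    proof eventually_elim
      case (elim \<theta>)
      show ?case unfolding tendsto_nontangential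
      proof (intro allI impI)
        fix \<alpha> :: real assume \<alpha>: "\<alpha> > 1"
        have "((\<lambda>z. 1 / (2*pi) * integral\<^sup>L ang (\<lambda>t. f t * of_real (poisson_kernel z t))) \<longlongrightarrow> f \<theta>) (at (cis \<theta>) within stolz_region (cis \<theta>) \<alpha>)"
          by (rule poisson_nontangential_limit[OF f(1,2) elim(1,2) \<alpha>])
        moreover have "eventually (\<lambda>z. 1 / (2*pi) * integral\<^sup>L ang (\<lambda>t. f t * of_real (poisson_kernel z t)) = h z) (at (cis \<theta>) within stolz_region (cis \<theta>) \<alpha>)"
          using hP by (auto simp: eventually_at stolz_region_def intro!: exI[of _ 1])
        ultimately show "(h \<longlongrightarrow> \<gamma> \<theta>) (at (cis \<theta>) within stolz_region (cis \<theta>) \<alpha>)"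
          unfolding elim(3) by (rule Lim_transform_eventually)
      qed
    qed
  qed
qed

lemma norm_vec_le_sum: "norm (x :: complex ^ 'n::finite) \<le> (\<Sum>k\<in>UNIV. norm (x $ k))"
  unfolding norm_vec_def by (rule L2_set_le_sum) simp

lemma bounded_annihilator_extends_vec:
  fixes \<gamma> :: "real \<Rightarrow> complex ^ 'n::finite"
  assumes g: "\<And>k. (\<lambda>\<theta>. \<gamma> \<theta> $ k) \<in> borel_measurable ang" and B: "\<And>k. AE \<theta> in ang. norm (\<gamma> \<theta> $ k) \<le> B"
    and mom: "\<And>k m. integral\<^sup>L ang (\<lambda>\<theta>. \<gamma> \<theta> $ k * cis (real m * \<theta>)) = 0"
  obtains h where "h \<in> hol_bounded unit_disk" "h 0 = 0"
    "AE \<theta> in ang. has_bdval h (cis \<theta>) \<and> bdval h (cis \<theta>) = \<gamma> \<theta>"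
proof -
  define Q where "Q k h \<longleftrightarrow> h holomorphic_on ball 0 1 \<and> bounded (h ` ball 0 1) \<and> h 0 = 0 \<and>
    (AE \<theta> in ang. (h \<longlongrightarrow> \<gamma> \<theta> $ k) (nontangential (cis \<theta>)))" for k h
  have "\<exists>h. Q k h" for k
  proof -
    obtain h where "h holomorphic_on ball 0 1" "bounded (h ` ball 0 1)" "h 0 = 0"
      "AE \<theta> in ang. (h \<longlongrightarrow> \<gamma> \<theta> $ k) (nontangential (cis \<theta>))"
      by (rule bounded_annihilator_extends[where \<gamma> = "\<lambda>\<theta>. \<gamma> \<theta> $ k", OF g B mom])
    then have "Q k h" unfolding Q_def by (intro conjI)
    then show ?thesis by blast
  qed
  then obtain H where "\<And>k. Q k (H k)" by metis
  then have H: "\<And>k. H k holomorphic_on ball 0 1" "\<And>k. bounded (H k ` ball 0 1)" "\<And>k. H k 0 = 0"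
    "\<And>k. AE \<theta> in ang. (H k \<longlongrightarrow> \<gamma> \<theta> $ k) (nontangential (cis \<theta>))" unfolding Q_def by blast+
  define h where "h = (\<lambda>z. \<chi> k. H k z)"
  have "\<exists>C. \<forall>z\<in>ball 0 1. norm (H k z) \<le> C" for k using H(2)[of k] unfolding bounded_iff by auto
  then obtain C where C: "\<And>k z. z \<in> ball 0 1 \<Longrightarrow> norm (H k z) \<le> C k" by metis
  show ?thesis
  proof (rule that[of h])
    have "norm (h z) \<le> (\<Sum>k\<in>UNIV. C k)" if "z \<in> ball 0 1" for z
    proof -
      have "norm (h z) \<le> (\<Sum>k\<in>UNIV. norm (h z $ k))" by (rule norm_vec_le_sum)
      also have "\<dots> \<le> (\<Sum>k\<in>UNIV. C k)" by (rule sum_mono) (use C that in \<open>simp add: h_def\<close>)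
      finally show ?thesis .
    qed
    then have "bounded (h ` unit_disk)" by (intro boundedI[of _ "\<Sum>k\<in>UNIV. C k"]) auto
    then show "h \<in> hol_bounded unit_disk" using H(1) by (simp add: hol_bounded_def vec_holomorphic_on_def h_def)
    show "h 0 = 0" using H(3) by (simp add: h_def vec_eq_iff)
    have "AE \<theta> in ang. \<forall>k. (H k \<longlongrightarrow> \<gamma> \<theta> $ k) (nontangential (cis \<theta>))"
      using H(4) by (simp add: AE_all_countable)
    then show "AE \<theta> in ang. has_bdval h (cis \<theta>) \<and> bdval h (cis \<theta>) = \<gamma> \<theta>"
    proof eventually_elim
      case (elim \<theta>)
      have "(h \<longlongrightarrow> \<gamma> \<theta>) (nontangential (cis \<theta>))"
        unfolding h_def by (rule vec_tendstoI) (use elim in simp)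
      then show ?case using bdval_eqI[of "cis \<theta>" h] by simp
    qed
  qed
qed

section \<open>Essential suprema and densities of functionals\<close>

text \<open>A substitute for \<open>L\<^sup>\<infinity>\<close> without passing to equivalence classes.\<close>

definition bounded_fns :: "(real \<Rightarrow> real) set" where
  "bounded_fns = {x \<in> borel_measurable ang. \<exists>C. AE \<theta> in ang. \<bar>x \<theta>\<bar> \<le> C}"

definition ess_sup :: "(real \<Rightarrow> real) \<Rightarrow> real" where
  "ess_sup x = Inf {c. AE \<theta> in ang. x \<theta> \<le> c}"

lemma bounded_fnsI: "x \<in> borel_measurable ang \<Longrightarrow> (AE \<theta> in ang. \<bar>x \<theta>\<bar> \<le> C) \<Longrightarrow> x \<in> bounded_fns"
  by (auto simp: bounded_fns_def)

lemma bounded_fns_const: "(\<lambda>_. c) \<in> bounded_fns"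
  by (rule bounded_fnsI[of _ "\<bar>c\<bar>"]) auto

lemma bounded_fns_add: "x \<in> bounded_fns \<Longrightarrow> y \<in> bounded_fns \<Longrightarrow> (\<lambda>t. x t + y t) \<in> bounded_fns"
proof -
  assume xy: "x \<in> bounded_fns" "y \<in> bounded_fns"
  then obtain C D where "AE \<theta> in ang. \<bar>x \<theta>\<bar> \<le> C" "AE \<theta> in ang. \<bar>y \<theta>\<bar> \<le> D" by (auto simp: bounded_fns_def)
  then have "AE \<theta> in ang. \<bar>x \<theta> + y \<theta>\<bar> \<le> C + D" by eventually_elim linarith
  then show ?thesis using xy by (intro bounded_fnsI) (auto simp: bounded_fns_def)
qed

lemma bounded_fns_scale: "x \<in> bounded_fns \<Longrightarrow> (\<lambda>t. c * x t) \<in> bounded_fns"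
proof -
  assume x: "x \<in> bounded_fns"
  then obtain C where "AE \<theta> in ang. \<bar>x \<theta>\<bar> \<le> C" by (auto simp: bounded_fns_def)
  then have "AE \<theta> in ang. \<bar>c * x \<theta>\<bar> \<le> \<bar>c\<bar> * C" by eventually_elim (simp add: abs_mult mult_left_mono)
  then show ?thesis using x by (intro bounded_fnsI) (auto simp: bounded_fns_def)
qed

lemma bounded_fns_sum: "finite I \<Longrightarrow> (\<And>i. i \<in> I \<Longrightarrow> x i \<in> bounded_fns) \<Longrightarrow> (\<lambda>t. \<Sum>i\<in>I. x i t) \<in> bounded_fns"
  by (induction I rule: finite_induct) (auto intro: bounded_fns_add bounded_fns_const)

lemma function_space_bounded_fns: "function_space bounded_fns"
  unfolding function_space_def using bounded_fns_const bounded_fns_add bounded_fns_scale by blast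

lemma bounded_fns_integrable: "x \<in> bounded_fns \<Longrightarrow> integrable ang x"
proof -
  assume "x \<in> bounded_fns"
  then obtain C where "x \<in> borel_measurable ang" "AE \<theta> in ang. norm (x \<theta>) \<le> C"
    by (auto simp: bounded_fns_def)
  then show ?thesis by (rule integrable_ang_bounded)
qed

lemma herglotz_add:
  assumes "\<phi> \<in> bounded_fns" "\<xi> \<in> bounded_fns" "norm z < 1"
  shows "herglotz (\<lambda>t. \<phi> t + \<xi> t) z = herglotz \<phi> z + herglotz \<xi> z"
proof -
  obtain C where C: "\<phi> \<in> borel_measurable ang" "AE \<theta> in ang. \<bar>\<phi> \<theta>\<bar> \<le> C" using assms(1) by (auto simp: bounded_fns_def)
  obtain D where D: "\<xi> \<in> borel_measurable ang" "AE \<theta> in ang. \<bar>\<xi> \<theta>\<bar> \<le> D" using assms(2) by (auto simp: bounded_fns_def)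
  obtain E where E: "(\<lambda>t. \<phi> t + \<xi> t) \<in> borel_measurable ang" "AE \<theta> in ang. \<bar>\<phi> \<theta> + \<xi> \<theta>\<bar> \<le> E"
    using bounded_fns_add[OF assms(1,2)] by (auto simp: bounded_fns_def)
  show ?thesis
    unfolding herglotz_integral(2)[OF C assms(3)] herglotz_integral(2)[OF D assms(3)] herglotz_integral(2)[OF E assms(3)]
      of_real_add distrib_right Bochner_Integration.integral_add[OF herglotz_integral(1)[OF C assms(3)] herglotz_integral(1)[OF D assms(3)]]
    by (simp add: distrib_left)
qed

lemma herglotz_scale: "herglotz (\<lambda>t. c * \<phi> t) z = of_real c * herglotz \<phi> z"
proof -
  have "integral\<^sup>L ang (\<lambda>\<theta>. of_real (c * \<phi> \<theta>) / (1 - z * cis (-\<theta>))) = of_real c * integral\<^sup>L ang (\<lambda>\<theta>. of_real (\<phi> \<theta>) / (1 - z * cis (-\<theta>)))"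
    unfolding integral_mult_right_zero[symmetric] by simp
  moreover have "integral\<^sup>L ang (\<lambda>\<theta>. complex_of_real (c * \<phi> \<theta>)) = of_real c * integral\<^sup>L ang (\<lambda>\<theta>. of_real (\<phi> \<theta>))"
    unfolding integral_mult_right_zero[symmetric] by simp
  ultimately show ?thesis unfolding herglotz_def cauchy_transform_def by (simp only:) (simp add: algebra_simps)
qed

lemma herglotz_nonneg:
  assumes "\<phi> \<in> bounded_fns" "\<And>\<theta>. 0 \<le> \<phi> \<theta>" "norm z < 1"
  shows "0 \<le> Re (herglotz \<phi> z)"
proof -
  obtain C where C: "AE \<theta> in ang. \<bar>\<phi> \<theta>\<bar> \<le> C" using assms(1) unfolding bounded_fns_def by blast
  have m: "\<phi> \<in> borel_measurable ang" using assms(1) by (simp add: bounded_fns_def)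
  show ?thesis unfolding Re_herglotz(1)[OF m C assms(3)] poisson_integral_def
    by (intro mult_nonneg_nonneg integral_nonneg_AE AE_I2) (use assms poisson_kernel_nonneg in auto)
qed

lemma bounded_fn_herglotz:
  assumes "\<phi> \<in> bounded_fns"
  shows "herglotz \<phi> holomorphic_on ball 0 1"
    "norm z < 1 \<Longrightarrow> Re (herglotz \<phi> z) = poisson_integral \<phi> z"
    "norm z < 1 \<Longrightarrow> integrable ang (\<lambda>\<theta>. \<phi> \<theta> * poisson_kernel z \<theta>)"
    "norm z < 1 \<Longrightarrow> norm (herglotz \<phi> z) \<le> 3 / (1 - norm z) * integral\<^sup>L ang (\<lambda>\<theta>. \<bar>\<phi> \<theta>\<bar>)"
proof -
  obtain C where C: "AE \<theta> in ang. \<bar>\<phi> \<theta>\<bar> \<le> C" using assms(1) unfolding bounded_fns_def by blast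
  have m: "\<phi> \<in> borel_measurable ang" using assms(1) by (simp add: bounded_fns_def)
  show "herglotz \<phi> holomorphic_on ball 0 1" by (rule herglotz_holomorphic[OF m C])
  show "Re (herglotz \<phi> z) = poisson_integral \<phi> z" if "norm z < 1" by (rule Re_herglotz(1)[OF m C that])
  show "integrable ang (\<lambda>\<theta>. \<phi> \<theta> * poisson_kernel z \<theta>)" if "norm z < 1" by (rule Re_herglotz(2)[OF m C that])
  show "norm (herglotz \<phi> z) \<le> 3 / (1 - norm z) * integral\<^sup>L ang (\<lambda>\<theta>. \<bar>\<phi> \<theta>\<bar>)" if "norm z < 1"
    by (rule norm_herglotz_le[OF m C that])
qed

lemma bounded_fns_bdd_below:
  assumes "x \<in> bounded_fns" shows "bdd_below {c. AE \<theta> in ang. x \<theta> \<le> c}"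
proof -
  obtain C where C: "AE \<theta> in ang. \<bar>x \<theta>\<bar> \<le> C" using assms by (auto simp: bounded_fns_def)
  show ?thesis
  proof (rule bdd_belowI[of _ "- C"])
    fix c assume "c \<in> {c. AE \<theta> in ang. x \<theta> \<le> c}"
    then have "AE \<theta> in ang. x \<theta> \<le> c" by simp
    with C have ae: "AE \<theta> in ang. - C \<le> c" by eventually_elim linarith
    show "- C \<le> c"
    proof (rule ccontr)
      assume "\<not> - C \<le> c"
      then show False using ae ang_not_AE_False by simp
    qed
  qed
qed

lemma ess_sup_le: "x \<in> bounded_fns \<Longrightarrow> (AE \<theta> in ang. x \<theta> \<le> c) \<Longrightarrow> ess_sup x \<le> c"
  unfolding ess_sup_def by (rule cInf_lower[OF _ bounded_fns_bdd_below]) auto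

lemma ess_sup_AE:
  assumes "x \<in> bounded_fns" "ess_sup x < c" shows "AE \<theta> in ang. x \<theta> \<le> c"
proof -
  obtain C where "AE \<theta> in ang. \<bar>x \<theta>\<bar> \<le> C" using assms(1) by (auto simp: bounded_fns_def)
  then have "AE \<theta> in ang. x \<theta> \<le> C" by eventually_elim auto
  then have "{c. AE \<theta> in ang. x \<theta> \<le> c} \<noteq> {}" by auto
  from cInf_lessD[OF this assms(2)[unfolded ess_sup_def]]
  obtain d where "d < c" "AE \<theta> in ang. x \<theta> \<le> d" by auto
  from this(2) show ?thesis by eventually_elim (use \<open>d < c\<close> in linarith)
qed

lemma sublinear_ess_sup: "sublinear_on bounded_fns ess_sup"
  unfolding sublinear_on_def
proof (intro conjI ballI allI impI)
  fix x y assume xy: "x \<in> bounded_fns" "y \<in> bounded_fns"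
  show "ess_sup (\<lambda>t. x t + y t) \<le> ess_sup x + ess_sup y"
  proof (rule field_le_epsilon)
    fix e :: real assume e: "e > 0"
    have "AE \<theta> in ang. x \<theta> \<le> ess_sup x + e / 2" "AE \<theta> in ang. y \<theta> \<le> ess_sup y + e / 2"
      using ess_sup_AE xy e by auto
    then have "AE \<theta> in ang. x \<theta> + y \<theta> \<le> ess_sup x + ess_sup y + e" by eventually_elim linarith
    then show "ess_sup (\<lambda>t. x t + y t) \<le> ess_sup x + ess_sup y + e"
      by (rule ess_sup_le[OF bounded_fns_add[OF xy]])
  qed
next
  fix c :: real and x assume c: "c > 0" and x: "x \<in> bounded_fns"
  show "ess_sup (\<lambda>t. c * x t) \<le> c * ess_sup x"
  proof (rule field_le_epsilon)
    fix e :: real assume e: "e > 0"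
    have "AE \<theta> in ang. x \<theta> \<le> ess_sup x + e / c" using ess_sup_AE[OF x] e c by auto
    then have "AE \<theta> in ang. c * x \<theta> \<le> c * ess_sup x + e"
    proof eventually_elim
      case (elim \<theta>)
      then have "c * x \<theta> \<le> c * (ess_sup x + e / c)" using c by (intro mult_left_mono) auto
      then show ?case using c by (simp add: distrib_left)
    qed
    then show "ess_sup (\<lambda>t. c * x t) \<le> c * ess_sup x + e"
      by (rule ess_sup_le[OF bounded_fns_scale[OF x]])
  qed
qed

lemma indicator_bounded_fns: "A \<in> sets ang \<Longrightarrow> indicat_real A \<in> bounded_fns"
  by (rule bounded_fnsI[of _ 1]) (auto simp: indicator_def)

lemma linear_form_sum:
  assumes l: "linear_form_on V l" and V: "function_space V" and I: "finite I" and x: "\<And>i. i \<in> I \<Longrightarrow> x i \<in> V"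
  shows "l (\<lambda>t. \<Sum>i\<in>I. c i * x i t) = (\<Sum>i\<in>I. c i * l (x i)) \<and> (\<lambda>t. \<Sum>i\<in>I. c i * x i t) \<in> V"
  using I x
proof (induction I rule: finite_induct)
  case empty
  have z: "(\<lambda>_. 0) \<in> V" using V by (simp add: function_space_def)
  then show ?case using linear_form_on_scale[OF l z, of 0] by simp
next
  case (insert i I)
  have ci: "(\<lambda>t. c i * x i t) \<in> V" by (rule function_space_scale[OF V]) (use insert.prems in auto)
  have IH: "l (\<lambda>t. \<Sum>i\<in>I. c i * x i t) = (\<Sum>i\<in>I. c i * l (x i))" "(\<lambda>t. \<Sum>i\<in>I. c i * x i t) \<in> V"
    using insert.IH insert.prems by auto
  have "l (\<lambda>t. c i * x i t + (\<Sum>i\<in>I. c i * x i t)) = l (\<lambda>t. c i * x i t) + l (\<lambda>t. \<Sum>i\<in>I. c i * x i t)"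
    by (rule linear_form_on_add[OF l ci IH(2)])
  moreover have "l (\<lambda>t. c i * x i t) = c i * l (x i)"
    using linear_form_on_scale[OF l, of "x i" "c i"] insert.prems by simp
  ultimately show ?case using insert.hyps IH function_space_add[OF V ci IH(2)] by simp
qed

text \<open>A linear form below the essential supremum is positive, but in general only finitely additive on
  indicators.  The integral bound makes it countably additive and absolutely continuous, so that the
  Radon-Nikodym theorem applies; the bound carries over to the density.  The representation extends from
  step functions to all bounded functions by uniform approximation.\<close>

lemma dominated_functional_density:
  assumes l: "linear_form_on bounded_fns l" and p: "\<And>x. x \<in> bounded_fns \<Longrightarrow> l x \<le> ess_sup x"
    and C: "\<And>\<phi>. \<phi> \<in> bounded_fns \<Longrightarrow> (\<And>\<theta>. 0 \<le> \<phi> \<theta>) \<Longrightarrow> l \<phi> \<le> C * integral\<^sup>L ang \<phi>"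
  obtains \<rho> where "\<rho> \<in> borel_measurable borel" "AE \<theta> in ang. 0 \<le> \<rho> \<theta> \<and> \<rho> \<theta> \<le> C"
    "\<And>x. x \<in> bounded_fns \<Longrightarrow> l x = integral\<^sup>L ang (\<lambda>\<theta>. \<rho> \<theta> * x \<theta>)"
proof -
  have ladd: "l (\<lambda>t. x t + y t) = l x + l y" if "x \<in> bounded_fns" "y \<in> bounded_fns" for x y
    by (rule linear_form_on_add[OF l that])
  have lsc: "l (\<lambda>t. c * x t) = c * l x" if "x \<in> bounded_fns" for x c
    by (rule linear_form_on_scale[OF l that])
  have lpos: "0 \<le> l x" if "x \<in> bounded_fns" "AE \<theta> in ang. 0 \<le> x \<theta>" for x
  proof -
    have "l (\<lambda>t. (-1) * x t) \<le> ess_sup (\<lambda>t. (-1) * x t)" by (rule p[OF bounded_fns_scale[OF that(1)]])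
    also have "\<dots> \<le> 0" by (rule ess_sup_le[OF bounded_fns_scale[OF that(1)]]) (use that(2) in simp)
    finally show ?thesis unfolding lsc[OF that(1)] by simp
  qed
  define \<mu> where "\<mu> = (\<lambda>A. ennreal (l (indicat_real A)))"
  define N where "N = measure_of (space ang) (sets ang) \<mu>"
  have indpos: "0 \<le> l (indicat_real A)" if "A \<in> sets ang" for A
    by (rule lpos[OF indicator_bounded_fns[OF that]]) auto
  interpret fm: finite_measure ang by (rule finite_measure_ang)
  have indC: "l (indicat_real A) \<le> C * measure ang A" if "A \<in> sets ang" for A
    using C[OF indicator_bounded_fns[OF that]] sets.sets_into_space[OF that] by (simp add: Int_absorb2)
  have inull: "l (indicat_real {}) = 0"
    using indC[of "{}"] indpos[of "{}"] by simp
  have ca: "countably_additive (sets ang) \<mu>"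
  proof (rule sets.empty_continuous_imp_countably_additive)
    show "positive (sets ang) \<mu>" unfolding positive_def \<mu>_def using inull by simp
    show "additive (sets ang) \<mu>"
      unfolding additive_def \<mu>_def
    proof (intro ballI impI)
      fix A B assume A: "A \<in> sets ang" and B: "B \<in> sets ang" and d: "A \<inter> B = {}"
      have "indicat_real (A \<union> B) = (\<lambda>t. indicat_real A t + indicat_real B t)"
        using d by (auto simp: indicator_def fun_eq_iff)
      then show "ennreal (l (indicat_real (A \<union> B))) = ennreal (l (indicat_real A)) + ennreal (l (indicat_real B))"
        using ladd[OF indicator_bounded_fns[OF A] indicator_bounded_fns[OF B]] indpos A B
        by (simp add: ennreal_plus)
    qed
    show "\<forall>A\<in>sets ang. \<mu> A \<noteq> \<infinity>" by (simp add: \<mu>_def)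
    fix A :: "nat \<Rightarrow> real set" assume A: "range A \<subseteq> sets ang" "decseq A" "(\<Inter>i. A i) = {}"
    have "(\<lambda>i. measure ang (A i)) \<longlonglongrightarrow> measure ang (\<Inter>i. A i)"
      by (rule fm.finite_Lim_measure_decseq[OF A(1,2)])
    then have "(\<lambda>i. C * measure ang (A i)) \<longlonglongrightarrow> C * 0" unfolding A(3) by (intro tendsto_intros) simp
    then have c0: "(\<lambda>i. C * measure ang (A i)) \<longlonglongrightarrow> 0" by simp
    have "(\<lambda>i. l (indicat_real (A i))) \<longlonglongrightarrow> 0"
      by (rule tendsto_sandwich[OF _ _ tendsto_const c0]) (use indpos indC A(1) in \<open>auto intro!: always_eventually\<close>)
    then show "(\<lambda>i. \<mu> (A i)) \<longlonglongrightarrow> 0" unfolding \<mu>_def using tendsto_ennrealI by fastforce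
  qed
  have Nsets: "sets N = sets ang" and Nspace: "space N = space ang"
    unfolding N_def by (rule sets.sets_measure_of_eq, rule sets.space_measure_of_eq)
  have emN: "emeasure N A = \<mu> A" if "A \<in> sets ang" for A
  proof -
    have "positive (sets N) \<mu>" unfolding positive_def \<mu>_def using inull by simp
    then show ?thesis
      using emeasure_measure_of[OF N_def] that ca sets.space_closed[of ang] by (simp add: Nsets)
  qed
  have "absolutely_continuous ang N"
    unfolding absolutely_continuous_def
  proof
    fix A assume A: "A \<in> null_sets ang"
    then have "l (indicat_real A) \<le> 0" using indC[of A] by (auto simp: measure_def null_sets_def)
    then show "A \<in> null_sets N" using A emN[of A] Nsets by (auto simp: null_sets_def \<mu>_def ennreal_neg)
  qed
  then obtain r where r: "r \<in> borel_measurable ang" "density ang r = N"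
    using fm.Radon_Nikodym[OF _ Nsets] by blast
  have rint: "(\<integral>\<^sup>+ \<theta>. r \<theta> * indicator A \<theta> \<partial>ang) = ennreal (l (indicat_real A))" if "A \<in> sets ang" for A
    using emeasure_density[OF r(1) that] emN[OF that] r(2) by (simp add: \<mu>_def)
  have "(\<integral>\<^sup>+ \<theta>. r \<theta> \<partial>ang) \<noteq> \<infinity>"
  proof -
    have "(\<integral>\<^sup>+ \<theta>. r \<theta> \<partial>ang) = (\<integral>\<^sup>+ \<theta>. r \<theta> * indicator (space ang) \<theta> \<partial>ang)"
      by (rule nn_integral_cong) (simp add: indicator_def)
    then show ?thesis using rint[OF sets.top] by simp
  qed
  then have rfin: "AE \<theta> in ang. r \<theta> \<noteq> \<infinity>" by (rule nn_integral_PInf_AE[OF r(1)])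
  define R where "R = (\<lambda>\<theta>. enn2real (r \<theta>))"
  have Rm: "R \<in> borel_measurable ang" unfolding R_def using r(1) by measurable
  have Rr: "AE \<theta> in ang. ennreal (R \<theta>) = r \<theta>" using rfin by eventually_elim (simp add: R_def less_top)
  have R0: "0 \<le> R \<theta>" for \<theta> by (simp add: R_def)
  have Rind: "integrable ang (\<lambda>\<theta>. R \<theta> * indicat_real A \<theta>) \<and> integral\<^sup>L ang (\<lambda>\<theta>. R \<theta> * indicat_real A \<theta>) = l (indicat_real A)" if A: "A \<in> sets ang" for A
  proof -
    have "(\<integral>\<^sup>+ \<theta>. ennreal (R \<theta> * indicat_real A \<theta>) \<partial>ang) = (\<integral>\<^sup>+ \<theta>. r \<theta> * indicator A \<theta> \<partial>ang)"
      by (rule nn_integral_cong_AE) (use Rr in \<open>eventually_elim, auto simp: indicator_def\<close>)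
    then have "(\<integral>\<^sup>+ \<theta>. ennreal (R \<theta> * indicat_real A \<theta>) \<partial>ang) = ennreal (l (indicat_real A))" using rint[OF A] by simp
    then have "has_bochner_integral ang (\<lambda>\<theta>. R \<theta> * indicat_real A \<theta>) (l (indicat_real A))"
      by (intro has_bochner_integral_nn_integral) (use Rm A R0 indpos in auto)
    then show ?thesis by (simp add: has_bochner_integral_iff)
  qed
  have RC: "AE \<theta> in ang. R \<theta> \<le> C"
  proof -
    define T where "T = {\<theta> \<in> space ang. C < R \<theta>}"
    have T: "T \<in> sets ang" unfolding T_def using Rm by measurable
    have i: "integrable ang (\<lambda>\<theta>. R \<theta> * indicat_real T \<theta> - C * indicat_real T \<theta>)"
      by (rule Bochner_Integration.integrable_diff[OF conjunct1[OF Rind[OF T]]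
          integrable_mult_right[OF bounded_fns_integrable[OF indicator_bounded_fns[OF T]]]])
    have "integral\<^sup>L ang (\<lambda>\<theta>. R \<theta> * indicat_real T \<theta> - C * indicat_real T \<theta>) = l (indicat_real T) - C * measure ang T"
      using Rind[OF T] bounded_fns_integrable[OF indicator_bounded_fns[OF T]] sets.sets_into_space[OF T]
      by (subst Bochner_Integration.integral_diff) (auto simp: Int_absorb2)
    then have le0: "integral\<^sup>L ang (\<lambda>\<theta>. R \<theta> * indicat_real T \<theta> - C * indicat_real T \<theta>) \<le> 0" using indC[OF T] by simp
    have nn: "AE \<theta> in ang. 0 \<le> R \<theta> * indicat_real T \<theta> - C * indicat_real T \<theta>"
      by (intro AE_I2) (auto simp: T_def indicator_def)
    have "AE \<theta> in ang. R \<theta> * indicat_real T \<theta> - C * indicat_real T \<theta> = 0"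
      using integral_nonneg_eq_0_iff_AE[OF i nn] le0 integral_nonneg_AE[OF nn] by simp
    then show ?thesis using AE_space by eventually_elim (auto simp: T_def indicator_def split: if_splits)
  qed
  obtain \<rho> where \<rho>: "\<rho> \<in> borel_measurable borel" "AE \<theta> in ang. R \<theta> = \<rho> \<theta>"
  proof -
    have "(\<lambda>\<theta>. indicator {0..2*pi} \<theta> *\<^sub>R R \<theta>) \<in> borel_measurable lebesgue"
      using Rm by (subst (asm) borel_measurable_restrict_space_iff) auto
    then obtain \<rho> where \<rho>: "\<rho> \<in> borel_measurable lborel" "AE x in lborel. indicator {0..2*pi} x *\<^sub>R R x = \<rho> x"
      using completion_ex_borel_measurable_real by blast
    have "AE \<theta> in ang. R \<theta> = \<rho> \<theta>" unfolding AE_ang_iff using \<rho>(2) by eventually_elim auto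
    then show ?thesis using that \<rho>(1) by auto
  qed
  have \<rho>m: "\<rho> \<in> borel_measurable ang" by (rule borel_imp_ang[OF \<rho>(1)])
  have \<rho>b: "AE \<theta> in ang. 0 \<le> \<rho> \<theta> \<and> \<rho> \<theta> \<le> C"
    using \<rho>(2) RC by eventually_elim (use R0 in metis)
  have \<rho>x: "integrable ang (\<lambda>\<theta>. \<rho> \<theta> * x \<theta>)" if x: "x \<in> bounded_fns" for x
  proof -
    obtain D where D: "AE \<theta> in ang. \<bar>x \<theta>\<bar> \<le> D" using x by (auto simp: bounded_fns_def)
    have "AE \<theta> in ang. norm (\<rho> \<theta> * x \<theta>) \<le> C * D"
      using \<rho>b D by eventually_elim (auto simp: abs_mult intro!: mult_mono)
    then show ?thesis by (rule integrable_ang_bounded[rotated]) (use \<rho>m x in \<open>auto simp: bounded_fns_def\<close>)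
  qed
  have \<rho>ind: "l (indicat_real A) = integral\<^sup>L ang (\<lambda>\<theta>. \<rho> \<theta> * indicat_real A \<theta>)" if A: "A \<in> sets ang" for A
  proof -
    have "integral\<^sup>L ang (\<lambda>\<theta>. R \<theta> * indicat_real A \<theta>) = integral\<^sup>L ang (\<lambda>\<theta>. \<rho> \<theta> * indicat_real A \<theta>)"
      by (rule integral_cong_AE) (use Rm \<rho>m A \<rho>(2) in auto)
    then show ?thesis using Rind[OF A] by simp
  qed
  have C0: "0 \<le> C"
  proof (rule ccontr)
    assume "\<not> 0 \<le> C"
    then have "AE \<theta> in ang. False" using \<rho>b by (auto elim: eventually_mono)
    then show False using ang_not_AE_False by simp
  qed
  have "l x = integral\<^sup>L ang (\<lambda>\<theta>. \<rho> \<theta> * x \<theta>)" if x: "x \<in> bounded_fns" for x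
  proof -
    define \<Lambda> where "\<Lambda> = (\<lambda>y. l y - integral\<^sup>L ang (\<lambda>\<theta>. \<rho> \<theta> * y \<theta>))"
    have \<Lambda>small: "\<bar>\<Lambda> y\<bar> \<le> (1 + C * (2*pi)) * c" if y: "y \<in> bounded_fns" and c: "AE \<theta> in ang. \<bar>y \<theta>\<bar> \<le> c" for y c
    proof -
      have "l y \<le> c" by (rule order_trans[OF p[OF y] ess_sup_le[OF y]]) (use c in \<open>auto elim: eventually_mono\<close>)
      moreover have "l (\<lambda>t. (-1) * y t) \<le> c"
      proof (rule order_trans[OF p ess_sup_le])
        show "(\<lambda>t. (-1) * y t) \<in> bounded_fns" by (rule bounded_fns_scale[OF y])
        then show "(\<lambda>t. (-1) * y t) \<in> bounded_fns" .
        show "AE \<theta> in ang. (-1) * y \<theta> \<le> c" using c by eventually_elim simp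
      qed
      moreover have "\<bar>integral\<^sup>L ang (\<lambda>\<theta>. \<rho> \<theta> * y \<theta>)\<bar> \<le> C * c * (2*pi)"
      proof -
        have "\<bar>integral\<^sup>L ang (\<lambda>\<theta>. \<rho> \<theta> * y \<theta>)\<bar> \<le> integral\<^sup>L ang (\<lambda>\<theta>. \<bar>\<rho> \<theta> * y \<theta>\<bar>)" by (rule integral_abs_bound)
        also have "\<dots> \<le> integral\<^sup>L ang (\<lambda>\<theta>. C * c)"
        proof (rule integral_mono_AE)
          show "integrable ang (\<lambda>\<theta>. \<bar>\<rho> \<theta> * y \<theta>\<bar>)" using \<rho>x[OF y] by (rule integrable_abs)
          show "AE \<theta> in ang. \<bar>\<rho> \<theta> * y \<theta>\<bar> \<le> C * c"
            using \<rho>b c by eventually_elim (auto simp: abs_mult intro!: mult_mono)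
        qed simp
        also have "\<dots> = C * c * (2*pi)" by (simp add: measure_ang)
        finally show ?thesis .
      qed
      ultimately show ?thesis unfolding \<Lambda>_def lsc[OF y] by (simp add: algebra_simps abs_le_iff)
    qed
    have \<Lambda>add: "\<Lambda> (\<lambda>t. y t + z t) = \<Lambda> y + \<Lambda> z" if "y \<in> bounded_fns" "z \<in> bounded_fns" for y z
      using ladd[OF that] Bochner_Integration.integral_add[OF \<rho>x[OF that(1)] \<rho>x[OF that(2)]]
      by (simp add: \<Lambda>_def algebra_simps)
    obtain D where D: "AE \<theta> in ang. \<bar>x \<theta>\<bar> \<le> D" using x unfolding bounded_fns_def by blast
    have xm: "x \<in> borel_measurable ang" using x by (auto simp: bounded_fns_def)
    have le: "\<bar>\<Lambda> x\<bar> \<le> (1 + C * (2*pi)) * e" if e: "e > 0" for e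
    proof -
      \<comment> \<open>The values of \<open>x\<close> are rounded down to multiples of \<open>e\<close>; the range \<open>J\<close> covers all values that occur almost everywhere.\<close>
      define J where "J = {-\<lceil>D/e\<rceil> - 1..\<lceil>D/e\<rceil> + 1}"
      define A where "A = (\<lambda>j::int. {\<theta> \<in> space ang. \<lfloor>x \<theta> / e\<rfloor> = j})"
      have A: "A j \<in> sets ang" for j unfolding A_def using xm by measurable
      define y where "y = (\<lambda>t. \<Sum>j\<in>J. (of_int j * e) * indicat_real (A j) t)"
      have ly: "l y = (\<Sum>j\<in>J. (of_int j * e) * l (indicat_real (A j)))" "y \<in> bounded_fns"
        using linear_form_sum[OF l function_space_bounded_fns, of J "\<lambda>j. indicat_real (A j)" "\<lambda>j. of_int j * e"]
          indicator_bounded_fns[OF A] by (auto simp: y_def J_def)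
      have "integral\<^sup>L ang (\<lambda>\<theta>. \<rho> \<theta> * y \<theta>) = integral\<^sup>L ang (\<lambda>\<theta>. \<Sum>j\<in>J. (of_int j * e) * (\<rho> \<theta> * indicat_real (A j) \<theta>))"
        by (simp add: y_def sum_distrib_left mult_ac)
      also have "\<dots> = (\<Sum>j\<in>J. (of_int j * e) * integral\<^sup>L ang (\<lambda>\<theta>. \<rho> \<theta> * indicat_real (A j) \<theta>))"
        using \<rho>x[OF indicator_bounded_fns[OF A]] by (subst Bochner_Integration.integral_sum) auto
      finally have y0: "\<Lambda> y = 0" unfolding \<Lambda>_def ly(1) using \<rho>ind[OF A] by simp
      have "AE \<theta> in ang. \<bar>x \<theta> + (-1) * y \<theta>\<bar> \<le> e"
        using D AE_space
      proof eventually_elim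
        case (elim \<theta>)
        define j where "j = \<lfloor>x \<theta> / e\<rfloor>"
        have "- (D / e) \<le> x \<theta> / e" "x \<theta> / e \<le> D / e" using elim(1) e by (auto simp: field_simps abs_le_iff)
        then have "j \<in> J" unfolding J_def j_def by (auto simp: floor_le_iff le_floor_iff) linarith+
        have "y \<theta> = (\<Sum>i\<in>J. if i = j then of_int j * e else 0)"
          unfolding y_def by (rule sum.cong) (use elim(2) in \<open>auto simp: A_def j_def indicator_def\<close>)
        also have "\<dots> = of_int j * e" using \<open>j \<in> J\<close> by (simp add: J_def)
        finally have "y \<theta> = of_int j * e" .
        moreover have "of_int j \<le> x \<theta> / e" "x \<theta> / e < of_int j + 1" unfolding j_def by linarith+
        then have "of_int j * e \<le> x \<theta>" "x \<theta> < of_int j * e + e" using e by (auto simp: field_simps)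
        ultimately show ?case by simp
      qed
      then have "\<bar>\<Lambda> (\<lambda>t. x t + (-1) * y t)\<bar> \<le> (1 + C * (2*pi)) * e"
        by (intro \<Lambda>small bounded_fns_add x bounded_fns_scale ly)
      moreover have "\<Lambda> (\<lambda>t. (-1) * y t) = 0"
        using y0 lsc[OF ly(2), of "-1"] by (simp add: \<Lambda>_def)
      ultimately show ?thesis using \<Lambda>add[OF x bounded_fns_scale[OF ly(2)], of "-1"] by simp
    qed
    have "\<bar>\<Lambda> x\<bar> \<le> 0 + d" if d: "d > 0" for d
    proof -
      have K: "0 < 1 + C * (2*pi)" using C0 by (simp add: add_pos_nonneg)
      show ?thesis using le[of "d / (1 + C * (2*pi))"] K d by simp
    qed
    then have "\<bar>\<Lambda> x\<bar> \<le> 0" by (rule field_le_epsilon)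
    then show ?thesis by (simp add: \<Lambda>_def)
  qed
  with \<rho>(1) \<rho>b show ?thesis using that by blast
qed

section \<open>The disc algebra and its annihilator\<close>

lemma vec_holomorphic_mult:
  assumes "vec_holomorphic_on F A" "vec_holomorphic_on H A"
  shows "vec_holomorphic_on (\<lambda>z. F z * H z) A"
  using assms by (auto simp: vec_holomorphic_on_def intro!: holomorphic_intros)

lemma vec_holomorphic_add:
  assumes "vec_holomorphic_on F A" "vec_holomorphic_on H A"
  shows "vec_holomorphic_on (\<lambda>z. F z + H z) A"
  using assms by (auto simp: vec_holomorphic_on_def intro!: holomorphic_intros)

lemma vec_holomorphic_scale:
  assumes "vec_holomorphic_on F A"
  shows "vec_holomorphic_on (\<lambda>z. c *\<^sub>R F z) A"
  using assms by (simp add: vec_holomorphic_on_def scaleR_conv_of_real[of c] holomorphic_on_mult holomorphic_on_const)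

lemma mult_scaleR_vec: "(x :: complex ^ 'm) * (c *\<^sub>R y) = c *\<^sub>R (x * y)"
  by (simp add: vec_eq_iff)

lemma tendsto_vec_mult:
  fixes F H :: "'b \<Rightarrow> complex ^ 'm"
  assumes "(F \<longlongrightarrow> x) net" "(H \<longlongrightarrow> y) net"
  shows "((\<lambda>z. F z * H z) \<longlongrightarrow> x * y) net"
  by (rule vec_tendstoI) (use assms in \<open>auto intro!: tendsto_intros\<close>)

abbreviation disk_algebra :: "(complex \<Rightarrow> complex ^ 'n::finite) set" where
  "disk_algebra \<equiv> hol_cont_closure unit_disk"

lemma disk_algebra_iff: "h \<in> disk_algebra \<longleftrightarrow> vec_holomorphic_on h (ball 0 1) \<and> continuous_on (cball 0 1) h"
  by (simp add: hol_cont_closure_def)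

lemma disk_algebra_add: "h \<in> disk_algebra \<Longrightarrow> k \<in> disk_algebra \<Longrightarrow> (\<lambda>z. h z + k z) \<in> disk_algebra"
  by (auto simp: disk_algebra_iff vec_holomorphic_on_def intro!: holomorphic_intros continuous_intros)

lemma disk_algebra_scale: "h \<in> disk_algebra \<Longrightarrow> (\<lambda>z. c *\<^sub>R h z) \<in> disk_algebra"
proof -
  assume h: "h \<in> disk_algebra"
  have "(\<lambda>z. (c *\<^sub>R h z) $ k) holomorphic_on ball 0 1" for k
    using h by (simp add: disk_algebra_iff vec_holomorphic_on_def scaleR_conv_of_real[of c] holomorphic_on_mult holomorphic_on_const)
  moreover have "continuous_on (cball 0 1) (\<lambda>z. c *\<^sub>R h z)"
    using h by (intro continuous_intros) (simp add: disk_algebra_iff)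
  ultimately show ?thesis by (simp add: disk_algebra_iff vec_holomorphic_on_def)
qed

lemma disk_algebra_zero: "(\<lambda>z. 0) \<in> disk_algebra"
  by (auto simp: disk_algebra_iff vec_holomorphic_on_def)

lemma disk_algebra_sum: "finite I \<Longrightarrow> (\<And>i. i \<in> I \<Longrightarrow> h i \<in> disk_algebra) \<Longrightarrow> (\<lambda>z. \<Sum>i\<in>I. c i *\<^sub>R h i z) \<in> disk_algebra"
  by (induction I rule: finite_induct) (auto intro!: disk_algebra_add disk_algebra_scale disk_algebra_zero)

lemma continuous_on_axis: "continuous_on A f \<Longrightarrow> continuous_on A (\<lambda>z. axis k (f z :: complex) :: complex ^ 'n::finite)"
proof -
  assume f: "continuous_on A f"
  have "continuous_on A (\<lambda>z. if i = k then f z else 0)" for i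
    using f by (cases "i = k") auto
  then show ?thesis unfolding axis_def by (intro continuous_on_vec_lambda)
qed

lemma norm_axis_complex: "norm (axis k c :: complex ^ 'n::finite) = norm c"
proof -
  have "(\<Sum>i\<in>UNIV. (norm ((axis k c :: complex ^ 'n) $ i))\<^sup>2) = (\<Sum>i\<in>UNIV. if i = k then (norm c)\<^sup>2 else 0)"
    by (rule sum.cong) (auto simp: axis_def)
  then show ?thesis by (simp add: norm_vec_def L2_set_def)
qed

lemma disk_algebra_monomial:
  fixes k :: "'n::finite"
  shows "(\<lambda>z. axis k (\<alpha> * z ^ m)) \<in> disk_algebra"
proof -
  have "(\<lambda>z. (axis k (\<alpha> * z ^ m) :: complex ^ 'n) $ i) holomorphic_on ball 0 1" for i
    by (cases "i = k") (auto simp: axis_def intro!: holomorphic_intros)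
  moreover have "continuous_on (cball 0 1) (\<lambda>z. axis k (\<alpha> * z ^ m) :: complex ^ 'n)"
    by (intro continuous_on_axis continuous_intros)
  ultimately show ?thesis by (auto simp: disk_algebra_iff vec_holomorphic_on_def)
qed

lemma disk_algebra_bounded:
  assumes "h \<in> disk_algebra"
  obtains B where "0 \<le> B" "\<And>z. norm z \<le> 1 \<Longrightarrow> norm (h z) \<le> B"
  using assms continuous_bounded_on_compact[OF compact_cball, of 0 1 h] by (auto simp: disk_algebra_iff)

lemma sup_norm_le: "(\<And>z. norm z < 1 \<Longrightarrow> norm (h z) \<le> B) \<Longrightarrow> sup_norm_on unit_disk h \<le> B"
  unfolding sup_norm_on_def by (rule cSUP_least) auto

lemma norm_le_sup_norm:
  assumes h: "h \<in> disk_algebra" and z: "norm z \<le> 1"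
  shows "norm (h z) \<le> sup_norm_on unit_disk h"
proof -
  obtain B where B: "\<And>z. norm z \<le> 1 \<Longrightarrow> norm (h z) \<le> B" using disk_algebra_bounded[OF h] by blast
  have bdd: "bdd_above ((\<lambda>z. norm (h z)) ` unit_disk)" using B by (intro bdd_aboveI[of _ B]) auto
  have le: "norm (h x) \<le> sup_norm_on unit_disk h" if "norm x < 1" for x
    unfolding sup_norm_on_def by (rule cSUP_upper[OF _ bdd]) (use that in simp)
  have hc: "continuous_on (cball 0 1) h" using h by (simp add: disk_algebra_iff)
  have n: "norm (of_real (rad m) * z) < 1" for m
    by (rule norm_rad_mult_less[OF z])
  have "(\<lambda>m. of_real (rad m) * z) \<longlonglongrightarrow> of_real 1 * z" by (intro tendsto_intros rad_tendsto)
  then have "(\<lambda>m. h (of_real (rad m) * z)) \<longlonglongrightarrow> h z"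
    by (intro continuous_on_tendsto_compose[OF hc]) (use n z in \<open>auto intro!: always_eventually less_imp_le\<close>)
  then have "(\<lambda>m. norm (h (of_real (rad m) * z))) \<longlonglongrightarrow> norm (h z)" by (rule tendsto_norm)
  then show ?thesis by (rule LIMSEQ_le_const2) (use le n in blast)
qed

lemma norm_vec_mult_le: "norm (a * b :: complex ^ 'n::finite) \<le> norm a * norm b"
proof -
  have "norm (a * b) = L2_set (\<lambda>k. norm (a $ k) * norm (b $ k)) UNIV" by (simp add: norm_vec_def norm_mult)
  also have "\<dots> \<le> L2_set (\<lambda>k. norm a * norm (b $ k)) UNIV"
    by (rule L2_set_mono) (auto intro!: mult_right_mono simp: Finite_Cartesian_Product.norm_nth_le)
  also have "\<dots> = norm a * norm b" by (simp add: norm_vec_def L2_set_right_distrib)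
  finally show ?thesis .
qed

lemma bullet_simps:
  fixes a b c :: "complex ^ 'n::finite"
  shows "a \<bullet>\<^sub>c (b + c) = a \<bullet>\<^sub>c b + a \<bullet>\<^sub>c c" "(a + b) \<bullet>\<^sub>c c = a \<bullet>\<^sub>c c + b \<bullet>\<^sub>c c"
    "(a - b) \<bullet>\<^sub>c c = a \<bullet>\<^sub>c c - b \<bullet>\<^sub>c c"
    "a \<bullet>\<^sub>c (r *\<^sub>R b) = r *\<^sub>R (a \<bullet>\<^sub>c b)" "(r *\<^sub>R a) \<bullet>\<^sub>c b = r *\<^sub>R (a \<bullet>\<^sub>c b)"
    "a \<bullet>\<^sub>c axis k x = a $ k * x" "a \<bullet>\<^sub>c (b * c) = (b * a) \<bullet>\<^sub>c c" "(a * b) \<bullet>\<^sub>c c = (c * a) \<bullet>\<^sub>c b"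
    "a \<bullet>\<^sub>c 0 = 0" "0 \<bullet>\<^sub>c a = 0"
  by (simp_all add: bullet_def sum.distrib sum_subtractf algebra_simps scaleR_sum_right axis_def if_distrib[of "\<lambda>x. _ * x"] cong: if_cong)

lemma bullet_sum: "(\<Sum>i\<in>I. a i) \<bullet>\<^sub>c c = (\<Sum>i\<in>I. a i \<bullet>\<^sub>c c)" "c \<bullet>\<^sub>c (\<Sum>i\<in>I. a i) = (\<Sum>i\<in>I. c \<bullet>\<^sub>c a i)"
  by (induction I rule: infinite_finite_induct) (auto simp: bullet_simps)

lemma vec_measurableI:
  fixes F :: "real \<Rightarrow> complex ^ 'n::finite"
  assumes "\<And>k. (\<lambda>\<theta>. F \<theta> $ k) \<in> borel_measurable ang"
  shows "F \<in> borel_measurable ang"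
  unfolding borel_measurable_euclidean_space[of F]
proof
  fix i :: "complex ^ 'n::finite" assume "i \<in> Basis"
  have "(\<lambda>\<theta>. \<Sum>k\<in>UNIV. F \<theta> $ k \<bullet> i $ k) \<in> borel_measurable ang"
    using assms by (intro borel_measurable_sum borel_measurable_inner) auto
  then show "(\<lambda>\<theta>. F \<theta> \<bullet> i) \<in> borel_measurable ang" by (simp add: inner_vec_def)
qed

lemma vec_mult_measurable:
  fixes X Y :: "real \<Rightarrow> complex ^ 'n::finite"
  assumes "X \<in> borel_measurable ang" "Y \<in> borel_measurable ang"
  shows "(\<lambda>\<theta>. X \<theta> * Y \<theta>) \<in> borel_measurable ang"
proof (rule vec_measurableI)
  fix k
  have c: "(\<lambda>x :: complex ^ 'n. x $ k) \<in> borel_measurable borel"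
    by (intro borel_measurable_continuous_onI continuous_intros)
  show "(\<lambda>\<theta>. (X \<theta> * Y \<theta>) $ k) \<in> borel_measurable ang"
    using measurable_compose[OF assms(1) c] measurable_compose[OF assms(2) c] by simp
qed

lemma bullet_measurable:
  fixes X Y :: "real \<Rightarrow> complex ^ 'n::finite"
  assumes "X \<in> borel_measurable ang" "Y \<in> borel_measurable ang"
  shows "(\<lambda>\<theta>. X \<theta> \<bullet>\<^sub>c Y \<theta>) \<in> borel_measurable ang"
proof -
  have c: "(\<lambda>x :: complex ^ 'n. x $ k) \<in> borel_measurable borel" for k
    by (intro borel_measurable_continuous_onI continuous_intros)
  have "(\<lambda>\<theta>. X \<theta> $ k) \<in> borel_measurable ang" "(\<lambda>\<theta>. Y \<theta> $ k) \<in> borel_measurable ang" for k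
    using measurable_compose[OF assms(1) c] measurable_compose[OF assms(2) c] by auto
  then show ?thesis unfolding bullet_def by (intro borel_measurable_sum borel_measurable_times)
qed

lemma disk_algebra_boundary_continuous: "h \<in> disk_algebra \<Longrightarrow> continuous_on {0..2*pi} (\<lambda>\<theta>. h (cis \<theta>))"
  by (rule continuous_on_compose2[of "cball 0 1" h]) (auto simp: disk_algebra_iff intro!: continuous_intros)

lemma norm_exp_minus_one: "Re x \<le> 0 \<Longrightarrow> norm (exp x - 1) \<le> norm (x::complex)"
proof -
  assume x: "Re x \<le> 0"
  have "norm (exp x - exp 0) \<le> 1 * norm (x - 0)"
  proof (rule field_differentiable_bound[where S = "{y. Re y \<le> 0}" and f' = exp])
    show "convex {y. Re y \<le> 0}" by (rule convex_halfspace_Re_le)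
    show "(exp has_field_derivative exp y) (at y within {y. Re y \<le> 0})" for y
      by (rule has_field_derivative_at_within[OF DERIV_exp])
    show "norm (exp y) \<le> 1" if "y \<in> {y. Re y \<le> 0}" for y :: complex using that by simp
  qed (use x in auto)
  then show ?thesis by simp
qed

text \<open>Testing with the monomials \<open>\<alpha> z\<^sup>m\<close> in each coordinate, for \<open>\<alpha> = 1\<close> and \<open>\<alpha> = \<i>\<close>, recovers all complex moments
  from the real parts.\<close>

lemma annihilator_of_disk_algebra:
  fixes \<gamma> :: "real \<Rightarrow> complex ^ 'n::finite"
  assumes g: "\<gamma> \<in> borel_measurable ang" and B: "AE \<theta> in ang. norm (\<gamma> \<theta>) \<le> B"
    and ann: "\<And>h. h \<in> disk_algebra \<Longrightarrow> integral\<^sup>L ang (\<lambda>\<theta>. Re (\<gamma> \<theta> \<bullet>\<^sub>c h (cis \<theta>))) = 0"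
  obtains h where "h \<in> hol_bounded unit_disk" "h 0 = 0"
    "AE \<theta> in ang. has_bdval h (cis \<theta>) \<and> bdval h (cis \<theta>) = \<gamma> \<theta>"
proof (rule bounded_annihilator_extends_vec[of \<gamma> B])
  have gk: "(\<lambda>\<theta>. \<gamma> \<theta> $ k) \<in> borel_measurable ang" for k
    by (rule measurable_compose[OF g]) (intro borel_measurable_continuous_onI continuous_intros)
  have Bk: "AE \<theta> in ang. norm (\<gamma> \<theta> $ k) \<le> B" for k
    using B by eventually_elim (rule order_trans[OF Finite_Cartesian_Product.norm_nth_le])
  show "(\<lambda>\<theta>. \<gamma> \<theta> $ k) \<in> borel_measurable ang" "AE \<theta> in ang. norm (\<gamma> \<theta> $ k) \<le> B" for k by (rule gk Bk)+
  show "integral\<^sup>L ang (\<lambda>\<theta>. \<gamma> \<theta> $ k * cis (real m * \<theta>)) = 0" for k and m :: nat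
  proof -
    let ?I = "integral\<^sup>L ang (\<lambda>\<theta>. \<gamma> \<theta> $ k * cis (real m * \<theta>))"
    have int: "integrable ang (\<lambda>\<theta>. \<gamma> \<theta> $ k * cis (real m * \<theta>))"
      by (rule cauchy_transform_integrable[OF gk Bk]) (intro continuous_intros)
    have R: "Re (\<alpha> * ?I) = 0" for \<alpha>
    proof -
      have "integral\<^sup>L ang (\<lambda>\<theta>. Re (\<alpha> * (\<gamma> \<theta> $ k * cis (real m * \<theta>)))) = Re (integral\<^sup>L ang (\<lambda>\<theta>. \<alpha> * (\<gamma> \<theta> $ k * cis (real m * \<theta>))))"
        by (rule integral_Re[OF integrable_mult_right[OF int]])
      moreover have "integral\<^sup>L ang (\<lambda>\<theta>. Re (\<gamma> \<theta> \<bullet>\<^sub>c axis k (\<alpha> * cis \<theta> ^ m))) = 0"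
        by (rule ann[OF disk_algebra_monomial])
      ultimately show ?thesis by (simp add: bullet_simps Complex.DeMoivre mult_ac del: Re_complex_of_real)
    qed
    from R[of 1] R[of \<i>] show ?thesis by (simp add: complex_eq_iff)
  qed
qed

text \<open>Linear independence of the functionals speaks about measurable sets of positive measure on which an
  equation holds everywhere; this converts almost-everywhere statements into that form.\<close>

lemma AE_circle_full_set:
  assumes "AE \<theta> in ang. P (cis \<theta>)"
  obtains T where "T \<in> sets circle_measure" "\<And>\<zeta>. \<zeta> \<in> T \<Longrightarrow> P \<zeta>" "T \<subseteq> unit_circle" "AE \<theta> in ang. cis \<theta> \<in> T"
proof -
  have "AE \<zeta> in circle_measure. P \<zeta>" using assms by (simp add: AE_circle_measure)
  then obtain N where N: "N \<in> null_sets circle_measure" "{\<zeta> \<in> space circle_measure. \<not> P \<zeta>} \<subseteq> N"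
    unfolding eventually_ae_filter by blast
  have "AE \<zeta> in circle_measure. \<zeta> \<in> unit_circle - N"
    using AE_not_in[OF N(1)] AE_space by eventually_elim (simp add: space_circle_measure)
  then have "AE \<theta> in ang. cis \<theta> \<in> unit_circle - N" by (simp add: AE_circle_measure)
  moreover have "unit_circle - N \<in> sets circle_measure"
    using N(1) sets.Diff[OF sets.top[of circle_measure], of N] by (auto simp: space_circle_measure)
  ultimately show ?thesis using N(2) by (intro that[of "unit_circle - N"]) (auto simp: space_circle_measure)
qed

section \<open>First-order data of an extremal map\<close>

locale extremal_setting =
  fixes N :: nat and \<nu> \<epsilon> :: real
    and w :: "nat \<Rightarrow> complex \<Rightarrow> complex ^ 'n::finite"
    and a :: "nat \<Rightarrow> real"
    and D G :: "(complex ^ 'n) set"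
    and u :: "complex ^ 'n \<Rightarrow> real"
    and f s :: "complex \<Rightarrow> complex ^ 'n"
    and S :: "complex set"
    and v :: "complex \<Rightarrow> (complex \<Rightarrow> complex ^ 'n) \<Rightarrow> complex"
  assumes \<nu>: "0 < \<nu>" "\<nu> < 1"
    and w: "\<And>j. j \<in> {1..N} \<Longrightarrow> w j \<in> hol_cont_closure (annulus \<nu>)"
    and indep: "functionals_lin_indep N w"
    and G: "open G" and DG: "relatively_compact_in D G"
    and psh: "psh_on G u" and ucont: "continuous_on G u"
    and D: "D = {z \<in> G. u z < 0}" and frD: "frontier D = {z \<in> G. u z = 0}"
    and ext: "extremal D N w a f"
    and S: "S \<subseteq> unit_circle" and s: "s \<in> hol_bounded unit_disk" and \<epsilon>: "\<epsilon> > 0"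
    and Snull: "unit_circle - S \<in> null_sets circle_measure"
    and bd: "\<And>\<zeta>. \<zeta> \<in> S \<Longrightarrow> has_bdval f \<zeta> \<and> has_bdval s \<zeta>"
    and snz: "\<And>k z. z \<in> unit_disk \<Longrightarrow> s z $ k \<noteq> 0"
    and expand: "\<And>\<zeta> h. \<zeta> \<in> S \<Longrightarrow> h \<in> hol_cont_closure unit_disk \<Longrightarrow>
          sup_norm_on unit_disk h \<le> \<epsilon> \<Longrightarrow>
          bdval f \<zeta> + bdval s \<zeta> * h \<zeta> \<in> G \<and>
          complex_of_real (u (bdval f \<zeta> + bdval s \<zeta> * h \<zeta>)) =
            complex_of_real (u (bdval f \<zeta>)) +
            2 * complex_of_real
                  (Re (complex_gradient u (bdval f \<zeta>) \<bullet>\<^sub>c (bdval s \<zeta> * h \<zeta>))) +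
            v \<zeta> h"
    and small: "((\<lambda>h. (SUP \<zeta>\<in>S. ennreal (norm (v \<zeta> h))) / ennreal (sup_norm_on unit_disk h))
          \<longlongrightarrow> 0) disk_algebra_at_0"
begin

definition f' :: "complex \<Rightarrow> complex ^ 'n" where "f' z = (\<chi> k. deriv (\<lambda>z. f z $ k) z)"

text \<open>Boundary data are treated as functions of the angle.  The gradient is multiplied by \<open>s\<close> from the start,
  since only the combination \<open>s \<cdot> \<nabla>u\<close> enters the first-order expansion.\<close>

definition ub :: "real \<Rightarrow> real" where "ub \<theta> = u (bdval f (cis \<theta>))"

definition grad :: "real \<Rightarrow> complex ^ 'n" where
  "grad \<theta> = bdval s (cis \<theta>) * complex_gradient u (bdval f (cis \<theta>))"

text \<open>A circle inside both the disc and the annulus of the weights, on which the functionals are evaluated.\<close>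

definition r0 :: real where "r0 = (1 + \<nu>) / 2"

text \<open>The functional \<open>\<Phi>\<^sub>j\<close> applied to \<open>s \<cdot> h\<close>: the rate of change of \<open>\<Phi>\<^sub>j\<close> along \<open>f + t s \<cdot> h\<close>.\<close>

definition outer_rate :: "nat \<Rightarrow> (complex \<Rightarrow> complex ^ 'n) \<Rightarrow> real" where
  "outer_rate j h = circle_pairing r0 (w j) (\<lambda>z. s z * h z)"

lemma r0: "\<nu> < r0" "r0 < 1" "0 < r0" using \<nu> by (auto simp: r0_def)

lemma AE_S: "AE \<theta> in ang. cis \<theta> \<in> S"
proof -
  have "AE \<zeta> in circle_measure. \<zeta> \<in> S"
    using AE_not_in[OF Snull] AE_space by eventually_elim (simp add: space_circle_measure)
  then show ?thesis by (simp add: AE_circle_measure)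
qed

lemma f: "vec_holomorphic_on f (ball 0 1)" "f ` ball 0 1 \<subseteq> D" "\<And>j. j \<in> {1..N} \<Longrightarrow> Phi (w j) f = a j"
  using ext by (auto simp: extremal_def hol_maps_def)

lemma clD: "compact (closure D)" "closure D \<subseteq> G" using DG by (auto simp: relatively_compact_in_def)

lemma D_sub: "D \<subseteq> closure D" by (rule closure_subset)

lemma f_bounded: "f \<in> hol_bounded unit_disk"
  using f compact_imp_bounded[OF clD(1)] D_sub by (auto simp: hol_bounded_def intro: bounded_subset)

lemma u_closure: "x \<in> closure D \<Longrightarrow> u x \<le> 0"
proof -
  assume x: "x \<in> closure D"
  then have "x \<in> D \<or> x \<in> frontier D" using closure_Un_frontier by blast
  then show ?thesis using D frD by auto
qed

lemma norm_S: "\<zeta> \<in> S \<Longrightarrow> norm \<zeta> = 1" using S by auto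

lemma bdval_f_in_closure: "\<zeta> \<in> S \<Longrightarrow> bdval f \<zeta> \<in> closure D"
  by (rule bdval_in_closed) (use bd norm_S f(2) D_sub in auto)

lemma ub_nonpos: "cis \<theta> \<in> S \<Longrightarrow> ub \<theta> \<le> 0" unfolding ub_def by (rule u_closure[OF bdval_f_in_closure])

text \<open>Variations of \<open>f\<close> leave \<open>D\<close>, but they stay in a compact neighbourhood of its closure, on which \<open>u\<close> is
  defined and uniformly continuous.\<close>

lemma closure_D_neighbourhood: obtains d where "d > 0" "compact {x. infdist x (closure D) \<le> d}" "{x. infdist x (closure D) \<le> d} \<subseteq> G"
proof -
  have ne: "closure D \<noteq> {}" using f(2) D_sub by fastforce
  obtain d where "d > 0" "{x. infdist x (closure D) \<le> d} \<subseteq> G"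
    using compact_in_open_separated[OF ne clD(1) G clD(2)] by blast
  then show ?thesis using that compact_infdist_le[OF ne clD(1)] by blast
qed

lemma s_bound: obtains B where "B > 0" "\<And>z. norm z < 1 \<Longrightarrow> norm (s z) \<le> B" "\<And>\<zeta>. \<zeta> \<in> S \<Longrightarrow> norm (bdval s \<zeta>) \<le> B"
proof -
  have "bounded (s ` unit_disk)" using s by (simp add: hol_bounded_def)
  then obtain B where B: "B > 0" "\<forall>x\<in>s ` unit_disk. norm x \<le> B" unfolding bounded_pos by blast
  have "bdval s \<zeta> \<in> cball 0 B" if "\<zeta> \<in> S" for \<zeta>
    by (rule bdval_in_closed) (use that bd norm_S B in auto)
  then show ?thesis using that[of B] B by auto
qed

lemma sh: "vec_holomorphic_on s (ball 0 1)" using s by (simp add: hol_bounded_def)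

text \<open>The smallness hypothesis on the remainder in terms of \<open>\<epsilon>\<close>-\<open>\<delta>\<close> estimates, uniformly on \<open>S\<close>.\<close>

lemma expansion:
  assumes \<eta>: "\<eta> > 0"
  obtains \<delta> where "\<delta> > 0" "\<delta> \<le> \<epsilon>" "\<And>h \<zeta>. h \<in> disk_algebra \<Longrightarrow> sup_norm_on unit_disk h \<le> \<delta> \<Longrightarrow> \<zeta> \<in> S \<Longrightarrow>
     \<bar>u (bdval f \<zeta> + bdval s \<zeta> * h \<zeta>) - u (bdval f \<zeta>) - 2 * Re ((bdval s \<zeta> * complex_gradient u (bdval f \<zeta>)) \<bullet>\<^sub>c h \<zeta>)\<bar>
       \<le> \<eta> * sup_norm_on unit_disk h"
proof -
  have "eventually (\<lambda>h. (SUP \<zeta>\<in>S. ennreal (norm (v \<zeta> h))) / ennreal (sup_norm_on unit_disk h) < ennreal \<eta>) disk_algebra_at_0"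
    by (rule order_tendstoD[OF small]) (use \<eta> in simp)
  then obtain P where P: "eventually P (at_right (0::real))"
    "\<And>h. P (sup_norm_on unit_disk h) \<Longrightarrow> h \<in> disk_algebra \<Longrightarrow>
      (SUP \<zeta>\<in>S. ennreal (norm (v \<zeta> h))) / ennreal (sup_norm_on unit_disk h) < ennreal \<eta>"
    unfolding disk_algebra_at_0_def eventually_inf_principal eventually_filtercomap by blast
  obtain b where b: "b > 0" "\<And>y. 0 < y \<Longrightarrow> y < b \<Longrightarrow> P y" using P(1) unfolding eventually_at_right[OF zero_less_one] by blast
  define \<delta> where "\<delta> = min (b / 2) \<epsilon>"
  have \<delta>: "\<delta> > 0" "\<delta> < b" "\<delta> \<le> \<epsilon>" using b \<epsilon> by (auto simp: \<delta>_def)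
  show ?thesis
  proof (rule that[OF \<delta>(1,3)])
    fix h :: "complex \<Rightarrow> complex ^ 'n" and \<zeta>
    assume h: "h \<in> disk_algebra" "sup_norm_on unit_disk h \<le> \<delta>" and \<zeta>: "\<zeta> \<in> S"
    let ?n = "sup_norm_on unit_disk h"
    have n0: "0 \<le> ?n" using norm_le_sup_norm[OF h(1), of 0] norm_ge_zero order_trans by (metis norm_zero zero_le_one)
    have ex: "complex_of_real (u (bdval f \<zeta> + bdval s \<zeta> * h \<zeta>)) = complex_of_real (u (bdval f \<zeta>)) +
            2 * complex_of_real (Re ((bdval s \<zeta> * complex_gradient u (bdval f \<zeta>)) \<bullet>\<^sub>c h \<zeta>)) + v \<zeta> h"
      using expand[OF \<zeta> h(1)] h(2) \<delta> by (simp add: bullet_simps)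
    have "v \<zeta> h = complex_of_real (u (bdval f \<zeta> + bdval s \<zeta> * h \<zeta>) - u (bdval f \<zeta>) - 2 * Re ((bdval s \<zeta> * complex_gradient u (bdval f \<zeta>)) \<bullet>\<^sub>c h \<zeta>))"
      using ex by (simp add: algebra_simps)
    then have eq: "\<bar>u (bdval f \<zeta> + bdval s \<zeta> * h \<zeta>) - u (bdval f \<zeta>) - 2 * Re ((bdval s \<zeta> * complex_gradient u (bdval f \<zeta>)) \<bullet>\<^sub>c h \<zeta>)\<bar> = norm (v \<zeta> h)"
      by (metis norm_of_real)
    show "\<bar>u (bdval f \<zeta> + bdval s \<zeta> * h \<zeta>) - u (bdval f \<zeta>) - 2 * Re ((bdval s \<zeta> * complex_gradient u (bdval f \<zeta>)) \<bullet>\<^sub>c h \<zeta>)\<bar> \<le> \<eta> * ?n"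
    proof (cases "?n = 0")
      case True
      then have "h \<zeta> = 0" using norm_le_sup_norm[OF h(1), of \<zeta>] norm_S[OF \<zeta>] by simp
      then show ?thesis using True by (simp add: bullet_simps)
    next
      case False
      then have n: "0 < ?n" using n0 by simp
      then have "(SUP \<zeta>\<in>S. ennreal (norm (v \<zeta> h))) / ennreal ?n < ennreal \<eta>"
        by (intro P(2) b(2) h(1)) (use h \<delta> in auto)
      moreover have "ennreal (norm (v \<zeta> h)) \<le> (SUP \<zeta>\<in>S. ennreal (norm (v \<zeta> h)))" by (rule SUP_upper[OF \<zeta>])
      ultimately have "ennreal (norm (v \<zeta> h)) / ennreal ?n < ennreal \<eta>"
        by (meson divide_right_mono_ennreal order_le_less_trans)
      then have "ennreal (norm (v \<zeta> h) / ?n) < ennreal \<eta>" using n by (simp add: divide_ennreal)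
      then have "norm (v \<zeta> h) / ?n < \<eta>" by (subst (asm) ennreal_less_iff) (use n in auto)
      then show ?thesis unfolding eq using n by (simp add: field_simps)
    qed
  qed
qed

text \<open>Although the gradient is only assumed to exist pointwise, the uniform expansion bounds it: \<open>u\<close> is
  bounded near the closure of \<open>D\<close>, and a constant \<open>h\<close> of fixed small norm in the direction of a component of
  the gradient changes \<open>u\<close> by a multiple of that component up to a bounded error.\<close>

lemma grad_bounded: obtains C where "C > 0" "\<And>\<theta>. cis \<theta> \<in> S \<Longrightarrow> norm (grad \<theta>) \<le> C"
proof -
  obtain \<delta> where \<delta>: "\<delta> > 0" "\<delta> \<le> \<epsilon>" "\<And>h \<zeta>. h \<in> disk_algebra \<Longrightarrow> sup_norm_on unit_disk h \<le> \<delta> \<Longrightarrow> \<zeta> \<in> S \<Longrightarrow>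
     \<bar>u (bdval f \<zeta> + bdval s \<zeta> * h \<zeta>) - u (bdval f \<zeta>) - 2 * Re ((bdval s \<zeta> * complex_gradient u (bdval f \<zeta>)) \<bullet>\<^sub>c h \<zeta>)\<bar>
       \<le> 1 * sup_norm_on unit_disk h"
    using expansion[of 1] by auto
  obtain d where d: "d > 0" "compact {x. infdist x (closure D) \<le> d}" "{x. infdist x (closure D) \<le> d} \<subseteq> G" by (rule closure_D_neighbourhood)
  obtain B where B: "B > 0" "\<And>\<zeta>. \<zeta> \<in> S \<Longrightarrow> norm (bdval s \<zeta>) \<le> B" by (rule s_bound) blast
  obtain M where M: "0 \<le> M" "\<And>x. infdist x (closure D) \<le> d \<Longrightarrow> norm (u x) \<le> M"
    using continuous_bounded_on_compact[OF d(2) continuous_on_subset[OF ucont d(3)]] by auto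
  define t where "t = min \<delta> (d / B)"
  have t: "t > 0" "t \<le> \<delta>" "B * t \<le> d" using \<delta> d B by (auto simp: t_def min_def field_simps)
  have comp: "norm (grad \<theta> $ k) \<le> (2 * M + \<delta>) / (2 * t)" if \<theta>: "cis \<theta> \<in> S" for \<theta> k
  proof (cases "grad \<theta> $ k = 0")
    case True
    then show ?thesis using M t \<delta> by simp
  next
    case False
    \<comment> \<open>The constant direction in which the \<open>k\<close>-th component of the gradient is fully seen.\<close>
    define c where "c = of_real t * cnj (grad \<theta> $ k) / of_real (norm (grad \<theta> $ k))"
    have nc: "norm c = t" using False t by (simp add: c_def norm_mult norm_divide)
    define h :: "complex \<Rightarrow> complex ^ 'n" where "h = (\<lambda>z. axis k (c * z ^ 0))"
    have h: "h \<in> disk_algebra" unfolding h_def by (rule disk_algebra_monomial)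
    have hn: "norm (h z) = t" for z by (simp add: h_def nc norm_axis_complex)
    have sn: "sup_norm_on unit_disk h \<le> t" by (rule sup_norm_le) (simp add: hn)
    have "norm (bdval s (cis \<theta>) * h (cis \<theta>)) \<le> B * t"
      by (rule order_trans[OF norm_vec_mult_le]) (use B(2)[OF \<theta>] hn t in \<open>auto intro!: mult_mono\<close>)
    then have "dist (bdval f (cis \<theta>) + bdval s (cis \<theta>) * h (cis \<theta>)) (bdval f (cis \<theta>)) \<le> d"
      using t by (simp add: dist_norm)
    then have "infdist (bdval f (cis \<theta>) + bdval s (cis \<theta>) * h (cis \<theta>)) (closure D) \<le> d"
      using infdist_le[OF bdval_f_in_closure[OF \<theta>]] order_trans by blast
    then have 1: "\<bar>u (bdval f (cis \<theta>) + bdval s (cis \<theta>) * h (cis \<theta>))\<bar> \<le> M" using M(2) by force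
    have 2: "\<bar>u (bdval f (cis \<theta>))\<bar> \<le> M" using M(2)[of "bdval f (cis \<theta>)"] bdval_f_in_closure[OF \<theta>] d(1) by simp
    have "\<bar>u (bdval f (cis \<theta>) + bdval s (cis \<theta>) * h (cis \<theta>)) - u (bdval f (cis \<theta>)) - 2 * Re (grad \<theta> \<bullet>\<^sub>c h (cis \<theta>))\<bar> \<le> \<delta>"
      unfolding grad_def by (rule order_trans[OF \<delta>(3)[OF h _ \<theta>]]) (use sn t in auto)
    then have "2 * Re (grad \<theta> \<bullet>\<^sub>c h (cis \<theta>)) \<le> 2 * M + \<delta>" using 1 2 by linarith
    moreover have "grad \<theta> \<bullet>\<^sub>c h (cis \<theta>) = of_real (t * norm (grad \<theta> $ k))"
    proof -
      have "grad \<theta> $ k * cnj (grad \<theta> $ k) = of_real (norm (grad \<theta> $ k)) * of_real (norm (grad \<theta> $ k))"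
        by (simp add: complex_norm_square[symmetric] power2_eq_square[symmetric])
      then show ?thesis using False by (simp add: h_def bullet_simps c_def field_simps)
    qed
    ultimately show ?thesis using t by (simp add: field_simps)
  qed
  define C where "C = (\<Sum>k\<in>(UNIV::'n set). (2 * M + \<delta>) / (2 * t)) + 1"
  have "norm (grad \<theta>) \<le> C" if "cis \<theta> \<in> S" for \<theta>
  proof -
    have "norm (grad \<theta>) \<le> (\<Sum>k\<in>UNIV. norm (grad \<theta> $ k))" by (rule norm_vec_le_sum)
    also have "\<dots> \<le> (\<Sum>k\<in>(UNIV::'n set). (2 * M + \<delta>) / (2 * t))" by (rule sum_mono) (rule comp[OF that])
    finally show ?thesis by (simp add: C_def)
  qed
  moreover have "C > 0" using M t \<delta> by (simp add: C_def add_nonneg_pos)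
  ultimately show ?thesis using that by blast
qed

lemma bdf_measurable: "(\<lambda>\<theta>. bdval f (cis \<theta>)) \<in> borel_measurable ang"
proof (rule bdval_measurable[OF vec_holomorphic_continuous_on[OF f(1)]])
  show "AE \<theta> in ang. has_bdval f (cis \<theta>)" using AE_S by eventually_elim (use bd in blast)
qed

lemma bds_measurable: "(\<lambda>\<theta>. bdval s (cis \<theta>)) \<in> borel_measurable ang"
proof (rule bdval_measurable[OF vec_holomorphic_continuous_on[OF sh]])
  show "AE \<theta> in ang. has_bdval s (cis \<theta>)" using AE_S by eventually_elim (use bd in blast)
qed

lemma u_compose_measurable:
  assumes "X \<in> borel_measurable ang"
  shows "(\<lambda>\<theta>. indicator G (X \<theta>) *\<^sub>R u (X \<theta>)) \<in> borel_measurable ang"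
proof -
  have "(\<lambda>x. indicator G x *\<^sub>R u x) \<in> borel_measurable borel"
    by (rule borel_measurable_continuous_on_indicator[OF _ ucont]) (use G in auto)
  from measurable_compose[OF assms this] show ?thesis .
qed

lemma ub_bounded_fn: "ub \<in> bounded_fns"
proof -
  obtain M where M: "0 \<le> M" "\<And>x. x \<in> closure D \<Longrightarrow> norm (u x) \<le> M"
    using continuous_bounded_on_compact[OF clD(1) continuous_on_subset[OF ucont clD(2)]] by auto
  have "AE \<theta> in ang. indicator G (bdval f (cis \<theta>)) *\<^sub>R u (bdval f (cis \<theta>)) = ub \<theta>"
    using AE_S by eventually_elim (use bdval_f_in_closure clD(2) in \<open>auto simp: ub_def indicator_def\<close>)
  then have "ub \<in> borel_measurable ang" by (rule ang_AE_measurable[OF u_compose_measurable[OF bdf_measurable]])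
  moreover have "AE \<theta> in ang. \<bar>ub \<theta>\<bar> \<le> M"
    using AE_S
  proof eventually_elim
    case (elim \<theta>)
    then show ?case using M(2)[OF bdval_f_in_closure[OF elim]] by (simp add: ub_def)
  qed
  ultimately show ?thesis by (rule bounded_fnsI)
qed

text \<open>Each component is an almost everywhere limit of difference quotients of \<open>u\<close>, taken in constant
  directions; the expansion guarantees the convergence.\<close>

lemma grad_measurable: "grad \<in> borel_measurable ang"
proof (rule vec_measurableI)
  fix k
  have Re_m: "(\<lambda>\<theta>. Re (grad \<theta> $ k * c)) \<in> borel_measurable ang" for c
  proof (rule ang_AE_limit_measurable)
    define h :: "nat \<Rightarrow> complex \<Rightarrow> complex ^ 'n" where "h = (\<lambda>m z. axis k ((of_real (1 / real (Suc m)) * c) * z ^ 0))"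
    define X where "X = (\<lambda>m \<theta>. bdval f (cis \<theta>) + bdval s (cis \<theta>) * h m (cis \<theta>))"
    have Xm: "X m \<in> borel_measurable ang" for m
    proof -
      have eq: "(\<lambda>y :: complex ^ 'n. y * h m 0) = (\<lambda>y. \<chi> i. y $ i * h m 0 $ i)" by (simp add: fun_eq_iff vec_eq_iff)
      have "continuous_on UNIV (\<lambda>y :: complex ^ 'n. y * h m 0)"
        unfolding eq by (intro continuous_on_vec_lambda continuous_intros)
      then have "(\<lambda>y :: complex ^ 'n. y * h m 0) \<in> borel_measurable borel" by (rule borel_measurable_continuous_onI)
      from measurable_compose[OF bds_measurable this]
      show ?thesis unfolding X_def h_def by (intro borel_measurable_add bdf_measurable) (simp add: h_def)
    qed
    show "(\<lambda>\<theta>. real (Suc m) / 2 * (indicator G (X m \<theta>) *\<^sub>R u (X m \<theta>) - indicator G (bdval f (cis \<theta>)) *\<^sub>R u (bdval f (cis \<theta>)))) \<in> borel_measurable ang" for m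
      by (intro borel_measurable_times borel_measurable_diff borel_measurable_const u_compose_measurable Xm bdf_measurable)
    show "AE \<theta> in ang. (\<lambda>m. real (Suc m) / 2 * (indicator G (X m \<theta>) *\<^sub>R u (X m \<theta>) - indicator G (bdval f (cis \<theta>)) *\<^sub>R u (bdval f (cis \<theta>)))) \<longlonglongrightarrow> Re (grad \<theta> $ k * c)"
      using AE_S
    proof eventually_elim
      case (elim \<theta>)
      show ?case
      proof (rule LIMSEQ_I)
        fix e :: real assume e: "e > 0"
        define \<eta> where "\<eta> = e / (norm c + 1)"
        have \<eta>: "\<eta> > 0" using e by (simp add: \<eta>_def add_nonneg_pos)
        obtain \<delta> where \<delta>: "\<delta> > 0" "\<delta> \<le> \<epsilon>" "\<And>h \<zeta>. h \<in> disk_algebra \<Longrightarrow> sup_norm_on unit_disk h \<le> \<delta> \<Longrightarrow> \<zeta> \<in> S \<Longrightarrow>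
           \<bar>u (bdval f \<zeta> + bdval s \<zeta> * h \<zeta>) - u (bdval f \<zeta>) - 2 * Re ((bdval s \<zeta> * complex_gradient u (bdval f \<zeta>)) \<bullet>\<^sub>c h \<zeta>)\<bar>
             \<le> \<eta> * sup_norm_on unit_disk h"
          using expansion[OF \<eta>] by blast
        obtain m0 where m0: "norm c / \<delta> < real m0" using reals_Archimedean2 by blast
        show "\<exists>no. \<forall>n\<ge>no. norm (real (Suc n) / 2 * (indicator G (X n \<theta>) *\<^sub>R u (X n \<theta>) - indicator G (bdval f (cis \<theta>)) *\<^sub>R u (bdval f (cis \<theta>))) - Re (grad \<theta> $ k * c)) < e"
        proof (intro exI[of _ m0] allI impI)
          fix n assume n: "m0 \<le> n"
          have hA: "h n \<in> disk_algebra" unfolding h_def by (rule disk_algebra_monomial)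
          have hn: "norm (h n z) = norm c / real (Suc n)" for z by (simp add: h_def norm_axis_complex norm_mult norm_divide del: of_nat_Suc)
          have sn: "sup_norm_on unit_disk (h n) \<le> norm c / real (Suc n)" by (rule sup_norm_le) (simp add: hn)
          have "norm c < \<delta> * real m0" using m0 \<delta>(1) by (simp add: field_simps)
          also have "\<dots> \<le> \<delta> * real (Suc n)" using n \<delta>(1) by (intro mult_left_mono) auto
          finally have c\<delta>: "norm c / real (Suc n) \<le> \<delta>" by (simp add: field_simps)
          have sd: "sup_norm_on unit_disk (h n) \<le> \<delta>" using sn c\<delta> by linarith
          have XG: "X n \<theta> \<in> G" using expand[OF elim hA] sd \<delta>(2) by (simp add: X_def)
          have fG: "bdval f (cis \<theta>) \<in> G" using bdval_f_in_closure[OF elim] clD(2) by auto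
          have "\<bar>u (X n \<theta>) - ub \<theta> - 2 * Re (grad \<theta> \<bullet>\<^sub>c h n (cis \<theta>))\<bar> \<le> \<eta> * sup_norm_on unit_disk (h n)"
            unfolding X_def ub_def grad_def by (rule \<delta>(3)[OF hA sd elim])
          also have "\<dots> \<le> \<eta> * (norm c / real (Suc n))" using sn \<eta> by (intro mult_left_mono) auto
          finally have 1: "\<bar>u (X n \<theta>) - ub \<theta> - 2 * Re (grad \<theta> \<bullet>\<^sub>c h n (cis \<theta>))\<bar> \<le> \<eta> * (norm c / real (Suc n))" .
          have 2: "Re (grad \<theta> \<bullet>\<^sub>c h n (cis \<theta>)) = Re (grad \<theta> $ k * c) / real (Suc n)"
          proof -
            have "grad \<theta> \<bullet>\<^sub>c h n (cis \<theta>) = of_real (1 / real (Suc n)) * (grad \<theta> $ k * c)"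
              by (simp add: h_def bullet_simps del: of_real_divide)
            moreover have "Re (of_real x * z) = x * Re z" for x z by simp
            ultimately show ?thesis by (simp only:) simp
          qed
          define x y K where "x = u (X n \<theta>) - ub \<theta>" and "y = Re (grad \<theta> $ k * c)" and "K = real (Suc n)"
          have K: "K > 0" by (simp add: K_def)
          have "K / 2 * \<bar>x - 2 * (y / K)\<bar> \<le> K / 2 * (\<eta> * (norm c / K))"
            using 1 unfolding 2 x_def[symmetric] y_def[symmetric] K_def[symmetric] using K by (intro mult_left_mono) auto
          also have "\<dots> = \<eta> * norm c / 2" using K by simp
          also have "\<dots> < e"
          proof -
            have "\<eta> * norm c \<le> \<eta> * (norm c + 1)" using \<eta> by (intro mult_left_mono) auto
            also have "\<dots> = e" using add_nonneg_pos[OF norm_ge_zero[of c] zero_less_one] by (simp add: \<eta>_def)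
            finally show ?thesis using e by simp
          qed
          finally have "K / 2 * \<bar>x - 2 * (y / K)\<bar> < e" .
          moreover have "K / 2 * \<bar>x - 2 * (y / K)\<bar> = \<bar>K / 2 * x - y\<bar>"
          proof -
            have "K / 2 * x - y = K / 2 * (x - 2 * (y / K))" using K by (simp add: field_simps)
            then show ?thesis unfolding abs_mult using K by (simp only: abs_mult abs_of_pos half_gt_zero)
          qed
          ultimately show "norm (real (Suc n) / 2 * (indicator G (X n \<theta>) *\<^sub>R u (X n \<theta>) - indicator G (bdval f (cis \<theta>)) *\<^sub>R u (bdval f (cis \<theta>))) - Re (grad \<theta> $ k * c)) < e"
            using XG fG by (simp add: x_def y_def K_def ub_def)
        qed
      qed
    qed
  qed
  have "(\<lambda>\<theta>. Re (grad \<theta> $ k)) \<in> borel_measurable ang" using Re_m[of 1] by simp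
  moreover have "(\<lambda>\<theta>. Im (grad \<theta> $ k)) \<in> borel_measurable ang" using Re_m[of "- \<i>"] by simp
  ultimately show "(\<lambda>\<theta>. grad \<theta> $ k) \<in> borel_measurable ang" by (simp add: borel_measurable_complex_iff)
qed

section \<open>The functionals on the disc algebra\<close>

lemma w_annulus:
  assumes j: "j \<in> {1..N}"
  shows "continuous_on {0..2*pi} (\<lambda>\<theta>. w j (of_real r0 * cis \<theta>))" "continuous_on {0..2*pi} (\<lambda>\<theta>. w j (cis \<theta>))"
proof -
  have wc: "continuous_on (closure (annulus \<nu>)) (w j)" using w[OF j] by (simp add: hol_cont_closure_def)
  show "continuous_on {0..2*pi} (\<lambda>\<theta>. w j (of_real r0 * cis \<theta>))"
    by (rule continuous_on_compose2[OF wc]) (use r0 \<nu> in \<open>auto intro!: continuous_intros annulus_closure simp: norm_mult\<close>)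
  show "continuous_on {0..2*pi} (\<lambda>\<theta>. w j (cis \<theta>))"
    by (rule continuous_on_compose2[OF wc]) (use \<nu> in \<open>auto intro!: continuous_intros annulus_closure\<close>)
qed

lemma w_bound: obtains W where "0 \<le> W" "\<And>j \<theta>. j \<in> {1..N} \<Longrightarrow> \<theta> \<in> {0..2*pi} \<Longrightarrow> norm (w j (of_real r0 * cis \<theta>)) \<le> W"
    "\<And>j \<theta>. j \<in> {1..N} \<Longrightarrow> \<theta> \<in> {0..2*pi} \<Longrightarrow> norm (w j (cis \<theta>)) \<le> W"
proof -
  have "\<exists>M. \<forall>\<theta>\<in>{0..2*pi}. norm (w j (of_real r0 * cis \<theta>)) \<le> M \<and> norm (w j (cis \<theta>)) \<le> M" if j: "j \<in> {1..N}" for j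
  proof -
    obtain M1 where M1: "0 \<le> M1" "\<And>\<theta>. \<theta> \<in> {0..2*pi} \<Longrightarrow> norm (w j (of_real r0 * cis \<theta>)) \<le> M1"
      using continuous_bounded_on_compact[OF compact_Icc w_annulus(1)[OF j]] by blast
    obtain M2 where M2: "0 \<le> M2" "\<And>\<theta>. \<theta> \<in> {0..2*pi} \<Longrightarrow> norm (w j (cis \<theta>)) \<le> M2"
      using continuous_bounded_on_compact[OF compact_Icc w_annulus(2)[OF j]] by blast
    show ?thesis
    proof (intro exI[of _ "M1 + M2"] ballI conjI)
      fix \<theta> :: real assume t: "\<theta> \<in> {0..2*pi}"
      show "norm (w j (of_real r0 * cis \<theta>)) \<le> M1 + M2" "norm (w j (cis \<theta>)) \<le> M1 + M2"
        using M1(2)[OF t] M2(2)[OF t] M1(1) M2(1) by linarith+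
    qed
  qed
  then obtain M where M: "\<And>j \<theta>. j \<in> {1..N} \<Longrightarrow> \<theta> \<in> {0..2*pi} \<Longrightarrow> norm (w j (of_real r0 * cis \<theta>)) \<le> M j \<and> norm (w j (cis \<theta>)) \<le> M j"
    by metis
  define W where "W = (\<Sum>j\<in>{1..N}. \<bar>M j\<bar>)"
  have "M j \<le> W" if "j \<in> {1..N}" for j
  proof -
    have "\<bar>M j\<bar> \<le> W" unfolding W_def by (rule member_le_sum[OF that]) auto
    then show ?thesis by simp
  qed
  moreover have "0 \<le> W" by (simp add: W_def sum_nonneg)
  ultimately show ?thesis using that[of W] M order_trans by meson
qed

lemma pairing_integrable:
  assumes j: "j \<in> {1..N}" and F: "continuous_on (ball 0 1) F"
  shows "integrable ang (\<lambda>\<theta>. Re (F (of_real r0 * cis \<theta>) \<bullet>\<^sub>c w j (of_real r0 * cis \<theta>)))"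
proof (intro integrable_ang_continuous continuous_on_Re continuous_on_bullet w_annulus(1)[OF j])
  show "continuous_on {0..2*pi} (\<lambda>\<theta>. F (of_real r0 * cis \<theta>))"
    by (rule continuous_on_compose2[OF F]) (use r0 in \<open>auto intro!: continuous_intros simp: norm_mult\<close>)
qed

lemma pairing_add:
  assumes j: "j \<in> {1..N}" and F: "continuous_on (ball 0 1) F" and H: "continuous_on (ball 0 1) H"
  shows "circle_pairing r0 (w j) (\<lambda>z. F z + H z) = circle_pairing r0 (w j) F + circle_pairing r0 (w j) H"
  unfolding circle_pairing_def bullet_simps plus_complex.simps
  by (subst Bochner_Integration.integral_add[OF pairing_integrable[OF j F] pairing_integrable[OF j H]]) (simp add: algebra_simps)

lemma pairing_scale: "circle_pairing r0 (w j) (\<lambda>z. c *\<^sub>R F z) = c * circle_pairing r0 (w j) F"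
  unfolding circle_pairing_def bullet_simps by simp

lemma sh_holomorphic: "h \<in> disk_algebra \<Longrightarrow> vec_holomorphic_on (\<lambda>z. s z * h z) (ball 0 1)"
  by (rule vec_holomorphic_mult[OF sh]) (simp add: disk_algebra_iff)

lemma sh_continuous: "h \<in> disk_algebra \<Longrightarrow> continuous_on (ball 0 1) (\<lambda>z. s z * h z)"
  by (rule vec_holomorphic_continuous_on[OF sh_holomorphic])

lemma outer_rate_add: "j \<in> {1..N} \<Longrightarrow> h \<in> disk_algebra \<Longrightarrow> k \<in> disk_algebra \<Longrightarrow> outer_rate j (\<lambda>z. h z + k z) = outer_rate j h + outer_rate j k"
  unfolding outer_rate_def distrib_left by (intro pairing_add sh_continuous)

lemma outer_rate_scale: "outer_rate j (\<lambda>z. c *\<^sub>R h z) = c * outer_rate j h"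
  unfolding outer_rate_def mult_scaleR_vec by (rule pairing_scale)

lemma bdval_sh:
  assumes \<zeta>: "\<zeta> \<in> S" and h: "h \<in> disk_algebra"
  shows "has_bdval (\<lambda>z. s z * h z) \<zeta>" "bdval (\<lambda>z. s z * h z) \<zeta> = bdval s \<zeta> * h \<zeta>"
proof -
  have n: "norm \<zeta> = 1" by (rule norm_S[OF \<zeta>])
  have hc: "continuous_on (cball 0 1) h" using h by (simp add: disk_algebra_iff)
  have "((\<lambda>z. s z * h z) \<longlongrightarrow> bdval s \<zeta> * h \<zeta>) (nontangential \<zeta>)"
    using tendsto_vec_mult[OF tendsto_bdval[OF n] tendsto_bdval[OF n bdval_continuous(1)[OF hc n]]] bd[OF \<zeta>]
    by (simp add: bdval_continuous(2)[OF hc n])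
  from bdval_eqI[OF n this] show "has_bdval (\<lambda>z. s z * h z) \<zeta>" "bdval (\<lambda>z. s z * h z) \<zeta> = bdval s \<zeta> * h \<zeta>" .
qed

lemma sh_bounded: "h \<in> disk_algebra \<Longrightarrow> (\<lambda>z. s z * h z) \<in> hol_bounded unit_disk"
proof -
  assume h: "h \<in> disk_algebra"
  obtain B where B: "B > 0" "\<And>z. norm z < 1 \<Longrightarrow> norm (s z) \<le> B" by (rule s_bound) blast
  obtain C where C: "0 \<le> C" "\<And>z. norm z \<le> 1 \<Longrightarrow> norm (h z) \<le> C" using disk_algebra_bounded[OF h] by blast
  have "norm (s z * h z) \<le> B * C" if "norm z < 1" for z
    by (rule order_trans[OF norm_vec_mult_le]) (use B C that in \<open>auto intro!: mult_mono\<close>)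
  then have "bounded ((\<lambda>z. s z * h z) ` unit_disk)" by (intro boundedI[of _ "B * C"]) auto
  then show ?thesis using sh_holomorphic[OF h] by (simp add: hol_bounded_def)
qed

lemma outer_rate_boundary:
  assumes j: "j \<in> {1..N}" and h: "h \<in> disk_algebra"
  shows "has_bochner_integral ang (\<lambda>\<theta>. Re ((w j (cis \<theta>) * bdval s (cis \<theta>)) \<bullet>\<^sub>c h (cis \<theta>))) (2*pi * outer_rate j h)"
proof -
  have ae: "AE \<theta> in ang. has_bdval (\<lambda>z. s z * h z) (cis \<theta>)"
    using AE_S by eventually_elim (rule bdval_sh(1)[OF _ h])
  note P = Phi_eq_circle_pairing[OF \<nu>(1) r0(1,2) w[OF j] sh_bounded[OF h] ae]
  have "has_bochner_integral ang (\<lambda>\<theta>. Re (bdval (\<lambda>z. s z * h z) (cis \<theta>) \<bullet>\<^sub>c w j (cis \<theta>))) (2*pi * outer_rate j h)"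
    using P unfolding Phi_def LINT_ang outer_rate_def has_bochner_integral_iff by (simp add: field_simps)
  moreover have c: "AE \<theta> in ang. Re (bdval (\<lambda>z. s z * h z) (cis \<theta>) \<bullet>\<^sub>c w j (cis \<theta>)) = Re ((w j (cis \<theta>) * bdval s (cis \<theta>)) \<bullet>\<^sub>c h (cis \<theta>))"
    using AE_S
  proof eventually_elim
    case (elim \<theta>)
    show ?case unfolding bdval_sh(2)[OF elim h] by (subst bullet_simps(8)) (rule refl)
  qed
  moreover have m: "(\<lambda>\<theta>. Re ((w j (cis \<theta>) * bdval s (cis \<theta>)) \<bullet>\<^sub>c h (cis \<theta>))) \<in> borel_measurable ang"
    by (rule ang_AE_measurable[OF _ c]) (use P(2) in auto)
  ultimately show ?thesis
    using has_bochner_integral_cong_AE[OF borel_measurable_integrable[OF P(2)] m c] by blast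
qed

text \<open>The density of the functional that takes \<open>h\<close> in the disc algebra to \<open>\<Sum> c\<^sub>j \<Phi>\<^sub>j(s \<cdot> h)\<close>.\<close>

definition kernel :: "(nat \<Rightarrow> real) \<Rightarrow> real \<Rightarrow> complex ^ 'n" where
  "kernel c \<theta> = (\<Sum>j\<in>{1..N}. c j *\<^sub>R (w j (cis \<theta>) * bdval s (cis \<theta>)))"

lemma kernel_measurable: "kernel c \<in> borel_measurable ang"
  unfolding kernel_def[abs_def]
  by (intro borel_measurable_sum borel_measurable_scaleR borel_measurable_const vec_mult_measurable
      continuous_imp_ang w_annulus(2) bds_measurable)

lemma kernel_bounded: obtains C where "AE \<theta> in ang. norm (kernel c \<theta>) \<le> C"
proof -
  obtain W where W: "0 \<le> W" "\<And>j \<theta>. j \<in> {1..N} \<Longrightarrow> \<theta> \<in> {0..2*pi} \<Longrightarrow> norm (w j (cis \<theta>)) \<le> W"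
    by (rule w_bound) blast
  obtain B where B: "B > 0" "\<And>\<zeta>. \<zeta> \<in> S \<Longrightarrow> norm (bdval s \<zeta>) \<le> B" by (rule s_bound) blast
  have "AE \<theta> in ang. norm (kernel c \<theta>) \<le> (\<Sum>j\<in>{1..N}. \<bar>c j\<bar> * (W * B))"
    using AE_S AE_space
  proof eventually_elim
    case (elim \<theta>)
    show ?case unfolding kernel_def
    proof (rule order_trans[OF norm_sum sum_mono])
      fix j assume j: "j \<in> {1..N}"
      have "norm (w j (cis \<theta>) * bdval s (cis \<theta>)) \<le> W * B"
        by (rule order_trans[OF norm_vec_mult_le]) (use W j B elim in \<open>auto intro!: mult_mono\<close>)
      then show "norm (c j *\<^sub>R (w j (cis \<theta>) * bdval s (cis \<theta>))) \<le> \<bar>c j\<bar> * (W * B)" by (simp add: mult_left_mono)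
    qed
  qed
  then show ?thesis by (rule that)
qed

lemma kernel_integral:
  assumes h: "h \<in> disk_algebra"
  shows "has_bochner_integral ang (\<lambda>\<theta>. Re (kernel c \<theta> \<bullet>\<^sub>c h (cis \<theta>))) (2*pi * (\<Sum>j\<in>{1..N}. c j * outer_rate j h))"
proof -
  have "has_bochner_integral ang (\<lambda>\<theta>. \<Sum>j\<in>{1..N}. c j * Re ((w j (cis \<theta>) * bdval s (cis \<theta>)) \<bullet>\<^sub>c h (cis \<theta>))) (\<Sum>j\<in>{1..N}. c j * (2*pi * outer_rate j h))"
    by (intro has_bochner_integral_sum has_bochner_integral_mult_right outer_rate_boundary h)
  then show ?thesis by (simp add: kernel_def bullet_sum bullet_simps sum_distrib_left mult_ac)
qed

lemma kernel_not_boundary_value: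
  assumes g: "g \<in> hol_bounded unit_disk" "g 0 = 0"
    and T: "T \<in> sets circle_measure" "0 < emeasure circle_measure T"
    and eq: "\<And>\<zeta>. \<zeta> \<in> T \<Longrightarrow> has_bdval s \<zeta> \<and> has_bdval g \<zeta> \<and> (\<Sum>j\<in>{1..N}. c j *\<^sub>R (w j \<zeta> * bdval s \<zeta>)) = bdval g \<zeta>"
    and j: "j \<in> {1..N}"
  shows "c j = 0"
  using indep s g T eq j snz unfolding functionals_lin_indep_def by blast

text \<open>A vanishing combination means that its kernel annihilates the disc algebra.  The kernel is then the
  boundary value of some \<open>g\<close> in \<open>H\<^sup>\<infinity>\<close> with \<open>g 0 = 0\<close>, and linear independence of the functionals applies.\<close>

lemma outer_rate_independent:
  assumes z: "\<And>h. h \<in> disk_algebra \<Longrightarrow> (\<Sum>j\<in>{1..N}. c j * outer_rate j h) = 0" and j: "j \<in> {1..N}"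
  shows "c j = 0"
proof -
  obtain C where C: "AE \<theta> in ang. norm (kernel c \<theta>) \<le> C" by (rule kernel_bounded)
  obtain g where g: "g \<in> hol_bounded unit_disk" "g 0 = 0" "AE \<theta> in ang. has_bdval g (cis \<theta>) \<and> bdval g (cis \<theta>) = kernel c \<theta>"
  proof (rule annihilator_of_disk_algebra[OF kernel_measurable C])
    fix h :: "complex \<Rightarrow> complex ^ 'n" assume h: "h \<in> disk_algebra"
    show "integral\<^sup>L ang (\<lambda>\<theta>. Re (kernel c \<theta> \<bullet>\<^sub>c h (cis \<theta>))) = 0"
      using has_bochner_integral_integral_eq[OF kernel_integral[OF h, of c]] z[OF h] by simp
  qed
  define P where "P = (\<lambda>\<zeta>. has_bdval s \<zeta> \<and> has_bdval g \<zeta> \<and> (\<Sum>j\<in>{1..N}. c j *\<^sub>R (w j \<zeta> * bdval s \<zeta>)) = bdval g \<zeta>)"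
  have "AE \<theta> in ang. P (cis \<theta>)"
    using g(3) AE_S by eventually_elim (use bd in \<open>auto simp: P_def kernel_def\<close>)
  then obtain T where T: "T \<in> sets circle_measure" "\<And>\<zeta>. \<zeta> \<in> T \<Longrightarrow> P \<zeta>" "T \<subseteq> unit_circle" "AE \<theta> in ang. cis \<theta> \<in> T"
    using AE_circle_full_set[of P] by blast
  have "0 < emeasure circle_measure T"
  proof (rule emeasure_circle_measure_pos[OF T(1)])
    show "\<not> (AE \<theta> in ang. cis \<theta> \<notin> T)"
    proof
      assume "AE \<theta> in ang. cis \<theta> \<notin> T"
      with T(4) have "AE \<theta> in ang. False" by eventually_elim simp
      then show False using ang_not_AE_False by simp
    qed
  qed
  then show ?thesis using kernel_not_boundary_value[OF g(1,2) T(1) _ _ j] T(2) unfolding P_def by blast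
qed

lemma dual_basis: obtains e where "\<And>i. i \<in> {1..N} \<Longrightarrow> e i \<in> disk_algebra"
  "\<And>i j. i \<in> {1..N} \<Longrightarrow> j \<in> {1..N} \<Longrightarrow> outer_rate j (e i) = (if i = j then 1 else 0)"
proof (rule dual_family_exists[of "{1..N}" disk_algebra "\<lambda>h k z. h z + k z" "\<lambda>c h z. c *\<^sub>R h z" outer_rate])
qed (use disk_algebra_add disk_algebra_scale outer_rate_add outer_rate_scale outer_rate_independent in \<open>blast+\<close>)

text \<open>The factor \<open>6\<close> is a reserve.  A perturbation of \<open>f\<close> spends half of it, which leaves \<open>3\<close>; the
  subtraction of the harmonic majorant spends at most one more, and \<open>2\<close> is what the Hopf majorant
  requires.\<close>

lemma hopf_constant: obtains \<kappa> where "\<kappa> > 0" "\<And>z. norm z \<le> 1/2 \<Longrightarrow> u (f z) \<le> - 6 * \<kappa> * ln 2"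
proof -
  have fc: "continuous_on (cball 0 (1/2)) f"
    by (rule continuous_on_subset[OF vec_holomorphic_continuous_on[OF f(1)]]) auto
  have ufc: "continuous_on (cball 0 (1/2)) (\<lambda>z. u (f z))"
  proof (rule continuous_on_compose2[OF ucont fc])
    show "f ` cball 0 (1/2) \<subseteq> G"
    proof (rule image_subsetI)
      fix z :: complex assume "z \<in> cball 0 (1/2)"
      then have "z \<in> ball 0 1" by simp
      then show "f z \<in> G" using f(2) D by blast
    qed
  qed
  have "cball (0::complex) (1/2) \<noteq> {}" by simp
  then obtain z0 where z0: "z0 \<in> cball 0 (1/2)" "\<And>z. z \<in> cball 0 (1/2) \<Longrightarrow> u (f z) \<le> u (f z0)"
    using continuous_attains_sup[OF compact_cball _ ufc] by blast
  have "f z0 \<in> D" using z0(1) f(2) by auto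
  then have neg: "u (f z0) < 0" using D by simp
  show ?thesis
  proof (rule that[of "- u (f z0) / (6 * ln 2)"])
    show "0 < - u (f z0) / (6 * ln 2)" using neg by (intro divide_pos_pos) auto
    show "u (f z) \<le> - 6 * (- u (f z0) / (6 * ln 2)) * ln 2" if "norm z \<le> 1/2" for z
      using z0(2)[of z] that by simp
  qed
qed

section \<open>Outer variations\<close>

definition perturb :: "(complex \<Rightarrow> complex ^ 'n) \<Rightarrow> real \<Rightarrow> complex \<Rightarrow> complex ^ 'n" where
  "perturb h t z = f z + t *\<^sub>R (s z * h z)"

lemma perturb_holomorphic: "h \<in> disk_algebra \<Longrightarrow> vec_holomorphic_on (perturb h t) (ball 0 1)"
  unfolding perturb_def[abs_def] by (intro vec_holomorphic_add vec_holomorphic_scale sh_holomorphic f(1))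

lemma perturb_bdval:
  assumes \<zeta>: "\<zeta> \<in> S" and h: "h \<in> disk_algebra"
  shows "has_bdval (perturb h t) \<zeta>" "bdval (perturb h t) \<zeta> = bdval f \<zeta> + t *\<^sub>R (bdval s \<zeta> * h \<zeta>)"
proof -
  have n: "norm \<zeta> = 1" by (rule norm_S[OF \<zeta>])
  have "(f \<longlongrightarrow> bdval f \<zeta>) (nontangential \<zeta>)" using tendsto_bdval[OF n] bd[OF \<zeta>] by blast
  moreover have "((\<lambda>z. s z * h z) \<longlongrightarrow> bdval s \<zeta> * h \<zeta>) (nontangential \<zeta>)"
    using tendsto_bdval[OF n bdval_sh(1)[OF \<zeta> h]] bdval_sh(2)[OF \<zeta> h] by simp
  ultimately have "(perturb h t \<longlongrightarrow> bdval f \<zeta> + t *\<^sub>R (bdval s \<zeta> * h \<zeta>)) (nontangential \<zeta>)"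
    unfolding perturb_def[abs_def] by (intro tendsto_intros)
  from bdval_eqI[OF n this] show "has_bdval (perturb h t) \<zeta>" "bdval (perturb h t) \<zeta> = bdval f \<zeta> + t *\<^sub>R (bdval s \<zeta> * h \<zeta>)" .
qed

lemma perturb_first_order:
  assumes Bh: "0 \<le> Bh" and \<gamma>: "\<gamma> > 0"
  obtains \<tau> where "\<tau> > 0" "\<And>h t \<theta>. h \<in> disk_algebra \<Longrightarrow> (\<And>z. norm z \<le> 1 \<Longrightarrow> norm (h z) \<le> Bh) \<Longrightarrow> 0 < t \<Longrightarrow> t \<le> \<tau> \<Longrightarrow> cis \<theta> \<in> S \<Longrightarrow>
    u (bdval (perturb h t) (cis \<theta>)) \<le> ub \<theta> + 2 * t * Re (grad \<theta> \<bullet>\<^sub>c h (cis \<theta>)) + t * \<gamma>"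
proof -
  define \<eta> where "\<eta> = \<gamma> / (Bh + 1)"
  have \<eta>: "\<eta> > 0" using Bh \<gamma> by (simp add: \<eta>_def add_nonneg_pos)
  obtain d where d: "d > 0" "d \<le> \<epsilon>" "\<And>h \<zeta>. h \<in> disk_algebra \<Longrightarrow> sup_norm_on unit_disk h \<le> d \<Longrightarrow> \<zeta> \<in> S \<Longrightarrow>
     \<bar>u (bdval f \<zeta> + bdval s \<zeta> * h \<zeta>) - u (bdval f \<zeta>) - 2 * Re ((bdval s \<zeta> * complex_gradient u (bdval f \<zeta>)) \<bullet>\<^sub>c h \<zeta>)\<bar>
       \<le> \<eta> * sup_norm_on unit_disk h"
    using expansion[OF \<eta>] by blast
  define \<tau> where "\<tau> = d / (Bh + 1)"
  have \<tau>: "\<tau> > 0" using Bh d by (simp add: \<tau>_def add_nonneg_pos)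
  show ?thesis
  proof (rule that[OF \<tau>])
    fix h :: "complex \<Rightarrow> complex ^ 'n" and t \<theta> :: real
    assume h: "h \<in> disk_algebra" "\<And>z. norm z \<le> 1 \<Longrightarrow> norm (h z) \<le> Bh" and t: "0 < t" "t \<le> \<tau>" and \<theta>: "cis \<theta> \<in> S"
    define k where "k = (\<lambda>z. t *\<^sub>R h z)"
    have k: "k \<in> disk_algebra" unfolding k_def by (rule disk_algebra_scale[OF h(1)])
    have sk: "sup_norm_on unit_disk k \<le> t * Bh"
      by (rule sup_norm_le) (use h(2) t in \<open>auto simp: k_def intro!: mult_left_mono\<close>)
    have "t * Bh \<le> \<tau> * (Bh + 1)" using t Bh by (intro mult_mono) auto
    also have "\<dots> = d" using Bh by (simp add: \<tau>_def)
    finally have "sup_norm_on unit_disk k \<le> d" using sk by simp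
    from d(3)[OF k this \<theta>]
    have 1: "\<bar>u (bdval f (cis \<theta>) + bdval s (cis \<theta>) * k (cis \<theta>)) - ub \<theta> - 2 * Re (grad \<theta> \<bullet>\<^sub>c k (cis \<theta>))\<bar> \<le> \<eta> * sup_norm_on unit_disk k"
      unfolding ub_def grad_def .
    have "\<eta> * sup_norm_on unit_disk k \<le> \<eta> * (t * Bh)" using sk \<eta> by (intro mult_left_mono) auto
    also have "\<dots> \<le> \<eta> * (t * (Bh + 1))" using \<eta> t by (intro mult_left_mono) auto
    also have "\<dots> = t * \<gamma>" using Bh by (simp add: \<eta>_def)
    finally have 2: "\<eta> * sup_norm_on unit_disk k \<le> t * \<gamma>" .
    have 3: "bdval (perturb h t) (cis \<theta>) = bdval f (cis \<theta>) + bdval s (cis \<theta>) * k (cis \<theta>)"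
      unfolding perturb_bdval(2)[OF \<theta> h(1)] k_def mult_scaleR_vec ..
    have 4: "2 * Re (grad \<theta> \<bullet>\<^sub>c k (cis \<theta>)) = 2 * t * Re (grad \<theta> \<bullet>\<^sub>c h (cis \<theta>))" by (simp add: k_def bullet_simps)
    show "u (bdval (perturb h t) (cis \<theta>)) \<le> ub \<theta> + 2 * t * Re (grad \<theta> \<bullet>\<^sub>c h (cis \<theta>)) + t * \<gamma>"
      unfolding 3 using 1 2 4 by linarith
  qed
qed

text \<open>For the map \<open>F = f + t s \<cdot> h\<close>, the first-order expansion and the hypothesis on \<open>h\<close> give
  \<open>u (F\<^sup>*) \<le> t * \<kappa> * \<phi> - t * \<delta> / 2\<close> on the circle, hence a Poisson majorant inside, which the Hopf majorant
  improves by \<open>\<kappa> * ln (norm z)\<close>.  The image of \<open>F\<close> may leave \<open>D\<close> where \<open>\<phi> > 0\<close>; composing with \<open>\<psi>\<close> such that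
  \<open>ln (norm (\<psi> z)) \<le> - t * Re (herglotz \<phi> (\<psi> z))\<close> cancels exactly this excess.  The bound on \<open>t\<close> does not
  depend on \<open>h\<close>, because the correcting terms of \<open>h\<close> are chosen only after \<open>t\<close>.\<close>

lemma perturbation_estimate:
  assumes \<kappa>: "\<kappa> > 0" and hopf: "\<And>z. norm z \<le> 1/2 \<Longrightarrow> u (f z) \<le> - 6 * \<kappa> * ln 2"
    and Bh: "0 \<le> Bh" and \<phi>: "\<phi> \<in> bounded_fns" "\<And>\<theta>. 0 \<le> \<phi> \<theta>" and \<delta>: "\<delta> > 0"
    and d: "d > 0" "compact {x. infdist x (closure D) \<le> d}" "{x. infdist x (closure D) \<le> d} \<subseteq> G"
  obtains \<tau> where "\<tau> > 0"
    "\<And>h t z. h \<in> disk_algebra \<Longrightarrow> (\<And>z. norm z \<le> 1 \<Longrightarrow> norm (h z) \<le> Bh) \<Longrightarrow> 0 < t \<Longrightarrow> t \<le> \<tau> \<Longrightarrow>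
      (AE \<theta> in ang. ub \<theta> + 2 * Re (grad \<theta> \<bullet>\<^sub>c h (cis \<theta>)) + \<delta> \<le> \<kappa> * \<phi> \<theta>) \<Longrightarrow> norm z < 1 \<Longrightarrow>
      infdist (perturb h t z) (closure D) \<le> d \<and>
      (norm z \<le> 1/2 \<longrightarrow> u (perturb h t z) \<le> - 3 * \<kappa> * ln 2) \<and>
      (1/2 < norm z \<longrightarrow> u (perturb h t z) \<le> t * \<kappa> * Re (herglotz \<phi> z) - t * \<delta> / 2 + \<kappa> * ln (norm z))"
proof -
  let ?K = "{x. infdist x (closure D) \<le> d}"
  obtain Bs where Bs: "Bs > 0" "\<And>z. norm z < 1 \<Longrightarrow> norm (s z) \<le> Bs" by (rule s_bound) blast
  obtain \<tau>1 where \<tau>1: "\<tau>1 > 0" "\<And>h t \<theta>. h \<in> disk_algebra \<Longrightarrow> (\<And>z. norm z \<le> 1 \<Longrightarrow> norm (h z) \<le> Bh) \<Longrightarrow> 0 < t \<Longrightarrow> t \<le> \<tau>1 \<Longrightarrow> cis \<theta> \<in> S \<Longrightarrow>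
    u (bdval (perturb h t) (cis \<theta>)) \<le> ub \<theta> + 2 * t * Re (grad \<theta> \<bullet>\<^sub>c h (cis \<theta>)) + t * (\<delta> / 2)"
    using perturb_first_order[OF Bh, of "\<delta> / 2"] \<delta> by auto
  have ucK: "continuous_on ?K u" by (rule continuous_on_subset[OF ucont d(3)])
  have k2: "\<kappa> * ln 2 > 0" using \<kappa> by simp
  have "uniformly_continuous_on ?K u" by (rule compact_uniformly_continuous[OF ucK d(2)])
  then obtain \<sigma> where \<sigma>: "\<sigma> > 0" "\<And>x y. x \<in> ?K \<Longrightarrow> y \<in> ?K \<Longrightarrow> dist x y < \<sigma> \<Longrightarrow> dist (u x) (u y) < 3 * (\<kappa> * ln 2)"
    unfolding uniformly_continuous_on_def using k2 by (metis zero_less_mult_iff zero_less_numeral)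
  define \<tau> where "\<tau> = Min {\<tau>1, 1, d / (Bs * (Bh + 1)), \<sigma> / (2 * (Bs * (Bh + 1))), 2 * (\<kappa> * ln 2) / \<delta>}"
  have BB: "Bs * (Bh + 1) > 0" using Bs Bh by simp
  have \<tau>: "\<tau> > 0" "\<tau> \<le> \<tau>1" "\<tau> \<le> 1" "\<tau> \<le> d / (Bs * (Bh + 1))" "\<tau> \<le> \<sigma> / (2 * (Bs * (Bh + 1)))" "\<tau> \<le> 2 * (\<kappa> * ln 2) / \<delta>"
  proof -
    show "\<tau> > 0" unfolding \<tau>_def using \<tau>1(1) d(1) BB \<sigma>(1) k2 \<delta> by (subst Min_gr_iff) auto
  qed (unfold \<tau>_def, (rule Min_le; simp)+)
  show ?thesis
  proof (rule that[OF \<tau>(1)])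
    fix h :: "complex \<Rightarrow> complex ^ 'n" and t :: real and z :: complex
    assume h: "h \<in> disk_algebra" "\<And>z. norm z \<le> 1 \<Longrightarrow> norm (h z) \<le> Bh" and t: "0 < t" "t \<le> \<tau>"
      and ae: "AE \<theta> in ang. ub \<theta> + 2 * Re (grad \<theta> \<bullet>\<^sub>c h (cis \<theta>)) + \<delta> \<le> \<kappa> * \<phi> \<theta>" and z: "norm z < 1"
    let ?F = "perturb h t"
    have Fdist: "dist (?F x) (f x) \<le> t * (Bs * (Bh + 1))" if "norm x < 1" for x
    proof -
      have "norm (s x * h x) \<le> Bs * (Bh + 1)"
        by (rule order_trans[OF norm_vec_mult_le]) (use Bs(2)[OF that] h(2)[of x] that Bh Bs(1) in \<open>auto intro!: mult_mono\<close>)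
      then show ?thesis using t by (simp add: perturb_def dist_norm mult_left_mono)
    qed
    have tB: "t * (Bs * (Bh + 1)) \<le> d" "t * (Bs * (Bh + 1)) < \<sigma>"
    proof -
      have "t \<le> d / (Bs * (Bh + 1))" using t \<tau> by linarith
      then show "t * (Bs * (Bh + 1)) \<le> d" using BB by (simp only: pos_le_divide_eq)
      have "t \<le> \<sigma> / (2 * (Bs * (Bh + 1)))" using t \<tau> by linarith
      then have "t * (2 * (Bs * (Bh + 1))) \<le> \<sigma>" using BB by (subst (asm) pos_le_divide_eq) auto
      then show "t * (Bs * (Bh + 1)) < \<sigma>" using \<sigma>(1) by simp
    qed
    have fD: "f x \<in> closure D" if "norm x < 1" for x
      using f(2) D_sub that by (meson image_subset_iff mem_ball_0 subsetD)
    have FK: "?F x \<in> ?K" if "norm x < 1" for x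
    proof -
      have "infdist (?F x) (closure D) \<le> dist (?F x) (f x)" by (rule infdist_le[OF fD[OF that]])
      then show ?thesis using Fdist[OF that] tB by simp
    qed
    have fK: "f x \<in> ?K" if "norm x < 1" for x using fD[OF that] d(1) by simp
    have half: "u (?F x) \<le> - 3 * \<kappa> * ln 2" if x: "norm x \<le> 1/2" for x
    proof -
      have x1: "norm x < 1" using x by simp
      have "dist (u (?F x)) (u (f x)) < 3 * (\<kappa> * ln 2)"
        by (rule \<sigma>(2)[OF FK[OF x1] fK[OF x1]]) (use Fdist[OF x1] tB in linarith)
      then have "u (?F x) < u (f x) + 3 * (\<kappa> * ln 2)" unfolding dist_real_def by linarith
      then show ?thesis using hopf[OF x] by (simp add: algebra_simps)
    qed
    have hF: "vec_holomorphic_on ?F (ball 0 1)" by (rule perturb_holomorphic[OF h(1)])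
    have imF: "?F ` ball 0 1 \<subseteq> ?K" using FK by auto
    have bF: "AE \<theta> in ang. has_bdval ?F (cis \<theta>)" using AE_S by eventually_elim (rule perturb_bdval(1)[OF _ h(1)])
    define q where "q = (\<lambda>x. of_real (t * \<kappa>) * herglotz \<phi> x - of_real (t * \<delta> / 2))"
    have qh: "q holomorphic_on ball 0 1" unfolding q_def by (intro holomorphic_intros bounded_fn_herglotz(1) \<phi>(1))
    have qR: "Re (q x) = t * \<kappa> * Re (herglotz \<phi> x) - t * \<delta> / 2" for x by (simp add: q_def)
    have le: "u (?F x) \<le> Re (q x)" if x: "norm x < 1" for x
    proof -
      have "u (?F x) \<le> poisson_integral (\<lambda>\<theta>. u (bdval ?F (cis \<theta>))) x"
        by (rule poisson_majorant[OF psh ucont G d(2,3) hF imF bF x])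
      also have "\<dots> \<le> 1 / (2*pi) * integral\<^sup>L ang (\<lambda>\<theta>. t * \<kappa> * (\<phi> \<theta> * poisson_kernel x \<theta>) - t * \<delta> / 2 * poisson_kernel x \<theta>)"
        unfolding poisson_integral_def
      proof (intro mult_left_mono integral_mono_AE)
        show "AE \<theta> in ang. u (bdval ?F (cis \<theta>)) * poisson_kernel x \<theta> \<le> t * \<kappa> * (\<phi> \<theta> * poisson_kernel x \<theta>) - t * \<delta> / 2 * poisson_kernel x \<theta>"
          using AE_S ae
        proof eventually_elim
          case (elim \<theta>)
          have "u (bdval ?F (cis \<theta>)) \<le> ub \<theta> + 2 * t * Re (grad \<theta> \<bullet>\<^sub>c h (cis \<theta>)) + t * (\<delta> / 2)"
            by (rule \<tau>1(2)[OF h t(1) _ elim(1)]) (use t \<tau> in auto)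
          \<comment> \<open>Here \<open>u (f\<^sup>*) \<le> 0\<close> is used: the full value of \<open>u (f\<^sup>*)\<close> is available although only its \<open>t\<close>-fold is needed.\<close>
          also have "ub \<theta> \<le> t * ub \<theta>"
            using mult_right_mono_neg[of t 1 "ub \<theta>"] ub_nonpos[OF elim(1)] t \<tau> by simp
          finally have "u (bdval ?F (cis \<theta>)) \<le> t * (ub \<theta> + 2 * Re (grad \<theta> \<bullet>\<^sub>c h (cis \<theta>)) + \<delta>) - t * \<delta> / 2"
            by (simp add: algebra_simps)
          also have "t * (ub \<theta> + 2 * Re (grad \<theta> \<bullet>\<^sub>c h (cis \<theta>)) + \<delta>) \<le> t * (\<kappa> * \<phi> \<theta>)"
            using elim(2) t by (intro mult_left_mono) auto
          finally have "u (bdval ?F (cis \<theta>)) \<le> t * (\<kappa> * \<phi> \<theta>) - t * \<delta> / 2" by simp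
          from mult_right_mono[OF this poisson_kernel_nonneg[OF x]] show ?case by (simp add: algebra_simps)
        qed
        show "integrable ang (\<lambda>\<theta>. t * \<kappa> * (\<phi> \<theta> * poisson_kernel x \<theta>) - t * \<delta> / 2 * poisson_kernel x \<theta>)"
          using bounded_fn_herglotz(3)[OF \<phi>(1) x] poisson_kernel_mean[OF x]
          by (intro Bochner_Integration.integrable_diff integrable_mult_right) (auto simp: has_bochner_integral_iff)
        have "(\<lambda>\<theta>. u (bdval ?F (cis \<theta>))) \<in> bounded_fns"
        proof -
          have m: "(\<lambda>\<theta>. bdval ?F (cis \<theta>)) \<in> borel_measurable ang"
            by (rule bdval_measurable[OF vec_holomorphic_continuous_on[OF hF] bF])
          have inK: "AE \<theta> in ang. bdval ?F (cis \<theta>) \<in> ?K"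
            using bF by eventually_elim (rule bdval_in_closed[OF _ _ compact_imp_closed[OF d(2)] imF], auto)
          then have "AE \<theta> in ang. indicator G (bdval ?F (cis \<theta>)) *\<^sub>R u (bdval ?F (cis \<theta>)) = u (bdval ?F (cis \<theta>))"
            by eventually_elim (use d(3) in auto)
          then have mm: "(\<lambda>\<theta>. u (bdval ?F (cis \<theta>))) \<in> borel_measurable ang"
            by (rule ang_AE_measurable[OF u_compose_measurable[OF m]])
          obtain M where M: "0 \<le> M" "\<And>x. x \<in> ?K \<Longrightarrow> norm (u x) \<le> M" using continuous_bounded_on_compact[OF d(2) ucK] by blast
          have "AE \<theta> in ang. \<bar>u (bdval ?F (cis \<theta>))\<bar> \<le> M" using inK by eventually_elim (use M(2) in force)
          then show ?thesis by (rule bounded_fnsI[OF mm])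
        qed
        from bounded_fn_herglotz(3)[OF this x]
        show "integrable ang (\<lambda>\<theta>. u (bdval ?F (cis \<theta>)) * poisson_kernel x \<theta>)" .
      qed simp
      also have "integral\<^sup>L ang (\<lambda>\<theta>. t * \<kappa> * (\<phi> \<theta> * poisson_kernel x \<theta>) - t * \<delta> / 2 * poisson_kernel x \<theta>)
          = t * \<kappa> * integral\<^sup>L ang (\<lambda>\<theta>. \<phi> \<theta> * poisson_kernel x \<theta>) - t * \<delta> / 2 * (2*pi)"
        using has_bochner_integral_integral_eq[OF has_bochner_integral_diff[OF
          has_bochner_integral_mult_right[OF has_bochner_integral_integrable[OF bounded_fn_herglotz(3)[OF \<phi>(1) x]]]
          has_bochner_integral_mult_right[OF poisson_kernel_mean[OF x]]]] .
      also have "1 / (2*pi) * (t * \<kappa> * integral\<^sup>L ang (\<lambda>\<theta>. \<phi> \<theta> * poisson_kernel x \<theta>) - t * \<delta> / 2 * (2*pi)) = Re (q x)"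
        unfolding qR bounded_fn_herglotz(2)[OF \<phi>(1) x] poisson_integral_def by (simp add: field_simps)
      finally show ?thesis .
    qed
    have "u (?F z) \<le> Re (q z) + \<kappa> * ln (norm z)" if z2: "1/2 < norm z"
    proof (rule hopf_majorant[OF psh ucont G d(2,3) hF imF qh le \<kappa> _ z2 z])
      fix x :: complex assume x: "norm x \<le> 1/2"
      have "0 \<le> t * \<kappa> * Re (herglotz \<phi> x)" using t \<kappa> herglotz_nonneg[OF \<phi>, of x] x by simp
      moreover have "t * \<delta> / 2 \<le> \<kappa> * ln 2"
      proof -
        have "t \<le> 2 * (\<kappa> * ln 2) / \<delta>" using t \<tau> by linarith
        then show ?thesis using \<delta> by (simp add: field_simps)
      qed
      ultimately show "u (?F x) - Re (q x) \<le> - \<kappa> * ln 2 * 2" using half[OF x] unfolding qR by (simp add: algebra_simps)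
    qed
    then show "infdist (?F z) (closure D) \<le> d \<and> (norm z \<le> 1/2 \<longrightarrow> u (?F z) \<le> - 3 * \<kappa> * ln 2) \<and>
      (1/2 < norm z \<longrightarrow> u (?F z) \<le> t * \<kappa> * Re (herglotz \<phi> z) - t * \<delta> / 2 + \<kappa> * ln (norm z))"
      using FK[OF z] half unfolding qR by blast
  qed
qed

lemma pairing_tendsto:
  assumes j: "j \<in> {1..N}" and F: "\<And>m::nat. continuous_on (ball 0 1) (F m)"
    and lim: "\<And>z. norm z = r0 \<Longrightarrow> (\<lambda>m. F m z) \<longlonglongrightarrow> F0 z"
    and b: "\<And>m z. norm z = r0 \<Longrightarrow> norm (F m z) \<le> C"
  shows "(\<lambda>m. circle_pairing r0 (w j) (F m)) \<longlonglongrightarrow> circle_pairing r0 (w j) F0"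
proof -
  obtain W where W: "0 \<le> W" "\<And>j \<theta>. j \<in> {1..N} \<Longrightarrow> \<theta> \<in> {0..2*pi} \<Longrightarrow> norm (w j (of_real r0 * cis \<theta>)) \<le> W"
    by (rule w_bound) blast
  have nz: "norm (of_real r0 * cis \<theta>) = r0" for \<theta> using r0 by (simp add: norm_mult)
  have C0: "0 \<le> C" using b[OF nz[of 0]] norm_ge_zero order_trans by blast
  have L: "AE \<theta> in ang. (\<lambda>m. Re (F m (of_real r0 * cis \<theta>) \<bullet>\<^sub>c w j (of_real r0 * cis \<theta>))) \<longlonglongrightarrow> Re (F0 (of_real r0 * cis \<theta>) \<bullet>\<^sub>c w j (of_real r0 * cis \<theta>))"
    by (intro AE_I2 tendsto_Re tendsto_bullet tendsto_const lim nz)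
  have m: "(\<lambda>\<theta>. Re (F m (of_real r0 * cis \<theta>) \<bullet>\<^sub>c w j (of_real r0 * cis \<theta>))) \<in> borel_measurable ang" for m
    using pairing_integrable[OF j F] by (rule borel_measurable_integrable)
  have "(\<lambda>m. integral\<^sup>L ang (\<lambda>\<theta>. Re (F m (of_real r0 * cis \<theta>) \<bullet>\<^sub>c w j (of_real r0 * cis \<theta>)))) \<longlonglongrightarrow>
      integral\<^sup>L ang (\<lambda>\<theta>. Re (F0 (of_real r0 * cis \<theta>) \<bullet>\<^sub>c w j (of_real r0 * cis \<theta>)))"
  proof (rule integral_dominated_convergence[OF ang_AE_limit_measurable[OF m L] m _ L])
    show "integrable ang (\<lambda>_. real CARD('n) * (C * W))" by (rule integrable_ang_continuous) auto
    show "AE \<theta> in ang. norm (Re (F m (of_real r0 * cis \<theta>) \<bullet>\<^sub>c w j (of_real r0 * cis \<theta>))) \<le> real CARD('n) * (C * W)" for m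
    proof (rule AE_I2)
      fix \<theta> assume "\<theta> \<in> space ang"
      then have t: "\<theta> \<in> {0..2*pi}" by simp
      have "norm (Re (F m (of_real r0 * cis \<theta>) \<bullet>\<^sub>c w j (of_real r0 * cis \<theta>))) \<le> norm (F m (of_real r0 * cis \<theta>) \<bullet>\<^sub>c w j (of_real r0 * cis \<theta>))"
        using abs_Re_le_cmod by simp
      also have "\<dots> \<le> real CARD('n) * (norm (F m (of_real r0 * cis \<theta>)) * norm (w j (of_real r0 * cis \<theta>)))" by (rule bullet_bound)
      also have "\<dots> \<le> real CARD('n) * (C * W)"
        by (intro mult_left_mono mult_mono b nz W(2)[OF j t] C0) auto
      finally show "norm (Re (F m (of_real r0 * cis \<theta>) \<bullet>\<^sub>c w j (of_real r0 * cis \<theta>))) \<le> real CARD('n) * (C * W)" .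
    qed
  qed
  then show ?thesis unfolding circle_pairing_def by (intro tendsto_mult tendsto_const)
qed

lemma f_lipschitz: obtains C where "0 \<le> C" "\<And>x y. norm x \<le> r0 \<Longrightarrow> norm y \<le> r0 \<Longrightarrow> norm (f x - f y) \<le> C * norm (x - y)"
proof -
  have fk: "(\<lambda>z. f z $ k) holomorphic_on ball 0 1" for k using f(1) by (simp add: vec_holomorphic_on_def)
  have sub: "cball 0 r0 \<subseteq> ball (0::complex) 1" using r0 by auto
  have "\<exists>M. \<forall>z\<in>cball 0 r0. norm (deriv (\<lambda>z. f z $ k) z) \<le> M" for k
  proof -
    have "continuous_on (cball 0 r0) (deriv (\<lambda>z. f z $ k))"
      by (rule continuous_on_subset[OF holomorphic_on_imp_continuous_on[OF holomorphic_deriv[OF fk open_ball]] sub])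
    then show ?thesis using continuous_bounded_on_compact[OF compact_cball] by metis
  qed
  then obtain M where M: "\<And>k z. z \<in> cball 0 r0 \<Longrightarrow> norm (deriv (\<lambda>z. f z $ k) z) \<le> M k" by metis
  have "norm (f x - f y) \<le> (\<Sum>k\<in>UNIV. \<bar>M k\<bar>) * norm (x - y)" if xy: "norm x \<le> r0" "norm y \<le> r0" for x y
  proof -
    have "norm (f x - f y) \<le> (\<Sum>k\<in>UNIV. norm ((f x - f y) $ k))" by (rule norm_vec_le_sum)
    also have "\<dots> \<le> (\<Sum>k\<in>UNIV. \<bar>M k\<bar> * norm (x - y))"
    proof (rule sum_mono)
      fix k
      have "norm (f x $ k - f y $ k) \<le> M k * norm (x - y)"
      proof (rule field_differentiable_bound[where S = "cball 0 r0" and f' = "deriv (\<lambda>z. f z $ k)"])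
        show "((\<lambda>z. f z $ k) has_field_derivative deriv (\<lambda>z. f z $ k) z) (at z within cball 0 r0)" if "z \<in> cball 0 r0" for z
          by (rule has_field_derivative_at_within[OF holomorphic_derivI[OF fk open_ball]]) (use that sub in blast)
        show "norm (deriv (\<lambda>z. f z $ k) z) \<le> M k" if "z \<in> cball 0 r0" for z by (rule M[OF that])
      qed (use xy in auto)
      also have "\<dots> \<le> \<bar>M k\<bar> * norm (x - y)" by (intro mult_right_mono) auto
      finally show "norm ((f x - f y) $ k) \<le> \<bar>M k\<bar> * norm (x - y)" by simp
    qed
    finally show ?thesis by (simp add: sum_distrib_right)
  qed
  then show ?thesis using that[of "\<Sum>k\<in>UNIV. \<bar>M k\<bar>"] by (simp add: sum_nonneg)
qed

section \<open>Inner variations\<close>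

text \<open>Composing \<open>f\<close> with \<open>\<psi>\<^sub>t\<close>, where \<open>\<psi>\<^sub>t z = z * exp (- t * herglotz \<phi> (\<psi>\<^sub>t z))\<close>, gives
  \<open>f - t z (herglotz \<phi> z) f' + o(t)\<close>.  So this is the rate at which the inner variation decreases \<open>\<Phi>\<^sub>j\<close>.\<close>

definition inner_rate :: "nat \<Rightarrow> (real \<Rightarrow> real) \<Rightarrow> real" where
  "inner_rate j \<phi> = circle_pairing r0 (w j) (\<lambda>z. (z * herglotz \<phi> z) *s f' z)"

lemma pairing_cong: "(\<And>z. norm z = r0 \<Longrightarrow> F z = H z) \<Longrightarrow> circle_pairing r0 (w j) F = circle_pairing r0 (w j) H"
  unfolding circle_pairing_def using r0 by (simp add: norm_mult)

lemma f'_holomorphic: "vec_holomorphic_on f' (ball 0 1)"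
  using f(1) by (auto simp: vec_holomorphic_on_def f'_def intro!: holomorphic_deriv)

lemma inner_field_continuous: "\<phi> \<in> bounded_fns \<Longrightarrow> continuous_on (ball 0 1) (\<lambda>z. (z * herglotz \<phi> z) *s f' z)"
  by (rule vec_holomorphic_continuous_on)
    (use f'_holomorphic bounded_fn_herglotz(1) in \<open>auto simp: vec_holomorphic_on_def intro!: holomorphic_intros\<close>)

lemma inner_rate_add:
  assumes j: "j \<in> {1..N}" and \<phi>: "\<phi> \<in> bounded_fns" "\<xi> \<in> bounded_fns"
  shows "inner_rate j (\<lambda>t. \<phi> t + \<xi> t) = inner_rate j \<phi> + inner_rate j \<xi>"
proof -
  have "inner_rate j (\<lambda>t. \<phi> t + \<xi> t) = circle_pairing r0 (w j) (\<lambda>z. (z * herglotz \<phi> z) *s f' z + (z * herglotz \<xi> z) *s f' z)"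
    unfolding inner_rate_def by (rule pairing_cong) (use \<phi> r0 in \<open>simp add: herglotz_add vec_eq_iff algebra_simps\<close>)
  then show ?thesis unfolding inner_rate_def using pairing_add[OF j inner_field_continuous[OF \<phi>(1)] inner_field_continuous[OF \<phi>(2)]] by simp
qed

lemma inner_rate_scale: "inner_rate j (\<lambda>t. c * \<phi> t) = c * inner_rate j \<phi>"
proof -
  have "inner_rate j (\<lambda>t. c * \<phi> t) = circle_pairing r0 (w j) (\<lambda>z. c *\<^sub>R ((z * herglotz \<phi> z) *s f' z))"
    unfolding inner_rate_def by (rule pairing_cong) (simp add: herglotz_scale vec_eq_iff, simp add: scaleR_conv_of_real algebra_simps)
  then show ?thesis unfolding inner_rate_def pairing_scale .
qed

text \<open>On the circle of radius \<open>r0\<close> the Herglotz integral is bounded by a multiple of the integral of \<open>\<phi>\<close>.\<close>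

lemma inner_rate_bound: obtains C where "0 \<le> C" "\<And>j \<phi>. j \<in> {1..N} \<Longrightarrow> \<phi> \<in> bounded_fns \<Longrightarrow> (\<And>\<theta>. 0 \<le> \<phi> \<theta>) \<Longrightarrow> \<bar>inner_rate j \<phi>\<bar> \<le> C * integral\<^sup>L ang \<phi>"
proof -
  obtain W where W: "0 \<le> W" "\<And>j \<theta>. j \<in> {1..N} \<Longrightarrow> \<theta> \<in> {0..2*pi} \<Longrightarrow> norm (w j (of_real r0 * cis \<theta>)) \<le> W"
    by (rule w_bound) blast
  have "continuous_on (cball 0 r0) f'"
    by (rule continuous_on_subset[OF vec_holomorphic_continuous_on[OF f'_holomorphic]]) (use r0 in auto)
  then obtain B where B: "0 \<le> B" "\<And>z. z \<in> cball 0 r0 \<Longrightarrow> norm (f' z) \<le> B"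
    using continuous_bounded_on_compact[OF compact_cball] by blast
  define C where "C = real CARD('n) * (3 / (1 - r0) * B * W)"
  have C0: "0 \<le> C" using W B r0 by (simp add: C_def)
  show ?thesis
  proof (rule that[OF C0])
    fix j \<phi> assume j: "j \<in> {1..N}" and \<phi>: "\<phi> \<in> bounded_fns" "\<And>\<theta>. 0 \<le> \<phi> \<theta>"
    let ?F = "\<lambda>z. (z * herglotz \<phi> z) *s f' z"
    let ?I = "integral\<^sup>L ang \<phi>"
    have I0: "0 \<le> ?I" using \<phi>(2) by simp
    have pw: "\<bar>Re (?F (of_real r0 * cis \<theta>) \<bullet>\<^sub>c w j (of_real r0 * cis \<theta>))\<bar> \<le> C * ?I" if t: "\<theta> \<in> {0..2*pi}" for \<theta>
    proof -
      let ?z = "of_real r0 * cis \<theta>"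
      have nz: "norm ?z = r0" using r0 by (simp add: norm_mult)
      have "norm (herglotz \<phi> ?z) \<le> 3 / (1 - r0) * ?I"
        using bounded_fn_herglotz(4)[OF \<phi>(1), of ?z] nz r0 \<phi>(2) by simp
      then have "norm (?z * herglotz \<phi> ?z) \<le> 1 * (3 / (1 - r0) * ?I)"
        unfolding norm_mult[of ?z] nz using r0 by (intro mult_mono) auto
      then have "norm (?F ?z) \<le> (3 / (1 - r0) * ?I) * B"
        unfolding norm_vector_scalar using B(2)[of ?z] nz B(1) I0 r0 by (intro mult_mono) auto
      then have *: "norm (?F ?z) * norm (w j ?z) \<le> ((3 / (1 - r0) * ?I) * B) * W"
        using W(2)[OF j t] W(1) B(1) I0 r0 by (intro mult_mono) auto
      have "\<bar>Re (?F ?z \<bullet>\<^sub>c w j ?z)\<bar> \<le> norm (?F ?z \<bullet>\<^sub>c w j ?z)" by (rule abs_Re_le_cmod)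
      also have "\<dots> \<le> real CARD('n) * (norm (?F ?z) * norm (w j ?z))" by (rule bullet_bound)
      also have "\<dots> \<le> real CARD('n) * (((3 / (1 - r0) * ?I) * B) * W)" by (rule mult_left_mono[OF *]) simp
      finally show ?thesis by (simp add: C_def mult_ac)
    qed
    have "\<bar>integral\<^sup>L ang (\<lambda>\<theta>. Re (?F (of_real r0 * cis \<theta>) \<bullet>\<^sub>c w j (of_real r0 * cis \<theta>)))\<bar>
        \<le> integral\<^sup>L ang (\<lambda>\<theta>. \<bar>Re (?F (of_real r0 * cis \<theta>) \<bullet>\<^sub>c w j (of_real r0 * cis \<theta>))\<bar>)" by (rule integral_abs_bound)
    also have "\<dots> \<le> integral\<^sup>L ang (\<lambda>\<theta>. C * ?I)"
    proof (rule integral_mono_AE)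
      show "integrable ang (\<lambda>\<theta>. \<bar>Re (?F (of_real r0 * cis \<theta>) \<bullet>\<^sub>c w j (of_real r0 * cis \<theta>))\<bar>)"
        by (rule integrable_abs[OF pairing_integrable[OF j inner_field_continuous[OF \<phi>(1)]]])
      show "integrable ang (\<lambda>\<theta>. C * ?I)" by (rule integrable_ang_continuous) auto
      show "AE \<theta> in ang. \<bar>Re (?F (of_real r0 * cis \<theta>) \<bullet>\<^sub>c w j (of_real r0 * cis \<theta>))\<bar> \<le> C * ?I"
        by (rule AE_I2) (use pw in simp)
    qed
    also have "\<dots> = 2*pi * (C * ?I)" by (simp add: measure_ang)
    finally have le: "\<bar>integral\<^sup>L ang (\<lambda>\<theta>. Re (?F (of_real r0 * cis \<theta>) \<bullet>\<^sub>c w j (of_real r0 * cis \<theta>)))\<bar> \<le> 2*pi * (C * ?I)" .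
    have "\<bar>inner_rate j \<phi>\<bar> = 1 / (2*pi) * \<bar>integral\<^sup>L ang (\<lambda>\<theta>. Re (?F (of_real r0 * cis \<theta>) \<bullet>\<^sub>c w j (of_real r0 * cis \<theta>)))\<bar>"
      unfolding inner_rate_def circle_pairing_def abs_mult by simp
    also have "\<dots> \<le> 1 / (2*pi) * (2*pi * (C * ?I))" by (rule mult_left_mono[OF le]) simp
    also have "\<dots> = C * ?I" by simp
    finally show "\<bar>inner_rate j \<phi>\<bar> \<le> C * ?I" .
  qed
qed

lemma grad_pairing_bound:
  assumes h: "h \<in> disk_algebra"
  obtains C where "0 \<le> C" "\<And>\<theta>. cis \<theta> \<in> S \<Longrightarrow> \<bar>Re (grad \<theta> \<bullet>\<^sub>c h (cis \<theta>))\<bar> \<le> C"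
proof -
  obtain Cg where Cg: "Cg > 0" "\<And>\<theta>. cis \<theta> \<in> S \<Longrightarrow> norm (grad \<theta>) \<le> Cg" by (rule grad_bounded) blast
  obtain B where B: "0 \<le> B" "\<And>z. norm z \<le> 1 \<Longrightarrow> norm (h z) \<le> B" using disk_algebra_bounded[OF h] by blast
  have "\<bar>Re (grad \<theta> \<bullet>\<^sub>c h (cis \<theta>))\<bar> \<le> real CARD('n) * (Cg * B)" if t: "cis \<theta> \<in> S" for \<theta>
  proof -
    have "\<bar>Re (grad \<theta> \<bullet>\<^sub>c h (cis \<theta>))\<bar> \<le> norm (grad \<theta> \<bullet>\<^sub>c h (cis \<theta>))" by (rule abs_Re_le_cmod)
    also have "\<dots> \<le> real CARD('n) * (norm (grad \<theta>) * norm (h (cis \<theta>)))" by (rule bullet_bound)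
    also have "\<dots> \<le> real CARD('n) * (Cg * B)"
      using Cg(2)[OF t] B(2)[of "cis \<theta>"] Cg(1) B(1) by (intro mult_left_mono mult_mono) auto
    finally show ?thesis .
  qed
  then show ?thesis using that[of "real CARD('n) * (Cg * B)"] Cg B by simp
qed

lemma disk_algebra_combination_bound:
  assumes h0: "h0 \<in> disk_algebra" and e: "\<And>i. i \<in> {1..N} \<Longrightarrow> e i \<in> disk_algebra"
  obtains Bh where "0 \<le> Bh" "\<And>y z. (\<And>i. i \<in> {1..N} \<Longrightarrow> \<bar>y i\<bar> \<le> 2) \<Longrightarrow> norm z \<le> 1 \<Longrightarrow> norm (h0 z + (\<Sum>i\<in>{1..N}. y i *\<^sub>R e i z)) \<le> Bh"
proof -
  obtain B0 where B0: "0 \<le> B0" "\<And>z. norm z \<le> 1 \<Longrightarrow> norm (h0 z) \<le> B0" using disk_algebra_bounded[OF h0] by blast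
  have "\<exists>B. 0 \<le> B \<and> (\<forall>z. norm z \<le> 1 \<longrightarrow> norm (e i z) \<le> B)" if "i \<in> {1..N}" for i
    using disk_algebra_bounded[OF e[OF that]] by metis
  then obtain B where B: "\<And>i. i \<in> {1..N} \<Longrightarrow> 0 \<le> B i \<and> (\<forall>z. norm z \<le> 1 \<longrightarrow> norm (e i z) \<le> B i)" by metis
  show ?thesis
  proof (rule that[of "B0 + (\<Sum>i\<in>{1..N}. 2 * B i)"])
    show "0 \<le> B0 + (\<Sum>i\<in>{1..N}. 2 * B i)" using B0 B by (intro add_nonneg_nonneg sum_nonneg) auto
    fix y :: "nat \<Rightarrow> real" and z :: complex assume y: "\<And>i. i \<in> {1..N} \<Longrightarrow> \<bar>y i\<bar> \<le> 2" and z: "norm z \<le> 1"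
    have "norm (\<Sum>i\<in>{1..N}. y i *\<^sub>R e i z) \<le> (\<Sum>i\<in>{1..N}. norm (y i *\<^sub>R e i z))" by (rule norm_sum)
    also have "\<dots> \<le> (\<Sum>i\<in>{1..N}. 2 * B i)"
      by (rule sum_mono) (use y B z in \<open>auto intro!: mult_mono\<close>)
    finally show "norm (h0 z + (\<Sum>i\<in>{1..N}. y i *\<^sub>R e i z)) \<le> B0 + (\<Sum>i\<in>{1..N}. 2 * B i)"
      using B0(2)[OF z] norm_triangle_ineq[of "h0 z"] by (meson add_mono order_trans)
  qed
qed

lemma pairing_sum:
  fixes c :: "'i \<Rightarrow> real"
  assumes j: "j \<in> {1..N}" and I: "finite I" and F: "\<And>i. i \<in> I \<Longrightarrow> continuous_on (ball 0 1) (F i)"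
  shows "circle_pairing r0 (w j) (\<lambda>z. \<Sum>i\<in>I. c i *\<^sub>R F i z) = (\<Sum>i\<in>I. c i * circle_pairing r0 (w j) (F i))"
  using I F
proof (induction I rule: finite_induct)
  case empty
  show ?case by (simp add: circle_pairing_def bullet_simps)
next
  case (insert i I)
  have "circle_pairing r0 (w j) (\<lambda>z. c i *\<^sub>R F i z + (\<Sum>i\<in>I. c i *\<^sub>R F i z))
      = circle_pairing r0 (w j) (\<lambda>z. c i *\<^sub>R F i z) + circle_pairing r0 (w j) (\<lambda>z. \<Sum>i\<in>I. c i *\<^sub>R F i z)"
    by (rule pairing_add[OF j]) (use insert.prems in \<open>auto intro!: continuous_intros\<close>)
  then show ?case using insert by (simp add: pairing_scale)
qed

text \<open>The self-maps \<open>\<psi>\<^sub>t\<close> are taken at the parameters \<open>t m = 1 / (m + 1)\<close> and are dilated by \<open>\<eta> m = 1 - (t m)\<^sup>2 / 2\<close>.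
  The dilation makes them continuous on the closed disc with values in the open disc, so that the images
  of competitors are relatively compact; being of second order, it does not affect derivatives at \<open>t = 0\<close>.\<close>

lemma inner_variation_limits:
  assumes \<phi>: "\<phi> \<in> bounded_fns" "\<And>\<theta>. 0 \<le> \<phi> \<theta>"
  obtains t :: "nat \<Rightarrow> real" and \<psi> where "\<And>m. 0 < t m" "t \<longlonglongrightarrow> 0"
    "\<And>m. \<psi> m holomorphic_on ball 0 1" "\<And>m. continuous_on (cball 0 1) (\<psi> m)"
    "\<And>m z. norm z \<le> 1 \<Longrightarrow> norm (\<psi> m z) < 1"
    "\<And>m z. norm z \<le> 1 \<Longrightarrow> \<psi> m z \<noteq> 0 \<Longrightarrow> ln (norm (\<psi> m z)) \<le> - t m * Re (herglotz \<phi> (\<psi> m z))"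
    "\<And>F j. j \<in> {1..N} \<Longrightarrow> vec_holomorphic_on F (ball 0 1) \<Longrightarrow> bounded (F ` ball 0 1) \<Longrightarrow>
       (\<lambda>m. circle_pairing r0 (w j) (\<lambda>z. F (\<psi> m z))) \<longlonglongrightarrow> circle_pairing r0 (w j) F"
    "\<And>j. j \<in> {1..N} \<Longrightarrow> (\<lambda>m. circle_pairing r0 (w j) (\<lambda>z. (1 / t m) *\<^sub>R (f z - f (\<psi> m z)))) \<longlonglongrightarrow> inner_rate j \<phi>"
proof -
  define q where "q = herglotz \<phi>"
  have qh: "q holomorphic_on ball 0 1" unfolding q_def by (rule bounded_fn_herglotz(1)[OF \<phi>(1)])
  have qc: "continuous_on (ball 0 1) q" by (rule holomorphic_on_imp_continuous_on[OF qh])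
  have q0: "0 \<le> Re (q z)" if "norm z < 1" for z unfolding q_def by (rule herglotz_nonneg[OF \<phi> that])
  define t where "t = (\<lambda>m. 1 / real (Suc m))"
  define \<eta> where "\<eta> = (\<lambda>m. 1 - (t m)\<^sup>2 / 2)"
  have t: "0 < t m" "t m \<le> 1" for m by (auto simp: t_def)
  have tlim: "t \<longlonglongrightarrow> 0" unfolding t_def by (rule LIMSEQ_Suc[OF lim_1_over_n])
  have \<eta>: "0 < \<eta> m" "\<eta> m < 1" "\<bar>\<eta> m\<bar> = \<eta> m" for m
  proof -
    have "(t m)\<^sup>2 \<le> 1" "0 < (t m)\<^sup>2" using t[of m] by (auto simp: power_le_one)
    then show "0 < \<eta> m" "\<eta> m < 1" "\<bar>\<eta> m\<bar> = \<eta> m" by (auto simp: \<eta>_def)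
  qed
  have "\<exists>\<psi>. \<psi> holomorphic_on ball 0 1 \<and> (\<forall>z. norm z < 1 \<longrightarrow> norm (\<psi> z) \<le> norm z \<and> \<psi> z = z * exp (- (of_real (t m) * q (\<psi> z))))" for m
  proof -
    have "(\<lambda>z. of_real (t m) * q z) holomorphic_on ball 0 1" by (intro holomorphic_intros qh)
    moreover have "0 \<le> Re (of_real (t m) * q z)" if "norm z < 1" for z using q0[OF that] t[of m] by simp
    ultimately obtain \<psi> where "\<psi> holomorphic_on ball 0 1" "\<And>z. norm z < 1 \<Longrightarrow> norm (\<psi> z) \<le> norm z"
      "\<And>z. norm z < 1 \<Longrightarrow> \<psi> z = z * exp (- (of_real (t m) * q (\<psi> z)))"
      using exponential_fixed_point_map by blast
    then show ?thesis by blast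
  qed
  then obtain \<Psi>0 where \<Psi>0: "\<And>m. \<Psi>0 m holomorphic_on ball 0 1"
    "\<And>m z. norm z < 1 \<Longrightarrow> norm (\<Psi>0 m z) \<le> norm z"
    "\<And>m z. norm z < 1 \<Longrightarrow> \<Psi>0 m z = z * exp (- (of_real (t m) * q (\<Psi>0 m z)))" by metis
  define G where "G = (\<lambda>m z. \<Psi>0 m (of_real (\<eta> m) * z))"
  have n\<eta>: "norm (of_real (\<eta> m) * z) = \<eta> m * norm z" for m and z :: complex using \<eta>[of m] by (simp add: norm_mult)
  have n\<eta>1: "norm (of_real (\<eta> m) * z) < 1" if "norm z \<le> 1" for m and z :: complex
  proof -
    have "\<eta> m * norm z \<le> \<eta> m * 1" using that \<eta>[of m] by (intro mult_left_mono) auto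
    then show ?thesis unfolding n\<eta> using \<eta>(2)[of m] by linarith
  qed
  have Gle: "norm (G m z) \<le> norm z" if "norm z \<le> 1" for m z
  proof -
    have "norm (G m z) \<le> \<eta> m * norm z" unfolding G_def using \<Psi>0(2)[OF n\<eta>1[OF that]] n\<eta> by simp
    also have "\<dots> \<le> 1 * norm z" using \<eta>[of m] by (intro mult_right_mono) auto
    finally show ?thesis by simp
  qed
  have G1: "norm (G m z) < 1" if "norm z \<le> 1" for m z
    unfolding G_def using \<Psi>0(2)[OF n\<eta>1[OF that]] n\<eta>1[OF that] by (rule order_le_less_trans)
  have Geq: "G m z = of_real (\<eta> m) * z * exp (- (of_real (t m) * q (G m z)))" if "norm z \<le> 1" for m z
    unfolding G_def by (rule \<Psi>0(3)[OF n\<eta>1[OF that]])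
  have Gh: "G m holomorphic_on ball 0 1" for m
    unfolding G_def by (rule holomorphic_on_compose_gen[OF _ \<Psi>0(1), unfolded o_def])
      (use n\<eta>1 in \<open>auto intro!: holomorphic_intros simp: less_imp_le\<close>)
  have Gc: "continuous_on (cball 0 1) (G m)" for m
    unfolding G_def by (rule continuous_on_compose2[OF holomorphic_on_imp_continuous_on[OF \<Psi>0(1)]])
      (use n\<eta>1 in \<open>auto intro!: continuous_intros\<close>)
  have Gln: "ln (norm (G m z)) \<le> - t m * Re (q (G m z))" if z: "norm z \<le> 1" and nz: "G m z \<noteq> 0" for m z
  proof -
    have z0: "z \<noteq> 0" using nz Geq[OF z] by auto
    have "norm (G m z) = norm (of_real (\<eta> m) * z) * exp (- (t m * Re (q (G m z))))"
      by (subst Geq[OF z]) (simp add: norm_mult)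
    then have "ln (norm (G m z)) = ln (norm (of_real (\<eta> m) * z)) + - (t m * Re (q (G m z)))"
      using z0 \<eta>[of m] by (simp add: ln_mult n\<eta>)
    moreover have "ln (norm (of_real (\<eta> m) * z)) \<le> 0"
      using n\<eta>1[OF z, of m] z0 \<eta>[of m] by (subst ln_le_zero_iff) (auto simp: n\<eta>)
    ultimately show ?thesis by simp
  qed
  have sub: "cball 0 r0 \<subseteq> ball (0::complex) 1" using r0 by auto
  obtain Cq where Cq: "0 \<le> Cq" "\<And>z. z \<in> cball 0 r0 \<Longrightarrow> norm (q z) \<le> Cq"
    using continuous_bounded_on_compact[OF compact_cball continuous_on_subset[OF qc sub]] by blast
  have Gr: "norm (G m z) \<le> r0" if "norm z = r0" for m z using Gle[of z m] that r0 by simp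
  have qG: "norm (q (G m z)) \<le> Cq" if "norm z = r0" for m z by (rule Cq(2)) (use Gr[OF that] in simp)
  have Gdist: "norm (G m z - z) \<le> t m * (Cq + 1)" if z: "norm z = r0" for m z
  proof -
    have z1: "norm z \<le> 1" using z r0 by simp
    define x where "x = - (of_real (t m) * q (G m z))"
    have "Re x \<le> 0" unfolding x_def using q0[OF G1[OF z1]] t[of m] by simp
    then have e1: "norm (exp x - 1) \<le> norm x" by (rule norm_exp_minus_one)
    have "norm x \<le> t m * Cq" unfolding x_def using qG[OF z] t[of m] by (simp add: norm_mult mult_left_mono)
    then have e2: "norm (exp x - 1) \<le> t m * Cq" using e1 by linarith
    have "G m z - z = of_real (\<eta> m) * z * (exp x - 1) + of_real (\<eta> m - 1) * z"
      by (subst Geq[OF z1]) (simp add: x_def algebra_simps)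
    then have "norm (G m z - z) \<le> norm (of_real (\<eta> m) * z) * norm (exp x - 1) + norm (of_real (\<eta> m - 1) * z)"
      by (metis norm_triangle_ineq norm_mult)
    also have "\<dots> \<le> 1 * (t m * Cq) + t m"
    proof (rule add_mono)
      show "norm (of_real (\<eta> m) * z) * norm (exp x - 1) \<le> 1 * (t m * Cq)"
        using n\<eta>1[OF z1, of m] e2 by (intro mult_mono) auto
      have "norm (of_real (\<eta> m - 1) * z) = (t m)\<^sup>2 / 2 * norm z" unfolding norm_mult norm_of_real by (simp add: \<eta>_def)
      also have "\<dots> \<le> (t m)\<^sup>2 / 2 * 1" using z1 by (intro mult_left_mono) auto
      also have "\<dots> \<le> t m" using t[of m] by (simp add: power2_eq_square)
      finally show "norm (of_real (\<eta> m - 1) * z) \<le> t m" .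
    qed
    finally show ?thesis by (simp add: algebra_simps)
  qed
  have Glim: "(\<lambda>m. G m z) \<longlonglongrightarrow> z" if z: "norm z = r0" for z
  proof -
    have "(\<lambda>m. t m * (Cq + 1)) \<longlonglongrightarrow> 0 * (Cq + 1)" by (intro tendsto_intros tlim)
    then have "(\<lambda>m. t m * (Cq + 1)) \<longlonglongrightarrow> 0" by simp
    then have "(\<lambda>m. G m z - z) \<longlonglongrightarrow> 0"
      by (rule Lim_null_comparison[rotated]) (use Gdist[OF z] in \<open>auto intro!: always_eventually\<close>)
    then show ?thesis by (simp add: LIM_zero_iff)
  qed
  have Gderiv: "(\<lambda>m. (G m z - z) / of_real (t m)) \<longlonglongrightarrow> - (z * q z)" if z: "norm z = r0" for z
  proof -
    have z1: "norm z \<le> 1" "norm z < 1" using z r0 by auto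
    obtain k where k: "\<And>x. exp x - exp 0 = k x * (x - 0)" "isCont k 0" "k 0 = exp (0::complex)"
      using DERIV_exp[of "0::complex"] unfolding CARAT_DERIV by auto
    define x where "x = (\<lambda>m. - (of_real (t m) * q (G m z)))"
    have qlim: "(\<lambda>m. q (G m z)) \<longlonglongrightarrow> q z"
      by (rule continuous_on_tendsto_compose[OF qc Glim[OF z]]) (use z1 G1[OF z1(1)] in auto)
    have "x \<longlonglongrightarrow> - (of_real 0 * q z)" unfolding x_def by (intro tendsto_intros tlim qlim)
    then have xlim: "x \<longlonglongrightarrow> 0" by simp
    have "(\<lambda>m. k (x m)) \<longlonglongrightarrow> k 0" by (rule isCont_tendsto_compose[OF k(2) xlim])
    then have klim: "(\<lambda>m. k (x m)) \<longlonglongrightarrow> 1" using k(3) by simp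
    have "(G m z - z) / of_real (t m) = of_real (\<eta> m) * z * (k (x m) * (- q (G m z))) - of_real (t m / 2) * z" for m
    proof -
      have tn: "complex_of_real (t m) \<noteq> 0" using t(1)[of m] by simp
      have "G m z - z = of_real (\<eta> m) * z * (exp (x m) - 1) + of_real (\<eta> m - 1) * z"
        by (subst Geq[OF z1(1)]) (simp add: x_def algebra_simps)
      also have "exp (x m) - 1 = k (x m) * x m" using k(1)[of "x m"] by simp
      also have "\<eta> m - 1 = - (t m * (t m / 2))" by (simp add: \<eta>_def power2_eq_square)
      finally have "G m z - z = of_real (t m) * (of_real (\<eta> m) * z * (k (x m) * (- q (G m z))) - of_real (t m / 2) * z)"
        by (simp add: x_def algebra_simps)
      then show ?thesis using tn by simp
    qed
    moreover have "(\<lambda>m. of_real (\<eta> m) * z * (k (x m) * (- q (G m z))) - of_real (t m / 2) * z) \<longlonglongrightarrow>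
        of_real (1 - 0\<^sup>2 / 2) * z * (1 * (- q z)) - of_real (0 / 2) * z"
      unfolding \<eta>_def by (intro tendsto_intros tlim klim qlim) auto
    ultimately show ?thesis by simp
  qed
  obtain Cf where Cf: "0 \<le> Cf" "\<And>x y. norm x \<le> r0 \<Longrightarrow> norm y \<le> r0 \<Longrightarrow> norm (f x - f y) \<le> Cf * norm (x - y)"
    by (rule f_lipschitz) blast
  have compc: "continuous_on (ball 0 1) (\<lambda>z. F (G m z))" if "vec_holomorphic_on F (ball 0 1)" for F :: "complex \<Rightarrow> complex ^ 'n" and m
    by (rule vec_holomorphic_continuous_on[OF vec_holomorphic_compose[OF that Gh]]) (use G1 in \<open>auto simp: less_imp_le\<close>)
  show ?thesis
  proof (rule that[of t G])
    show "0 < t m" for m by (rule t)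
    show "t \<longlonglongrightarrow> 0" by (rule tlim)
    show "G m holomorphic_on ball 0 1" for m by (rule Gh)
    show "continuous_on (cball 0 1) (G m)" for m by (rule Gc)
    show "norm (G m z) < 1" if "norm z \<le> 1" for m z by (rule G1[OF that])
    show "ln (norm (G m z)) \<le> - t m * Re (herglotz \<phi> (G m z))" if "norm z \<le> 1" "G m z \<noteq> 0" for m z
      using Gln[OF that] unfolding q_def .
    show "(\<lambda>m. circle_pairing r0 (w j) (\<lambda>z. F (G m z))) \<longlonglongrightarrow> circle_pairing r0 (w j) F"
      if j: "j \<in> {1..N}" and F: "vec_holomorphic_on F (ball 0 1)" and b: "bounded (F ` ball 0 1)" for F j
    proof -
      obtain C where C: "\<forall>x\<in>ball 0 1. norm (F x) \<le> C" using b unfolding bounded_iff by auto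
      show ?thesis
      proof (rule pairing_tendsto[OF j compc[OF F]])
        show "(\<lambda>m. F (G m z)) \<longlonglongrightarrow> F z" if "norm z = r0" for z
          by (rule continuous_on_tendsto_compose[OF vec_holomorphic_continuous_on[OF F] Glim[OF that]])
            (use that r0 G1[of z] in auto)
        show "norm (F (G m z)) \<le> C" if "norm z = r0" for m z
          using C G1[of z m] that r0 by simp
      qed
    qed
    show "(\<lambda>m. circle_pairing r0 (w j) (\<lambda>z. (1 / t m) *\<^sub>R (f z - f (G m z)))) \<longlonglongrightarrow> inner_rate j \<phi>" if j: "j \<in> {1..N}" for j
      unfolding inner_rate_def
    proof (rule pairing_tendsto[OF j])
      show "continuous_on (ball 0 1) (\<lambda>z. (1 / t m) *\<^sub>R (f z - f (G m z)))" for m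
        by (intro continuous_intros compc f(1) vec_holomorphic_continuous_on)
      show "norm ((1 / t m) *\<^sub>R (f z - f (G m z))) \<le> Cf * (Cq + 1)" if z: "norm z = r0" for m z
      proof -
        have "norm (f z - f (G m z)) \<le> Cf * norm (z - G m z)" by (rule Cf(2)) (use z Gr[OF z] in auto)
        also have "\<dots> \<le> Cf * (t m * (Cq + 1))" using Gdist[OF z] Cf(1) by (intro mult_left_mono) (auto simp: norm_minus_commute)
        finally have "norm (f z - f (G m z)) \<le> Cf * (t m * (Cq + 1))" .
        then have "(1 / t m) * norm (f z - f (G m z)) \<le> (1 / t m) * (Cf * (t m * (Cq + 1)))"
          using t(1)[of m] by (intro mult_left_mono) auto
        then show ?thesis using t(1)[of m] by (simp add: less_imp_le)
      qed
      show "(\<lambda>m. (1 / t m) *\<^sub>R (f z - f (G m z))) \<longlonglongrightarrow> (z * herglotz \<phi> z) *s f' z" if z: "norm z = r0" for z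
      proof (rule vec_tendstoI)
        fix k
        have fk: "(\<lambda>z. f z $ k) holomorphic_on ball 0 1" using f(1) by (simp add: vec_holomorphic_on_def)
        have zb: "z \<in> ball 0 1" using z r0 by simp
        have "((\<lambda>z. f z $ k) has_field_derivative f' z $ k) (at z)"
          using holomorphic_derivI[OF fk open_ball zb] by (simp add: f'_def)
        then obtain c where c: "\<And>x. f x $ k - f z $ k = c x * (x - z)" "isCont c z" "c z = f' z $ k"
          unfolding CARAT_DERIV by auto
        have "(\<lambda>m. c (G m z)) \<longlonglongrightarrow> c z" by (rule isCont_tendsto_compose[OF c(2) Glim[OF z]])
        then have "(\<lambda>m. - (c (G m z) * ((G m z - z) / of_real (t m)))) \<longlonglongrightarrow> - (c z * - (z * q z))"
          by (intro tendsto_intros Gderiv[OF z])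
        moreover have "((1 / t m) *\<^sub>R (f z - f (G m z))) $ k = - (c (G m z) * ((G m z - z) / of_real (t m)))" for m
        proof -
          have "((1 / t m) *\<^sub>R (f z - f (G m z))) $ k = - ((f (G m z) $ k - f z $ k) / of_real (t m))"
            by (simp add: scaleR_conv_of_real[of "1 / t m" "_ :: complex"] diff_divide_distrib right_diff_distrib)
          then show ?thesis unfolding c(1) by simp
        qed
        ultimately show "(\<lambda>m. ((1 / t m) *\<^sub>R (f z - f (G m z))) $ k) \<longlonglongrightarrow> ((z * herglotz \<phi> z) *s f' z) $ k"
          by (simp add: c(3) q_def mult_ac)
      qed
    qed
  qed
qed

text \<open>The core of the argument.  If \<open>h0\<close> and \<open>\<phi>\<close> satisfied the strict boundary inequality and had equal rates,
  then \<open>(f + t s \<cdot> h) \<circ> \<psi>\<^sub>t\<close> would contradict extremality for small \<open>t\<close> and a suitable \<open>h\<close> near \<open>h0\<close>: the bound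
  for the outer perturbation and the modulus of \<open>\<psi>\<^sub>t\<close> add up to \<open>u \<le> - c < 0\<close> on the closed disc, and the
  equality of rates makes all \<open>\<Phi>\<^sub>j\<close> agree with the prescribed values to first order.  To make them agree
  exactly one takes \<open>h = h0 + \<Sum> y\<^sub>i e\<^sub>i\<close> with a dual basis \<open>e\<close>.  For fixed \<open>t\<close> the conditions are linear in \<open>y\<close>
  and their matrix tends to the identity, so a Neumann series suffices where one might expect the implicit
  function theorem.\<close>

lemma no_admissible_variation:
  assumes \<kappa>: "\<kappa> > 0" and hopf: "\<And>z. norm z \<le> 1/2 \<Longrightarrow> u (f z) \<le> - 6 * \<kappa> * ln 2"
    and h0: "h0 \<in> disk_algebra" and \<phi>: "\<phi> \<in> bounded_fns" "\<And>\<theta>. 0 \<le> \<phi> \<theta>" and \<delta>: "\<delta> > 0"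
    and ae: "AE \<theta> in ang. ub \<theta> + 2 * Re (grad \<theta> \<bullet>\<^sub>c h0 (cis \<theta>)) + \<delta> \<le> \<kappa> * \<phi> \<theta>"
    and eq: "\<And>j. j \<in> {1..N} \<Longrightarrow> outer_rate j h0 = inner_rate j \<phi>"
  shows False
proof -
  let ?J = "{1..N}"
  obtain e where e: "\<And>i. i \<in> ?J \<Longrightarrow> e i \<in> disk_algebra"
    "\<And>i j. i \<in> ?J \<Longrightarrow> j \<in> ?J \<Longrightarrow> outer_rate j (e i) = (if i = j then 1 else 0)" by (rule dual_basis) blast
  obtain d where d: "d > 0" "compact {x. infdist x (closure D) \<le> d}" "{x. infdist x (closure D) \<le> d} \<subseteq> G" by (rule closure_D_neighbourhood)
  let ?K = "{x. infdist x (closure D) \<le> d}"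
  obtain Bh where Bh: "0 \<le> Bh" "\<And>y z. (\<And>i. i \<in> ?J \<Longrightarrow> \<bar>y i\<bar> \<le> 2) \<Longrightarrow> norm z \<le> 1 \<Longrightarrow> norm (h0 z + (\<Sum>i\<in>?J. y i *\<^sub>R e i z)) \<le> Bh"
    by (rule disk_algebra_combination_bound[of h0 e, OF h0 e(1)]) blast+
  have \<delta>2: "\<delta> / 2 > 0" using \<delta> by simp
  obtain \<tau> where \<tau>: "\<tau> > 0" "\<And>h t z. h \<in> disk_algebra \<Longrightarrow> (\<And>z. norm z \<le> 1 \<Longrightarrow> norm (h z) \<le> Bh) \<Longrightarrow> 0 < t \<Longrightarrow> t \<le> \<tau> \<Longrightarrow>
      (AE \<theta> in ang. ub \<theta> + 2 * Re (grad \<theta> \<bullet>\<^sub>c h (cis \<theta>)) + \<delta> / 2 \<le> \<kappa> * \<phi> \<theta>) \<Longrightarrow> norm z < 1 \<Longrightarrow>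
      infdist (perturb h t z) (closure D) \<le> d \<and>
      (norm z \<le> 1/2 \<longrightarrow> u (perturb h t z) \<le> - 3 * \<kappa> * ln 2) \<and>
      (1/2 < norm z \<longrightarrow> u (perturb h t z) \<le> t * \<kappa> * Re (herglotz \<phi> z) - t * (\<delta> / 2) / 2 + \<kappa> * ln (norm z))"
    using perturbation_estimate[OF \<kappa> hopf Bh(1) \<phi> \<delta>2 d] by blast
  have "\<exists>C. 0 \<le> C \<and> (\<forall>\<theta>. cis \<theta> \<in> S \<longrightarrow> \<bar>Re (grad \<theta> \<bullet>\<^sub>c e i (cis \<theta>))\<bar> \<le> C)" if "i \<in> ?J" for i
    using grad_pairing_bound[OF e(1)[OF that]] by metis
  then obtain R where R: "\<And>i. i \<in> ?J \<Longrightarrow> 0 \<le> R i \<and> (\<forall>\<theta>. cis \<theta> \<in> S \<longrightarrow> \<bar>Re (grad \<theta> \<bullet>\<^sub>c e i (cis \<theta>))\<bar> \<le> R i)" by metis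
  define Rs where "Rs = (\<Sum>i\<in>?J. R i)"
  have Rs: "0 \<le> Rs" unfolding Rs_def using R by (intro sum_nonneg) auto
  \<comment> \<open>Corrections with \<open>\<bar>y i\<bar> \<le> 2 * \<beta>\<close> change the boundary inequality by at most \<open>\<delta> / 2\<close>.\<close>
  define \<beta> where "\<beta> = min 1 (\<delta> / (8 * (Rs + 1)))"
  have \<beta>: "\<beta> > 0" "\<beta> \<le> 1" "\<beta> * Rs \<le> \<delta> / 8"
  proof -
    show "\<beta> > 0" "\<beta> \<le> 1" using \<delta> Rs by (auto simp: \<beta>_def)
    have "\<beta> * Rs \<le> \<delta> / (8 * (Rs + 1)) * (Rs + 1)" using Rs \<delta> by (intro mult_mono) (auto simp: \<beta>_def)
    also have "\<dots> = \<delta> / 8" using Rs by (simp add: field_simps)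
    finally show "\<beta> * Rs \<le> \<delta> / 8" .
  qed
  obtain t :: "nat \<Rightarrow> real" and \<psi> where t: "\<And>m. 0 < t m" "t \<longlonglongrightarrow> 0"
    and \<psi>h: "\<And>m. \<psi> m holomorphic_on ball 0 1" and \<psi>c: "\<And>m. continuous_on (cball 0 1) (\<psi> m)"
    and \<psi>1: "\<And>m z. norm z \<le> 1 \<Longrightarrow> norm (\<psi> m z) < 1"
    and \<psi>ln: "\<And>m z. norm z \<le> 1 \<Longrightarrow> \<psi> m z \<noteq> 0 \<Longrightarrow> ln (norm (\<psi> m z)) \<le> - t m * Re (herglotz \<phi> (\<psi> m z))"
    and lim1: "\<And>F j. j \<in> ?J \<Longrightarrow> vec_holomorphic_on F (ball 0 1) \<Longrightarrow> bounded (F ` ball 0 1) \<Longrightarrow>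
       (\<lambda>m. circle_pairing r0 (w j) (\<lambda>z. F (\<psi> m z))) \<longlonglongrightarrow> circle_pairing r0 (w j) F"
    and lim2: "\<And>j. j \<in> ?J \<Longrightarrow> (\<lambda>m. circle_pairing r0 (w j) (\<lambda>z. (1 / t m) *\<^sub>R (f z - f (\<psi> m z)))) \<longlonglongrightarrow> inner_rate j \<phi>"
  proof (rule inner_variation_limits[OF \<phi>], goal_cases)
    case (1 t \<psi>)
    show ?case by (rule 1(1)[OF 1(2-9)])
  qed
  have vcomp: "vec_holomorphic_on (\<lambda>z. F (\<psi> m z)) (ball 0 1)" if "vec_holomorphic_on F (ball 0 1)" for F :: "complex \<Rightarrow> complex ^ 'n" and m
    by (rule vec_holomorphic_compose[OF that \<psi>h]) (use \<psi>1 in \<open>auto simp: less_imp_le\<close>)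
  have ccomp: "continuous_on (ball 0 1) (\<lambda>z. F (\<psi> m z))" if "vec_holomorphic_on F (ball 0 1)" for F :: "complex \<Rightarrow> complex ^ 'n" and m
    by (rule vec_holomorphic_continuous_on[OF vcomp[OF that]])
  define P where "P = (\<lambda>h m j. circle_pairing r0 (w j) (\<lambda>z. s (\<psi> m z) * h (\<psi> m z)))"
  have Plim: "(\<lambda>m. P h m j) \<longlonglongrightarrow> outer_rate j h" if "h \<in> disk_algebra" "j \<in> ?J" for h j
    unfolding P_def outer_rate_def
    using lim1[OF that(2) sh_holomorphic[OF that(1)]] sh_bounded[OF that(1)] by (simp add: hol_bounded_def)
  \<comment> \<open>The defect of the \<open>j\<close>-th condition, divided by \<open>t m\<close>; it tends to zero by equality of the rates.\<close>
  define b where "b = (\<lambda>m j. circle_pairing r0 (w j) (\<lambda>z. (1 / t m) *\<^sub>R (f z - f (\<psi> m z))) - P h0 m j)"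
  have blim: "(\<lambda>m. b m j) \<longlonglongrightarrow> 0" if "j \<in> ?J" for j
    unfolding b_def using tendsto_diff[OF lim2[OF that] Plim[OF h0 that]] eq[OF that] by simp
  define E where "E = (\<lambda>m j i. (if i = j then 1 else 0) - P (e i) m j)"
  have Elim: "(\<lambda>m. \<Sum>i\<in>?J. \<bar>E m j i\<bar>) \<longlonglongrightarrow> 0" if j: "j \<in> ?J" for j
  proof -
    have "(\<lambda>m. \<bar>E m j i\<bar>) \<longlonglongrightarrow> 0" if i: "i \<in> ?J" for i
    proof -
      have "(\<lambda>m. E m j i) \<longlonglongrightarrow> (if i = j then 1 else 0) - outer_rate j (e i)"
        unfolding E_def by (intro tendsto_intros Plim e(1) i j)
      then have "(\<lambda>m. E m j i) \<longlonglongrightarrow> 0" using e(2)[OF i j] by simp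
      then show ?thesis by (rule tendsto_rabs_zero)
    qed
    then have "(\<lambda>m. \<Sum>i\<in>?J. \<bar>E m j i\<bar>) \<longlonglongrightarrow> (\<Sum>i\<in>?J. 0)" by (intro tendsto_sum)
    then show ?thesis by simp
  qed
  have "eventually (\<lambda>m. (\<Sum>i\<in>?J. \<bar>E m j i\<bar>) < 1/2) sequentially" if "j \<in> ?J" for j
    by (rule order_tendstoD(2)[OF Elim[OF that]]) simp
  then have ev1: "eventually (\<lambda>m. \<forall>j\<in>?J. (\<Sum>i\<in>?J. \<bar>E m j i\<bar>) < 1/2) sequentially"
    by (intro eventually_ball_finite) auto
  have "eventually (\<lambda>m. \<bar>b m j\<bar> < \<beta>) sequentially" if "j \<in> ?J" for j
    by (rule order_tendstoD(2)[OF tendsto_rabs_zero[OF blim[OF that]] \<beta>(1)])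
  then have ev2: "eventually (\<lambda>m. \<forall>j\<in>?J. \<bar>b m j\<bar> < \<beta>) sequentially"
    by (intro eventually_ball_finite) auto
  have ev3: "eventually (\<lambda>m. t m < \<tau>) sequentially" by (rule order_tendstoD(2)[OF t(2) \<tau>(1)])
  obtain m where m: "\<And>j. j \<in> ?J \<Longrightarrow> (\<Sum>i\<in>?J. \<bar>E m j i\<bar>) < 1/2" "\<And>j. j \<in> ?J \<Longrightarrow> \<bar>b m j\<bar> < \<beta>" "t m < \<tau>"
    using eventually_conj[OF ev1 eventually_conj[OF ev2 ev3]] eventually_happens' sequentially_bot by blast
  obtain y where y: "\<And>j. j \<in> ?J \<Longrightarrow> y j - (\<Sum>i\<in>?J. E m j i * y i) = b m j" "\<And>j. j \<in> ?J \<Longrightarrow> \<bar>y j\<bar> \<le> 2 * \<beta>"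
  proof (rule near_identity_system_solvable[of ?J "E m" "b m" \<beta>])
    show "finite ?J" by simp
  qed (use m in \<open>auto simp: less_imp_le\<close>)
  have y': "(\<Sum>i\<in>?J. y i * P (e i) m j) = b m j" if j: "j \<in> ?J" for j
  proof -
    have "(\<Sum>i\<in>?J. E m j i * y i) = (\<Sum>i\<in>?J. (if i = j then y i else 0) - y i * P (e i) m j)"
      by (rule sum.cong) (auto simp: E_def algebra_simps)
    also have "\<dots> = y j - (\<Sum>i\<in>?J. y i * P (e i) m j)" using j by (simp add: sum_subtractf)
    finally show ?thesis using y(1)[OF j] by simp
  qed
  define h where "h = (\<lambda>z. h0 z + (\<Sum>i\<in>?J. y i *\<^sub>R e i z))"
  have h: "h \<in> disk_algebra" unfolding h_def by (intro disk_algebra_add h0 disk_algebra_sum e(1)) auto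
  have hb: "norm (h z) \<le> Bh" if "norm z \<le> 1" for z
    unfolding h_def by (rule Bh(2)[OF _ that]) (use y(2) \<beta>(2) in \<open>fastforce\<close>)
  have aeh: "AE \<theta> in ang. ub \<theta> + 2 * Re (grad \<theta> \<bullet>\<^sub>c h (cis \<theta>)) + \<delta> / 2 \<le> \<kappa> * \<phi> \<theta>"
    using ae AE_S
  proof eventually_elim
    case (elim \<theta>)
    have "Re (grad \<theta> \<bullet>\<^sub>c h (cis \<theta>)) = Re (grad \<theta> \<bullet>\<^sub>c h0 (cis \<theta>)) + (\<Sum>i\<in>?J. y i * Re (grad \<theta> \<bullet>\<^sub>c e i (cis \<theta>)))"
      by (simp add: h_def bullet_simps bullet_sum)
    moreover have "(\<Sum>i\<in>?J. y i * Re (grad \<theta> \<bullet>\<^sub>c e i (cis \<theta>))) \<le> (\<Sum>i\<in>?J. 2 * \<beta> * R i)"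
    proof (rule sum_mono)
      fix i assume i: "i \<in> ?J"
      have "y i * Re (grad \<theta> \<bullet>\<^sub>c e i (cis \<theta>)) \<le> \<bar>y i\<bar> * \<bar>Re (grad \<theta> \<bullet>\<^sub>c e i (cis \<theta>))\<bar>"
        by (metis abs_ge_self abs_mult)
      also have "\<dots> \<le> 2 * \<beta> * R i" using y(2)[OF i] R[OF i] elim(2) \<beta>(1) by (intro mult_mono) auto
      finally show "y i * Re (grad \<theta> \<bullet>\<^sub>c e i (cis \<theta>)) \<le> 2 * \<beta> * R i" .
    qed
    moreover have "(\<Sum>i\<in>?J. 2 * \<beta> * R i) = 2 * (\<beta> * Rs)" by (simp add: Rs_def sum_distrib_left mult_ac)
    ultimately show ?case using elim(1) \<beta>(3) by linarith
  qed
  have est: "infdist (perturb h (t m) z) (closure D) \<le> d \<and>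
      (norm z \<le> 1/2 \<longrightarrow> u (perturb h (t m) z) \<le> - 3 * \<kappa> * ln 2) \<and>
      (1/2 < norm z \<longrightarrow> u (perturb h (t m) z) \<le> t m * \<kappa> * Re (herglotz \<phi> z) - t m * (\<delta> / 2) / 2 + \<kappa> * ln (norm z))"
    if "norm z < 1" for z
    by (rule \<tau>(2)[OF h hb t(1) _ aeh that]) (use m(3) in auto)
  define F where "F = (\<lambda>z. perturb h (t m) (\<psi> m z))"
  define c where "c = min (3 * \<kappa> * ln 2) (t m * \<delta> / 4)"
  have c: "c > 0" using \<kappa> t(1) \<delta> by (simp add: c_def)
  have FK: "F z \<in> ?K" if "norm z \<le> 1" for z unfolding F_def using est[OF \<psi>1[OF that]] by blast
  have uF: "u (F z) \<le> - c" if z: "norm z \<le> 1" for z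
  proof (cases "norm (\<psi> m z) \<le> 1/2")
    case True
    then have "u (F z) \<le> - 3 * \<kappa> * ln 2" unfolding F_def using est[OF \<psi>1[OF z]] by blast
    then show ?thesis by (simp add: c_def)
  next
    case False
    then have nz: "\<psi> m z \<noteq> 0" by auto
    have "u (F z) \<le> t m * \<kappa> * Re (herglotz \<phi> (\<psi> m z)) - t m * (\<delta> / 2) / 2 + \<kappa> * ln (norm (\<psi> m z))"
      unfolding F_def using est[OF \<psi>1[OF z]] False by force
    also have "\<kappa> * ln (norm (\<psi> m z)) \<le> \<kappa> * (- t m * Re (herglotz \<phi> (\<psi> m z)))"
      by (rule mult_left_mono[OF \<psi>ln[OF z nz]]) (use \<kappa> in simp)
    finally show ?thesis by (simp add: c_def algebra_simps)
  qed
  have Fh: "vec_holomorphic_on F (ball 0 1)" unfolding F_def by (rule vcomp[OF perturb_holomorphic[OF h]])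
  have Fc: "continuous_on (cball 0 1) F"
    unfolding F_def by (rule continuous_on_compose2[OF vec_holomorphic_continuous_on[OF perturb_holomorphic[OF h]] \<psi>c])
      (use \<psi>1 in auto)
  have ucK: "continuous_on ?K u" by (rule continuous_on_subset[OF ucont d(3)])
  define Kc where "Kc = {x \<in> ?K. u x \<le> - c}"
  have Kc: "compact Kc"
  proof -
    have "Kc = ?K \<inter> u -` {..- c}" by (auto simp: Kc_def)
    moreover have "closed (?K \<inter> u -` {..- c})"
      by (rule continuous_closed_preimage[OF ucK compact_imp_closed[OF d(2)] closed_atMost])
    ultimately show ?thesis using compact_Int_closed[OF d(2), of Kc] by (simp add: Int_absorb1)
  qed
  have KcD: "Kc \<subseteq> D" using d(3) c D by (auto simp: Kc_def)
  have Fim: "F ` ball 0 1 \<subseteq> Kc" using FK uF by (auto simp: Kc_def less_imp_le)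
  have cl: "closure (F ` ball 0 1) \<subseteq> Kc" by (rule closure_minimal[OF Fim compact_imp_closed[OF Kc]])
  have rc: "relatively_compact_in (F ` unit_disk) D"
    unfolding relatively_compact_in_def
    using cl KcD bounded_subset[OF compact_imp_bounded[OF Kc] Fim] by (auto simp: compact_closure)
  have Fmap: "F \<in> hol_maps unit_disk D" using Fh Fim KcD by (auto simp: hol_maps_def)
  have Fb: "F \<in> hol_bounded unit_disk"
    using Fh bounded_subset[OF compact_imp_bounded[OF Kc] Fim] by (simp add: hol_bounded_def)
  have "Phi (w j) F = a j" if j: "j \<in> ?J" for j
  proof -
    have "AE \<theta> in ang. has_bdval F (cis \<theta>)" by (intro AE_I2 bdval_continuous(1)[OF Fc]) simp
    from Phi_eq_circle_pairing(1)[OF \<nu>(1) r0(1,2) w[OF j] Fb this]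
    have 1: "Phi (w j) F = circle_pairing r0 (w j) F" .
    have "AE \<theta> in ang. has_bdval f (cis \<theta>)" using AE_S by eventually_elim (use bd in blast)
    from Phi_eq_circle_pairing(1)[OF \<nu>(1) r0(1,2) w[OF j] f_bounded this]
    have 2: "circle_pairing r0 (w j) f = a j" using f(3)[OF j] by simp
    have fc: "continuous_on (ball 0 1) f" by (rule vec_holomorphic_continuous_on[OF f(1)])
    have c1: "continuous_on (ball 0 1) (\<lambda>z. f (\<psi> m z))" by (rule ccomp[OF f(1)])
    have c2: "continuous_on (ball 0 1) (\<lambda>z. s (\<psi> m z) * h0 (\<psi> m z))" by (rule ccomp[OF sh_holomorphic[OF h0]])
    have c3: "continuous_on (ball 0 1) (\<lambda>z. s (\<psi> m z) * e i (\<psi> m z))" if "i \<in> ?J" for i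
      by (rule ccomp[OF sh_holomorphic[OF e(1)[OF that]]])
    have c4: "continuous_on (ball 0 1) (\<lambda>z. \<Sum>i\<in>?J. y i *\<^sub>R (s (\<psi> m z) * e i (\<psi> m z)))"
      using c3 by (intro continuous_intros) auto
    have "F = (\<lambda>z. f (\<psi> m z) + t m *\<^sub>R (s (\<psi> m z) * h0 (\<psi> m z) + (\<Sum>i\<in>?J. y i *\<^sub>R (s (\<psi> m z) * e i (\<psi> m z)))))"
      by (simp add: fun_eq_iff F_def perturb_def h_def distrib_left sum_distrib_left mult_scaleR_vec)
    then have 3: "circle_pairing r0 (w j) F = circle_pairing r0 (w j) (\<lambda>z. f (\<psi> m z)) +
        t m * (P h0 m j + (\<Sum>i\<in>?J. y i * P (e i) m j))"
      using pairing_add[OF j c1 continuous_on_scaleR[OF continuous_on_const continuous_on_add[OF c2 c4], of "t m"]]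
        pairing_add[OF j c2 c4] pairing_sum[where I = ?J and c = y, OF j _ c3]
      by (simp add: pairing_scale P_def)
    have "circle_pairing r0 (w j) (\<lambda>z. (1 / t m) *\<^sub>R (f z - f (\<psi> m z))) = 1 / t m * (circle_pairing r0 (w j) f - circle_pairing r0 (w j) (\<lambda>z. f (\<psi> m z)))"
    proof -
      have "circle_pairing r0 (w j) (\<lambda>z. f z + (-1) *\<^sub>R f (\<psi> m z)) = circle_pairing r0 (w j) f + (-1) * circle_pairing r0 (w j) (\<lambda>z. f (\<psi> m z))"
        using pairing_add[OF j fc continuous_on_scaleR[OF continuous_on_const c1, of "-1"]] unfolding pairing_scale .
      then show ?thesis unfolding pairing_scale by simp
    qed
    then have "t m * (b m j + P h0 m j) = circle_pairing r0 (w j) f - circle_pairing r0 (w j) (\<lambda>z. f (\<psi> m z))"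
      unfolding b_def using t(1)[of m] by simp
    then show ?thesis unfolding 1 3 y'[OF j] using 2 by (simp add: algebra_simps)
  qed
  then show False using ext Fmap rc unfolding extremal_def by blast
qed

section \<open>Multipliers\<close>

text \<open>The rate of change of the boundary values of \<open>u\<close> along \<open>f + t s \<cdot> h\<close>.\<close>

definition boundary_slope :: "(complex \<Rightarrow> complex ^ 'n) \<Rightarrow> real \<Rightarrow> real" where
  "boundary_slope h \<theta> = 2 * Re (grad \<theta> \<bullet>\<^sub>c h (cis \<theta>))"

lemma boundary_slope_add: "boundary_slope (\<lambda>z. h z + k z) \<theta> = boundary_slope h \<theta> + boundary_slope k \<theta>"
  and boundary_slope_scale: "boundary_slope (\<lambda>z. c *\<^sub>R h z) \<theta> = c * boundary_slope h \<theta>"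
  and boundary_slope_sum: "boundary_slope (\<lambda>z. \<Sum>i\<in>I. b i *\<^sub>R e i z) \<theta> = (\<Sum>i\<in>I. b i * boundary_slope (e i) \<theta>)"
  by (simp_all add: boundary_slope_def bullet_simps(1,4) bullet_sum sum_distrib_left mult_ac)

lemma boundary_slope_bounded_fn: assumes h: "h \<in> disk_algebra" shows "boundary_slope h \<in> bounded_fns"
proof -
  obtain C where C: "0 \<le> C" "\<And>\<theta>. cis \<theta> \<in> S \<Longrightarrow> \<bar>Re (grad \<theta> \<bullet>\<^sub>c h (cis \<theta>))\<bar> \<le> C" using grad_pairing_bound[OF h] by metis
  have "(\<lambda>\<theta>. grad \<theta> \<bullet>\<^sub>c h (cis \<theta>)) \<in> borel_measurable ang"
    by (rule bullet_measurable[OF grad_measurable continuous_imp_ang[OF disk_algebra_boundary_continuous[OF h]]])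
  then have "(\<lambda>\<theta>. 2 * Re (grad \<theta> \<bullet>\<^sub>c h (cis \<theta>))) \<in> borel_measurable ang"
    by (intro borel_measurable_times borel_measurable_const measurable_compose[OF _ borel_measurable_Re])
  moreover have "AE \<theta> in ang. \<bar>2 * Re (grad \<theta> \<bullet>\<^sub>c h (cis \<theta>))\<bar> \<le> 2 * C"
    using AE_S by eventually_elim (simp add: abs_mult C)
  ultimately show ?thesis unfolding boundary_slope_def[abs_def] by (rule bounded_fnsI)
qed

text \<open>Correcting \<open>h\<close> and \<open>\<phi>\<close> by the dual basis \<open>e\<close>, every pair \<open>(h, \<phi>)\<close> yields a variation with equal rates.  Its
  effect on the boundary inequality is \<open>A h + B \<phi>\<close>, to which nonnegative multiples of \<open>u (f\<^sup>*)\<close> may be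
  added.  Since no variation is admissible, no element of the cone \<open>K\<close> of these functions has negative
  essential supremum, and separation yields a linear form \<open>l\<close>.  The numbers \<open>c i = l (boundary_slope (e i))\<close> are the
  Lagrange multipliers.  On \<open>A h\<close>, a linear subspace, \<open>l\<close> vanishes, which is the multiplier rule; on
  \<open>B \<phi>\<close> it is nonnegative, which bounds \<open>l\<close> by a multiple of the integral.\<close>

lemma multiplier_functional:
  obtains l C c where "linear_form_on bounded_fns l" "\<And>x. x \<in> bounded_fns \<Longrightarrow> l x \<le> ess_sup x"
    "\<And>\<phi>. \<phi> \<in> bounded_fns \<Longrightarrow> (\<And>\<theta>. 0 \<le> \<phi> \<theta>) \<Longrightarrow> l \<phi> \<le> C * integral\<^sup>L ang \<phi>"
    "0 \<le> l ub" "\<And>h. h \<in> disk_algebra \<Longrightarrow> l (boundary_slope h) = (\<Sum>i\<in>{1..N}. c i * outer_rate i h)"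
    "\<exists>i\<in>{1..N}. c i \<noteq> 0"
proof -
  let ?J = "{1..N}"
  obtain \<kappa> where \<kappa>: "\<kappa> > 0" "\<And>z. norm z \<le> 1/2 \<Longrightarrow> u (f z) \<le> - 6 * \<kappa> * ln 2" by (rule hopf_constant) blast
  obtain e where e: "\<And>i. i \<in> ?J \<Longrightarrow> e i \<in> disk_algebra"
    "\<And>i j. i \<in> ?J \<Longrightarrow> j \<in> ?J \<Longrightarrow> outer_rate j (e i) = (if i = j then 1 else 0)" by (rule dual_basis) blast
  define A where "A = (\<lambda>h \<theta>. boundary_slope h \<theta> - (\<Sum>i\<in>?J. outer_rate i h * boundary_slope (e i) \<theta>))"
  define B where "B = (\<lambda>\<phi> \<theta>. - \<kappa> * \<phi> \<theta> + (\<Sum>i\<in>?J. inner_rate i \<phi> * boundary_slope (e i) \<theta>))"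
  define K where "K = {(\<lambda>\<theta>. r * ub \<theta> + A h \<theta> + B \<phi> \<theta>) | r h \<phi>. 0 \<le> r \<and> h \<in> disk_algebra \<and> \<phi> \<in> bounded_fns \<and> (\<forall>\<theta>. 0 \<le> \<phi> \<theta>)}"
  have KI: "(\<lambda>\<theta>. r * ub \<theta> + A h \<theta> + B \<phi> \<theta>) \<in> K"
    if "0 \<le> r" "h \<in> disk_algebra" "\<phi> \<in> bounded_fns" "\<And>\<theta>. 0 \<le> \<phi> \<theta>" for r h \<phi>
    unfolding K_def using that by blast
  have sumB: "(\<lambda>\<theta>. \<Sum>i\<in>?J. y i * boundary_slope (e i) \<theta>) \<in> bounded_fns" for y
    by (intro bounded_fns_sum bounded_fns_scale boundary_slope_bounded_fn e(1)) auto
  have AB: "A h \<in> bounded_fns" if "h \<in> disk_algebra" for h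
    using bounded_fns_add[OF boundary_slope_bounded_fn[OF that] bounded_fns_scale[OF sumB, of "-1" "\<lambda>i. outer_rate i h"]] by (simp add: A_def)
  have BB: "B \<phi> \<in> bounded_fns" if "\<phi> \<in> bounded_fns" for \<phi>
    unfolding B_def by (rule bounded_fns_add[OF bounded_fns_scale[OF that] sumB])
  have Lz: "inner_rate i (\<lambda>_. 0) = 0" for i using inner_rate_scale[of i 0 "\<lambda>_. 0"] by simp
  have \<Psi>z: "outer_rate i (\<lambda>_. 0) = 0" for i using outer_rate_scale[of i 0 "\<lambda>_. 0"] by simp
  have xz: "boundary_slope (\<lambda>_. 0) \<theta> = 0" for \<theta> by (simp add: boundary_slope_def bullet_simps(9))
  have Az: "A (\<lambda>_. 0) = (\<lambda>_. 0)" by (simp add: A_def \<Psi>z xz)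
  have Bz: "B (\<lambda>_. 0) = (\<lambda>_. 0)" by (simp add: B_def Lz)
  have AK: "A h \<in> K" if "h \<in> disk_algebra" for h
    using KI[of 0 h "\<lambda>_. 0"] that by (simp add: Bz bounded_fns_const)
  have BK: "B \<phi> \<in> K" if "\<phi> \<in> bounded_fns" "\<And>\<theta>. 0 \<le> \<phi> \<theta>" for \<phi>
    using KI[of 0 "\<lambda>_. 0" \<phi>] that by (simp add: Az disk_algebra_zero)
  have uK: "ub \<in> K"
    using KI[of 1 "\<lambda>_. 0" "\<lambda>_. 0"] by (simp add: Az Bz disk_algebra_zero bounded_fns_const)
  have KV: "K \<subseteq> bounded_fns"
    unfolding K_def using AB BB ub_bounded_fn by (auto intro!: bounded_fns_add bounded_fns_scale)
  have K0: "(\<lambda>_. 0) \<in> K" using AK[OF disk_algebra_zero] by (simp add: Az)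
  have Aadd: "A (\<lambda>z. h z + k z) \<theta> = A h \<theta> + A k \<theta>" if "h \<in> disk_algebra" "k \<in> disk_algebra" for h k \<theta>
  proof -
    have "(\<Sum>i\<in>?J. outer_rate i (\<lambda>z. h z + k z) * boundary_slope (e i) \<theta>) = (\<Sum>i\<in>?J. outer_rate i h * boundary_slope (e i) \<theta> + outer_rate i k * boundary_slope (e i) \<theta>)"
      by (rule sum.cong) (simp_all add: outer_rate_add that distrib_right)
    then show ?thesis by (simp add: A_def boundary_slope_add sum.distrib)
  qed
  have Asc: "A (\<lambda>z. c *\<^sub>R h z) \<theta> = c * A h \<theta>" for c h \<theta>
    by (simp add: A_def boundary_slope_scale outer_rate_scale sum_distrib_left right_diff_distrib mult_ac)
  have Badd: "B (\<lambda>t. \<phi> t + \<xi> t) \<theta> = B \<phi> \<theta> + B \<xi> \<theta>" if "\<phi> \<in> bounded_fns" "\<xi> \<in> bounded_fns" for \<phi> \<xi> \<theta>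
  proof -
    have "(\<Sum>i\<in>?J. inner_rate i (\<lambda>t. \<phi> t + \<xi> t) * boundary_slope (e i) \<theta>) = (\<Sum>i\<in>?J. inner_rate i \<phi> * boundary_slope (e i) \<theta> + inner_rate i \<xi> * boundary_slope (e i) \<theta>)"
      by (rule sum.cong) (simp_all add: inner_rate_add that distrib_right)
    then show ?thesis by (simp add: B_def sum.distrib algebra_simps)
  qed
  have Bsc: "B (\<lambda>t. c * \<phi> t) \<theta> = c * B \<phi> \<theta>" for c \<phi> \<theta>
    by (simp add: B_def inner_rate_scale sum_distrib_left distrib_left mult_ac right_diff_distrib)
  have Kadd: "(\<lambda>t. x t + y t) \<in> K" if xK: "x \<in> K" and yK: "y \<in> K" for x y
  proof -
    obtain r h \<phi> where x: "x = (\<lambda>\<theta>. r * ub \<theta> + A h \<theta> + B \<phi> \<theta>)" "0 \<le> r" "h \<in> disk_algebra" "\<phi> \<in> bounded_fns" "\<And>\<theta>. 0 \<le> \<phi> \<theta>"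
      using xK unfolding K_def by blast
    obtain r' h' \<phi>' where y: "y = (\<lambda>\<theta>. r' * ub \<theta> + A h' \<theta> + B \<phi>' \<theta>)" "0 \<le> r'" "h' \<in> disk_algebra" "\<phi>' \<in> bounded_fns" "\<And>\<theta>. 0 \<le> \<phi>' \<theta>"
      using yK unfolding K_def by blast
    have "(\<lambda>t. x t + y t) = (\<lambda>\<theta>. (r + r') * ub \<theta> + A (\<lambda>z. h z + h' z) \<theta> + B (\<lambda>t. \<phi> t + \<phi>' t) \<theta>)"
      by (simp add: fun_eq_iff x(1) y(1) Aadd[OF x(3) y(3)] Badd[OF x(4) y(4)] distrib_right)
    also have "\<dots> \<in> K"
      by (rule KI) (use x y in \<open>auto intro: disk_algebra_add bounded_fns_add\<close>)
    finally show ?thesis .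
  qed
  have Kscale: "(\<lambda>t. c * x t) \<in> K" if c: "c > 0" and xK: "x \<in> K" for c x
  proof -
    obtain r h \<phi> where x: "x = (\<lambda>\<theta>. r * ub \<theta> + A h \<theta> + B \<phi> \<theta>)" "0 \<le> r" "h \<in> disk_algebra" "\<phi> \<in> bounded_fns" "\<And>\<theta>. 0 \<le> \<phi> \<theta>"
      using xK unfolding K_def by blast
    have "(\<lambda>t. c * x t) = (\<lambda>\<theta>. (c * r) * ub \<theta> + A (\<lambda>z. c *\<^sub>R h z) \<theta> + B (\<lambda>t. c * \<phi> t) \<theta>)"
      by (simp add: fun_eq_iff x(1) Asc Bsc algebra_simps)
    also have "\<dots> \<in> K"
      by (rule KI) (use x c in \<open>auto intro: disk_algebra_scale bounded_fns_scale\<close>)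
    finally show ?thesis .
  qed
  have pK: "0 \<le> ess_sup k" if "k \<in> K" for k
  proof (rule ccontr)
    assume "\<not> 0 \<le> ess_sup k"
    then have neg: "ess_sup k < ess_sup k / 2" by simp
    define \<delta> where "\<delta> = - (ess_sup k / 2)"
    have \<delta>: "\<delta> > 0" using \<open>\<not> 0 \<le> ess_sup k\<close> by (simp add: \<delta>_def)
    have aek: "AE \<theta> in ang. k \<theta> \<le> - \<delta>" using ess_sup_AE[OF subsetD[OF KV that] neg] by (simp add: \<delta>_def)
    obtain r h \<phi> where k: "k = (\<lambda>\<theta>. r * ub \<theta> + A h \<theta> + B \<phi> \<theta>)" "0 \<le> r" "h \<in> disk_algebra" "\<phi> \<in> bounded_fns" "\<And>\<theta>. 0 \<le> \<phi> \<theta>"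
      using \<open>k \<in> K\<close> unfolding K_def by blast
    \<comment> \<open>Because \<open>u (f\<^sup>*) \<le> 0\<close>, one more copy of it may be added; dividing by \<open>R\<close> normalises its coefficient to \<open>1\<close>.\<close>
    define R where "R = r + 1"
    have R: "R > 0" using k(2) by (simp add: R_def)
    define y where "y = (\<lambda>i. inner_rate i \<phi> - outer_rate i h)"
    define h1 where "h1 = (\<lambda>z. h z + (\<Sum>i\<in>?J. y i *\<^sub>R e i z))"
    have se: "(\<lambda>z. \<Sum>i\<in>?J. y i *\<^sub>R e i z) \<in> disk_algebra" by (intro disk_algebra_sum e(1)) auto
    have h1: "h1 \<in> disk_algebra" unfolding h1_def by (rule disk_algebra_add[OF k(3) se])
    have \<Psi>s: "outer_rate j (\<lambda>z. \<Sum>i\<in>I. y i *\<^sub>R e i z) = (\<Sum>i\<in>I. y i * outer_rate j (e i))" if j: "j \<in> ?J" and I: "finite I" "I \<subseteq> ?J" for j I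
      using I
    proof (induction I rule: finite_induct)
      case empty
      show ?case by (simp add: \<Psi>z)
    next
      case (insert i I)
      have "(\<lambda>z. \<Sum>i\<in>I. y i *\<^sub>R e i z) \<in> disk_algebra" by (intro disk_algebra_sum e(1)) (use insert in auto)
      from outer_rate_add[OF j disk_algebra_scale[OF e(1)] this, of i "y i"] insert show ?case by (simp add: outer_rate_scale)
    qed
    have \<Psi>1: "outer_rate j h1 = inner_rate j \<phi>" if j: "j \<in> ?J" for j
    proof -
      have "outer_rate j h1 = outer_rate j h + (\<Sum>i\<in>?J. y i * outer_rate j (e i))"
        unfolding h1_def outer_rate_add[OF j k(3) se] using \<Psi>s[OF j, of ?J] by simp
      also have "(\<Sum>i\<in>?J. y i * outer_rate j (e i)) = (\<Sum>i\<in>?J. if i = j then y i else 0)"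
        by (intro sum.cong refl) (subst e(2)[OF _ j], assumption, simp)
      also have "\<dots> = y j" using j by simp
      finally show ?thesis by (simp add: y_def)
    qed
    show False
    proof (rule no_admissible_variation[of \<kappa> "\<lambda>z. (1 / R) *\<^sub>R h1 z" "\<lambda>t. (1 / R) * \<phi> t" "\<delta> / R"])
      show "0 < \<kappa>" by (rule \<kappa>(1))
      show "\<And>z. norm z \<le> 1/2 \<Longrightarrow> u (f z) \<le> - 6 * \<kappa> * ln 2" by (rule \<kappa>(2))
      show "(\<lambda>z. (1 / R) *\<^sub>R h1 z) \<in> disk_algebra" by (rule disk_algebra_scale[OF h1])
      show "(\<lambda>t. (1 / R) * \<phi> t) \<in> bounded_fns" by (rule bounded_fns_scale[OF k(4)])
      show "0 \<le> (1 / R) * \<phi> \<theta>" for \<theta> using R k(5)[of \<theta>] by simp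
      show "0 < \<delta> / R" using \<delta> R by simp
      show "outer_rate j (\<lambda>z. (1 / R) *\<^sub>R h1 z) = inner_rate j (\<lambda>t. (1 / R) * \<phi> t)" if "j \<in> ?J" for j
        unfolding outer_rate_scale inner_rate_scale \<Psi>1[OF that] ..
      show "AE \<theta> in ang. ub \<theta> + 2 * Re (grad \<theta> \<bullet>\<^sub>c (1 / R) *\<^sub>R h1 (cis \<theta>)) + \<delta> / R \<le> \<kappa> * (1 / R * \<phi> \<theta>)"
        using aek AE_S
      proof eventually_elim
        case (elim \<theta>)
        have ub: "ub \<theta> \<le> 0" by (rule ub_nonpos[OF elim(2)])
        have "boundary_slope h1 \<theta> = boundary_slope h \<theta> + (\<Sum>i\<in>?J. y i * boundary_slope (e i) \<theta>)" unfolding h1_def boundary_slope_add boundary_slope_sum ..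
        also have "\<dots> = A h \<theta> + (B \<phi> \<theta> + \<kappa> * \<phi> \<theta>)"
          by (simp add: A_def B_def y_def left_diff_distrib sum_subtractf)
        finally have "R * ub \<theta> + boundary_slope h1 \<theta> + \<delta> \<le> \<kappa> * \<phi> \<theta>"
          using elim(1) ub by (simp add: k(1) R_def distrib_right)
        then have "(R * ub \<theta> + boundary_slope h1 \<theta> + \<delta>) / R \<le> \<kappa> * \<phi> \<theta> / R" using R by (intro divide_right_mono) auto
        moreover have "2 * Re (grad \<theta> \<bullet>\<^sub>c (1 / R) *\<^sub>R h1 (cis \<theta>)) = boundary_slope h1 \<theta> / R"
          by (simp add: boundary_slope_def bullet_simps(4))
        ultimately show ?case using R by (simp add: add_divide_distrib)
      qed
    qed
  qed
  obtain l where l: "linear_form_on bounded_fns l" "\<And>x. x \<in> bounded_fns \<Longrightarrow> l x \<le> ess_sup x" "\<And>k. k \<in> K \<Longrightarrow> 0 \<le> l k"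
  proof (rule linear_form_nonneg_on_cone[OF function_space_bounded_fns sublinear_ess_sup KV K0 Kadd Kscale pK])
    fix l :: "(real \<Rightarrow> real) \<Rightarrow> real"
    assume "linear_form_on bounded_fns l" "\<And>x. x \<in> bounded_fns \<Longrightarrow> l x \<le> ess_sup x" "\<And>k. k \<in> K \<Longrightarrow> 0 \<le> l k"
    then show thesis by (rule that)
  qed
  have ladd: "l (\<lambda>t. x t + y t) = l x + l y" if "x \<in> bounded_fns" "y \<in> bounded_fns" for x y
    by (rule linear_form_on_add[OF l(1) that])
  have lsc: "l (\<lambda>t. c * x t) = c * l x" if "x \<in> bounded_fns" for x c
    by (rule linear_form_on_scale[OF l(1) that])
  define c where "c = (\<lambda>i. l (boundary_slope (e i)))"
  have lsum: "l (\<lambda>\<theta>. \<Sum>i\<in>?J. y i * boundary_slope (e i) \<theta>) = (\<Sum>i\<in>?J. y i * c i)" for y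
    using linear_form_sum[OF l(1) function_space_bounded_fns, of ?J "\<lambda>i. boundary_slope (e i)" y] boundary_slope_bounded_fn[OF e(1)] by (simp add: c_def)
  have lA: "l (A h) = l (boundary_slope h) - (\<Sum>i\<in>?J. outer_rate i h * c i)" if h: "h \<in> disk_algebra" for h
  proof -
    have Ah: "A h = (\<lambda>\<theta>. boundary_slope h \<theta> + (-1) * (\<Sum>i\<in>?J. outer_rate i h * boundary_slope (e i) \<theta>))" by (simp add: A_def fun_eq_iff)
    show ?thesis unfolding Ah ladd[OF boundary_slope_bounded_fn[OF h] bounded_fns_scale[OF sumB]] lsc[OF sumB] lsum by simp
  qed
  have A0: "l (A h) = 0" if h: "h \<in> disk_algebra" for h
  proof -
    have "A (\<lambda>z. (-1) *\<^sub>R h z) = (\<lambda>\<theta>. (-1) * A h \<theta>)" by (rule HOL.ext) (rule Asc)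
    moreover have "0 \<le> l (A (\<lambda>z. (-1) *\<^sub>R h z))" by (rule l(3)[OF AK[OF disk_algebra_scale[OF h]]])
    ultimately have "0 \<le> - l (A h)" using lsc[OF AB[OF h], of "-1"] by simp
    then show ?thesis using l(3)[OF AK[OF h]] by linarith
  qed
  have lB: "\<kappa> * l \<phi> \<le> (\<Sum>i\<in>?J. inner_rate i \<phi> * c i)" if \<phi>: "\<phi> \<in> bounded_fns" "\<And>\<theta>. 0 \<le> \<phi> \<theta>" for \<phi>
  proof -
    have "0 \<le> l (B \<phi>)" by (rule l(3)[OF BK[OF \<phi>]])
    also have "l (B \<phi>) = - \<kappa> * l \<phi> + (\<Sum>i\<in>?J. inner_rate i \<phi> * c i)"
      unfolding B_def ladd[OF bounded_fns_scale[OF \<phi>(1)] sumB] lsc[OF \<phi>(1)] lsum ..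
    finally show ?thesis by simp
  qed
  obtain CL where CL: "0 \<le> CL" "\<And>j \<phi>. j \<in> ?J \<Longrightarrow> \<phi> \<in> bounded_fns \<Longrightarrow> (\<And>\<theta>. 0 \<le> \<phi> \<theta>) \<Longrightarrow> \<bar>inner_rate j \<phi>\<bar> \<le> CL * integral\<^sup>L ang \<phi>"
    by (rule inner_rate_bound) blast
  define C where "C = (\<Sum>i\<in>?J. CL * \<bar>c i\<bar>) / \<kappa>"
  have lC: "l \<phi> \<le> C * integral\<^sup>L ang \<phi>" if \<phi>: "\<phi> \<in> bounded_fns" "\<And>\<theta>. 0 \<le> \<phi> \<theta>" for \<phi>
  proof -
    have "inner_rate i \<phi> * c i \<le> (CL * \<bar>c i\<bar>) * integral\<^sup>L ang \<phi>" if "i \<in> ?J" for i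
    proof -
      have "inner_rate i \<phi> * c i \<le> \<bar>inner_rate i \<phi>\<bar> * \<bar>c i\<bar>" by (metis abs_ge_self abs_mult)
      also have "\<dots> \<le> (CL * integral\<^sup>L ang \<phi>) * \<bar>c i\<bar>" by (rule mult_right_mono[OF CL(2)[OF that \<phi>]]) simp
      finally show ?thesis by (simp add: mult_ac)
    qed
    then have "(\<Sum>i\<in>?J. inner_rate i \<phi> * c i) \<le> (\<Sum>i\<in>?J. (CL * \<bar>c i\<bar>) * integral\<^sup>L ang \<phi>)" by (rule sum_mono)
    also have "\<dots> = (\<kappa> * C) * integral\<^sup>L ang \<phi>" using \<kappa>(1) by (simp add: C_def sum_distrib_right)
    finally have "\<kappa> * l \<phi> \<le> \<kappa> * (C * integral\<^sup>L ang \<phi>)" using lB[OF \<phi>] by (simp add: mult_ac)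
    then show ?thesis using \<kappa>(1) by simp
  qed
  \<comment> \<open>Otherwise \<open>l\<close> would be nonpositive on the constant \<open>1\<close>, where domination by the essential supremum forces the value \<open>1\<close>.\<close>
  have nz: "\<exists>i\<in>?J. c i \<noteq> 0"
  proof (rule ccontr)
    assume "\<not> (\<exists>i\<in>?J. c i \<noteq> 0)"
    then have "\<kappa> * l (\<lambda>_. 1) \<le> 0" using lB[OF bounded_fns_const, of 1] by simp
    then have "l (\<lambda>_. 1) \<le> 0" using \<kappa>(1) by (simp add: mult_le_0_iff)
    moreover have "l (\<lambda>_. -1) \<le> -1"
      by (rule order_trans[OF l(2)[OF bounded_fns_const] ess_sup_le[OF bounded_fns_const]]) simp
    moreover have "l (\<lambda>_. -1) = - l (\<lambda>_. 1)" using lsc[OF bounded_fns_const[of 1], of "-1"] by simp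
    ultimately show False by linarith
  qed
  show thesis
  proof (rule that[of l C c])
    show "l (boundary_slope h) = (\<Sum>i\<in>?J. c i * outer_rate i h)" if "h \<in> disk_algebra" for h
      using lA[OF that] A0[OF that] by (simp add: mult_ac)
  qed (use l lC l(3)[OF uK] nz in auto)
qed

text \<open>The density \<open>\<rho>\<close> of the multiplier functional satisfies
  \<open>\<integral> \<rho> * 2 * Re ((s \<cdot> \<nabla>u) \<bullet> h) = \<Sum> c\<^sub>i \<Phi>\<^sub>i(s \<cdot> h)\<close> on the disc algebra, and the right-hand side is the integral of
  \<open>Re (kernel c \<bullet> h)\<close> divided by \<open>2*pi\<close>; hence the factor \<open>4 * pi\<close>, and the difference is a boundary value of
  some \<open>g\<close>.  On a set of positive measure where \<open>\<rho> = 0\<close> the kernel would be the boundary value of \<open>- g\<close>, which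
  linear independence excludes.  Finally \<open>\<integral> \<rho> * u (f\<^sup>*) \<ge> 0\<close> with \<open>\<rho> > 0\<close> and \<open>u (f\<^sup>*) \<le> 0\<close> forces
  \<open>u (f\<^sup>*) = 0\<close> almost everywhere.\<close>

lemma extremal_multipliers:
  obtains \<rho> :: "real \<Rightarrow> real" and C g c where "\<rho> \<in> borel_measurable borel" "AE \<theta> in ang. \<bar>\<rho> \<theta>\<bar> \<le> C"
    "AE \<theta> in ang. 0 < \<rho> \<theta>" "AE \<theta> in ang. ub \<theta> = 0"
    "g \<in> hol_bounded unit_disk" "\<exists>j\<in>{1..N}. c j \<noteq> 0"
    "AE \<theta> in ang. has_bdval g (cis \<theta>) \<and> kernel c \<theta> + bdval g (cis \<theta>) = \<rho> \<theta> *\<^sub>R grad \<theta>"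
proof -
  let ?J = "{1..N}"
  obtain l C c where l: "linear_form_on bounded_fns l" "\<And>x. x \<in> bounded_fns \<Longrightarrow> l x \<le> ess_sup x"
    "\<And>\<phi>. \<phi> \<in> bounded_fns \<Longrightarrow> (\<And>\<theta>. 0 \<le> \<phi> \<theta>) \<Longrightarrow> l \<phi> \<le> C * integral\<^sup>L ang \<phi>"
    and lub: "0 \<le> l ub" and lx: "\<And>h. h \<in> disk_algebra \<Longrightarrow> l (boundary_slope h) = (\<Sum>i\<in>{1..N}. c i * outer_rate i h)"
    and nz: "\<exists>i\<in>?J. c i \<noteq> 0" by (rule multiplier_functional) blast
  obtain \<rho> where \<rho>: "\<rho> \<in> borel_measurable borel" "AE \<theta> in ang. 0 \<le> \<rho> \<theta> \<and> \<rho> \<theta> \<le> C"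
    and lr: "\<And>x. x \<in> bounded_fns \<Longrightarrow> l x = integral\<^sup>L ang (\<lambda>\<theta>. \<rho> \<theta> * x \<theta>)"
  proof (rule dominated_functional_density[of l C])
    fix \<rho> :: "real \<Rightarrow> real"
    assume "\<rho> \<in> borel_measurable borel" "AE \<theta> in ang. 0 \<le> \<rho> \<theta> \<and> \<rho> \<theta> \<le> C"
      "\<And>x. x \<in> bounded_fns \<Longrightarrow> l x = integral\<^sup>L ang (\<lambda>\<theta>. \<rho> \<theta> * x \<theta>)"
    then show thesis by (rule that)
  qed (auto intro: l)
  have \<rho>m: "\<rho> \<in> borel_measurable ang"
    by (rule borel_imp_ang[OF \<rho>(1)])
  obtain Cg where Cg: "Cg > 0" "\<And>\<theta>. cis \<theta> \<in> S \<Longrightarrow> norm (grad \<theta>) \<le> Cg" by (rule grad_bounded) blast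
  obtain Ck where Ck: "AE \<theta> in ang. norm (kernel c \<theta>) \<le> Ck" by (rule kernel_bounded)
  define \<gamma> where "\<gamma> = (\<lambda>\<theta>. (4 * pi * \<rho> \<theta>) *\<^sub>R grad \<theta> - kernel c \<theta>)"
  have \<gamma>m: "\<gamma> \<in> borel_measurable ang"
    unfolding \<gamma>_def by (intro borel_measurable_diff borel_measurable_scaleR borel_measurable_times borel_measurable_const \<rho>m grad_measurable kernel_measurable)
  have \<gamma>B: "AE \<theta> in ang. norm (\<gamma> \<theta>) \<le> 4 * pi * C * Cg + Ck"
    using \<rho>(2) Ck AE_S
  proof eventually_elim
    case (elim \<theta>)
    have "norm (\<gamma> \<theta>) \<le> norm ((4 * pi * \<rho> \<theta>) *\<^sub>R grad \<theta>) + norm (kernel c \<theta>)" unfolding \<gamma>_def by (rule norm_triangle_ineq4)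
    also have "norm ((4 * pi * \<rho> \<theta>) *\<^sub>R grad \<theta>) \<le> 4 * pi * C * Cg"
      unfolding norm_scaleR using elim Cg by (intro mult_mono) auto
    finally show ?case using elim by linarith
  qed
  have ann: "integral\<^sup>L ang (\<lambda>\<theta>. Re (\<gamma> \<theta> \<bullet>\<^sub>c h (cis \<theta>))) = 0" if h: "h \<in> disk_algebra" for h
  proof -
    have xb: "boundary_slope h \<in> bounded_fns" by (rule boundary_slope_bounded_fn[OF h])
    obtain M where M: "boundary_slope h \<in> borel_measurable ang" "AE \<theta> in ang. \<bar>boundary_slope h \<theta>\<bar> \<le> M" using xb by (auto simp: bounded_fns_def)
    have "integrable ang (\<lambda>\<theta>. \<rho> \<theta> * boundary_slope h \<theta>)"
    proof (rule integrable_ang_bounded)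
      show "(\<lambda>\<theta>. \<rho> \<theta> * boundary_slope h \<theta>) \<in> borel_measurable ang" by (intro borel_measurable_times \<rho>m M(1))
      show "AE \<theta> in ang. norm (\<rho> \<theta> * boundary_slope h \<theta>) \<le> C * M"
        using \<rho>(2) M(2) by eventually_elim (auto simp: abs_mult intro!: mult_mono)
    qed
    then have "has_bochner_integral ang (\<lambda>\<theta>. \<rho> \<theta> * boundary_slope h \<theta>) (\<Sum>i\<in>?J. c i * outer_rate i h)"
      using lr[OF xb] lx[OF h] by (simp add: has_bochner_integral_iff)
    from has_bochner_integral_diff[OF has_bochner_integral_mult_right[OF this, of "2*pi"] kernel_integral[OF h, of c]]
    have "has_bochner_integral ang (\<lambda>\<theta>. 2*pi * (\<rho> \<theta> * boundary_slope h \<theta>) - Re (kernel c \<theta> \<bullet>\<^sub>c h (cis \<theta>))) 0" by simp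
    moreover have "(\<lambda>\<theta>. 2*pi * (\<rho> \<theta> * boundary_slope h \<theta>) - Re (kernel c \<theta> \<bullet>\<^sub>c h (cis \<theta>))) = (\<lambda>\<theta>. Re (\<gamma> \<theta> \<bullet>\<^sub>c h (cis \<theta>)))"
      by (simp add: fun_eq_iff \<gamma>_def boundary_slope_def bullet_simps(3,5))
    ultimately show ?thesis by (simp add: has_bochner_integral_iff)
  qed
  obtain g where g: "g \<in> hol_bounded unit_disk" "g 0 = 0"
    and g\<gamma>: "AE \<theta> in ang. has_bdval g (cis \<theta>) \<and> bdval g (cis \<theta>) = \<gamma> \<theta>"
    by (rule annihilator_of_disk_algebra[OF \<gamma>m \<gamma>B ann]) blast
  have pos: "AE \<theta> in ang. 0 < \<rho> \<theta>"
  proof -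
    define P where "P = (\<lambda>\<zeta>. \<zeta> \<in> S \<and> has_bdval g \<zeta> \<and> 0 \<le> \<rho> (Arg2pi \<zeta>) \<and>
       bdval g \<zeta> = (4 * pi * \<rho> (Arg2pi \<zeta>)) *\<^sub>R (bdval s \<zeta> * complex_gradient u (bdval f \<zeta>)) - (\<Sum>j\<in>?J. c j *\<^sub>R (w j \<zeta> * bdval s \<zeta>)))"
    have "AE \<theta> in ang. P (cis \<theta>)"
      using \<rho>(2) AE_S g\<gamma> AE_Arg2pi_cis
    proof eventually_elim
      case (elim \<theta>)
      then show ?case by (simp add: P_def \<gamma>_def grad_def kernel_def)
    qed
    then obtain T where T: "T \<in> sets circle_measure" "\<And>\<zeta>. \<zeta> \<in> T \<Longrightarrow> P \<zeta>" "T \<subseteq> unit_circle" "AE \<theta> in ang. cis \<theta> \<in> T"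
      using AE_circle_full_set[of P] by blast
    have \<rho>c: "(\<lambda>\<zeta>. \<rho> (Arg2pi \<zeta>)) \<in> borel_measurable circle_measure" by (rule circle_measure_measurable[OF \<rho>(1)])
    define T' where "T' = T \<inter> {\<zeta> \<in> space circle_measure. \<rho> (Arg2pi \<zeta>) \<le> 0}"
    have T': "T' \<in> sets circle_measure" unfolding T'_def using T(1) \<rho>c by measurable
    have "AE \<theta> in ang. cis \<theta> \<notin> T'"
    proof (rule ccontr)
      assume "\<not> (AE \<theta> in ang. cis \<theta> \<notin> T')"
      from emeasure_circle_measure_pos[OF T' this] have em: "0 < emeasure circle_measure T'" .
      have mg: "(\<lambda>z. - g z) \<in> hol_bounded unit_disk" using g(1)
        by (auto simp: hol_bounded_def vec_holomorphic_on_def bounded_iff intro!: holomorphic_intros)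
      have "c j = 0" if j: "j \<in> ?J" for j
      proof (rule kernel_not_boundary_value[OF mg _ T' em _ j])
        show "- g 0 = 0" using g(2) by simp
        fix \<zeta> assume "\<zeta> \<in> T'"
        then have p: "P \<zeta>" "\<rho> (Arg2pi \<zeta>) \<le> 0" "\<zeta> \<in> unit_circle" using T(2,3) by (auto simp: T'_def)
        then have zero: "\<rho> (Arg2pi \<zeta>) = 0" by (auto simp: P_def)
        have n: "norm \<zeta> = 1" using p(3) by simp
        have gz: "((\<lambda>z. - g z) \<longlongrightarrow> - bdval g \<zeta>) (nontangential \<zeta>)"
          using p(1) by (intro tendsto_minus tendsto_bdval[OF n]) (simp add: P_def)
        have "has_bdval (\<lambda>z. - g z) \<zeta>" unfolding has_bdval_def using gz by blast
        moreover have "bdval (\<lambda>z. - g z) \<zeta> = - bdval g \<zeta>" by (rule bdval_eqI[OF n gz])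
        moreover have "has_bdval s \<zeta>" using p(1) bd by (simp add: P_def)
        ultimately show "has_bdval s \<zeta> \<and> has_bdval (\<lambda>z. - g z) \<zeta> \<and> (\<Sum>j\<in>?J. c j *\<^sub>R (w j \<zeta> * bdval s \<zeta>)) = bdval (\<lambda>z. - g z) \<zeta>"
          using p(1) zero by (simp add: P_def)
      qed
      then show False using nz by blast
    qed
    then show ?thesis using T(4) AE_Arg2pi_cis
    proof eventually_elim
      case (elim \<theta>)
      then show ?case by (auto simp: T'_def space_circle_measure)
    qed
  qed
  have ub0: "AE \<theta> in ang. ub \<theta> = 0"
  proof -
    obtain M where M: "ub \<in> borel_measurable ang" "AE \<theta> in ang. \<bar>ub \<theta>\<bar> \<le> M" using ub_bounded_fn by (auto simp: bounded_fns_def)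
    have i: "integrable ang (\<lambda>\<theta>. - (\<rho> \<theta> * ub \<theta>))"
    proof (rule integrable_ang_bounded)
      show "(\<lambda>\<theta>. - (\<rho> \<theta> * ub \<theta>)) \<in> borel_measurable ang" by (intro borel_measurable_uminus borel_measurable_times \<rho>m M(1))
      show "AE \<theta> in ang. norm (- (\<rho> \<theta> * ub \<theta>)) \<le> C * M"
        using \<rho>(2) M(2) by eventually_elim (auto simp: abs_mult intro!: mult_mono)
    qed
    have nn: "AE \<theta> in ang. 0 \<le> - (\<rho> \<theta> * ub \<theta>)"
      using \<rho>(2) AE_S by eventually_elim (use ub_nonpos in \<open>auto simp: mult_le_0_iff\<close>)
    have "integral\<^sup>L ang (\<lambda>\<theta>. - (\<rho> \<theta> * ub \<theta>)) = - l ub" using lr[OF ub_bounded_fn] by simp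
    then have "integral\<^sup>L ang (\<lambda>\<theta>. - (\<rho> \<theta> * ub \<theta>)) = 0"
      using lub integral_nonneg_AE[OF nn] by linarith
    then have "AE \<theta> in ang. - (\<rho> \<theta> * ub \<theta>) = 0" using integral_nonneg_eq_0_iff_AE[OF i nn] by simp
    with pos show ?thesis by eventually_elim simp
  qed
  show thesis
  proof (rule that[of "\<lambda>\<theta>. 4 * pi * \<rho> \<theta>" "4 * pi * C" g c])
    show "(\<lambda>\<theta>. 4 * pi * \<rho> \<theta>) \<in> borel_measurable borel" using \<rho>(1) by simp
    show "AE \<theta> in ang. \<bar>4 * pi * \<rho> \<theta>\<bar> \<le> 4 * pi * C" using \<rho>(2) by eventually_elim (simp add: abs_mult)
    show "AE \<theta> in ang. 0 < 4 * pi * \<rho> \<theta>" using pos by eventually_elim simp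
    show "AE \<theta> in ang. has_bdval g (cis \<theta>) \<and> kernel c \<theta> + bdval g (cis \<theta>) = (4 * pi * \<rho> \<theta>) *\<^sub>R grad \<theta>"
      using g\<gamma> by eventually_elim (simp add: \<gamma>_def)
  qed (fact ub0 g nz)+
qed

end

theorem theorem1:
  fixes N :: nat and \<nu> \<epsilon> :: real
    and w :: "nat \<Rightarrow> complex \<Rightarrow> complex ^ 'n::finite"
    and a :: "nat \<Rightarrow> real"
    and D G :: "(complex ^ 'n) set"
    and u :: "complex ^ 'n \<Rightarrow> real"
    and f s :: "complex \<Rightarrow> complex ^ 'n"
    and S :: "complex set"
    and v :: "complex \<Rightarrow> (complex \<Rightarrow> complex ^ 'n) \<Rightarrow> complex"
  assumes "N \<ge> 1" and "0 < \<nu>" and "\<nu> < 1"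
    and "\<And>j. j \<in> {1..N} \<Longrightarrow> w j \<in> hol_cont_closure (annulus \<nu>)"
    and "functionals_lin_indep N w"
    and "is_domain D" and "is_domain G"
    and "relatively_compact_in D G" and "relatively_compact_in G UNIV"
    and "psh_on G u" and "continuous_on G u"
    and "D = {z \<in> G. u z < 0}" and "frontier D = {z \<in> G. u z = 0}"
    and "extremal D N w a f"
    and "S \<subseteq> unit_circle" and "s \<in> hol_bounded unit_disk" and "\<epsilon> > 0"
    and a: "unit_circle - S \<in> null_sets circle_measure"
    and b: "\<And>\<zeta>. \<zeta> \<in> S \<Longrightarrow>
          has_bdval f \<zeta> \<and> has_complex_gradient u (bdval f \<zeta>) \<and> has_bdval s \<zeta>"
    and c: "\<And>k z. z \<in> unit_disk \<Longrightarrow> s z $ k \<noteq> 0"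
    and d: "\<And>\<zeta> h. \<zeta> \<in> S \<Longrightarrow> h \<in> hol_cont_closure unit_disk \<Longrightarrow>
          sup_norm_on unit_disk h \<le> \<epsilon> \<Longrightarrow>
          bdval f \<zeta> + bdval s \<zeta> * h \<zeta> \<in> G \<and>
          complex_of_real (u (bdval f \<zeta> + bdval s \<zeta> * h \<zeta>)) =
            complex_of_real (u (bdval f \<zeta>)) +
            2 * complex_of_real
                  (Re (complex_gradient u (bdval f \<zeta>) \<bullet>\<^sub>c (bdval s \<zeta> * h \<zeta>))) +
            v \<zeta> h"
    and e: "((\<lambda>h. (SUP \<zeta>\<in>S. ennreal (norm (v \<zeta> h))) / ennreal (sup_norm_on unit_disk h))
          \<longlongrightarrow> 0) disk_algebra_at_0"
  shows "(AE \<zeta> in circle_measure. has_bdval f \<zeta> \<and> bdval f \<zeta> \<in> frontier D) \<and>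
    (\<exists>(\<rho> :: complex \<Rightarrow> real) (g :: complex \<Rightarrow> complex ^ 'n) (lam :: nat \<Rightarrow> real).
        \<rho> \<in> borel_measurable circle_measure \<and>
        (\<exists>C. AE \<zeta> in circle_measure. \<bar>\<rho> \<zeta>\<bar> \<le> C) \<and>
        (AE \<zeta> in circle_measure. 0 < \<rho> \<zeta>) \<and>
        g \<in> hol_bounded unit_disk \<and>
        (\<exists>j\<in>{1..N}. lam j \<noteq> 0) \<and>
        (AE \<zeta> in circle_measure.
           has_bdval g \<zeta> \<and>
           (\<Sum>j\<in>{1..N}. lam j *\<^sub>R (w j \<zeta> * bdval s \<zeta>)) + bdval g \<zeta> =
             \<rho> \<zeta> *\<^sub>R (bdval s \<zeta> * complex_gradient u (bdval f \<zeta>))))"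
proof -
  interpret extremal_setting N \<nu> \<epsilon> w a D G u f s S v
  proof (rule extremal_setting.intro)
    show "open G" using \<open>is_domain G\<close> by (simp add: is_domain_def)
    show "has_bdval f \<zeta> \<and> has_bdval s \<zeta>" if "\<zeta> \<in> S" for \<zeta> using b[OF that] by blast
  qed (fact assms)+
  obtain \<rho> C g lam where \<rho>: "\<rho> \<in> borel_measurable borel" "AE \<theta> in ang. \<bar>\<rho> \<theta>\<bar> \<le> C" "AE \<theta> in ang. 0 < \<rho> \<theta>"
    and ub: "AE \<theta> in ang. ub \<theta> = 0" and g: "g \<in> hol_bounded unit_disk" and lam: "\<exists>j\<in>{1..N}. lam j \<noteq> 0"
    and eq: "AE \<theta> in ang. has_bdval g (cis \<theta>) \<and> kernel lam \<theta> + bdval g (cis \<theta>) = \<rho> \<theta> *\<^sub>R grad \<theta>"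
    by (rule extremal_multipliers) blast
  show ?thesis
  proof (intro conjI exI)
    show "AE \<zeta> in circle_measure. has_bdval f \<zeta> \<and> bdval f \<zeta> \<in> frontier D"
      unfolding AE_circle_measure using AE_S ub
    proof eventually_elim
      case (elim \<theta>)
      then show ?case using b[OF elim(1)] bdval_f_in_closure[OF elim(1)] clD(2) frD by (auto simp: ub_def)
    qed
    show "(\<lambda>\<zeta>. \<rho> (Arg2pi \<zeta>)) \<in> borel_measurable circle_measure" by (rule circle_measure_measurable[OF \<rho>(1)])
    show "AE \<zeta> in circle_measure. \<bar>\<rho> (Arg2pi \<zeta>)\<bar> \<le> C"
      unfolding AE_circle_measure using \<rho>(2) AE_Arg2pi_cis by eventually_elim simp
    show "AE \<zeta> in circle_measure. 0 < \<rho> (Arg2pi \<zeta>)"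
      unfolding AE_circle_measure using \<rho>(3) AE_Arg2pi_cis by eventually_elim simp
    show "AE \<zeta> in circle_measure. has_bdval g \<zeta> \<and> (\<Sum>j\<in>{1..N}. lam j *\<^sub>R (w j \<zeta> * bdval s \<zeta>)) + bdval g \<zeta> =
             \<rho> (Arg2pi \<zeta>) *\<^sub>R (bdval s \<zeta> * complex_gradient u (bdval f \<zeta>))"
      unfolding AE_circle_measure using eq AE_Arg2pi_cis by eventually_elim (simp add: kernel_def grad_def)
  qed (fact g lam)+
qed

end
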